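(* The limit $\bar S_g\in C([0,T];\mathbb P(\bar\Omega\times[d_\infty,1/d_\infty]))$ of the bubble distribution functions $S_t^{(N)}=\frac1N\sum_{k=1}^N\delta_{(c_k(t),NR_k(t))}$ (see context) satisfies, in the sense of distributions in the variables $(t,x,r)$, $$\partial_t\bar S_{g,t}+\partial_x(\bar S_{g,t}\,\bar u)+\frac1{\mu_g}\partial_r\Big(\big(r(\bar\Sigma_g+\mathrm p_g(\bar\rho_g))+\bar\gamma_s/2\big)\bar S_{g,t}\Big)=0.$$
   Context: Microscopic system. $\Omega=(-1,1)$; $N$ disjoint ordered bubbles $B_k(t)=(x_k^-,x_k^+)$, $x_k^\pm=c_k\pm R_k$; $x_0^+=-1$, $x_{N+1}^-=1$, $\mathcal F_k=(x_k^+,x_{k+1}^-)$ ($0\le k\le N$), $\mathcal F=\Omega\setminus\bigcup_k\overline{B_k}$. Constants $\mu_f,\mu_g>0$; $\mathrm p_f(\rho)=\kappa_f\rho^{\gamma_f}$ ($\kappa_f>0,\gamma_f>1$); $\mathrm p_g(\rho)=a_g^2\rho$; masses $m_k>0$ (time-independent), $\rho_k=m_k/(2R_k)$; surface tension $\gamma_s=\bar\gamma_s/N$ with $\bar\gamma_s>0$ fixed; $\kappa_k:=R_k(\mathrm p_g(\rho_k)+\gamma_s/(2R_k))$ (constant in time). Equations: in $\mathcal F$, $\partial_t\rho_f+\partial_x(\rho_fu_f)=0$, $\partial_t(\rho_fu_f)+\partial_x(\rho_fu_f^2)=\partial_x\Sigma_f$, $\Sigma_f=\mu_f\partial_xu_f-\mathrm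 p_f(\rho_f)$; $u_f(t,\pm1)=0$; $u_f(t,x_k^\pm)=\dot c_k\pm\dot R_k$; $m_k\ddot c_k=\Sigma_f(x_k^+)-\Sigma_f(x_k^-)$; $\frac{m_k}3\ddot R_k=\Sigma_f(x_k^-)+\Sigma_f(x_k^+)-2\Sigma_k$, $\Sigma_k=\mu_g\dot R_k/R_k-\kappa_k/R_k$. Classical solution: no overlap, $c_k,R_k\in H^2$ in time, $u_f\in H^1_tL^2_x\cap L^2_tH^2_x$ and $0<\rho_f\in H^1_{t,x}$ in the fluid domain. Macroscopic initial data: $\bar\rho_f^0,\bar\rho_g^0,\bar\alpha_f^0,\bar\alpha_g^0,\bar f_g^0\in H^1(\Omega)$, $\bar u^0\in H^1_0(\Omega)$, with $\min(\bar\rho_f^0,\bar\rho_g^0)\ge\rho_{min}>0$, $\min(\bar\alpha_f^0,\bar\alpha_g^0)\ge\alpha_{min}>0$, $\bar\alpha_f^0+\bar\alpha_g^0=1$, $\bar f_g^0\ge f_{min}>0$, $\int_\Omega\bar\alpha_g^0\bar f_g^0\,dx=1$. Microscopic initial data: for each $N$, $(c_k^{(N),0},R_k^{(N),0},m_k^{(N)})_{k\le N}$ are such that, with $M_\infty,d_\infty>0$ independent of $N$, $M_\infty\le Nm_k,N\kappa_k\le M_\infty^{-1}$, $2d_\infty\le NR_k^0\le(2d_\infty)^{-1}$, $2d_\infty\le N|\mathcal F_k^0|\le(2d_\infty)^{-1}$; and there are functions $\tilde f_g^{(N),0},\tilde\rho_g^{(N),0}$, bounded in $H^1(\Omega)$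 uniformly in $N$, equal on each $B_k^0$ to $1/(2NR_k^0)$ and $m_k/(2R_k^0)$ respectively, such that for all $\beta\in C^1([0,\infty)^2)$, $\beta(\tilde\rho_g^{(N),0},\tilde f_g^{(N),0})\mathbb 1_{\Omega\setminus\overline{\mathcal F^{(N),0}}}\rightharpoonup\bar\alpha_g^0\beta(\bar\rho_g^0,\bar f_g^0)$ in $\mathcal D'(\Omega)$ (such data exist). The initial conditions are $c_k(0)=c_k^0$, $R_k(0)=R_k^0$, $(\rho_f,u_f)(0)=(\bar\rho_f^0,\bar u^0)$ on $\mathcal F^0$, $\dot c_k(0)\pm\dot R_k(0)=\bar u^0(c_k^0\pm R_k^0)$. Solutions: $T,K>0$ are independent of $N$ and such that for every $N$ the corresponding classical solution exists on $[0,T]$ and satisfies there, with $\underline\rho_\infty,\bar\rho_\infty>0$ independent of $N$: $d_\infty\le NR_k\le d_\infty^{-1}$; $d_\infty\le N|\mathcal F_k|\le d_\infty^{-1}$; $\underline\rho_\infty\le\rho_f\le\bar\rho_\infty$; $\int_{\mathcal F}\mu_f\frac{|\partial_xu_f|^2}2dx+\mu_g\sum_k\frac{|\dot R_k|^2}{R_k}\le K$; $\int_0^T\big[\|\tilde\Sigma_f\|^2_{H^1(\Omega)}+\|\tilde\Sigma_g\|^2_{H^1(\Omega)}+\sum_km_k(|\ddot R_k|^2+|\ddot c_k|^2)\big]dt\le K$. Extensions (superscript $(N)$ implicit): $\tilde\Sigma_f=\Sigma_f$ in $\mathcal F$ and $\tilde\Sigma_f$ is the affine interpolation of $\Sigma_f(x_k^-),\Sigma_f(x_k^+)$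 in $B_k$. $\tilde\Sigma_g=\Sigma_k$ in $B_k$, $=\Sigma_1$ in $\mathcal F_0$, $=\Sigma_N$ in $\mathcal F_N$, and affine interpolation between $\Sigma_k$ (at $x_k^+$) and $\Sigma_{k+1}$ (at $x_{k+1}^-$) in $\mathcal F_k$, $1\le k\le N-1$. $\tilde u=u_f$ in $\mathcal F$ and $\tilde u=\dot c_k+\frac{\dot R_k}{R_k}(x-c_k)$ in $B_k$. $\tilde\rho_f$ solves $\partial_t\tilde\rho_f+\tilde u\partial_x\tilde\rho_f=-\frac{\tilde\rho_f}{\mu_f}(\tilde\Sigma_f+\mathrm p_f(\tilde\rho_f))$ on $(0,T)\times\Omega$, $\tilde\rho_f(0)=\bar\rho_f^0$. $(\tilde\rho_g,\tilde f_g)$ solves $\partial_tw+\tilde u\partial_xw=-\frac{w}{\mu_g}(\tilde\Sigma_g+\mathrm p_g(\tilde\rho_g)+\bar\gamma_s\tilde f_g)$ for $w=\tilde\rho_g$ and $w=\tilde f_g$, with data $(\tilde\rho_g^{(N),0},\tilde f_g^{(N),0})$. $\chi^{(N)}=\mathbb 1_{\mathcal F^{(N)}}$. $T$ is assumed small enough (independently of $N$) that these extended densities and covolumes exist on $[0,T]$ with uniform $L^\infty(0,T;H^1(\Omega))$ bounds. Limits: along a common subsequence, $\chi^{(N)}\rightharpoonup\bar\alpha_f$ weak-* in $L^\infty((0,T)\times\Omega)$, $\bar\alpha_g=1-\bar\alpha_f$; $\tilde\rho_f^{(N)}\to\bar\rho_f$, $\tilde\rho_g^{(N)}\to\bar\rho_g$,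 $\tilde f_g^{(N)}\to\bar f_g$, $\tilde u^{(N)}\to\bar u$ strongly in $L^2((0,T)\times\Omega)$; $\tilde\Sigma_f^{(N)}\rightharpoonup\bar\Sigma_f$, $\tilde\Sigma_g^{(N)}\rightharpoonup\bar\Sigma_g$ weakly in $L^2((0,T);H^1(\Omega))$; and $\langle S^{(N)}_t,\beta\rangle\to\langle\bar S_{g,t},\beta\rangle$ in $C([0,T])$ for every $\beta\in C(\bar\Omega\times[d_\infty,1/d_\infty])$, where $\mathbb P$ denotes probability measures and $r$ is the scaled-radius variable. *)

theory Defs
  imports "HOL-Probability.Probability"
begin

section \<open>Test functions, weak derivatives and Sobolev spaces\<close>

text \<open>
  Functions of time and space have type \<open>real \<times> real \<Rightarrow> real\<close>, with argument \<open>(t, x)\<close>.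
  Elements of Lebesgue and Sobolev spaces are represented by Borel functions.
\<close>

definition pd :: "'a::euclidean_space \<Rightarrow> ('a \<Rightarrow> real) \<Rightarrow> 'a \<Rightarrow> real" where
  "pd b f z = frechet_derivative f (at z) b"

fun C_order :: "nat \<Rightarrow> ('a::euclidean_space \<Rightarrow> real) \<Rightarrow> bool" where
  "C_order 0 f = continuous_on UNIV f"
| "C_order (Suc n) f = ((\<forall>z. f differentiable (at z)) \<and> (\<forall>b\<in>Basis. C_order n (pd b f)))"

definition test_fun :: "'a::euclidean_space set \<Rightarrow> ('a \<Rightarrow> real) \<Rightarrow> bool" where
  "test_fun U \<phi> \<longleftrightarrow> (\<forall>n. C_order n \<phi>) \<and>
     compact (closure {z. \<phi> z \<noteq> 0}) \<and> closure {z. \<phi> z \<noteq> 0} \<subseteq> U"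

definition loc_integrable :: "'a::euclidean_space set \<Rightarrow> ('a \<Rightarrow> real) \<Rightarrow> bool" where
  "loc_integrable U f \<longleftrightarrow> (\<forall>C. compact C \<and> C \<subseteq> U \<longrightarrow> set_integrable lborel C f)"

definition has_weak_deriv ::
    "'a::euclidean_space set \<Rightarrow> 'a \<Rightarrow> ('a \<Rightarrow> real) \<Rightarrow> ('a \<Rightarrow> real) \<Rightarrow> bool" where
  "has_weak_deriv U b f g \<longleftrightarrow> loc_integrable U f \<and> loc_integrable U g \<and>
     (\<forall>\<phi>. test_fun U \<phi> \<longrightarrow>
        (LINT z:U|lborel. f z * pd b \<phi> z) = - (LINT z:U|lborel. g z * \<phi> z))"

text \<open>The weak derivative is only determined up to a null set; below, \<open>weak_d\<close> is used only
  where this does not matter.\<close>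

definition weak_d :: "'a::euclidean_space set \<Rightarrow> 'a \<Rightarrow> ('a \<Rightarrow> real) \<Rightarrow> 'a \<Rightarrow> real" where
  "weak_d U b f = (SOME g. has_weak_deriv U b f g)"

definition L2_on :: "'a::euclidean_space set \<Rightarrow> ('a \<Rightarrow> real) \<Rightarrow> bool" where
  "L2_on U f \<longleftrightarrow> set_borel_measurable lborel U f \<and> set_integrable lborel U (\<lambda>z. (f z)\<^sup>2)"

definition has_L2_deriv :: "'a::euclidean_space set \<Rightarrow> 'a \<Rightarrow> ('a \<Rightarrow> real) \<Rightarrow> bool" where
  "has_L2_deriv U b f \<longleftrightarrow> (\<exists>g. L2_on U g \<and> has_weak_deriv U b f g)"

definition Omega :: "real set" where
  "Omega = {-1<..<1}"

definition cyl :: "real \<Rightarrow> (real \<times> real) set" where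
  "cyl T = {0<..<T} \<times> Omega"

text \<open>Elements of \<open>H\<^sup>1(\<Omega>)\<close> are represented by their continuous version on the closed interval.\<close>

definition H1 :: "(real \<Rightarrow> real) \<Rightarrow> bool" where
  "H1 f \<longleftrightarrow> continuous_on {-1..1} f \<and> L2_on Omega f \<and> has_L2_deriv Omega 1 f"

definition H10 :: "(real \<Rightarrow> real) \<Rightarrow> bool" where
  "H10 f \<longleftrightarrow> H1 f \<and> f (-1) = 0 \<and> f 1 = 0"

definition H1_sq :: "(real \<Rightarrow> real) \<Rightarrow> real" where
  "H1_sq f = (LINT x:Omega|lborel. (f x)\<^sup>2) + (LINT x:Omega|lborel. (weak_d Omega 1 f x)\<^sup>2)"

text \<open>\<open>H\<^sup>2(0,T)\<close>: elements are represented by their \<open>C\<^sup>1\<close> version on \<open>[0,T]\<close>; \<open>tder\<close> is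
  then the continuous version of the first derivative.\<close>

definition tder :: "real \<Rightarrow> (real \<Rightarrow> real) \<Rightarrow> real \<Rightarrow> real" where
  "tder T f t = vector_derivative f (at t within {0..T})"

definition tder2 :: "real \<Rightarrow> (real \<Rightarrow> real) \<Rightarrow> real \<Rightarrow> real" where
  "tder2 T f = weak_d {0<..<T} 1 (tder T f)"

definition H2_time :: "real \<Rightarrow> (real \<Rightarrow> real) \<Rightarrow> bool" where
  "H2_time T f \<longleftrightarrow> f differentiable_on {0..T} \<and> continuous_on {0..T} (tder T f) \<and>
     has_L2_deriv {0<..<T} 1 (tder T f)"

definition H1_tx :: "(real \<times> real) set \<Rightarrow> (real \<times> real \<Rightarrow> real) \<Rightarrow> bool" where
  "H1_tx Q w \<longleftrightarrow> L2_on Q w \<and> has_L2_deriv Q (1,0) w \<and> has_L2_deriv Q (0,1) w"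

text \<open>\<open>L\<^sup>2(0,T;H\<^sup>1(\<Omega>))\<close>, its squared norm, and weak convergence against its dual.\<close>

definition L2H1 :: "real \<Rightarrow> (real \<times> real \<Rightarrow> real) \<Rightarrow> bool" where
  "L2H1 T w \<longleftrightarrow> L2_on (cyl T) w \<and> has_L2_deriv (cyl T) (0,1) w"

definition L2H1_sq :: "real \<Rightarrow> (real \<times> real \<Rightarrow> real) \<Rightarrow> real" where
  "L2H1_sq T w = (LINT z:cyl T|lborel. (w z)\<^sup>2) + (LINT z:cyl T|lborel. (weak_d (cyl T) (0,1) w z)\<^sup>2)"

definition bdd_functional_L2H1 :: "real \<Rightarrow> ((real \<times> real \<Rightarrow> real) \<Rightarrow> real) \<Rightarrow> bool" where
  "bdd_functional_L2H1 T L \<longleftrightarrow>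
     (\<forall>v w a b. L2H1 T v \<and> L2H1 T w \<longrightarrow> L (\<lambda>z. a * v z + b * w z) = a * L v + b * L w) \<and>
     (\<exists>C. \<forall>v. L2H1 T v \<longrightarrow> \<bar>L v\<bar> \<le> C * sqrt (L2H1_sq T v))"

definition weak_conv_L2H1 ::
    "real \<Rightarrow> (nat \<Rightarrow> real \<times> real \<Rightarrow> real) \<Rightarrow> (real \<times> real \<Rightarrow> real) \<Rightarrow> bool" where
  "weak_conv_L2H1 T w w_lim \<longleftrightarrow> (\<forall>\<^sub>F n in sequentially. L2H1 T (w n)) \<and> L2H1 T w_lim \<and>
     (\<forall>L. bdd_functional_L2H1 T L \<longrightarrow> (\<lambda>n. L (w n)) \<longlonglongrightarrow> L w_lim)"

definition conv_L2 ::
    "(real \<times> real) set \<Rightarrow> (nat \<Rightarrow> real \<times> real \<Rightarrow> real) \<Rightarrow> (real \<times> real \<Rightarrow> real) \<Rightarrow> bool" where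
  "conv_L2 Q w w_lim \<longleftrightarrow> (\<forall>\<^sub>F n in sequentially. L2_on Q (w n)) \<and> L2_on Q w_lim \<and>
     (\<lambda>n. LINT z:Q|lborel. (w n z - w_lim z)\<^sup>2) \<longlonglongrightarrow> 0"

definition ess_bounded :: "(real \<times> real) set \<Rightarrow> (real \<times> real \<Rightarrow> real) \<Rightarrow> bool" where
  "ess_bounded Q w \<longleftrightarrow> set_borel_measurable lborel Q w \<and> (\<exists>C. AE z\<in>Q in lborel. \<bar>w z\<bar> \<le> C)"

definition weak_star_conv_Linf ::
    "(real \<times> real) set \<Rightarrow> (nat \<Rightarrow> real \<times> real \<Rightarrow> real) \<Rightarrow> (real \<times> real \<Rightarrow> real) \<Rightarrow> bool" where
  "weak_star_conv_Linf Q w w_lim \<longleftrightarrow>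
     (\<forall>\<^sub>F n in sequentially. ess_bounded Q (w n)) \<and> ess_bounded Q w_lim \<and>
     (\<forall>\<psi>. set_integrable lborel Q \<psi> \<longrightarrow>
        (\<lambda>n. LINT z:Q|lborel. w n z * \<psi> z) \<longlonglongrightarrow> (LINT z:Q|lborel. w_lim z * \<psi> z))"

definition LinfH1_le :: "real \<Rightarrow> (real \<times> real \<Rightarrow> real) \<Rightarrow> real \<Rightarrow> bool" where
  "LinfH1_le T w C \<longleftrightarrow> (AE t\<in>{0<..<T} in lborel.
     (LINT x:Omega|lborel. (w (t,x))\<^sup>2) +
     (LINT x:Omega|lborel. (weak_d (cyl T) (0,1) w (t,x))\<^sup>2) \<le> C\<^sup>2)"

text \<open>Trace at \<open>t = 0\<close>, through Green's formula, of a function on a space-time domain with time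
  sections \<open>G t\<close>.  The test functions do not have to vanish at \<open>t = 0\<close>.\<close>

definition has_initial_trace ::
    "real \<Rightarrow> (real \<Rightarrow> real set) \<Rightarrow> (real \<times> real \<Rightarrow> real) \<Rightarrow> (real \<Rightarrow> real) \<Rightarrow> bool" where
  "has_initial_trace T G f f0 \<longleftrightarrow> (let Q = {(t,x). 0 < t \<and> t < T \<and> x \<in> G t} in
     \<forall>\<phi>. test_fun {(t,x). t < T \<and> x \<in> G (max t 0)} \<phi> \<longrightarrow>
       (LINT z:Q|lborel. f z * pd (1,0) \<phi> z + weak_d Q (1,0) f z * \<phi> z)
         = - (LINT x:G 0|lborel. f0 x * \<phi> (0,x)))"

text \<open>\<open>\<partial>\<^sub>t q + \<partial>\<^sub>x F = 0\<close> in the sense of distributions.\<close>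

definition conservation_law ::
    "(real \<times> real) set \<Rightarrow> (real \<times> real \<Rightarrow> real) \<Rightarrow> (real \<times> real \<Rightarrow> real) \<Rightarrow> bool" where
  "conservation_law Q q F \<longleftrightarrow> loc_integrable Q q \<and> loc_integrable Q F \<and>
     (\<forall>\<phi>. test_fun Q \<phi> \<longrightarrow>
        (LINT z:Q|lborel. q z * pd (1,0) \<phi> z + F z * pd (0,1) \<phi> z) = 0)"


section \<open>The microscopic system\<close>

record phys =
  mu_f :: real
  mu_g :: real
  kappa_f :: real
  gamma_f :: real
  a_g :: real
  gamma_s_bar :: real

definition phys_ok :: "phys \<Rightarrow> bool" where
  "phys_ok P \<longleftrightarrow> mu_f P > 0 \<and> mu_g P > 0 \<and> kappa_f P > 0 \<and> gamma_f P > 1 \<and>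
     gamma_s_bar P > 0"

definition p_f :: "phys \<Rightarrow> real \<Rightarrow> real" where
  "p_f P \<rho> = kappa_f P * \<rho> powr gamma_f P"

definition p_g :: "phys \<Rightarrow> real \<Rightarrow> real" where
  "p_g P \<rho> = (a_g P)\<^sup>2 * \<rho>"

definition gamma_s :: "phys \<Rightarrow> nat \<Rightarrow> real" where
  "gamma_s P N = gamma_s_bar P / real N"

text \<open>The constant \<open>\<kappa>\<^sub>k\<close> of a bubble of mass \<open>m\<close> and radius \<open>R\<close>; its value does not depend on \<open>R \<noteq> 0\<close>.\<close>

definition kappa :: "phys \<Rightarrow> nat \<Rightarrow> real \<Rightarrow> real \<Rightarrow> real" where
  "kappa P N m R = R * (p_g P (m / (2 * R)) + gamma_s P N / (2 * R))"

text \<open>A configuration of \<open>N\<close> bubbles is given by centres \<open>c k\<close> and radii \<open>R k\<close>, \<open>1 \<le> k \<le> N\<close>;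
  \<open>x_plus\<close> and \<open>x_minus\<close> include the conventions at \<open>k = 0\<close> and \<open>k = N + 1\<close>.\<close>

definition x_plus :: "(nat \<Rightarrow> real) \<Rightarrow> (nat \<Rightarrow> real) \<Rightarrow> nat \<Rightarrow> real" where
  "x_plus c R k = (if k = 0 then -1 else c k + R k)"

definition x_minus :: "nat \<Rightarrow> (nat \<Rightarrow> real) \<Rightarrow> (nat \<Rightarrow> real) \<Rightarrow> nat \<Rightarrow> real" where
  "x_minus N c R k = (if k = N + 1 then 1 else c k - R k)"

definition bubble :: "(nat \<Rightarrow> real) \<Rightarrow> (nat \<Rightarrow> real) \<Rightarrow> nat \<Rightarrow> real set" where
  "bubble c R k = {c k - R k <..< c k + R k}"

definition gap :: "nat \<Rightarrow> (nat \<Rightarrow> real) \<Rightarrow> (nat \<Rightarrow> real) \<Rightarrow> nat \<Rightarrow> real set" where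
  "gap N c R k = {x_plus c R k <..< x_minus N c R (k + 1)}"

definition gap_length :: "nat \<Rightarrow> (nat \<Rightarrow> real) \<Rightarrow> (nat \<Rightarrow> real) \<Rightarrow> nat \<Rightarrow> real" where
  "gap_length N c R k = x_minus N c R (k + 1) - x_plus c R k"

definition fluid :: "nat \<Rightarrow> (nat \<Rightarrow> real) \<Rightarrow> (nat \<Rightarrow> real) \<Rightarrow> real set" where
  "fluid N c R = Omega - (\<Union>k\<in>{1..N}. closure (bubble c R k))"

text \<open>The interpolant with value \<open>va\<close> at \<open>a\<close> and \<open>vb\<close> at \<open>b\<close>.\<close>

definition affine_interp :: "real \<Rightarrow> real \<Rightarrow> real \<Rightarrow> real \<Rightarrow> real \<Rightarrow> real" where
  "affine_interp a va b vb x = va + (x - a) / (b - a) * (vb - va)"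

record micro_data =
  c_init :: "nat \<Rightarrow> real"
  R_init :: "nat \<Rightarrow> real"
  mass :: "nat \<Rightarrow> real"
  f_g_init :: "real \<Rightarrow> real"
  rho_g_init :: "real \<Rightarrow> real"

text \<open>The last three fields are the extended densities and covolumes; \<open>stress\<close> is \<open>\<Sigma>\<^sub>f\<close>.\<close>

record micro_sol =
  cen :: "nat \<Rightarrow> real \<Rightarrow> real"
  rad :: "nat \<Rightarrow> real \<Rightarrow> real"
  rho_f :: "real \<times> real \<Rightarrow> real"
  u_f :: "real \<times> real \<Rightarrow> real"
  stress :: "real \<times> real \<Rightarrow> real"
  rho_f_ext :: "real \<times> real \<Rightarrow> real"
  rho_g_ext :: "real \<times> real \<Rightarrow> real"
  f_g_ext :: "real \<times> real \<Rightarrow> real"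

definition cs :: "micro_sol \<Rightarrow> real \<Rightarrow> nat \<Rightarrow> real" where
  "cs s t k = cen s k t"

definition Rs :: "micro_sol \<Rightarrow> real \<Rightarrow> nat \<Rightarrow> real" where
  "Rs s t k = rad s k t"

abbreviation "xp s t k \<equiv> x_plus (cs s t) (Rs s t) k"
abbreviation "xm N s t k \<equiv> x_minus N (cs s t) (Rs s t) k"

definition fluid_at :: "nat \<Rightarrow> micro_sol \<Rightarrow> real \<Rightarrow> real set" where
  "fluid_at N s t = fluid N (cs s t) (Rs s t)"

definition fluid_dom :: "nat \<Rightarrow> real \<Rightarrow> micro_sol \<Rightarrow> (real \<times> real) set" where
  "fluid_dom N T s = {(t,x). 0 < t \<and> t < T \<and> x \<in> fluid_at N s t}"

definition fluid_dom_closed :: "nat \<Rightarrow> real \<Rightarrow> micro_sol \<Rightarrow> (real \<times> real) set" where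
  "fluid_dom_closed N T s =
     {(t,x). 0 \<le> t \<and> t \<le> T \<and> (\<exists>k\<le>N. xp s t k \<le> x \<and> x \<le> xm N s t (k + 1))}"

definition bubble_stress :: "phys \<Rightarrow> nat \<Rightarrow> real \<Rightarrow> micro_data \<Rightarrow> micro_sol \<Rightarrow> nat \<Rightarrow> real \<Rightarrow> real" where
  "bubble_stress P N T D s k t =
     mu_g P * tder T (rad s k) t / rad s k t - kappa P N (mass D k) (rad s k t) / rad s k t"

text \<open>
  The velocity is represented by its version that is continuous up to the boundary
  (\<open>H\<^sup>1\<^sub>tL\<^sup>2\<^sub>x \<inter> L\<^sup>2\<^sub>tH\<^sup>2\<^sub>x\<close> embeds into continuous functions), and \<open>\<Sigma>\<^sub>f\<close> by a version
  that for almost every time is continuous in space up to the interfaces; \<open>stress s (t, xp s t k)\<close>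
  and \<open>stress s (t, xm N s t k)\<close> are therefore the one-sided traces from the fluid.
\<close>

definition classical_solution ::
    "phys \<Rightarrow> nat \<Rightarrow> real \<Rightarrow> (real \<Rightarrow> real) \<Rightarrow> (real \<Rightarrow> real) \<Rightarrow> micro_data \<Rightarrow> micro_sol \<Rightarrow> bool" where
  "classical_solution P N T rho0 u0 D s \<longleftrightarrow> (let Q = fluid_dom N T s in
     \<comment> \<open>no overlap\<close>
     (\<forall>t\<in>{0..T}. (\<forall>k\<in>{1..N}. rad s k t > 0) \<and> (\<forall>k\<le>N. xp s t k < xm N s t (k + 1))) \<and>
     \<comment> \<open>regularity\<close>
     (\<forall>k\<in>{1..N}. H2_time T (cen s k) \<and> H2_time T (rad s k)) \<and>
     rho_f s \<in> borel_measurable borel \<and> u_f s \<in> borel_measurable borel \<and>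
     stress s \<in> borel_measurable borel \<and>
     H1_tx Q (rho_f s) \<and> (AE z\<in>Q in lborel. rho_f s z > 0) \<and>
     H1_tx Q (u_f s) \<and> has_L2_deriv Q (0,1) (weak_d Q (0,1) (u_f s)) \<and>
     continuous_on (fluid_dom_closed N T s) (u_f s) \<and>
     (AE z\<in>Q in lborel. stress s z = mu_f P * weak_d Q (0,1) (u_f s) z - p_f P (rho_f s z)) \<and>
     (AE t\<in>{0<..<T} in lborel. \<forall>k\<le>N.
        continuous_on {xp s t k..xm N s t (k + 1)} (\<lambda>x. stress s (t,x))) \<and>
     \<comment> \<open>fluid equations\<close>
     conservation_law Q (rho_f s) (\<lambda>z. rho_f s z * u_f s z) \<and>
     conservation_law Q (\<lambda>z. rho_f s z * u_f s z) (\<lambda>z. rho_f s z * (u_f s z)\<^sup>2 - stress s z) \<and>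
     \<comment> \<open>boundary and interface conditions\<close>
     (\<forall>t\<in>{0..T}. u_f s (t,-1) = 0 \<and> u_f s (t,1) = 0 \<and>
        (\<forall>k\<in>{1..N}. u_f s (t, xp s t k) = tder T (cen s k) t + tder T (rad s k) t \<and>
                    u_f s (t, xm N s t k) = tder T (cen s k) t - tder T (rad s k) t)) \<and>
     \<comment> \<open>bubble dynamics\<close>
     (AE t\<in>{0<..<T} in lborel. \<forall>k\<in>{1..N}.
        mass D k * tder2 T (cen s k) t = stress s (t, xp s t k) - stress s (t, xm N s t k) \<and>
        mass D k / 3 * tder2 T (rad s k) t
          = stress s (t, xm N s t k) + stress s (t, xp s t k) - 2 * bubble_stress P N T D s k t) \<and>
     \<comment> \<open>initial conditions\<close>
     (\<forall>k\<in>{1..N}. cen s k 0 = c_init D k \<and> rad s k 0 = R_init D k \<and>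
        tder T (cen s k) 0 + tder T (rad s k) 0 = u0 (c_init D k + R_init D k) \<and>
        tder T (cen s k) 0 - tder T (rad s k) 0 = u0 (c_init D k - R_init D k)) \<and>
     has_initial_trace T (fluid_at N s) (rho_f s) rho0 \<and>
     (\<forall>x\<in>fluid_at N s 0. u_f s (0,x) = u0 x))"


section \<open>Extensions to the whole interval\<close>

definition u_ext :: "nat \<Rightarrow> real \<Rightarrow> micro_sol \<Rightarrow> real \<times> real \<Rightarrow> real" where
  "u_ext N T s = (\<lambda>(t,x). indicator (fluid_at N s t) x * u_f s (t,x) +
     (\<Sum>k\<in>{1..N}. indicator (closure (bubble (cs s t) (Rs s t) k)) x *
        (tder T (cen s k) t + tder T (rad s k) t / rad s k t * (x - cen s k t))))"

definition stress_f_ext :: "nat \<Rightarrow> micro_sol \<Rightarrow> real \<times> real \<Rightarrow> real" where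
  "stress_f_ext N s = (\<lambda>(t,x). indicator (fluid_at N s t) x * stress s (t,x) +
     (\<Sum>k\<in>{1..N}. indicator (closure (bubble (cs s t) (Rs s t) k)) x *
        affine_interp (xm N s t k) (stress s (t, xm N s t k)) (xp s t k) (stress s (t, xp s t k)) x))"

definition stress_g_ext ::
    "phys \<Rightarrow> nat \<Rightarrow> real \<Rightarrow> micro_data \<Rightarrow> micro_sol \<Rightarrow> real \<times> real \<Rightarrow> real" where
  "stress_g_ext P N T D s = (\<lambda>(t,x).
     (\<Sum>k\<in>{1..N}. indicator (closure (bubble (cs s t) (Rs s t) k)) x * bubble_stress P N T D s k t) +
     indicator (gap N (cs s t) (Rs s t) 0) x * bubble_stress P N T D s 1 t +
     indicator (gap N (cs s t) (Rs s t) N) x * bubble_stress P N T D s N t +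
     (\<Sum>k\<in>{1..N - 1}. indicator (gap N (cs s t) (Rs s t) k) x *
        affine_interp (xp s t k) (bubble_stress P N T D s k t)
          (xm N s t (k + 1)) (bubble_stress P N T D s (k + 1) t) x))"

definition chi :: "nat \<Rightarrow> micro_sol \<Rightarrow> real \<times> real \<Rightarrow> real" where
  "chi N s = (\<lambda>(t,x). indicator (fluid_at N s t) x)"

text \<open>\<open>\<partial>\<^sub>t w + u \<partial>\<^sub>x w = G\<close> on \<open>(0,T) \<times> \<Omega>\<close>, \<open>w(0) = w0\<close>.  A solution that is bounded with values
  in \<open>H\<^sup>1(\<Omega>)\<close> lies in \<open>H\<^sup>1((0,T) \<times> \<Omega>)\<close> and has a version that is continuous up to the boundary.\<close>

definition transport_solution ::
    "real \<Rightarrow> (real \<times> real \<Rightarrow> real) \<Rightarrow> (real \<times> real \<Rightarrow> real) \<Rightarrow> (real \<times> real \<Rightarrow> real) \<Rightarrow>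
     (real \<Rightarrow> real) \<Rightarrow> bool" where
  "transport_solution T u w G w0 \<longleftrightarrow>
     continuous_on ({0..T} \<times> {-1..1}) w \<and> H1_tx (cyl T) w \<and>
     (AE z\<in>cyl T in lborel. weak_d (cyl T) (1,0) w z + u z * weak_d (cyl T) (0,1) w z = G z) \<and>
     (\<forall>x\<in>{-1..1}. w (0,x) = w0 x)"

definition extended_solution ::
    "phys \<Rightarrow> nat \<Rightarrow> real \<Rightarrow> (real \<Rightarrow> real) \<Rightarrow> micro_data \<Rightarrow> micro_sol \<Rightarrow> bool" where
  "extended_solution P N T rho0 D s \<longleftrightarrow>
     (\<forall>z\<in>{0..T} \<times> {-1..1}. rho_f_ext s z > 0) \<and>
     transport_solution T (u_ext N T s) (rho_f_ext s)
       (\<lambda>z. - (rho_f_ext s z / mu_f P) * (stress_f_ext N s z + p_f P (rho_f_ext s z))) rho0 \<and>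
     transport_solution T (u_ext N T s) (rho_g_ext s)
       (\<lambda>z. - (rho_g_ext s z / mu_g P) *
          (stress_g_ext P N T D s z + p_g P (rho_g_ext s z) + gamma_s_bar P * f_g_ext s z))
       (rho_g_init D) \<and>
     transport_solution T (u_ext N T s) (f_g_ext s)
       (\<lambda>z. - (f_g_ext s z / mu_g P) *
          (stress_g_ext P N T D s z + p_g P (rho_g_ext s z) + gamma_s_bar P * f_g_ext s z))
       (f_g_init D)"


section \<open>Initial data and uniform bounds\<close>

record macro_data =
  rhof0 :: "real \<Rightarrow> real"
  rhog0 :: "real \<Rightarrow> real"
  alphaf0 :: "real \<Rightarrow> real"
  alphag0 :: "real \<Rightarrow> real"
  fg0 :: "real \<Rightarrow> real"
  u0 :: "real \<Rightarrow> real"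

definition macro_data_ok :: "macro_data \<Rightarrow> bool" where
  "macro_data_ok I \<longleftrightarrow>
     H1 (rhof0 I) \<and> H1 (rhog0 I) \<and> H1 (alphaf0 I) \<and> H1 (alphag0 I) \<and> H1 (fg0 I) \<and> H10 (u0 I) \<and>
     (\<exists>rho_min alpha_min f_min. rho_min > 0 \<and> alpha_min > 0 \<and> f_min > 0 \<and>
        (\<forall>x\<in>Omega. min (rhof0 I x) (rhog0 I x) \<ge> rho_min \<and>
           min (alphaf0 I x) (alphag0 I x) \<ge> alpha_min \<and>
           alphaf0 I x + alphag0 I x = 1 \<and> fg0 I x \<ge> f_min)) \<and>
     (LINT x:Omega|lborel. alphag0 I x * fg0 I x) = 1"

text \<open>\<open>C\<^sup>1([0,\<infinity>)\<^sup>2)\<close>, with derivatives continuous up to the boundary.\<close>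

definition C1_quadrant :: "(real \<times> real \<Rightarrow> real) \<Rightarrow> bool" where
  "C1_quadrant \<beta> \<longleftrightarrow> (\<exists>D1 D2. continuous_on ({0..} \<times> {0..}) D1 \<and> continuous_on ({0..} \<times> {0..}) D2 \<and>
     (\<forall>z\<in>{0..} \<times> {0..}.
        (\<beta> has_derivative (\<lambda>(h,k). D1 z * h + D2 z * k)) (at z within {0..} \<times> {0..})))"

definition micro_data_ok ::
    "phys \<Rightarrow> macro_data \<Rightarrow> real \<Rightarrow> real \<Rightarrow> (nat \<Rightarrow> micro_data) \<Rightarrow> bool" where
  "micro_data_ok P I M d D \<longleftrightarrow>
     (\<forall>N\<ge>1. let c = c_init (D N); R = R_init (D N); m = mass (D N) in
        (\<forall>k\<in>{1..N}.
           M \<le> N * m k \<and> N * m k \<le> 1 / M \<and>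
           M \<le> N * kappa P N (m k) (R k) \<and> N * kappa P N (m k) (R k) \<le> 1 / M \<and>
           2 * d \<le> N * R k \<and> N * R k \<le> 1 / (2 * d)) \<and>
        (\<forall>k\<le>N. 2 * d \<le> N * gap_length N c R k \<and> N * gap_length N c R k \<le> 1 / (2 * d)) \<and>
        (\<forall>k\<in>{1..N}. \<forall>x\<in>bubble c R k.
           f_g_init (D N) x = 1 / (2 * N * R k) \<and> rho_g_init (D N) x = m k / (2 * R k))) \<and>
     (\<forall>N\<ge>1. H1 (f_g_init (D N)) \<and> H1 (rho_g_init (D N))) \<and>
     (\<exists>C. \<forall>N\<ge>1. H1_sq (f_g_init (D N)) \<le> C\<^sup>2 \<and> H1_sq (rho_g_init (D N)) \<le> C\<^sup>2) \<and>
     (\<forall>\<beta>. C1_quadrant \<beta> \<longrightarrow> (\<forall>\<phi>. test_fun Omega \<phi> \<longrightarrow>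
        (\<lambda>N. LINT x:Omega - closure (fluid N (c_init (D N)) (R_init (D N)))|lborel.
               \<beta> (rho_g_init (D N) x, f_g_init (D N) x) * \<phi> x)
          \<longlonglongrightarrow> (LINT x:Omega|lborel. alphag0 I x * \<beta> (rhog0 I x, fg0 I x) * \<phi> x)))"

definition uniform_bounds ::
    "phys \<Rightarrow> real \<Rightarrow> real \<Rightarrow> real \<Rightarrow> real \<Rightarrow> real \<Rightarrow> nat \<Rightarrow> micro_data \<Rightarrow> micro_sol \<Rightarrow> bool" where
  "uniform_bounds P T K d rho_lo rho_hi N D s \<longleftrightarrow> (let Q = fluid_dom N T s in
     (\<forall>t\<in>{0..T}.
        (\<forall>k\<in>{1..N}. d \<le> N * rad s k t \<and> N * rad s k t \<le> 1 / d) \<and>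
        (\<forall>k\<le>N. d \<le> N * gap_length N (cs s t) (Rs s t) k \<and>
               N * gap_length N (cs s t) (Rs s t) k \<le> 1 / d)) \<and>
     (AE z\<in>Q in lborel. rho_lo \<le> rho_f s z \<and> rho_f s z \<le> rho_hi) \<and>
     (AE t\<in>{0<..<T} in lborel.
        (LINT x:fluid_at N s t|lborel. mu_f P * (weak_d Q (0,1) (u_f s) (t,x))\<^sup>2 / 2) +
        mu_g P * (\<Sum>k\<in>{1..N}. (tder T (rad s k) t)\<^sup>2 / rad s k t) \<le> K) \<and>
     L2H1 T (stress_f_ext N s) \<and> L2H1 T (stress_g_ext P N T D s) \<and>
     L2H1_sq T (stress_f_ext N s) + L2H1_sq T (stress_g_ext P N T D s) +
       (LINT t:{0<..<T}|lborel.
          \<Sum>k\<in>{1..N}. mass D k * ((tder2 T (rad s k) t)\<^sup>2 + (tder2 T (cen s k) t)\<^sup>2)) \<le> K)"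


section \<open>Bubble distribution functions and the limit equation\<close>

text \<open>\<open>(1/N) \<Sum>\<^sub>k \<delta>\<^bsub>(c\<^sub>k(t), N R\<^sub>k(t))\<^esub>\<close>\<close>

definition bubble_distr :: "nat \<Rightarrow> micro_sol \<Rightarrow> real \<Rightarrow> (real \<times> real) measure" where
  "bubble_distr N s t =
     distr (uniform_count_measure {1..N}) borel (\<lambda>k. (cen s k t, real N * rad s k t))"

definition phase :: "real \<Rightarrow> (real \<times> real) set" where
  "phase d = {-1..1} \<times> {d..1/d}"

definition prob_on :: "(real \<times> real) set \<Rightarrow> (real \<times> real) measure \<Rightarrow> bool" where
  "prob_on X S \<longleftrightarrow> sets S = sets borel \<and> prob_space S \<and> measure S X = 1"

text \<open>The product \<open>a S\<close> is well defined as a distribution on \<open>(0,T) \<times> \<Omega> \<times> (0,\<infinity>)\<close>.\<close>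

definition flux_integrable ::
    "real \<Rightarrow> (real \<Rightarrow> (real \<times> real) measure) \<Rightarrow> (real \<times> real \<times> real \<Rightarrow> real) \<Rightarrow> bool" where
  "flux_integrable T S a \<longleftrightarrow>
     (AE t\<in>{0<..<T} in lborel. set_integrable (S t) (Omega \<times> {0<..}) (\<lambda>y. a (t,y))) \<and>
     set_integrable lborel {0<..<T} (\<lambda>t. LINT y:Omega \<times> {0<..}|S t. \<bar>a (t,y)\<bar>)"

text \<open>\<open>\<partial>\<^sub>t S + \<partial>\<^sub>x (a S) + \<partial>\<^sub>r (b S) = 0\<close> in the sense of distributions in
  \<open>(t,x,r) \<in> (0,T) \<times> \<Omega> \<times> (0,\<infinity>)\<close>.\<close>

definition transport_distributional ::
    "real \<Rightarrow> (real \<Rightarrow> (real \<times> real) measure) \<Rightarrow> (real \<times> real \<times> real \<Rightarrow> real) \<Rightarrow>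
     (real \<times> real \<times> real \<Rightarrow> real) \<Rightarrow> bool" where
  "transport_distributional T S a b \<longleftrightarrow> flux_integrable T S a \<and> flux_integrable T S b \<and>
     (\<forall>\<phi>. test_fun ({0<..<T} \<times> Omega \<times> {0<..}) \<phi> \<longrightarrow>
        (LINT t:{0<..<T}|lborel. LINT y:Omega \<times> {0<..}|S t.
            pd (1,0,0) \<phi> (t,y) + a (t,y) * pd (0,1,0) \<phi> (t,y) + b (t,y) * pd (0,0,1) \<phi> (t,y)) = 0)"

end

theory Submission
  imports Defs
begin

text \<open>
  For a single bubble and a test function \<open>\<phi>\<close>, integrating \<open>d/dt \<phi>(t, c\<^sub>k, N R\<^sub>k)\<close> over \<open>[0,T]\<close> gives
  \<open>0\<close>.  Here \<open>c\<^sub>k'\<close> is the value of the extended velocity at \<open>c\<^sub>k\<close>, and the definition of \<open>\<Sigma>\<^sub>k\<close> reads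
  \<open>\<mu>\<^sub>g R\<^sub>k' = R\<^sub>k \<Sigma>\<^sub>k + \<kappa>\<^sub>k\<close>, where \<open>\<kappa>\<^sub>k\<close> is expressed through the extended gas density at \<open>c\<^sub>k\<close>.  Averaging
  over \<open>k\<close> yields the weak equation for the empirical measures, and each product of a field with the
  empirical measure has to be passed to the limit.

  Since \<open>N R\<^sub>k\<close> is bounded from below, the bubbles are disjoint and each of them has length of order \<open>1/N\<close>.
  The fields are affine in every bubble, so their values at the centres are means over the bubbles; the
  pairing with the empirical measure is therefore the integral of the field against a bounded function,
  which is enough for strongly convergent fields.  The stress converges only weakly, but its bound in
  \<open>L\<^sup>2(H\<^sup>1)\<close> controls the oscillation in space uniformly in \<open>N\<close>: its values at the centres can be replaced by
  averages over a fixed small scale, and these are tested against functions that converge strongly.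
\<close>

section \<open>Smooth functions\<close>

text \<open>The gas density is available only as a weak \<open>H1\<close> solution of a transport
  equation, yet its value at every bubble centre is needed. Inside a bubble the velocity is affine
  in space, so the curves \<open>c + R y\<close> are characteristics; testing the equation with
  bumps that travel along such a curve and shrink onto it yields an ordinary differential equation,
  and its solution is the density \<open>m / (2 R)\<close>. The bound on the stress is stated
  through \<open>weak_d\<close>, an arbitrary choice of weak derivative. It says something about the
  slopes of the piecewise affine stress only once weak derivatives are known to be unique almost
  everywhere; this is the purpose of the fundamental lemma. The limit equation multiplies a measure
  by fields that are defined only almost everywhere. This is meaningful because a bubble of mass
  \<open>1/N\<close> has length at least \<open>2d/N\<close>: the position marginal of the limit
  measure has a density bounded by \<open>1/(2d)\<close>. The same constant bounds the functions
  against which fields are integrated before the limit, and it makes approximation of the limit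
  fields in \<open>L1\<close> harmless.\<close>

lemma pd_eq:
  assumes "(f has_derivative D) (at z)"
  shows "pd b f z = D b"
  using frechet_derivative_at[OF assms] by (simp add: pd_def)

lemma pd_has_derivative:
  "f differentiable (at z) \<Longrightarrow> (f has_derivative (\<lambda>b. pd b f z)) (at z)"
  unfolding pd_def by (simp add: frechet_derivative_works[symmetric])

lemma C_order_Suc_imp: "C_order (Suc n) f \<Longrightarrow> C_order n f"
proof (induction n arbitrary: f)
  case 0
  then show ?case
    by (auto intro!: continuous_at_imp_continuous_on differentiable_imp_continuous_within)
next
  case (Suc n)
  then show ?case by (metis C_order.simps(2))
qed

lemma C_order_const: "C_order n (\<lambda>z. c)"
proof (induction n arbitrary: c)
  case (Suc n)
  have "pd b (\<lambda>z. c) = (\<lambda>z. 0)" for b :: 'a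
    by (intro ext pd_eq derivative_intros)
  then show ?case using Suc by simp
qed simp

lemma C_order_linear: "bounded_linear f \<Longrightarrow> C_order n f"
proof (cases n)
  case 0
  assume "bounded_linear f"
  then show ?thesis using 0 by (simp add: bounded_linear.linear linear_continuous_on)
next
  case (Suc m)
  assume f: "bounded_linear f"
  then have "(f has_derivative f) (at z)" for z by (rule bounded_linear_imp_has_derivative)
  moreover from this have "pd b f = (\<lambda>z. f b)" for b by (intro ext pd_eq)
  ultimately show ?thesis using Suc by (auto simp: C_order_const differentiable_def)
qed

lemma C_order_add: "C_order n f \<Longrightarrow> C_order n g \<Longrightarrow> C_order n (\<lambda>z. f z + g z)"
proof (induction n arbitrary: f g)
  case 0
  then show ?case by (auto intro: continuous_intros)
next
  case (Suc n)
  have "pd b (\<lambda>z. f z + g z) = (\<lambda>z. pd b f z + pd b g z)" for b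
    using Suc.prems by (auto intro!: ext pd_eq has_derivative_add pd_has_derivative)
  then show ?case using Suc by simp
qed

lemma C_order_mult: "C_order n f \<Longrightarrow> C_order n g \<Longrightarrow> C_order n (\<lambda>z. f z * g z)"
proof (induction n arbitrary: f g)
  case 0
  then show ?case by (auto intro: continuous_intros)
next
  case (Suc n)
  have "pd b (\<lambda>z. f z * g z) = (\<lambda>z. f z * pd b g z + pd b f z * g z)" for b
    using Suc.prems by (auto intro!: ext pd_eq has_derivative_mult pd_has_derivative)
  moreover have "C_order n (\<lambda>z. f z * pd b g z + pd b f z * g z)" if "b \<in> Basis" for b
  proof -
    \<comment> \<open>The product rule leaves one factor undifferentiated; the induction hypothesis
      needs that factor at the lower order.\<close>
    have "C_order n f" "C_order n g" using Suc.prems by (auto intro: C_order_Suc_imp simp del: C_order.simps)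
    with that Suc.prems show ?thesis by (intro C_order_add Suc.IH) auto
  qed
  ultimately show ?case using Suc by simp
qed

text \<open>The chain rule turns the derivative into a product whose first factor is again a
  composition, with outer function \<open>pd 1 g\<close>. Hence the induction runs over all
  \<open>f\<close> and \<open>g\<close> simultaneously.\<close>

lemma C_order_comp:
  fixes g :: "real \<Rightarrow> real"
  shows "C_order n f \<Longrightarrow> C_order n g \<Longrightarrow> C_order n (\<lambda>z. g (f z))"
proof (induction n arbitrary: f g)
  case 0
  then show ?case by (auto intro: continuous_on_compose2[of UNIV])
next
  case (Suc n)
  have eq: "pd b (\<lambda>z. g (f z)) = (\<lambda>z. pd 1 g (f z) * pd b f z)" for b
  proof (intro ext)
    fix z
    have "(g has_derivative (\<lambda>b. pd b g (f z))) (at (f z))" "(f has_derivative (\<lambda>b. pd b f z)) (at z)"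
      using Suc.prems by (auto intro!: pd_has_derivative)
    from has_derivative_compose[OF this(2,1)]
    have "pd b (\<lambda>z. g (f z)) z = pd (pd b f z) g (f z)"
      by (rule pd_eq)
    also have "\<dots> = pd b f z * pd 1 g (f z)"
    proof -
      have "linear (\<lambda>b. pd b g (f z))"
        using \<open>(g has_derivative _) _\<close> by (simp add: has_derivative_linear)
      from linear_cmul[OF this, of "pd b f z" 1] show ?thesis by simp
    qed
    finally show "pd b (\<lambda>z. g (f z)) z = pd 1 g (f z) * pd b f z" by simp
  qed
  moreover have "C_order n (\<lambda>z. pd 1 g (f z) * pd b f z)" if "b \<in> Basis" for b
  proof (rule C_order_mult)
    have "C_order n f" "C_order n (pd 1 g)" using Suc.prems C_order_Suc_imp by (blast, simp)
    then show "C_order n (\<lambda>z. pd 1 g (f z))" by (rule Suc.IH)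
    show "C_order n (pd b f)" using that Suc.prems by simp
  qed
  moreover have "(\<lambda>z. g (f z)) differentiable (at z)" for z
  proof -
    have "f differentiable (at z)" "g differentiable (at (f z))" using Suc.prems by auto
    from differentiable_chain_at[OF this] show ?thesis by (simp add: o_def)
  qed
  ultimately show ?case unfolding C_order.simps eq by blast
qed

text \<open>On the line the only basis vector is 1, so \<open>C_order\<close> counts ordinary
  derivatives. A family closed under differentiation is then smooth by induction, and so is a
  primitive of a smooth function.\<close>

lemma C_order_Suc_real:
  fixes f :: "real \<Rightarrow> real"
  assumes "\<And>x. (f has_real_derivative f' x) (at x)"
  shows "C_order (Suc n) f \<longleftrightarrow> C_order n f'"
proof -
  have "pd 1 f = f'"
    using assms by (auto intro!: ext pd_eq[THEN trans] simp: has_field_derivative_def)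
  moreover have "f differentiable (at x)" for x
    using assms by (auto simp: real_differentiable_def)
  ultimately show ?thesis by simp
qed

text \<open>The regularity half of \<open>test_fun\<close>. Separated from the support condition, it
  is closed under sums, products and compositions.\<close>

definition smooth :: "('a::euclidean_space \<Rightarrow> real) \<Rightarrow> bool" where
  "smooth f \<longleftrightarrow> (\<forall>n. C_order n f)"

lemma smooth_const: "smooth (\<lambda>z. c)"
  and smooth_add: "smooth f \<Longrightarrow> smooth g \<Longrightarrow> smooth (\<lambda>z. f z + g z)"
  and smooth_mult: "smooth f \<Longrightarrow> smooth g \<Longrightarrow> smooth (\<lambda>z. f z * g z)"
  and smooth_linear: "bounded_linear f \<Longrightarrow> smooth f"
  and smooth_comp: "smooth f \<Longrightarrow> smooth h \<Longrightarrow> smooth (\<lambda>z. h (f z))"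
  for f g :: "'a::euclidean_space \<Rightarrow> real" and h :: "real \<Rightarrow> real"
proof -
  show "smooth (\<lambda>z. c)" by (simp add: smooth_def C_order_const)
  show "smooth f \<Longrightarrow> smooth g \<Longrightarrow> smooth (\<lambda>z. f z + g z)" by (simp add: smooth_def C_order_add)
  show "smooth f \<Longrightarrow> smooth g \<Longrightarrow> smooth (\<lambda>z. f z * g z)" by (simp add: smooth_def C_order_mult)
  show "bounded_linear f \<Longrightarrow> smooth f" by (simp add: smooth_def C_order_linear)
  assume "smooth f" "smooth h"
  then show "smooth (\<lambda>z. h (f z))" unfolding smooth_def using C_order_comp by blast
qed

lemma smooth_diff: "smooth f \<Longrightarrow> smooth g \<Longrightarrow> smooth (\<lambda>z. f z - g z)"
  using smooth_add[of f "\<lambda>z. (-1) * g z"] smooth_mult[OF smooth_const[of "-1"], of g] by simp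

lemma smooth_ident: "smooth (\<lambda>x::real. x)"
  and smooth_fst: "smooth (fst :: real \<times> real \<Rightarrow> real)"
  and smooth_snd: "smooth (snd :: real \<times> real \<Rightarrow> real)"
  by (auto intro!: smooth_linear bounded_linear_fst bounded_linear_snd bounded_linear_ident)

lemma smooth_differentiable: "smooth f \<Longrightarrow> f differentiable (at z)"
  unfolding smooth_def by (metis C_order.simps(2))

lemma smooth_pd: "smooth f \<Longrightarrow> b \<in> Basis \<Longrightarrow> smooth (pd b f)"
  unfolding smooth_def by (metis C_order.simps(2))

lemma smooth_continuous: "smooth f \<Longrightarrow> continuous_on S f"
  unfolding smooth_def by (metis C_order.simps(1) continuous_on_subset subset_UNIV)

lemma smooth_pd_has_derivative: "smooth f \<Longrightarrow> (f has_derivative (\<lambda>b. pd b f z)) (at z)"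
  by (intro pd_has_derivative smooth_differentiable)

lemma smooth_has_real_derivative:
  fixes f :: "real \<Rightarrow> real"
  assumes "smooth f"
  shows "(f has_real_derivative pd 1 f x) (at x)"
proof -
  have *: "(f has_derivative (\<lambda>b. pd b f x)) (at x)"
    by (rule smooth_pd_has_derivative[OF assms])
  have "pd b f x = pd 1 f x * b" for b
    using linear_cmul[OF has_derivative_linear[OF *], of b 1] by simp
  then have "(\<lambda>b. pd b f x) = (*) (pd 1 f x)" by blast
  with * show ?thesis by (simp add: has_field_derivative_def)
qed

lemma smooth_antideriv:
  fixes f :: "real \<Rightarrow> real"
  assumes "\<And>x. (f has_real_derivative g x) (at x)" "smooth g"
  shows "smooth f"
  unfolding smooth_def
proof
  fix n
  have "C_order (Suc n) f"
    using C_order_Suc_real[OF assms(1)] assms(2) by (simp add: smooth_def)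
  then show "C_order n f" by (rule C_order_Suc_imp)
qed

lemma smooth_real_polynomial:
  fixes f :: "real \<Rightarrow> real"
  assumes "real_polynomial_function f" shows "smooth f"
  using assms by induction (auto intro: smooth_const smooth_add smooth_mult smooth_linear)

lemma pd_zero_outside:
  assumes "closed S" "\<And>z. z \<notin> S \<Longrightarrow> f z = 0" "z \<notin> S"
  shows "pd b f z = 0"
proof -
  have "(f has_derivative (\<lambda>_. 0)) (at z)"
    by (rule has_derivative_transform_within_open[of "\<lambda>_. 0" _ _ _ "-S"])
       (use assms in \<open>auto simp: open_Compl\<close>)
  then show ?thesis by (rule pd_eq)
qed

text \<open>Any compact set outside which the function vanishes will do, so the exact support never
  has to be computed.\<close>

lemma test_funI:
  assumes "smooth f" "compact S" "S \<subseteq> U" "\<And>z. z \<notin> S \<Longrightarrow> f z = 0"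
  shows "test_fun U f"
proof -
  have "closure {z. f z \<noteq> 0} \<subseteq> S"
    using assms by (intro closure_minimal) (auto intro: compact_imp_closed)
  then show ?thesis
    using assms compact_Int_closed[of S "closure {z. f z \<noteq> 0}"]
    by (auto simp: test_fun_def smooth_def inf.absorb2 inf_commute)
qed

lemma test_funD:
  assumes "test_fun U f"
  obtains S where "smooth f" "compact S" "S \<subseteq> U" "\<And>z. z \<notin> S \<Longrightarrow> f z = 0"
    "\<And>z b. z \<notin> S \<Longrightarrow> pd b f z = 0"
proof (rule that[of "closure {z. f z \<noteq> 0}"])
  show z: "f z = 0" if "z \<notin> closure {z. f z \<noteq> 0}" for z
    using that closure_subset[of "{z. f z \<noteq> 0}"] by auto
  show "pd b f z = 0" if "z \<notin> closure {z. f z \<noteq> 0}" for z b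
    by (rule pd_zero_outside[OF closed_closure z that])
qed (use assms in \<open>auto simp: test_fun_def smooth_def\<close>)

subsection \<open>Bump functions\<close>

text \<open>The classical function \<open>exp (-1/x)\<close>, flat at 0, with a polynomial in
  \<open>1/x\<close> as a prefactor. The prefactor makes the family closed under
  differentiation.\<close>

definition flat_exp :: "real poly \<Rightarrow> real \<Rightarrow> real" where
  "flat_exp p x = (if x > 0 then poly p (1 / x) * exp (- (1 / x)) else 0)"

lemma poly_times_exp_tendsto_0: "((\<lambda>y. y ^ k * poly p y * exp (- y)) \<longlongrightarrow> (0::real)) at_top"
proof (induction p arbitrary: k)
  case (pCons a p)
  have "((\<lambda>y. a * (y ^ k / exp y) + y ^ Suc k * poly p y * exp (- y)) \<longlongrightarrow> a * 0 + 0) at_top"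
    by (intro tendsto_intros tendsto_power_div_exp_0 pCons.IH)
  then show ?case
    by (simp add: algebra_simps exp_minus divide_inverse)
qed simp

lemma flat_exp_tendsto_0: "(flat_exp p \<longlongrightarrow> 0) (at_right 0)"
proof -
  have "((\<lambda>x. poly p (inverse x) * exp (- inverse x)) \<longlongrightarrow> 0) (at_right 0)"
    using filterlim_compose[OF poly_times_exp_tendsto_0[of 0 p] filterlim_inverse_at_top_right]
    by simp
  then show ?thesis
    by (rule Lim_transform_eventually)
       (auto simp: eventually_at_right_less flat_exp_def divide_inverse eventually_at_filter)
qed

text \<open>With \<open>y = 1/x\<close> one has \<open>dy/dx = - y^2\<close>, so the derivative of
  \<open>p(y) exp(-y)\<close> is \<open>y^2 (p - p')(y) exp(-y)\<close>; the polynomial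
  \<open>[:0, 0, 1:]\<close> is \<open>y^2\<close>.\<close>

lemma flat_exp_has_derivative:
  "(flat_exp p has_real_derivative flat_exp ([:0, 0, 1:] * (p - pderiv p)) x) (at x)"
proof -
  consider "x > 0" | "x < 0" | "x = 0" by linarith
  then show ?thesis
  proof cases
    case 1
    have "((\<lambda>x. poly p (1 / x) * exp (- (1 / x))) has_real_derivative
        flat_exp ([:0, 0, 1:] * (p - pderiv p)) x) (at x)"
      using 1 by (auto intro!: derivative_eq_intros DERIV_chain2[OF poly_DERIV]
          simp: flat_exp_def field_simps power2_eq_square)
    then show ?thesis
      by (rule has_field_derivative_transform_within_open[of _ _ _ "{0<..}"]) (use 1 in \<open>auto simp: flat_exp_def\<close>)
  next
    case 2
    have "((\<lambda>x. 0) has_real_derivative 0) (at x)" by simp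
    then have "(flat_exp p has_real_derivative 0) (at x)"
      by (rule has_field_derivative_transform_within_open[of _ _ _ "{..<0}"]) (use 2 in \<open>auto simp: flat_exp_def\<close>)
    then show ?thesis using 2 by (simp add: flat_exp_def)
  next
    case 3
    \<comment> \<open>For \<open>h > 0\<close> the difference quotient at 0 is again a member of the
      family: division by \<open>h\<close> multiplies the polynomial by \<open>y\<close>, which is
      \<open>pCons 0 p\<close>.\<close>
    have "((\<lambda>h. flat_exp p h / h) \<longlongrightarrow> 0) (at_right 0)"
      using flat_exp_tendsto_0[of "pCons 0 p"]
      by (rule Lim_transform_eventually) (auto simp: eventually_at_filter flat_exp_def)
    moreover have "((\<lambda>h. flat_exp p h / h) \<longlongrightarrow> 0) (at_left 0)"
      by (rule Lim_transform_eventually[of "\<lambda>_. 0"]) (auto simp: eventually_at_filter flat_exp_def)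
    ultimately have "((\<lambda>h. flat_exp p h / h) \<longlongrightarrow> 0) (at 0)"
      by (simp add: filterlim_at_split)
    then have "(flat_exp p has_real_derivative 0) (at 0)"
      by (simp add: has_field_derivative_iff flat_exp_def[of _ 0])
    then show ?thesis using 3 by (simp add: flat_exp_def)
  qed
qed

lemma smooth_flat_exp: "smooth (flat_exp p)"
  unfolding smooth_def
proof
  fix n show "C_order n (flat_exp p)"
  proof (induction n arbitrary: p)
    case 0
    have "continuous_on UNIV (flat_exp p)"
      by (auto intro!: continuous_at_imp_continuous_on DERIV_isCont flat_exp_has_derivative)
    then show ?case by simp
  next
    case (Suc n)
    then show ?case using C_order_Suc_real[OF flat_exp_has_derivative] by auto
  qed
qed

lemma flat_exp_1: "flat_exp 1 x = (if x > 0 then exp (- (1 / x)) else 0)"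
  by (simp add: flat_exp_def)

lemma flat_exp_1_bounds: "0 \<le> flat_exp 1 x" "flat_exp 1 x \<le> 1" "flat_exp 1 x > 0 \<longleftrightarrow> x > 0" "x \<le> 0 \<Longrightarrow> flat_exp 1 x = 0"
  by (auto simp: flat_exp_1)

lemma mollifier_exists:
  obtains \<eta> :: "real \<Rightarrow> real" where "smooth \<eta>" "\<And>x. 0 \<le> \<eta> x" "\<And>x. \<bar>x\<bar> \<ge> 1 \<Longrightarrow> \<eta> x = 0"
    "integrable lborel \<eta>" "(LINT x|lborel. \<eta> x) = 1"
proof -
  define f where "f = (\<lambda>x. flat_exp 1 (1 + x) * flat_exp 1 (1 - x))"
  have sf: "smooth f"
    unfolding f_def
    by (rule smooth_mult; rule smooth_comp[of _ "flat_exp 1", OF _ smooth_flat_exp];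
        intro smooth_add smooth_diff smooth_const smooth_ident)
  have f0: "0 \<le> f x" for x
    by (simp add: f_def flat_exp_1_bounds)
  have fz: "f x = 0" if "\<bar>x\<bar> \<ge> 1" for x
    using that flat_exp_1_bounds(4)[of "1 + x"] flat_exp_1_bounds(4)[of "1 - x"]
    by (cases "x \<ge> 0") (auto simp: f_def)
  have fp: "f x > 0" if "\<bar>x\<bar> < 1" for x
    using that by (auto simp: f_def flat_exp_1_bounds intro!: mult_pos_pos)
  have "set_integrable lborel {-1..1} f"
    unfolding set_integrable_def by (intro borel_integrable_compact smooth_continuous sf) auto
  then have int: "integrable lborel f"
  proof -
    have "(\<lambda>x. indicator {-1..1} x *\<^sub>R f x) = f"
    proof
      fix x show "indicator {-1..1} x *\<^sub>R f x = f x"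
        using fz[of x] by (cases "\<bar>x\<bar> \<ge> 1") (auto simp: indicator_def)
    qed
    then show ?thesis using \<open>set_integrable lborel {-1..1} f\<close> by (simp add: set_integrable_def)
  qed
  have "integral\<^sup>L lborel f \<noteq> 0"
  proof
    assume "integral\<^sup>L lborel f = 0"
    then have "AE x in lborel. f x = 0"
      using integral_nonneg_eq_0_iff_AE[OF int] f0 by simp
    then have "AE x in lborel. x \<notin> {-1<..<1::real}"
    proof eventually_elim
      case (elim x)
      then show ?case using fp[of x] by (cases "\<bar>x\<bar> < 1") auto
    qed
    then have "emeasure lborel {x::real. \<not> x \<notin> {-1<..<1}} = 0"
      by (subst (asm) AE_iff_measurable[OF _ refl]) auto
    moreover have "{x::real. \<not> x \<notin> {-1<..<1}} = {-1<..<1}" by auto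
    ultimately show False by simp
  qed
  then have pos: "integral\<^sup>L lborel f > 0"
    using Bochner_Integration.integral_nonneg[of lborel f] f0 by (simp add: order_less_le)
  show thesis
  proof (rule that[of "\<lambda>x. f x * (1 / integral\<^sup>L lborel f)"])
    show "smooth (\<lambda>x. f x * (1 / integral\<^sup>L lborel f))"
      by (intro smooth_mult sf smooth_const)
  qed (use f0 fz pos int in auto)
qed

text \<open>Smooth approximations from below of the indicator of an open half line. Products of them
  approximate indicators of boxes.\<close>

lemma flat_exp_scaled_tendsto:
  "(\<lambda>n. flat_exp 1 (real (Suc n) * x)) \<longlonglongrightarrow> (if x > 0 then 1 else 0)"
proof (cases "x > 0")
  case True
  have "(\<lambda>n. exp (- ((1 / x) * (1 / real (Suc n))))) \<longlonglongrightarrow> exp (- ((1 / x) * 0))"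
    by (intro tendsto_intros lim_1_over_real_power[of 1, simplified] LIMSEQ_Suc[of "\<lambda>n. 1 / real n"] lim_1_over_n)
  then show ?thesis using True by (simp add: flat_exp_1 mult.commute)
next
  case False
  then have "real (Suc n) * x \<le> 0" for n by (intro mult_nonneg_nonpos) auto
  then show ?thesis using False by (simp add: flat_exp_1_bounds del: of_nat_Suc)
qed

section \<open>The fundamental lemma of the calculus of variations\<close>

text \<open>Four scaled half-line approximations, one for each side, multiply to a test function
  that vanishes outside the closed box and converges to the indicator of the open box; dominated
  convergence does the rest.\<close>

lemma integral_box_eq_0:
  fixes p q :: "real \<times> real"
  assumes g: "loc_integrable U g" and U: "cbox p q \<subseteq> U"
    and zero: "\<And>\<psi>. test_fun U \<psi> \<Longrightarrow> (LINT z:U|lborel. g z * \<psi> z) = 0"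
  shows "(LINT z:box p q|lborel. g z) = 0"
proof -
  define \<psi> where "\<psi> = (\<lambda>n z. (flat_exp 1 (real (Suc n) * (fst z - fst p)) * flat_exp 1 (real (Suc n) * (fst q - fst z))) *
    (flat_exp 1 (real (Suc n) * (snd z - snd p)) * flat_exp 1 (real (Suc n) * (snd q - snd z))))"
  have box: "box p q = {z. 0 < fst z - fst p \<and> 0 < fst q - fst z \<and> 0 < snd z - snd p \<and> 0 < snd q - snd z}"
    by (cases p; cases q) (auto simp: box_def Basis_prod_def)
  have cbox: "cbox p q = {z. 0 \<le> fst z - fst p \<and> 0 \<le> fst q - fst z \<and> 0 \<le> snd z - snd p \<and> 0 \<le> snd q - snd z}"
    by (cases p; cases q) (auto simp: cbox_def Basis_prod_def)
  have outside: "\<psi> n z = 0" if "z \<notin> cbox p q" for n z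
  proof -
    have "real (Suc n) * y \<le> 0" if "\<not> 0 \<le> y" for y
      using that by (intro mult_nonneg_nonpos) auto
    then show ?thesis
      using that unfolding cbox \<psi>_def by (auto simp: flat_exp_1_bounds simp del: of_nat_Suc)
  qed
  have smooth: "smooth (\<psi> n)" for n
    unfolding \<psi>_def
    by (rule smooth_mult; rule smooth_mult; rule smooth_comp[of _ "flat_exp 1", OF _ smooth_flat_exp];
        intro smooth_mult smooth_diff smooth_const smooth_fst smooth_snd)
  have test: "test_fun U (\<psi> n)" for n
    by (rule test_funI[OF smooth compact_cbox U outside])
  have bound: "0 \<le> \<psi> n z" "\<psi> n z \<le> 1" for n z
    unfolding \<psi>_def by (auto intro!: mult_le_one mult_nonneg_nonneg flat_exp_1_bounds simp del: of_nat_Suc)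
  have lim: "(\<lambda>n. \<psi> n z) \<longlonglongrightarrow> indicator (box p q) z" for z
  proof -
    have "(\<lambda>n. \<psi> n z) \<longlonglongrightarrow> ((if 0 < fst z - fst p then 1 else 0) * (if 0 < fst q - fst z then 1 else 0)) *
        ((if 0 < snd z - snd p then 1 else 0) * (if 0 < snd q - snd z then 1 else 0))"
      unfolding \<psi>_def by (intro tendsto_mult flat_exp_scaled_tendsto)
    then show ?thesis by (simp add: box indicator_def del: diff_gt_0_iff_gt split: if_splits)
  qed
  have int: "set_integrable lborel (cbox p q) g"
    using g U by (simp add: loc_integrable_def compact_cbox)
  define G where "G = (\<lambda>z. indicator (cbox p q) z * g z)"
  have G: "integrable lborel G"
    using int by (simp add: G_def set_integrable_def)
  have [measurable]: "\<psi> n \<in> borel_measurable borel" for n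
    by (intro borel_measurable_continuous_onI smooth_continuous smooth)
  have eq: "(LINT z:U|lborel. g z * \<psi> n z) = (LINT z|lborel. G z * \<psi> n z)" for n
    unfolding set_lebesgue_integral_def
    by (rule Bochner_Integration.integral_cong)
      (use U outside in \<open>auto simp: G_def indicator_def\<close>)
  have "(\<lambda>n. LINT z|lborel. G z * \<psi> n z) \<longlonglongrightarrow> (LINT z|lborel. G z * indicator (box p q) z)"
  proof (rule integral_dominated_convergence[where w = "\<lambda>z. \<bar>G z\<bar>"])
    show "AE z in lborel. (\<lambda>n. G z * \<psi> n z) \<longlonglongrightarrow> G z * indicator (box p q) z"
      by (intro always_eventually allI tendsto_intros lim)
    show "AE z in lborel. norm (G z * \<psi> n z) \<le> \<bar>G z\<bar>" for n
      using bound by (auto simp: abs_mult mult_left_le)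
  qed (use G in auto)
  moreover have "(LINT z|lborel. G z * \<psi> n z) = 0" for n
    using zero[OF test] eq by simp
  moreover have "(LINT z|lborel. G z * indicator (box p q) z) = (LINT z:box p q|lborel. g z)"
    unfolding set_lebesgue_integral_def
    by (rule Bochner_Integration.integral_cong)
       (use box_subset_cbox[of p q] in \<open>auto simp: G_def indicator_def\<close>)
  ultimately show ?thesis by (simp add: LIMSEQ_const_iff)
qed

lemma Int_stable_boxes: "Int_stable (range (\<lambda>(a, b). box a b :: 'a::euclidean_space set))"
  unfolding Int_stable_def
proof safe
  fix a b c d :: 'a
  show "box a b \<inter> box c d \<in> range (\<lambda>(a, b). box a b)"
    unfolding box_Int_box by (rule image_eqI[of _ _ "(_, _)"]) auto
qed

text \<open>Open boxes form an intersection-stable generator of the Borel sets. After the cut-off to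
  one box \<open>g\<close> is integrable, and a Dynkin argument extends the vanishing of its
  integrals from boxes to all Borel sets.\<close>

lemma AE_box_eq_0:
  fixes p q :: "real \<times> real"
  assumes g: "loc_integrable U g" and U: "cbox p q \<subseteq> U"
    and zero: "\<And>\<psi>. test_fun U \<psi> \<Longrightarrow> (LINT z:U|lborel. g z * \<psi> z) = 0"
  shows "AE z in lborel. z \<in> box p q \<longrightarrow> g z = 0"
proof -
  define G where "G = (\<lambda>z. indicator (box p q) z * g z)"
  have "set_integrable lborel (cbox p q) g"
    using g U by (simp add: loc_integrable_def compact_cbox)
  then have "set_integrable lborel (box p q) g"
    by (rule set_integrable_subset) (auto simp: box_subset_cbox)
  then have G: "integrable lborel G"
    by (simp add: G_def set_integrable_def)
  have Gset: "set_integrable lborel A G" if "A \<in> sets borel" for A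
    using set_integrable_subset[of lborel UNIV G A] G that by (simp add: set_integrable_def)
  have Gbox: "(LINT z:box a b|lborel. G z) = 0" for a b
  proof (cases "box a b \<inter> box p q = {}")
    case True
    then have "(LINT z:box a b|lborel. G z) = (LINT z:box a b|lborel. 0)"
      by (intro set_lebesgue_integral_cong) (auto simp: G_def disjoint_iff indicator_def)
    then show ?thesis by simp
  next
    case False
    obtain c d where cd: "box a b \<inter> box p q = box c d"
      using box_Int_box[of a b p q] by blast
    with False have "cbox c d = closure (box c d)" by (metis closure_box)
    also have "\<dots> \<subseteq> closure (box p q)" using cd by (intro closure_mono) blast
    also have "\<dots> \<subseteq> U" using U False by (metis Int_empty_right closure_box)
    finally have "(LINT z:box c d|lborel. g z) = 0"
      by (rule integral_box_eq_0[OF g _ zero])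
    then show ?thesis
      unfolding cd[symmetric] set_lebesgue_integral_def G_def
      by (simp add: indicator_inter_arith mult.assoc)
  qed
  have "(LINT z:A|lborel. G z) = 0" if "A \<in> sets lborel" for A
  proof -
    have "A \<in> sigma_sets UNIV (range (\<lambda>(a, b). box a b :: (real \<times> real) set))"
      using that by (simp add: borel_eq_box)
    have "range (\<lambda>(a, b). box a b :: (real \<times> real) set) \<subseteq> Pow UNIV" by simp
    from this \<open>A \<in> sigma_sets _ _\<close> show ?thesis
    proof (induction rule: sigma_sets_induct_disjoint[OF Int_stable_boxes, consumes 2, case_names basic empty compl union])
      case (basic A)
      then show ?case using Gbox by auto
    next
      case empty
      show ?case by (simp add: set_lebesgue_integral_def)
    next
      case (compl A)
      then have A: "A \<in> sets borel" by (simp add: borel_eq_box)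
      have "(LINT z:A \<union> (UNIV - A)|lborel. G z) = (LINT z:A|lborel. G z) + (LINT z:UNIV - A|lborel. G z)"
        by (rule set_integral_Un) (use A in \<open>auto intro!: Gset\<close>)
      \<comment> \<open>The whole space is not a box, but \<open>G\<close> lives on
        \<open>box p q\<close>, so its total integral is covered by the box case.\<close>
      moreover have "(LINT z:UNIV|lborel. G z) = (LINT z:box p q|lborel. G z)"
        unfolding set_lebesgue_integral_def
        by (rule Bochner_Integration.integral_cong) (auto simp: G_def indicator_def)
      ultimately show ?case using compl Gbox[of p q] by simp
    next
      case (union A)
      have "A i \<in> sets borel" for i using union by (auto simp: borel_eq_box)
      then have "(LINT z:(\<Union>i. A i)|lborel. G z) = (\<Sum>i. LINT z:A i|lborel. G z)"
        using union by (intro lebesgue_integral_countable_add Gset) (auto simp: disjoint_family_on_def)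
      then show ?case using union by simp
    qed
  qed
  then have "AE z in lborel. G z = 0"
    by (intro density_unique_real[OF G]) auto
  then show ?thesis by eventually_elim (auto simp: G_def)
qed

text \<open>The cylinder is exhausted by countably many boxes whose closures stay inside it; the
  first of them may be empty.\<close>

lemma fundamental_lemma_cyl:
  assumes g: "loc_integrable (cyl T) g"
    and zero: "\<And>\<psi>. test_fun (cyl T) \<psi> \<Longrightarrow> (LINT z:cyl T|lborel. g z * \<psi> z) = 0"
  shows "AE z\<in>cyl T in lborel. g z = 0"
proof -
  define p where "p = (\<lambda>n. (1 / real (Suc n), -1 + 1 / real (Suc n)))"
  define q where "q = (\<lambda>n. (T - 1 / real (Suc n), 1 - 1 / real (Suc n)))"
  have "cbox (p n) (q n) \<subseteq> cyl T" for n
  proof -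
    have "0 < 1 / real (Suc n)" by simp
    moreover define r where "r = 1 / real (Suc n)"
    ultimately have "0 < r" by simp
    then show ?thesis
      unfolding p_def q_def cbox_Pair_eq cyl_def Omega_def r_def[symmetric] by auto
  qed
  then have "AE z in lborel. \<forall>n. z \<in> box (p n) (q n) \<longrightarrow> g z = 0"
    unfolding AE_all_countable using AE_box_eq_0[OF g _ zero] by blast
  then show ?thesis
  proof eventually_elim
    case (elim z)
    show ?case
    proof
      assume z: "z \<in> cyl T"
      have "0 < min (min (fst z) (T - fst z)) (min (snd z + 1) (1 - snd z))"
        using z by (auto simp: cyl_def Omega_def)
      then obtain n where "1 / real (Suc n) < min (min (fst z) (T - fst z)) (min (snd z + 1) (1 - snd z))"
        using nat_approx_posE by blast
      then have "z \<in> box (p n) (q n)"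
        by (cases z) (auto simp: p_def q_def box_def Basis_prod_def)
      with elim show "g z = 0" by blast
    qed
  qed
qed

section \<open>Products with test functions and uniqueness of weak derivatives\<close>

lemma loc_integrable_times:
  assumes h: "loc_integrable U h" and S: "compact S" "S \<subseteq> U" "\<And>z. z \<notin> S \<Longrightarrow> \<psi> z = 0"
    and \<psi>: "continuous_on UNIV \<psi>"
  shows "set_integrable lborel U (\<lambda>z. h z * \<psi> z)"
proof -
  have eq: "(\<lambda>z. indicator U z *\<^sub>R (h z * \<psi> z)) = (\<lambda>z. (indicator S z *\<^sub>R h z) * \<psi> z)"
    using S by (auto simp: fun_eq_iff indicator_def)
  obtain B where B: "\<And>z. z \<in> S \<Longrightarrow> \<bar>\<psi> z\<bar> \<le> B"
    using compact_imp_bounded[OF compact_continuous_image[OF continuous_on_subset[OF \<psi> subset_UNIV] S(1)]]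
    by (auto simp: bounded_iff)
  have h': "integrable lborel (\<lambda>z. indicator S z *\<^sub>R h z)"
    using h S by (auto simp: loc_integrable_def set_integrable_def)
  have [measurable]: "\<psi> \<in> borel_measurable borel"
    by (rule borel_measurable_continuous_onI[OF \<psi>])
  have "integrable lborel (\<lambda>z. (indicator S z *\<^sub>R h z) * \<psi> z)"
  proof (rule Bochner_Integration.integrable_bound[OF integrable_mult_right[OF integrable_norm[OF h'], of B]])
    show "(\<lambda>z. (indicator S z *\<^sub>R h z) * \<psi> z) \<in> borel_measurable lborel"
      using borel_measurable_integrable[OF h'] by (intro borel_measurable_times) auto
    have "norm ((indicator S z *\<^sub>R h z) * \<psi> z) \<le> norm (B * norm (indicator S z *\<^sub>R h z))" for z
    proof (cases "z \<in> S")
      case True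
      have "\<bar>h z * \<psi> z\<bar> \<le> B * \<bar>h z\<bar>"
        using mult_right_mono[OF B[OF True], of "\<bar>h z\<bar>"] by (simp add: abs_mult mult.commute)
      also have "\<dots> \<le> norm (B * \<bar>h z\<bar>)" by simp
      finally show ?thesis using True by simp
    qed simp
    then show "AE z in lborel. norm ((indicator S z *\<^sub>R h z) * \<psi> z) \<le> norm (B * norm (indicator S z *\<^sub>R h z))"
      by simp
  qed
  then show ?thesis unfolding set_integrable_def eq .
qed

lemma loc_integrable_times_test:
  assumes "loc_integrable U h" "test_fun U \<psi>"
  shows "set_integrable lborel U (\<lambda>z. h z * \<psi> z)"
  using assms(2) by (rule test_funD) (auto intro: loc_integrable_times[OF assms(1)] smooth_continuous)

text \<open>Allows an integral of the chosen derivative \<open>weak_d\<close> to be evaluated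
  through any explicitly known weak derivative.\<close>

lemma weak_deriv_unique_cyl:
  assumes "has_weak_deriv (cyl T) b f g" "has_weak_deriv (cyl T) b f g'"
  shows "AE z\<in>cyl T in lborel. g z = g' z"
proof -
  have "AE z\<in>cyl T in lborel. g z - g' z = 0"
  proof (rule fundamental_lemma_cyl)
    show "loc_integrable (cyl T) (\<lambda>z. g z - g' z)"
      using assms by (auto simp: has_weak_deriv_def loc_integrable_def intro!: set_integral_diff)
    fix \<psi> assume \<psi>: "test_fun (cyl T) \<psi>"
    from test_funD[OF this] obtain S where S: "smooth \<psi>" "compact S" "S \<subseteq> cyl T" "\<And>z. z \<notin> S \<Longrightarrow> \<psi> z = 0"
      by metis
    have int: "set_integrable lborel (cyl T) (\<lambda>z. h z * \<psi> z)" if "loc_integrable (cyl T) h" for h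
      by (rule loc_integrable_times_test[OF that \<psi>])
    have "(LINT z:cyl T|lborel. (g z - g' z) * \<psi> z) =
        (LINT z:cyl T|lborel. g z * \<psi> z) - (LINT z:cyl T|lborel. g' z * \<psi> z)"
      using assms by (subst set_integral_diff(2)[symmetric])
        (auto simp: has_weak_deriv_def left_diff_distrib intro!: int)
    then show "(LINT z:cyl T|lborel. (g z - g' z) * \<psi> z) = 0"
      using assms \<psi> by (simp add: has_weak_deriv_def)
  qed
  then show ?thesis by simp
qed

section \<open>Approximation of integrable functions\<close>

text \<open>Density of compactly supported continuous functions in \<open>L1\<close>. The
  approximation property is passed through the induction principle for integrable functions; only
  the case of an indicator has content, by outer regularity.\<close>

lemma integrable_approx_continuous:
  fixes f :: "'a::euclidean_space \<Rightarrow> real"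
  assumes "integrable lborel f" "e > 0"
  obtains b S where "continuous_on UNIV b" "compact S" "\<And>z. z \<notin> S \<Longrightarrow> b z = 0"
    "integrable lborel b" "(LINT z|lborel. \<bar>f z - b z\<bar>) < e"
proof -
  define P :: "('a \<Rightarrow> real) \<Rightarrow> bool" where "P = (\<lambda>f. \<forall>e>0. \<exists>b S. continuous_on UNIV b \<and> compact S \<and> (\<forall>z. z \<notin> S \<longrightarrow> b z = 0) \<and>
    integrable lborel b \<and> (LINT z|lborel. \<bar>f z - b z\<bar>) < (e::real))"
  from assms(1) have "P f"
  proof (induction rule: integrable_induct)
    case (base A c)
    show ?case unfolding P_def
    proof safe
      fix e :: real assume e: "e > 0"
      show "\<exists>b S. continuous_on UNIV b \<and> compact S \<and> (\<forall>z. z \<notin> S \<longrightarrow> b z = 0) \<and>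
        integrable lborel b \<and> (LINT z|lborel. \<bar>indicator A z *\<^sub>R c - b z\<bar>) < e"
      proof -
        \<comment> \<open>Half of the error is reserved for replacing \<open>A\<close> by an open
          superset, which costs \<open>\<bar>c\<bar>\<close> times the excess measure. The
          \<open>+ 1\<close> covers \<open>c = 0\<close>.\<close>
        define e' where "e' = e / (2 * (\<bar>c\<bar> + 1))"
        have e': "e' > 0" "\<bar>c\<bar> * e' < e / 2" using e by (auto simp: e'_def field_simps)
        have A: "A \<in> sets borel" using base by simp
        obtain U where U: "open U" "A \<subseteq> U" "emeasure lborel (U - A) < ennreal e'"
          using outer_regular_lborel[OF A e'(1)] by blast
        have Um[measurable]: "U \<in> sets borel" "A \<in> sets borel" using U(1) A by auto
        have "emeasure lborel U = emeasure lborel A + emeasure lborel (U - A)"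
          using U A by (subst plus_emeasure) (auto simp: Un_absorb1)
        also have "\<dots> < \<infinity>" using base U(3) by (auto simp: less_top[symmetric])
        finally have Ufin: "emeasure lborel U < \<infinity>" .
        \<comment> \<open>The distance to the empty set is 0 by convention, so the functions
          \<open>b\<close> below would vanish identically if \<open>U\<close> were the whole
          space.\<close>
        then have "U \<noteq> UNIV" by auto
        then have ne: "- U \<noteq> {}" by blast
        have cl: "closed (- U)" using U(1) by (simp add: closed_Compl)
        have mUA: "measure lborel (U - A) < e'"
        proof -
          have "emeasure lborel (U - A) = ennreal (measure lborel (U - A))"
            by (intro emeasure_eq_ennreal_measure) (use U(3) in auto)
          then show ?thesis using U(3) by (simp add: ennreal_less_iff)
        qed
        \<comment> \<open>The first factor tends to the indicator of \<open>U\<close>, the second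
          one restricts the support to the ball of radius \<open>n\<close>.\<close>
        define b where "b = (\<lambda>n x. min 1 (real n * infdist x (- U)) * max 0 (min 1 (real n - norm x)) * c)"
        have cont: "continuous_on UNIV (b n)" for n
          unfolding b_def by (intro continuous_intros)
        have [measurable]: "b n \<in> borel_measurable borel" for n
          by (intro borel_measurable_continuous_onI cont)
        have iU: "integrable lborel (\<lambda>x. indicator U x * \<bar>c\<bar>)"
          using Ufin by auto
        have bbound: "\<bar>b n x\<bar> \<le> indicator U x * \<bar>c\<bar>" for n x
        proof (cases "x \<in> U")
          case True
          have "min 1 (real n * infdist x (- U)) * max 0 (min 1 (real n - norm x)) \<le> 1"
            by (intro mult_le_one) (auto simp: infdist_nonneg)
          then show ?thesis using True
            by (auto simp: b_def abs_mult infdist_nonneg intro!: mult_left_le_one_le)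
        qed (simp add: b_def)
        have bi: "integrable lborel (b n)" for n
          by (rule Bochner_Integration.integrable_bound[OF iU]) (use bbound in auto)
        have lim: "(\<lambda>n. b n x) \<longlonglongrightarrow> indicator U x * c" for x
        proof (cases "x \<in> U")
          case True
          then have pos: "infdist x (- U) > 0" by (intro infdist_pos_not_in_closed cl ne) auto
          obtain k where k: "real k \<ge> 1 / infdist x (- U)" using real_arch_simple by blast
          obtain l where l: "real l \<ge> 1 + norm x" using real_arch_simple by blast
          have "b n x = c" if "n \<ge> max k l" for n
          proof -
            have "real n \<ge> 1 / infdist x (- U)" "real n \<ge> 1 + norm x" using that k l by auto
            then show ?thesis using pos by (simp add: b_def field_simps)
          qed
          then show ?thesis using True
            by (intro tendsto_eventually eventually_sequentiallyI[of "max k l"]) auto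
        qed (simp add: b_def)
        have "(\<lambda>n. LINT x|lborel. \<bar>indicator U x * c - b n x\<bar>) \<longlonglongrightarrow> (LINT x::'a|lborel. 0)"
        proof (rule integral_dominated_convergence[where w = "\<lambda>x. 2 * (indicator U x * \<bar>c\<bar>)"])
          show "AE x in lborel. (\<lambda>n. \<bar>indicator U x * c - b n x\<bar>) \<longlonglongrightarrow> 0"
            by (intro always_eventually allI tendsto_rabs_zero) (auto intro!: tendsto_eq_intros lim)
          show "AE x in lborel. norm \<bar>indicator U x * c - b n x\<bar> \<le> 2 * (indicator U x * \<bar>c\<bar>)" for n
          proof (intro always_eventually allI)
            fix x
            have "\<bar>indicator U x * c - b n x\<bar> \<le> \<bar>indicator U x * c\<bar> + \<bar>b n x\<bar>" by simp
            also have "\<bar>indicator U x * c\<bar> = indicator U x * \<bar>c\<bar>" by (simp add: abs_mult)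
            finally show "norm \<bar>indicator U x * c - b n x\<bar> \<le> 2 * (indicator U x * \<bar>c\<bar>)"
              using bbound[of n x] by simp
          qed
        qed (use iU in auto)
        then have "eventually (\<lambda>n. (LINT x|lborel. \<bar>indicator U x * c - b n x\<bar>) < e / 2) sequentially"
          using e by (intro order_tendstoD(2)[of _ 0]) auto
        then obtain n where n: "(LINT x|lborel. \<bar>indicator U x * c - b n x\<bar>) < e / 2"
          by (auto simp: eventually_sequentially)
        have UA: "integrable lborel (\<lambda>x. indicator (U - A) x * \<bar>c\<bar>)"
          using order.strict_trans[OF U(3) ennreal_less_top] by auto
        have iUc: "integrable lborel (\<lambda>x. indicator U x * c)"
          using Ufin by auto
        have "(LINT x|lborel. \<bar>indicator A x *\<^sub>R c - b n x\<bar>) \<le>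
          (LINT x|lborel. indicator (U - A) x * \<bar>c\<bar> + \<bar>indicator U x * c - b n x\<bar>)"
        proof (rule integral_mono)
          show "integrable lborel (\<lambda>x. \<bar>indicator A x *\<^sub>R c - b n x\<bar>)"
            using base bi by auto
          show "integrable lborel (\<lambda>x. indicator (U - A) x * \<bar>c\<bar> + \<bar>indicator U x * c - b n x\<bar>)"
            using UA iUc bi by auto
          show "\<bar>indicator A x *\<^sub>R c - b n x\<bar> \<le> indicator (U - A) x * \<bar>c\<bar> + \<bar>indicator U x * c - b n x\<bar>" for x
            using U(2) by (auto simp: indicator_def)
        qed
        also have "\<dots> = measure lborel (U - A) * \<bar>c\<bar> + (LINT x|lborel. \<bar>indicator U x * c - b n x\<bar>)"
          using UA iUc bi by (subst Bochner_Integration.integral_add) auto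
        also have "\<dots> < e"
          using n e'(2) mUA mult_left_mono[of "measure lborel (U - A)" e' "\<bar>c\<bar>"] by (simp add: mult.commute)
        finally have "(LINT x|lborel. \<bar>indicator A x *\<^sub>R c - b n x\<bar>) < e" .
        then show ?thesis
          using cont bi by (intro exI[of _ "b n"] exI[of _ "cball 0 (real n)"]) (auto simp: b_def)
      qed
    qed
  next
    case (add f g)
    show ?case unfolding P_def
    proof safe
      fix e :: real assume e: "e > 0"
      then obtain b S b' S' where 1: "continuous_on UNIV b" "compact S" "\<forall>z. z \<notin> S \<longrightarrow> b z = 0"
        "integrable lborel b" "(LINT z|lborel. \<bar>f z - b z\<bar>) < e / 2"
        and 2: "continuous_on UNIV b'" "compact S'" "\<forall>z. z \<notin> S' \<longrightarrow> b' z = 0"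
        "integrable lborel b'" "(LINT z|lborel. \<bar>g z - b' z\<bar>) < e / 2"
        using add by (auto simp: P_def dest!: spec[of _ "e / 2"])
      have "(LINT z|lborel. \<bar>f z + g z - (b z + b' z)\<bar>) \<le> (LINT z|lborel. \<bar>f z - b z\<bar> + \<bar>g z - b' z\<bar>)"
        using add 1 2 by (intro integral_mono) auto
      also have "\<dots> < e" using add 1 2 by simp
      finally show "\<exists>b S. continuous_on UNIV b \<and> compact S \<and> (\<forall>z. z \<notin> S \<longrightarrow> b z = 0) \<and>
        integrable lborel b \<and> (LINT z|lborel. \<bar>f z + g z - b z\<bar>) < e"
        using 1 2 by (intro exI[of _ "\<lambda>z. b z + b' z"] exI[of _ "S \<union> S'"]) (auto intro: continuous_on_add)
    qed
  next
    case (lim f s)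
    show ?case unfolding P_def
    proof safe
      fix e :: real assume e: "e > 0"
      \<comment> \<open>The induction principle supplies approximants with
        \<open>\<bar>s i z\<bar> \<le> 2 * \<bar>f z\<bar>\<close>, which gives the dominating
        function \<open>3 * \<bar>f z\<bar>\<close>.\<close>
      have "(\<lambda>i. LINT z|lborel. \<bar>f z - s i z\<bar>) \<longlonglongrightarrow> (LINT z::'a|lborel. 0)"
      proof (rule integral_dominated_convergence[where w = "\<lambda>z. 3 * \<bar>f z\<bar>"])
        show "AE z in lborel. (\<lambda>i. \<bar>f z - s i z\<bar>) \<longlonglongrightarrow> 0"
          using lim by (intro always_eventually allI tendsto_rabs_zero) (auto intro!: tendsto_eq_intros)
        show "AE z in lborel. norm \<bar>f z - s i z\<bar> \<le> 3 * \<bar>f z\<bar>" for i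
        proof (intro always_eventually allI)
          fix z show "norm \<bar>f z - s i z\<bar> \<le> 3 * \<bar>f z\<bar>" using lim.hyps(3)[of z i] by simp
        qed
      qed (use lim in auto)
      then have "eventually (\<lambda>i. (LINT z|lborel. \<bar>f z - s i z\<bar>) < e / 2) sequentially"
        using e by (intro order_tendstoD(2)[of _ 0]) auto
      then obtain i where i: "(LINT z|lborel. \<bar>f z - s i z\<bar>) < e / 2"
        by (auto simp: eventually_sequentially)
      obtain b S where 1: "continuous_on UNIV b" "compact S" "\<forall>z. z \<notin> S \<longrightarrow> b z = 0"
        "integrable lborel b" "(LINT z|lborel. \<bar>s i z - b z\<bar>) < e / 2"
        using lim.IH[of i] e by (auto simp: P_def dest!: spec[of _ "e / 2"])
      have "(LINT z|lborel. \<bar>f z - b z\<bar>) \<le> (LINT z|lborel. \<bar>f z - s i z\<bar> + \<bar>s i z - b z\<bar>)"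
        using lim 1 by (intro integral_mono) auto
      also have "\<dots> < e" using lim 1 i by simp
      finally show "\<exists>b S. continuous_on UNIV b \<and> compact S \<and> (\<forall>z. z \<notin> S \<longrightarrow> b z = 0) \<and>
        integrable lborel b \<and> (LINT z|lborel. \<bar>f z - b z\<bar>) < e"
        using 1 by blast
    qed
  qed
  then show thesis using assms(2) that by (auto simp: P_def)
qed

section \<open>Characteristics of weak solutions of transport equations\<close>

lemma integrable_continuous_compact:
  fixes f :: "'a::euclidean_space \<Rightarrow> real"
  assumes "continuous_on UNIV f" "compact S" "\<And>z. z \<notin> S \<Longrightarrow> f z = 0"
  shows "integrable lborel f"
proof -
  have "(\<lambda>x. indicator S x *\<^sub>R f x) = f"
  proof
    fix x show "indicator S x *\<^sub>R f x = f x" using assms(3)[of x] by (cases "x \<in> S") auto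
  qed
  then show ?thesis
    using borel_integrable_compact[OF assms(2) continuous_on_subset[OF assms(1)]] by simp
qed

lemma bounded_continuous_compact:
  fixes f :: "'a::topological_space \<Rightarrow> real"
  assumes "continuous_on S f" "compact S"
  obtains C where "0 \<le> C" "\<And>x. x \<in> S \<Longrightarrow> \<bar>f x\<bar> \<le> C"
proof -
  obtain C where "\<And>x. x \<in> S \<Longrightarrow> \<bar>f x\<bar> \<le> C"
    using compact_imp_bounded[OF compact_continuous_image[OF assms]] by (auto simp: bounded_iff)
  then have "\<And>x. x \<in> S \<Longrightarrow> \<bar>f x\<bar> \<le> \<bar>C\<bar>" by (meson abs_ge_self order_trans)
  then show thesis by (intro that[of "\<bar>C\<bar>"]) auto
qed

lemma antiderivative_exists:
  fixes g :: "real \<Rightarrow> real"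
  assumes "continuous_on UNIV g"
  obtains Q where "\<And>x. (Q has_real_derivative g x) (at x)"
proof -
  have "\<exists>F. \<forall>x::real. -\<infinity> < ereal x \<longrightarrow> ereal x < \<infinity> \<longrightarrow> (F has_vector_derivative g x) (at x)"
    by (rule einterval_antiderivative) (use assms in \<open>auto simp: continuous_on_eq_continuous_at\<close>)
  then show thesis
    using that by (auto simp: has_real_derivative_iff_has_vector_derivative)
qed

lemma integral_derivative_eq_0:
  fixes g :: "real \<Rightarrow> real"
  assumes g: "\<And>x. (g has_real_derivative g' x) (at x)" and g': "continuous_on UNIV g'"
    and M: "\<And>x. \<bar>x\<bar> \<ge> M \<Longrightarrow> g x = 0"
  shows "(LINT x|lborel. g' x) = 0"
proof -
  define L where "L = \<bar>M\<bar> + 1"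
  have zero: "g' x = 0" if "\<bar>x\<bar> > L" for x
  proof -
    have g0: "0 = g y" if "y \<in> - {-L..L}" for y
      using that by (intro M[symmetric]) (auto simp: L_def)
    have "((\<lambda>_. 0) has_real_derivative 0) (at x)" by simp
    then have "(g has_real_derivative 0) (at x)"
      by (rule has_field_derivative_transform_within_open[where S = "- {-L..L}"]) (use that g0 in auto)
    with g show ?thesis by (rule DERIV_unique)
  qed
  have "(LINT x|lborel. indicator {-L..L} x *\<^sub>R g' x) = g L - g (-L)"
    by (rule integral_FTC_Icc)
      (use g g' in \<open>auto simp: L_def has_real_derivative_iff_has_vector_derivative
        intro: has_vector_derivative_at_within continuous_on_subset\<close>)
  moreover have "(\<lambda>x. indicator {-L..L} x *\<^sub>R g' x) = g'"
  proof
    fix x show "indicator {-L..L} x *\<^sub>R g' x = g' x"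
      using zero[of x] by (cases "\<bar>x\<bar> > L") (auto simp: indicator_def)
  qed
  ultimately show ?thesis by (simp add: M L_def)
qed

section \<open>The du Bois-Reymond lemma on an interval\<close>

lemma mollify_tendsto:
  fixes g \<kappa> :: "real \<Rightarrow> real"
  assumes g: "continuous_on UNIV g" and \<kappa>: "continuous_on UNIV \<kappa>" and supp: "\<And>x. \<bar>x\<bar> \<ge> 1 \<Longrightarrow> \<kappa> x = 0"
  shows "(\<lambda>n. LINT x|lborel. g x * (real (Suc n) * \<kappa> (real (Suc n) * (x - a)))) \<longlonglongrightarrow> g a * (LINT x|lborel. \<kappa> x)"
proof -
  have eq: "(LINT x|lborel. g x * (real (Suc n) * \<kappa> (real (Suc n) * (x - a)))) =
      (LINT z|lborel. g (a + 1 / real (Suc n) * z) * \<kappa> z)" for n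
  proof -
    have "1 / real (Suc n) \<noteq> 0" by simp
    from lborel_integral_real_affine[OF this, of "\<lambda>x. g x * (real (Suc n) * \<kappa> (real (Suc n) * (x - a)))" a]
    have "(LINT x|lborel. g x * (real (Suc n) * \<kappa> (real (Suc n) * (x - a)))) =
      1 / real (Suc n) * (LINT z|lborel. g (a + 1 / real (Suc n) * z) * (real (Suc n) * \<kappa> z))"
      by simp
    also have "\<dots> = (LINT z|lborel. g (a + 1 / real (Suc n) * z) * \<kappa> z)"
      by (subst integral_mult_right_zero[symmetric]) (simp del: of_nat_Suc)
    finally show ?thesis .
  qed
  obtain C where C: "0 \<le> C" "\<And>x. x \<in> {a - 1..a + 1} \<Longrightarrow> \<bar>g x\<bar> \<le> C"
    using bounded_continuous_compact[OF continuous_on_subset[OF g subset_UNIV] compact_Icc] by metis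
  have i\<kappa>: "integrable lborel \<kappa>"
    by (rule integrable_continuous_compact[OF \<kappa>, of "{-1..1}"]) (auto intro!: supp)
  have [measurable]: "g \<in> borel_measurable borel" "\<kappa> \<in> borel_measurable borel"
    using g \<kappa> by (auto intro: borel_measurable_continuous_onI)
  have "(\<lambda>n. LINT z|lborel. g (a + 1 / real (Suc n) * z) * \<kappa> z) \<longlonglongrightarrow> (LINT z|lborel. g a * \<kappa> z)"
  proof (rule integral_dominated_convergence[where w = "\<lambda>z. C * \<bar>\<kappa> z\<bar>"])
    show "AE z in lborel. (\<lambda>n. g (a + 1 / real (Suc n) * z) * \<kappa> z) \<longlonglongrightarrow> g a * \<kappa> z"
    proof (intro always_eventually allI tendsto_mult_right)
      fix z
      have "(\<lambda>n. a + 1 / real (Suc n) * z) \<longlonglongrightarrow> a + 0 * z"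
        by (intro tendsto_intros LIMSEQ_Suc[of "\<lambda>n. 1 / real n"] lim_1_over_n)
      then have "(\<lambda>n. a + 1 / real (Suc n) * z) \<longlonglongrightarrow> a" by simp
      then show "(\<lambda>n. g (a + 1 / real (Suc n) * z)) \<longlonglongrightarrow> g a"
        using g by (intro isCont_tendsto_compose[of _ g]) (auto simp: continuous_on_eq_continuous_at)
    qed
    show "AE z in lborel. norm (g (a + 1 / real (Suc n) * z) * \<kappa> z) \<le> C * \<bar>\<kappa> z\<bar>" for n
    proof (intro always_eventually allI)
      fix z show "norm (g (a + 1 / real (Suc n) * z) * \<kappa> z) \<le> C * \<bar>\<kappa> z\<bar>"
      proof (cases "\<bar>z\<bar> \<ge> 1")
        case False
        define y where "y = 1 / real (Suc n) * z"
        have "\<bar>y\<bar> \<le> 1"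
          using False by (auto simp: y_def abs_mult divide_simps)
        then have "\<bar>g (a + y)\<bar> \<le> C" by (intro C(2)) auto
        then show ?thesis unfolding y_def[symmetric] by (auto simp: abs_mult intro!: mult_right_mono)
      qed (simp add: supp)
    qed
  qed (use i\<kappa> in auto)
  then show ?thesis by (simp add: eq del: of_nat_Suc)
qed

text \<open>\<open>P\<close> is a smoothed Heaviside function. The difference of two scaled
  translates of \<open>P\<close> has compact support, and its derivative is a difference of two
  approximate Dirac masses.\<close>

lemma smooth_step_exists:
  obtains \<eta> P :: "real \<Rightarrow> real" where "smooth P" "smooth \<eta>" "\<And>x. (P has_real_derivative \<eta> x) (at x)"
    "\<And>x. \<bar>x\<bar> \<ge> 1 \<Longrightarrow> \<eta> x = 0" "(LINT x|lborel. \<eta> x) = 1" "\<And>x. x \<le> -1 \<Longrightarrow> P x = 0" "\<And>x. x \<ge> 1 \<Longrightarrow> P x = 1"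
proof -
  obtain \<eta> :: "real \<Rightarrow> real" where \<eta>: "smooth \<eta>" "\<And>x. \<bar>x\<bar> \<ge> 1 \<Longrightarrow> \<eta> x = 0" "(LINT x|lborel. \<eta> x) = 1"
    using mollifier_exists by metis
  obtain Q where Q: "\<And>x. (Q has_real_derivative \<eta> x) (at x)"
    using antiderivative_exists[OF smooth_continuous[OF \<eta>(1)]] by blast
  have const: "Q x = Q y" if "x \<le> y" "\<And>z. x < z \<Longrightarrow> z < y \<Longrightarrow> \<bar>z\<bar> \<ge> 1" for x y
  proof (cases "x = y")
    case False
    show ?thesis
    proof (rule DERIV_isconst2[of x y Q y, symmetric])
      show "(Q has_real_derivative 0) (at z)" if "x < z" "z < y" for z
        using Q[of z] \<eta>(2)[OF \<open>\<And>z. x < z \<Longrightarrow> z < y \<Longrightarrow> \<bar>z\<bar> \<ge> 1\<close>[OF that]] by simp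
      show "continuous_on {x..y} Q"
        using Q by (auto intro!: continuous_at_imp_continuous_on DERIV_isCont)
    qed (use that False in auto)
  qed simp
  have "(LINT x|lborel. indicator {-1..1} x *\<^sub>R \<eta> x) = Q 1 - Q (-1)"
    by (rule integral_FTC_Icc)
      (use Q in \<open>auto simp: has_real_derivative_iff_has_vector_derivative
        intro: has_vector_derivative_at_within smooth_continuous[OF \<eta>(1)]\<close>)
  moreover have "(\<lambda>x. indicator {-1..1} x *\<^sub>R \<eta> x) = \<eta>"
  proof
    fix x show "indicator {-1..1} x *\<^sub>R \<eta> x = \<eta> x"
      using \<eta>(2)[of x] by (cases "\<bar>x\<bar> \<ge> 1") (auto simp: indicator_def)
  qed
  ultimately have 1: "Q 1 - Q (-1) = 1" using \<eta>(3) by simp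
  show thesis
  proof (rule that[of "\<lambda>x. Q x - Q (-1)" \<eta>])
    show "smooth (\<lambda>x. Q x - Q (-1))"
      by (intro smooth_diff smooth_const smooth_antideriv[OF Q \<eta>(1)])
    show "((\<lambda>x. Q x - Q (-1)) has_real_derivative \<eta> x) (at x)" for x
      using Q by (auto intro!: derivative_eq_intros)
    show "Q x - Q (-1) = 0" if "x \<le> -1" for x
      using const[of x "-1"] that by auto
    show "Q x - Q (-1) = 1" if "x \<ge> 1" for x
      using const[of 1 x] that 1 by auto
  qed (use \<eta> in auto)
qed

lemma smooth_pd_eq:
  fixes f :: "real \<Rightarrow> real"
  assumes "(f has_real_derivative d) (at x)"
  shows "pd 1 f x = d"
  using pd_eq[of f "(*) d" x 1] assms by (simp add: has_field_derivative_def)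

text \<open>Testing with the difference of smooth steps at \<open>s\<close> and \<open>t\<close>
  compares mollified values of \<open>E\<close> at these two points; letting the scale shrink gives
  \<open>E s = E t\<close>. The endpoints follow by continuity.\<close>

lemma dubois_reymond_const:
  fixes E :: "real \<Rightarrow> real"
  assumes T: "0 < T" and E: "continuous_on UNIV E"
    and zero: "\<And>\<theta>. test_fun {0<..<T} \<theta> \<Longrightarrow> (LINT t|lborel. E t * pd 1 \<theta> t) = 0"
    and t: "t \<in> {0..T}"
  shows "E t = E 0"
proof -
  obtain \<eta> P :: "real \<Rightarrow> real" where \<eta>: "smooth P" "smooth \<eta>" "\<And>x. (P has_real_derivative \<eta> x) (at x)"
    "\<And>x. \<bar>x\<bar> \<ge> 1 \<Longrightarrow> \<eta> x = 0" "(LINT x|lborel. \<eta> x) = 1" "\<And>x. x \<le> -1 \<Longrightarrow> P x = 0" "\<And>x. x \<ge> 1 \<Longrightarrow> P x = 1"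
    using smooth_step_exists by metis
  have eq: "E s = E t" if st: "0 < s" "s < t" "t < T" for s t
  proof -
    \<comment> \<open>The distance of \<open>s\<close> and \<open>t\<close> from the ends of the
      interval; steps of width below \<open>m\<close> give a test function supported inside
      \<open>{0<..<T}\<close>.\<close>
    define m where "m = min s (T - t)"
    have m: "m > 0" using st by (simp add: m_def)
    define k where "k = (\<lambda>n x a. real (Suc n) * \<eta> (real (Suc n) * (x - a)))"
    have ev: "eventually (\<lambda>n. (LINT x|lborel. E x * k n x s) = (LINT x|lborel. E x * k n x t)) sequentially"
    proof -
      obtain n0 where n0: "1 / real (Suc n0) < m" using m nat_approx_posE by blast
      show ?thesis
      proof (rule eventually_sequentiallyI[of n0])
        fix n assume "n \<ge> n0"
        then have "1 / real (Suc n) \<le> 1 / real (Suc n0)" by (intro divide_left_mono) auto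
        with n0 have n: "1 / real (Suc n) < m" by simp
        define c where "c = real (Suc n)"
        have c: "c > 0" "1 / c < m" using n by (auto simp: c_def simp del: of_nat_Suc)
        define \<theta> where "\<theta> = (\<lambda>x. P (c * (x - s)) - P (c * (x - t)))"
        have "\<theta> x = 0" if x: "x \<notin> {s - 1 / c..t + 1 / c}" for x
        proof (cases "x < s - 1 / c")
          case True
          then have "c * (x - s) \<le> -1" using c by (simp add: field_simps)
          moreover from this have "c * (x - t) \<le> -1"
            using mult_strict_left_mono[OF st(2) c(1)] by (simp add: algebra_simps)
          ultimately show ?thesis by (simp add: \<theta>_def \<eta>)
        next
          case False
          then have "c * (x - t) \<ge> 1" using c x by (simp add: field_simps)
          moreover from this have "c * (x - s) \<ge> 1"
            using mult_strict_left_mono[OF st(2) c(1)] by (simp add: algebra_simps)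
          ultimately show ?thesis by (simp add: \<theta>_def \<eta>)
        qed
        moreover have "smooth \<theta>" unfolding \<theta>_def
          by (rule smooth_diff; rule smooth_comp[of _ P, OF _ \<eta>(1)]; intro smooth_mult smooth_diff smooth_const smooth_ident)
        ultimately have "test_fun {0<..<T} \<theta>"
          using c st by (intro test_funI[of _ "{s - 1 / c..t + 1 / c}"]) (auto simp: m_def)
        then have "(LINT x|lborel. E x * pd 1 \<theta> x) = 0" by (rule zero)
        moreover have "pd 1 \<theta> x = k n x s - k n x t" for x
        proof (rule smooth_pd_eq)
          show "(\<theta> has_real_derivative k n x s - k n x t) (at x)"
            unfolding \<theta>_def k_def c_def[symmetric]
            by (auto intro!: derivative_eq_intros DERIV_chain2[OF \<eta>(3)])
        qed
        moreover have "integrable lborel (\<lambda>x. E x * k n x a)" for a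
        proof (rule integrable_continuous_compact[where S = "{a - 1 / c..a + 1 / c}"])
          show "continuous_on UNIV (\<lambda>x. E x * k n x a)"
            unfolding k_def
            by (intro continuous_intros E continuous_on_compose2[OF smooth_continuous[OF \<eta>(2), of UNIV]]) auto
          show "E x * k n x a = 0" if "x \<notin> {a - 1 / c..a + 1 / c}" for x
          proof -
            have "1 / c < \<bar>x - a\<bar>" using that by auto
            then have "1 \<le> \<bar>c * (x - a)\<bar>" using c by (simp add: abs_mult pos_divide_less_eq mult.commute)
            then show ?thesis by (simp add: k_def c_def \<eta> del: of_nat_Suc)
          qed
        qed auto
        ultimately show "(LINT x|lborel. E x * k n x s) = (LINT x|lborel. E x * k n x t)"
          by (simp add: right_diff_distrib)
      qed
    qed
    have lim: "(\<lambda>n. LINT x|lborel. E x * k n x a) \<longlonglongrightarrow> E a" for a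
      using mollify_tendsto[OF E smooth_continuous[OF \<eta>(2)] \<eta>(4), of a] \<eta>(5) by (simp add: k_def)
    have "(\<lambda>n. LINT x|lborel. E x * k n x t) \<longlonglongrightarrow> E s"
      by (rule Lim_transform_eventually[OF lim ev])
    then show ?thesis using lim LIMSEQ_unique by blast
  qed
  have eq2: "E s = E (T / 2)" if "s \<in> {0<..<T}" for s
  proof -
    have "0 < T / 2" "T / 2 < T" using T by auto
    then consider "s < T / 2" | "s = T / 2" | "T / 2 < s" by linarith
    then show ?thesis
    proof cases
      case 1
      then show ?thesis using eq[of s "T / 2"] that T by simp
    next
      case 2
      then show ?thesis by (simp only:)
    next
      case 3
      then show ?thesis using eq[of "T / 2" s] that T by simp
    qed
  qed
  have "E s = E (T / 2)" if "s \<in> {0..T}" for s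
  proof (rule continuous_constant_on_closure[of "{0<..<T}" E])
    show "continuous_on (closure {0<..<T}) E" by (rule continuous_on_subset[OF E]) simp
    show "s \<in> closure {0<..<T}" using that T by simp
    show "E x = E (T / 2)" if "x \<in> {0<..<T}" for x by (rule eq2[OF that])
  qed
  note half = this
  have "E 0 = E (T / 2)" by (rule half) (use T in simp)
  with half[OF t] show ?thesis by (rule trans[OF _ sym])
qed

text \<open>A primitive of \<open>G\<close> has the same weak derivative as \<open>F\<close>, so the
  difference is constant on the interval. A weak equation with continuous data is therefore a
  classical one.\<close>

lemma dubois_reymond:
  fixes F G :: "real \<Rightarrow> real"
  assumes T: "0 < T" and F: "continuous_on UNIV F" and G: "continuous_on UNIV G"
    and weak: "\<And>\<theta>. test_fun {0<..<T} \<theta> \<Longrightarrow> (LINT t|lborel. F t * pd 1 \<theta> t) = - (LINT t|lborel. G t * \<theta> t)"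
    and t: "t \<in> {0..T}"
  shows "(F has_real_derivative G t) (at t within {0..T})"
proof -
  obtain Q where Q: "\<And>x. (Q has_real_derivative G x) (at x)"
    using antiderivative_exists[OF G] by blast
  have Qc: "continuous_on UNIV Q"
    using Q by (auto intro!: continuous_at_imp_continuous_on DERIV_isCont)
  have const: "F s - Q s = F 0 - Q 0" if "s \<in> {0..T}" for s
  proof (rule dubois_reymond_const[OF T _ _ that, where E = "\<lambda>t. F t - Q t"])
    show "continuous_on UNIV (\<lambda>t. F t - Q t)" by (intro continuous_intros F Qc)
    fix \<theta> assume \<theta>: "test_fun {0<..<T} \<theta>"
    from test_funD[OF this] obtain S where S: "smooth \<theta>" "compact S" "S \<subseteq> {0<..<T}"
      "\<And>z. z \<notin> S \<Longrightarrow> \<theta> z = 0" "\<And>z b. z \<notin> S \<Longrightarrow> pd b \<theta> z = 0" by metis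
    have \<theta>': "continuous_on UNIV (pd 1 \<theta>)" by (intro smooth_continuous smooth_pd S) auto
    have int: "integrable lborel (\<lambda>x. h x * pd 1 \<theta> x)" "integrable lborel (\<lambda>x. h x * \<theta> x)" if "continuous_on UNIV h" for h
      by (rule integrable_continuous_compact[OF _ S(2)];
          use that \<theta>' S(4,5) in \<open>auto intro!: continuous_intros smooth_continuous[OF S(1)]\<close>)+
    have "(LINT t|lborel. G t * \<theta> t + Q t * pd 1 \<theta> t) = 0"
    proof (rule integral_derivative_eq_0[where g = "\<lambda>t. Q t * \<theta> t" and M = T])
      show "((\<lambda>t. Q t * \<theta> t) has_real_derivative G x * \<theta> x + Q x * pd 1 \<theta> x) (at x)" for x
        using DERIV_mult[OF Q[of x] smooth_has_real_derivative[OF S(1), of x]] by (simp add: mult.commute)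
      show "continuous_on UNIV (\<lambda>x. G x * \<theta> x + Q x * pd 1 \<theta> x)"
        by (intro continuous_intros G Qc \<theta>' smooth_continuous[OF S(1)])
      show "Q x * \<theta> x = 0" if "\<bar>x\<bar> \<ge> T" for x
        using S(3,4) that by force
    qed
    then have "(LINT t|lborel. Q t * pd 1 \<theta> t) = - (LINT t|lborel. G t * \<theta> t)"
      using int(2)[OF G] int(1)[OF Qc] by simp
    with weak[OF \<theta>] show "(LINT t|lborel. (F t - Q t) * pd 1 \<theta> t) = 0"
      using int(1)[OF F] int(1)[OF Qc] by (simp add: left_diff_distrib)
  qed
  have "((\<lambda>s. Q s + (F 0 - Q 0)) has_real_derivative G t) (at t within {0..T})"
    using has_field_derivative_at_within[OF Q, of t "{0..T}"] by (auto intro!: derivative_eq_intros)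
  then show ?thesis
    by (rule has_field_derivative_transform_within[of _ _ _ _ 1])
      (use t const in \<open>auto simp: algebra_simps\<close>)
qed

text \<open>Approximating \<open>X\<close> alone would say nothing about its derivative. Instead
  \<open>X'\<close> is approximated by a polynomial, which is then integrated; dividing
  \<open>e\<close> by \<open>T + 1\<close> pays for the accumulation of the error over the
  interval.\<close>

lemma C1_approx_smooth:
  fixes X :: "real \<Rightarrow> real"
  assumes X: "\<And>t. t \<in> {0..T} \<Longrightarrow> (X has_real_derivative X' t) (at t within {0..T})"
    and X': "continuous_on {0..T} X'" and e: "e > 0"
  obtains Y Y' where "smooth Y" "smooth Y'" "\<And>t. (Y has_real_derivative Y' t) (at t)"
    "\<And>t. t \<in> {0..T} \<Longrightarrow> \<bar>Y t - X t\<bar> \<le> e" "\<And>t. t \<in> {0..T} \<Longrightarrow> \<bar>Y' t - X' t\<bar> \<le> e"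
proof (cases "T \<ge> 0")
  case True
  define d where "d = e / (T + 1)"
  have d: "d > 0" "d \<le> e" "d * T \<le> e" using e True by (auto simp: d_def field_simps)
  obtain g where g: "real_polynomial_function g" "\<And>x. x \<in> {0..T} \<Longrightarrow> \<bar>X' x - g x\<bar> < d"
    using Stone_Weierstrass_real_polynomial_function[OF _ X' d(1)] by auto
  have gs: "smooth g" by (rule smooth_real_polynomial[OF g(1)])
  obtain Q where Q: "\<And>x. (Q has_real_derivative g x) (at x)"
    using antiderivative_exists[OF smooth_continuous[OF gs]] by blast
  define Y where "Y = (\<lambda>t. Q t - Q 0 + X 0)"
  have Y: "(Y has_real_derivative g t) (at t)" for t
    unfolding Y_def using Q by (auto intro!: derivative_eq_intros)
  show thesis
  proof (rule that[OF _ gs Y])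
    show "smooth Y" by (rule smooth_antideriv[OF Y gs])
    show "\<bar>g t - X' t\<bar> \<le> e" if "t \<in> {0..T}" for t using g(2)[OF that] d by simp
    fix t assume t: "t \<in> {0..T}"
    have "norm ((Y t - X t) - (Y 0 - X 0)) \<le> d * norm (t - 0)"
    proof (rule field_differentiable_bound[of "{0..T}" "\<lambda>t. Y t - X t" "\<lambda>t. g t - X' t"])
      show "((\<lambda>t. Y t - X t) has_real_derivative g z - X' z) (at z within {0..T})" if "z \<in> {0..T}" for z
        using X[OF that] has_field_derivative_at_within[OF Y] by (intro derivative_intros)
      show "norm (g z - X' z) \<le> d" if "z \<in> {0..T}" for z
        using g(2)[OF that] by (simp add: abs_minus_commute)
    qed (use t True in auto)
    also have "\<dots> \<le> d * T" using t d by (intro mult_left_mono) auto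
    finally show "\<bar>Y t - X t\<bar> \<le> e" using d(3) by (simp add: Y_def)
  qed
next
  case False
  then show thesis
    by (intro that[of "\<lambda>_. 0" "\<lambda>_. 0"]) (auto simp: smooth_const)
qed

text \<open>In every time slice this is the affine substitution \<open>x = Y t + c y\<close>, whose
  Jacobian \<open>c\<close> does not depend on time.\<close>

lemma integral_shear:
  fixes f :: "real \<times> real \<Rightarrow> real"
  assumes f: "continuous_on UNIV f" and S: "compact S" "\<And>z. z \<notin> S \<Longrightarrow> f z = 0"
    and Y: "continuous_on UNIV Y" and c: "c > 0"
  shows "(LINT z|lborel. f z) = c * (LINT p|lborel. f (fst p, Y (fst p) + c * snd p))"
proof -
  define g where "g = (\<lambda>p. f (fst p, Y (fst p) + c * snd p))"
  have fi: "integrable (lborel \<Otimes>\<^sub>M lborel) f"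
    using integrable_continuous_compact[OF f S] by (simp add: lborel_prod)
  have Y': "continuous_on U (\<lambda>p. Y (fst p))" for U :: "(real \<times> real) set"
    by (rule continuous_on_compose2[OF Y]) (auto intro: continuous_intros)
  have "integrable lborel g"
  proof (rule integrable_continuous_compact)
    show "continuous_on UNIV g"
      unfolding g_def by (rule continuous_on_compose2[OF f]) (auto intro!: continuous_intros Y')
    show "compact ((\<lambda>z. (fst z, (snd z - Y (fst z)) / c)) ` S)"
      using c by (intro compact_continuous_image S continuous_intros Y') auto
    show "g p = 0" if "p \<notin> (\<lambda>z. (fst z, (snd z - Y (fst z)) / c)) ` S" for p
      unfolding g_def
    proof (rule S(2), rule)
      assume "(fst p, Y (fst p) + c * snd p) \<in> S"
      then have "p \<in> (\<lambda>z. (fst z, (snd z - Y (fst z)) / c)) ` S"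
        by (rule rev_image_eqI) (use c in simp)
      with that show False by simp
    qed
  qed
  then have gi: "integrable (lborel \<Otimes>\<^sub>M lborel) g" by (simp add: lborel_prod)
  have "(LINT z|lborel. f z) = (LINT t|lborel. LINT x|lborel. f (t, x))"
    using lborel_pair.integral_fst'[OF fi] by (simp add: lborel_prod)
  also have "\<dots> = (LINT t|lborel. c * (LINT x|lborel. g (t, x)))"
    using c lborel_integral_real_affine[of c "\<lambda>x. f (_, x)" "Y _"]
    by (intro Bochner_Integration.integral_cong) (auto simp: g_def)
  also have "\<dots> = c * (LINT z|lborel. g z)"
    using lborel_pair.integral_fst'[OF gi] by (simp add: lborel_prod)
  finally show ?thesis by (simp add: g_def)
qed

text \<open>Weak derivatives are tested with smooth functions, while the coefficients
  \<open>a\<close> and \<open>b\<close> are merely continuous in time. Since only a space derivative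
  is involved, no derivative of them occurs in the identity, and uniform polynomial approximation in
  time suffices.\<close>

lemma weak_deriv_affine:
  fixes w g :: "real \<times> real \<Rightarrow> real" and a b :: "real \<Rightarrow> real"
  assumes wd: "has_weak_deriv (cyl T) (0,1) w g"
    and a: "continuous_on UNIV a" and b: "continuous_on UNIV b" and \<psi>: "test_fun (cyl T) \<psi>"
  shows "(LINT z:cyl T|lborel. w z * (b (fst z) * \<psi> z + (a (fst z) + b (fst z) * snd z) * pd (0,1) \<psi> z)) =
    - (LINT z:cyl T|lborel. g z * ((a (fst z) + b (fst z) * snd z) * \<psi> z))"
proof -
  from test_funD[OF \<psi>] obtain S where S: "smooth \<psi>" "compact S" "S \<subseteq> cyl T"
    "\<And>z. z \<notin> S \<Longrightarrow> \<psi> z = 0" "\<And>z b. z \<notin> S \<Longrightarrow> pd b \<psi> z = 0" by metis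
  have li: "loc_integrable (cyl T) w" "loc_integrable (cyl T) g"
    using wd by (auto simp: has_weak_deriv_def)
  have \<psi>c: "continuous_on UNIV \<psi>" "continuous_on UNIV (pd (0,1) \<psi>)"
    by (intro smooth_continuous smooth_pd S; simp add: Basis_prod_def)+
  have ctf: "continuous_on UNIV (\<lambda>z::real \<times> real. h (fst z))" if "continuous_on UNIV h" for h :: "real \<Rightarrow> real"
    by (rule continuous_on_compose2[OF that]) (auto intro: continuous_intros)
  define D where "D = (\<lambda>a b z. b (fst z) * \<psi> z + (a (fst z) + b (fst z) * snd z) * pd (0,1) \<psi> z)"
  define V where "V = (\<lambda>a b z. (a (fst z) + b (fst z) * snd z) * \<psi> z)"
  have int: "set_integrable lborel (cyl T) (\<lambda>z. w z * D a b z)" "set_integrable lborel (cyl T) (\<lambda>z. g z * V a b z)"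
    if "continuous_on UNIV a" "continuous_on UNIV b" for a b
    by (rule loc_integrable_times[OF _ S(2,3)];
      use li S that in \<open>auto simp: D_def V_def intro!: continuous_intros ctf \<psi>c\<close>)+
  have "\<exists>p. smooth p \<and> (\<forall>t\<in>{0..T}. \<bar>h t - p t\<bar> < 1 / real (Suc n))" if h: "continuous_on UNIV h"
    for h :: "real \<Rightarrow> real" and n
  proof -
    have "0 < 1 / real (Suc n)" by simp
    from Stone_Weierstrass_real_polynomial_function[OF compact_Icc[of 0 T] continuous_on_subset[OF h subset_UNIV] this]
    obtain p where "real_polynomial_function p" "\<And>x. x \<in> {0..T} \<Longrightarrow> \<bar>h x - p x\<bar> < 1 / real (Suc n)" by blast
    then show ?thesis using smooth_real_polynomial by blast
  qed
  then have "\<forall>h n. \<exists>p. continuous_on UNIV h \<longrightarrow> smooth p \<and> (\<forall>t\<in>{0..T}. \<bar>h t - p t\<bar> < 1 / real (Suc n))"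
    by blast
  then obtain A where A: "\<And>h n. continuous_on UNIV h \<Longrightarrow> smooth (A h n)"
      "\<And>h n t. continuous_on UNIV h \<Longrightarrow> t \<in> {0..T} \<Longrightarrow> \<bar>h t - A h n t\<bar> < 1 / real (Suc n)"
    by metis
  have Ac: "continuous_on UNIV (A h n)" if "continuous_on UNIV h" for h n
    by (rule smooth_continuous[OF A(1)[OF that]])
  have poly_eq: "(LINT z:cyl T|lborel. w z * D (A a n) (A b n) z) = - (LINT z:cyl T|lborel. g z * V (A a n) (A b n) z)" for n
  proof -
    have "smooth (V (A a n) (A b n))"
      unfolding V_def
      by (intro smooth_mult smooth_add smooth_comp[OF smooth_fst A(1)[OF a]]
        smooth_comp[OF smooth_fst A(1)[OF b]] smooth_snd S(1))
    then have "test_fun (cyl T) (V (A a n) (A b n))"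
      by (rule test_funI[OF _ S(2,3)]) (simp add: V_def S)
    then have "(LINT z:cyl T|lborel. w z * pd (0,1) (V (A a n) (A b n)) z) = - (LINT z:cyl T|lborel. g z * V (A a n) (A b n) z)"
      using wd by (simp add: has_weak_deriv_def)
    moreover have "pd (0,1) (V (A a n) (A b n)) z = D (A a n) (A b n) z" for z
    proof -
      have fd: "((\<lambda>z::real \<times> real. A h n (fst z)) has_derivative (\<lambda>v. pd 1 (A h n) (fst z) * fst v)) (at z)"
        if "continuous_on UNIV h" for h
        by (rule has_derivative_compose[OF has_derivative_fst[OF has_derivative_ident]
           smooth_has_real_derivative[OF A(1)[OF that], of n, unfolded has_field_derivative_def]])
      have "((V (A a n) (A b n)) has_derivative
        (\<lambda>v. (A a n (fst z) + A b n (fst z) * snd z) * pd v \<psi> z +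
          (pd 1 (A a n) (fst z) * fst v + (A b n (fst z) * snd v + (pd 1 (A b n) (fst z) * fst v) * snd z)) * \<psi> z)) (at z)"
        unfolding V_def
        by (intro has_derivative_mult has_derivative_add fd a b smooth_pd_has_derivative S has_derivative_snd has_derivative_ident)
      from pd_eq[OF this, of "(0,1)"] show ?thesis by (simp add: D_def algebra_simps)
    qed
    ultimately show ?thesis by simp
  qed
  have lim: "(\<lambda>n. A h n t) \<longlonglongrightarrow> h t" if "continuous_on UNIV h" "t \<in> {0..T}" for h t
  proof (rule LIMSEQ_I)
    fix e :: real assume "e > 0"
    then obtain N where N: "1 / real (Suc N) < e" using nat_approx_posE by blast
    have "\<bar>A h n t - h t\<bar> < e" if n: "n \<ge> N" for n
    proof -
      have "\<bar>h t - A h n t\<bar> < 1 / real (Suc n)" by (rule A(2)) fact+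
      also have "\<dots> \<le> 1 / real (Suc N)" using n by (intro divide_left_mono) auto
      finally show ?thesis using N by (simp add: abs_minus_commute)
    qed
    then show "\<exists>N. \<forall>n\<ge>N. norm (A h n t - h t) < e" by auto
  qed
  have bnd: "\<bar>A h n t\<bar> \<le> \<bar>h t\<bar> + 1" if "continuous_on UNIV h" "t \<in> {0..T}" for h n t
  proof -
    have "1 / real (Suc n) \<le> 1" by simp
    with A(2)[OF that, of n] show ?thesis by linarith
  qed
  \<comment> \<open>\<open>D'\<close> and \<open>V'\<close> dominate the approximations: the
    polynomials differ from the coefficients by less than 1 on \<open>{0..T}\<close>.\<close>
  define D' where "D' = (\<lambda>z. (\<bar>b (fst z)\<bar> + 1) * \<bar>\<psi> z\<bar> + (\<bar>a (fst z)\<bar> + 1 + (\<bar>b (fst z)\<bar> + 1) * \<bar>snd z\<bar>) * \<bar>pd (0,1) \<psi> z\<bar>)"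
  define V' where "V' = (\<lambda>z. (\<bar>a (fst z)\<bar> + 1 + (\<bar>b (fst z)\<bar> + 1) * \<bar>snd z\<bar>) * \<bar>\<psi> z\<bar>)"
  have int': "set_integrable lborel (cyl T) (\<lambda>z. w z * D' z)" "set_integrable lborel (cyl T) (\<lambda>z. g z * V' z)"
    by (rule loc_integrable_times[OF _ S(2,3)];
      use li S in \<open>auto simp: D'_def V'_def intro!: continuous_intros ctf \<psi>c a b\<close>)+
  have cylT: "fst z \<in> {0..T}" if "z \<in> cyl T" for z using that by (auto simp: cyl_def)
  have D'b: "\<bar>D (A a n) (A b n) z\<bar> \<le> D' z" "\<bar>V (A a n) (A b n) z\<bar> \<le> V' z" if z: "z \<in> cyl T" for n z
  proof -
    have u: "\<bar>A a n (fst z) + A b n (fst z) * snd z\<bar> \<le> \<bar>a (fst z)\<bar> + 1 + (\<bar>b (fst z)\<bar> + 1) * \<bar>snd z\<bar>"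
      by (rule order_trans[OF abs_triangle_ineq], unfold abs_mult)
         (intro add_mono mult_right_mono bnd a b cylT[OF z]; simp)
    show "\<bar>D (A a n) (A b n) z\<bar> \<le> D' z"
      unfolding D_def D'_def
      by (rule order_trans[OF abs_triangle_ineq], unfold abs_mult)
         (intro add_mono mult_right_mono bnd b u cylT[OF z]; simp)
    show "\<bar>V (A a n) (A b n) z\<bar> \<le> V' z"
      unfolding V_def V'_def abs_mult by (intro mult_right_mono u) simp
  qed
  have conv: "(\<lambda>n. LINT z:cyl T|lborel. h z * L n z) \<longlonglongrightarrow> (LINT z:cyl T|lborel. h z * L' z)"
    if L: "\<And>n. set_integrable lborel (cyl T) (\<lambda>z. h z * L n z)" "set_integrable lborel (cyl T) (\<lambda>z. h z * L' z)"
      "set_integrable lborel (cyl T) (\<lambda>z. h z * M z)"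
      "\<And>n z. z \<in> cyl T \<Longrightarrow> \<bar>L n z\<bar> \<le> M z" "\<And>z. z \<in> cyl T \<Longrightarrow> (\<lambda>n. L n z) \<longlonglongrightarrow> L' z"
    for h L L' and M :: "real \<times> real \<Rightarrow> real"
    unfolding set_lebesgue_integral_def
  proof (rule integral_dominated_convergence[where w = "\<lambda>z. \<bar>indicator (cyl T) z * (h z * M z)\<bar>"])
    show "AE z in lborel. (\<lambda>n. indicator (cyl T) z *\<^sub>R (h z * L n z)) \<longlonglongrightarrow> indicator (cyl T) z *\<^sub>R (h z * L' z)"
    proof (intro always_eventually allI)
      fix z show "(\<lambda>n. indicator (cyl T) z *\<^sub>R (h z * L n z)) \<longlonglongrightarrow> indicator (cyl T) z *\<^sub>R (h z * L' z)"
        using L(5)[of z] by (cases "z \<in> cyl T") (auto intro: tendsto_intros)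
    qed
    show "AE z in lborel. norm (indicator (cyl T) z *\<^sub>R (h z * L n z)) \<le> \<bar>indicator (cyl T) z * (h z * M z)\<bar>" for n
    proof (intro always_eventually allI)
      fix z show "norm (indicator (cyl T) z *\<^sub>R (h z * L n z)) \<le> \<bar>indicator (cyl T) z * (h z * M z)\<bar>"
        using order_trans[OF L(4)[of z n] abs_ge_self]
        by (cases "z \<in> cyl T") (auto simp: abs_mult intro: mult_left_mono)
    qed
  qed (use L(1,2,3) in \<open>auto simp: set_integrable_def\<close>)
  have "(\<lambda>n. LINT z:cyl T|lborel. w z * D (A a n) (A b n) z) \<longlonglongrightarrow> (LINT z:cyl T|lborel. w z * D a b z)"
    by (rule conv[OF int(1)[OF Ac[OF a] Ac[OF b]] int(1)[OF a b] int'(1) D'b(1)], assumption)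
      (unfold D_def, intro tendsto_intros lim a b cylT)
  moreover have "(\<lambda>n. LINT z:cyl T|lborel. g z * V (A a n) (A b n) z) \<longlonglongrightarrow> (LINT z:cyl T|lborel. g z * V a b z)"
    by (rule conv[OF int(2)[OF Ac[OF a] Ac[OF b]] int(2)[OF a b] int'(2) D'b(2)], assumption)
      (unfold V_def, intro tendsto_intros lim a b cylT)
  then have "(\<lambda>n. - (LINT z:cyl T|lborel. g z * V (A a n) (A b n) z)) \<longlonglongrightarrow> - (LINT z:cyl T|lborel. g z * V a b z)"
    by (rule tendsto_minus)
  ultimately have "(LINT z:cyl T|lborel. w z * D a b z) = - (LINT z:cyl T|lborel. g z * V a b z)"
    unfolding poly_eq by (rule LIMSEQ_unique)
  then show ?thesis by (simp add: D_def V_def)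
qed

text \<open>The equation is tested with the travelling bump
  \<open>\<theta>(t) \<eta>(c (x - Y t))\<close>, and the integrals are then rewritten in the moving
  coordinate \<open>y = c (x - Y t)\<close>. The term with \<open>B\<close> alone is the divergence
  of the velocity; the term with the factor \<open>c\<close> measures how far \<open>Y\<close> is
  from being a characteristic. The affine form of the velocity enters only in the tube of half-width
  \<open>1 / c\<close> around \<open>Y\<close>.\<close>

lemma weak_transport_along_smooth_path:
  fixes w g1 g2 \<Gamma> :: "real \<times> real \<Rightarrow> real" and A B Y Y' \<theta> \<eta> :: "real \<Rightarrow> real"
  assumes wd: "has_weak_deriv (cyl T) (1,0) w g1" "has_weak_deriv (cyl T) (0,1) w g2"
    and W: "continuous_on UNIV W" "\<And>z. z \<in> cyl T \<Longrightarrow> W z = w z"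
    and G: "continuous_on UNIV \<Gamma>"
    and AB: "continuous_on UNIV A" "continuous_on UNIV B"
    and Y: "smooth Y" "smooth Y'" "\<And>t. (Y has_real_derivative Y' t) (at t)"
    and \<theta>: "smooth \<theta>" "compact S" "S \<subseteq> {0<..<T}" "\<And>t. t \<notin> S \<Longrightarrow> \<theta> t = 0" "\<And>t. t \<notin> S \<Longrightarrow> pd 1 \<theta> t = 0"
    and \<eta>: "smooth \<eta>" "\<And>x. \<bar>x\<bar> \<ge> 1 \<Longrightarrow> \<eta> x = 0"
    and c: "c > 0"
    and tube: "\<And>t x. t \<in> S \<Longrightarrow> \<bar>x - Y t\<bar> \<le> 1 / c \<Longrightarrow> x \<in> Omega"
    and eq: "AE z\<in>cyl T in lborel. \<bar>snd z - Y (fst z)\<bar> \<le> 1 / c \<longrightarrow> g1 z + (A (fst z) + B (fst z) * snd z) * g2 z = \<Gamma> z"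
  shows "(LINT p|lborel. W (fst p, Y (fst p) + 1 / c * snd p) *
      (pd 1 \<theta> (fst p) * \<eta> (snd p) + B (fst p) * (\<theta> (fst p) * \<eta> (snd p)) +
       (A (fst p) + B (fst p) * (Y (fst p) + 1 / c * snd p) - Y' (fst p)) * (\<theta> (fst p) * (c * pd 1 \<eta> (snd p))))) =
    - (LINT p|lborel. \<Gamma> (fst p, Y (fst p) + 1 / c * snd p) * (\<theta> (fst p) * \<eta> (snd p)))"
proof -
  have \<eta>': "pd 1 \<eta> x = 0" if "\<bar>x\<bar> > 1" for x
    by (rule pd_zero_outside[of "{-1..1}"]) (use that in \<open>auto intro!: \<eta>(2)\<close>)
  define \<psi> where "\<psi> = (\<lambda>z. \<theta> (fst z) * \<eta> (c * (snd z - Y (fst z))))"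
  define D1 where "D1 = (\<lambda>z. pd 1 \<theta> (fst z) * \<eta> (c * (snd z - Y (fst z)))
    - \<theta> (fst z) * (c * Y' (fst z) * pd 1 \<eta> (c * (snd z - Y (fst z)))))"
  define D2 where "D2 = (\<lambda>z. \<theta> (fst z) * (c * pd 1 \<eta> (c * (snd z - Y (fst z)))))"
  define K where "K = (\<lambda>p. (fst p, Y (fst p) + 1 / c * snd p)) ` (S \<times> {-1..1})"
  have cf: "continuous_on U (\<lambda>z::real \<times> real. h (fst z))" if "continuous_on UNIV h" for h :: "real \<Rightarrow> real" and U
    by (rule continuous_on_compose2[OF that]) (auto intro: continuous_intros)
  have Yc: "continuous_on U (\<lambda>z::real \<times> real. Y (fst z))" for U by (intro cf smooth_continuous Y)
  have K: "compact K"
    unfolding K_def by (intro compact_continuous_image compact_Times \<theta> continuous_intros Yc) auto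
  have Kcyl: "K \<subseteq> cyl T"
  proof
    fix z assume "z \<in> K"
    then obtain t y where ty: "t \<in> S" "\<bar>y\<bar> \<le> 1" "z = (t, Y t + 1 / c * y)"
      by (auto simp: K_def abs_le_iff)
    have "\<bar>1 / c * y\<bar> \<le> 1 / c" using c ty(2) by (simp add: abs_mult divide_right_mono)
    then have "Y t + 1 / c * y \<in> Omega" using tube[OF ty(1)] by simp
    then show "z \<in> cyl T" using ty \<theta>(3) by (auto simp: cyl_def)
  qed
  have outK: "fst z \<notin> S \<or> \<bar>c * (snd z - Y (fst z))\<bar> > 1" if "z \<notin> K" for z
  proof (rule ccontr)
    assume a: "\<not> ?thesis"
    have "(fst z, c * (snd z - Y (fst z))) \<in> S \<times> {-1..1}" using a by (auto simp: abs_le_iff)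
    then have "z \<in> K" unfolding K_def
      by (rule rev_image_eqI) (use c in \<open>cases z; simp\<close>)
    with that show False by simp
  qed
  have \<psi>0: "\<psi> z = 0" "D1 z = 0" "D2 z = 0" if "z \<notin> K" for z
    using outK[OF that] by (auto simp: \<psi>_def D1_def D2_def \<theta> \<eta> \<eta>')
  have \<psi>s: "smooth \<psi>"
    unfolding \<psi>_def
    by (intro smooth_mult smooth_comp[OF smooth_fst \<theta>(1)] smooth_comp[OF _ \<eta>(1)] smooth_diff smooth_const
        smooth_snd smooth_comp[OF smooth_fst Y(1)])
  have \<psi>: "test_fun (cyl T) \<psi>" by (rule test_funI[OF \<psi>s K Kcyl \<psi>0(1)])
  have deriv: "(\<psi> has_derivative (\<lambda>v. \<theta> (fst z) * (pd 1 \<eta> (c * (snd z - Y (fst z))) * (c * (snd v - Y' (fst z) * fst v)))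
      + (pd 1 \<theta> (fst z) * fst v) * \<eta> (c * (snd z - Y (fst z))))) (at z)" for z
  proof -
    have comp: "((\<lambda>z. f (h z)) has_derivative (\<lambda>v. f' * h' v)) (at z)"
      if "(f has_real_derivative f') (at (h z))" "(h has_derivative h') (at z)" for f f' h h'
      using has_derivative_compose[OF that(2)] that(1) by (simp add: has_field_derivative_def)
    show ?thesis
      unfolding \<psi>_def
      by (intro has_derivative_mult comp[OF smooth_has_real_derivative[OF \<eta>(1)]]
          comp[OF smooth_has_real_derivative[OF \<theta>(1)]] comp[OF Y(3)] has_derivative_mult_right
          has_derivative_diff has_derivative_fst has_derivative_snd has_derivative_ident)
  qed
  have pd1: "pd (1,0) \<psi> z = D1 z" for z
    using pd_eq[OF deriv, of "(1,0)" z] by (simp add: D1_def algebra_simps)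
  have pd2: "pd (0,1) \<psi> z = D2 z" for z
    using pd_eq[OF deriv, of "(0,1)" z] by (simp add: D2_def algebra_simps)
  have shift: "continuous_on UNIV (\<lambda>z. h (c * (snd z - Y (fst z))))" if "continuous_on UNIV h" for h :: "real \<Rightarrow> real"
    by (rule continuous_on_compose2[OF that]) (auto intro!: continuous_intros Yc)
  have cont: "continuous_on UNIV \<psi>" "continuous_on UNIV D1" "continuous_on UNIV D2"
    unfolding \<psi>_def D1_def D2_def
    by (intro continuous_intros shift cf smooth_continuous \<theta> \<eta> Y smooth_pd; simp)+
  have li: "loc_integrable (cyl T) w" "loc_integrable (cyl T) g1" "loc_integrable (cyl T) g2"
    using wd by (auto simp: has_weak_deriv_def)
  \<comment> \<open>This is \<open>\<partial>\<^sub>t \<psi> + \<partial>\<^sub>x ((A + B x)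
    \<psi>)\<close>, the adjoint transport operator applied to the bump.\<close>
  define E where "E = (\<lambda>z. D1 z + (B (fst z) * \<psi> z + (A (fst z) + B (fst z) * snd z) * D2 z))"
  have Ec: "continuous_on UNIV E" unfolding E_def by (intro continuous_intros cont cf AB)
  have E0: "E z = 0" if "z \<notin> K" for z using \<psi>0[OF that] by (simp add: E_def)
  have "(LINT z:cyl T|lborel. w z * E z) = (LINT z:cyl T|lborel. w z * D1 z) +
     (LINT z:cyl T|lborel. w z * (B (fst z) * \<psi> z + (A (fst z) + B (fst z) * snd z) * D2 z))"
    unfolding E_def distrib_left[of "w _" "D1 _"]
    by (rule set_integral_add(2); rule loc_integrable_times[OF li(1) K Kcyl])
       (auto intro!: continuous_intros cont cf AB simp: \<psi>0)
  also have "(LINT z:cyl T|lborel. w z * D1 z) = - (LINT z:cyl T|lborel. g1 z * \<psi> z)"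
    using wd(1) \<psi> by (simp add: has_weak_deriv_def flip: pd1)
  also have "- (LINT z:cyl T|lborel. g1 z * \<psi> z) +
     (LINT z:cyl T|lborel. w z * (B (fst z) * \<psi> z + (A (fst z) + B (fst z) * snd z) * D2 z)) =
     - (LINT z:cyl T|lborel. g1 z * \<psi> z) - (LINT z:cyl T|lborel. g2 z * ((A (fst z) + B (fst z) * snd z) * \<psi> z))"
    using weak_deriv_affine[OF wd(2) AB \<psi>] by (simp add: pd2)
  also have "\<dots> = - (LINT z:cyl T|lborel. g1 z * \<psi> z + g2 z * ((A (fst z) + B (fst z) * snd z) * \<psi> z))"
    by (subst set_integral_add(2))
       (auto intro!: loc_integrable_times[OF li(2) K Kcyl] loc_integrable_times[OF li(3) K Kcyl] continuous_intros cont cf AB simp: \<psi>0)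
  also have "(LINT z:cyl T|lborel. g1 z * \<psi> z + g2 z * ((A (fst z) + B (fst z) * snd z) * \<psi> z)) = (LINT z|lborel. \<Gamma> z * \<psi> z)"
    unfolding set_lebesgue_integral_def
  proof (rule integral_cong_AE)
    have m: "(\<lambda>z. indicator (cyl T) z *\<^sub>R (h z * k z)) \<in> borel_measurable lborel"
      if "loc_integrable (cyl T) h" "continuous_on UNIV k" "\<And>z. z \<notin> K \<Longrightarrow> k z = 0" for h k
      using loc_integrable_times[OF that(1) K Kcyl that(3,2)] by (simp add: set_integrable_def)
    show "(\<lambda>z. indicator (cyl T) z *\<^sub>R (g1 z * \<psi> z + g2 z * ((A (fst z) + B (fst z) * snd z) * \<psi> z))) \<in> borel_measurable lborel"
      unfolding scaleR_add_right
      by (intro borel_measurable_add m li continuous_intros cont cf AB) (auto simp: \<psi>0)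
    show "(\<lambda>z. \<Gamma> z * \<psi> z) \<in> borel_measurable lborel"
      using borel_measurable_continuous_onI[of "\<lambda>z. \<Gamma> z * \<psi> z"] G cont by (auto intro!: continuous_intros)
    show "AE z in lborel. indicator (cyl T) z *\<^sub>R (g1 z * \<psi> z + g2 z * ((A (fst z) + B (fst z) * snd z) * \<psi> z)) = \<Gamma> z * \<psi> z"
      using eq
    proof eventually_elim
      case (elim z)
      show ?case
      proof (cases "z \<in> K")
        case True
        then obtain t y where ty: "t \<in> S" "\<bar>y\<bar> \<le> 1" "z = (t, Y t + 1 / c * y)"
          by (auto simp: K_def abs_le_iff)
        have "\<bar>1 / c * y\<bar> \<le> 1 / c" using c ty(2) by (simp add: abs_mult divide_right_mono)
        then have "\<bar>snd z - Y (fst z)\<bar> \<le> 1 / c" by (simp add: ty(3))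
        then have "g1 z + (A (fst z) + B (fst z) * snd z) * g2 z = \<Gamma> z" "z \<in> cyl T"
          using elim True Kcyl by auto
        then show ?thesis by (simp add: algebra_simps flip: \<open>g1 z + _ = \<Gamma> z\<close>)
      qed (simp add: \<psi>0)
    qed
  qed
  also have "(LINT z:cyl T|lborel. w z * E z) = (LINT z|lborel. W z * E z)"
    unfolding set_lebesgue_integral_def
  proof (rule Bochner_Integration.integral_cong)
    fix z show "indicator (cyl T) z *\<^sub>R (w z * E z) = W z * E z"
      using E0[of z] W(2)[of z] Kcyl by (cases "z \<in> K") (auto simp: indicator_def)
  qed simp
  finally have main: "(LINT z|lborel. W z * E z) = - (LINT z|lborel. \<Gamma> z * \<psi> z)" .
  have "1 / c > 0" using c by simp
  have 1: "(LINT z|lborel. W z * E z) = 1 / c * (LINT p|lborel. W (fst p, Y (fst p) + 1 / c * snd p) * E (fst p, Y (fst p) + 1 / c * snd p))"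
    by (rule integral_shear[OF _ K _ smooth_continuous[OF Y(1)] \<open>1 / c > 0\<close>])
       (auto intro!: continuous_intros W Ec simp: E0)
  have 2: "(LINT z|lborel. \<Gamma> z * \<psi> z) = 1 / c * (LINT p|lborel. \<Gamma> (fst p, Y (fst p) + 1 / c * snd p) * \<psi> (fst p, Y (fst p) + 1 / c * snd p))"
    by (rule integral_shear[OF _ K _ smooth_continuous[OF Y(1)] \<open>1 / c > 0\<close>])
       (auto intro!: continuous_intros G cont simp: \<psi>0)
  have "(LINT p|lborel. W (fst p, Y (fst p) + 1 / c * snd p) * E (fst p, Y (fst p) + 1 / c * snd p)) =
    - (LINT p|lborel. \<Gamma> (fst p, Y (fst p) + 1 / c * snd p) * \<psi> (fst p, Y (fst p) + 1 / c * snd p))"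
    using main c unfolding 1 2 by (simp add: field_simps)
  moreover have "E (fst p, Y (fst p) + 1 / c * snd p) = pd 1 \<theta> (fst p) * \<eta> (snd p) + B (fst p) * (\<theta> (fst p) * \<eta> (snd p)) +
       (A (fst p) + B (fst p) * (Y (fst p) + 1 / c * snd p) - Y' (fst p)) * (\<theta> (fst p) * (c * pd 1 \<eta> (snd p)))" for p
    using c by (simp add: E_def D1_def D2_def \<psi>_def algebra_simps)
  moreover have "\<psi> (fst p, Y (fst p) + 1 / c * snd p) = \<theta> (fst p) * \<eta> (snd p)" for p
    using c by (simp add: \<psi>_def)
  ultimately show ?thesis by simp
qed

text \<open>\<open>X\<close> is only continuously differentiable, but a bump must be smooth to be a
  test function. So the bump follows smooth paths \<open>Y n\<close>, whose error is of smaller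
  order than its width, and the limit gives the weak form of the claimed ordinary differential
  equation for \<open>w\<close> along \<open>X\<close>.\<close>

lemma weak_transport_along_characteristic:
  fixes w g1 g2 \<Gamma> :: "real \<times> real \<Rightarrow> real" and A B X :: "real \<Rightarrow> real"
  assumes T: "0 < T"
    and wd: "has_weak_deriv (cyl T) (1,0) w g1" "has_weak_deriv (cyl T) (0,1) w g2"
    and w: "continuous_on ({0..T} \<times> {-1..1}) w" and \<Gamma>: "continuous_on ({0..T} \<times> {-1..1}) \<Gamma>"
    and AB: "continuous_on {0..T} A" "continuous_on {0..T} B"
    and X: "\<And>t. t \<in> {0..T} \<Longrightarrow> (X has_real_derivative A t + B t * X t) (at t within {0..T})"
    and r: "r > 0" and tube: "\<And>t. t \<in> {0..T} \<Longrightarrow> -1 < X t - r \<and> X t + r < 1"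
    and eq: "AE z\<in>cyl T in lborel. \<bar>snd z - X (fst z)\<bar> < r \<longrightarrow> g1 z + (A (fst z) + B (fst z) * snd z) * g2 z = \<Gamma> z"
    and t: "t \<in> {0..T}"
  shows "((\<lambda>s. w (s, X s)) has_real_derivative \<Gamma> (t, X t)) (at t within {0..T})"
proof -
  \<comment> \<open>Clamping time and space extends all data continuously to the plane without
    changing them in the closed cylinder.\<close>
  define cl where "cl = (\<lambda>t. max 0 (min T t))"
  define cx where "cx = (\<lambda>x::real. max (-1) (min 1 x))"
  have cl: "cl t \<in> {0..T}" "continuous_on U cl" for t U
    using T by (auto simp: cl_def intro!: continuous_intros)
  have cx: "cx x \<in> {-1..1}" "continuous_on U cx" for x U
    by (auto simp: cx_def intro!: continuous_intros)
  have cl_id: "cl t = t" if "t \<in> {0..T}" for t using that by (auto simp: cl_def)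
  have cx_id: "cx x = x" if "x \<in> {-1..1}" for x using that by (auto simp: cx_def)
  define W where "W = (\<lambda>z. w (cl (fst z), cx (snd z)))"
  define G where "G = (\<lambda>z. \<Gamma> (cl (fst z), cx (snd z)))"
  have ext2: "continuous_on UNIV (\<lambda>z. h (cl (fst z), cx (snd z)))" if "continuous_on ({0..T} \<times> {-1..1}) h"
    for h :: "real \<times> real \<Rightarrow> real"
    by (rule continuous_on_compose2[OF that])
       (auto simp del: atLeastAtMost_iff intro!: continuous_intros cl cx continuous_on_compose2[OF cl(2)] continuous_on_compose2[OF cx(2)])
  have ext1: "continuous_on UNIV (\<lambda>t. h (cl t))" if "continuous_on {0..T} h" for h :: "real \<Rightarrow> real"
    by (rule continuous_on_compose2[OF that cl(2)]) (use cl in blast)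
  have Xc: "continuous_on {0..T} X"
    by (rule DERIV_continuous_on[OF X])
  define a where "a = (\<lambda>t. A (cl t))"
  define b where "b = (\<lambda>t. B (cl t))"
  define x where "x = (\<lambda>t. X (cl t))"
  have Wc: "continuous_on UNIV W" unfolding W_def by (rule ext2[OF w])
  have Gc: "continuous_on UNIV G" unfolding G_def by (rule ext2[OF \<Gamma>])
  have ab: "continuous_on UNIV a" "continuous_on UNIV b" unfolding a_def b_def by (intro ext1 AB)+
  have xc: "continuous_on UNIV x" unfolding x_def by (rule ext1[OF Xc])
  have bdd: "\<exists>C\<ge>0. \<forall>z. \<bar>h (cl (fst z), cx (snd z))\<bar> \<le> C" if h: "continuous_on ({0..T} \<times> {-1..1}) h"
    for h :: "real \<times> real \<Rightarrow> real"
  proof -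
    obtain C where "0 \<le> C" "\<And>z. z \<in> {0..T} \<times> {-1..1} \<Longrightarrow> \<bar>h z\<bar> \<le> C"
      using bounded_continuous_compact[OF h compact_Times[OF compact_Icc compact_Icc]] by blast
    then show ?thesis using cl(1) cx(1) by blast
  qed
  obtain CW where CW: "0 \<le> CW" "\<And>z. \<bar>W z\<bar> \<le> CW" using bdd[OF w] unfolding W_def by blast
  obtain CG where CG: "0 \<le> CG" "\<And>z. \<bar>G z\<bar> \<le> CG" using bdd[OF \<Gamma>] unfolding G_def by blast
  obtain CB where CB: "0 \<le> CB" "\<And>t. t \<in> {0..T} \<Longrightarrow> \<bar>B t\<bar> \<le> CB"
    using bounded_continuous_compact[OF AB(2) compact_Icc] by blast
  obtain \<eta> P :: "real \<Rightarrow> real" where \<eta>: "smooth P" "smooth \<eta>" "\<And>x. (P has_real_derivative \<eta> x) (at x)"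
    "\<And>x. \<bar>x\<bar> \<ge> 1 \<Longrightarrow> \<eta> x = 0" "(LINT x|lborel. \<eta> x) = 1" "\<And>x. x \<le> -1 \<Longrightarrow> P x = 0" "\<And>x. x \<ge> 1 \<Longrightarrow> P x = 1"
    using smooth_step_exists by metis
  have \<eta>': "pd 1 \<eta> x = 0" if "\<bar>x\<bar> > 1" for x
    by (rule pd_zero_outside[of "{-1..1}"]) (use that in \<open>auto intro!: \<eta>(4)\<close>)
  have \<eta>c: "continuous_on UNIV \<eta>" "continuous_on UNIV (pd 1 \<eta>)"
    by (intro smooth_continuous \<eta> smooth_pd; simp)+
  have \<eta>i: "integrable lborel \<eta>"
    by (rule integrable_continuous_compact[OF \<eta>c(1), of "{-1..1}"]) (auto intro!: \<eta>(4))
  have z\<eta>'i: "integrable lborel (\<lambda>z. z * pd 1 \<eta> z)"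
    by (rule integrable_continuous_compact[of _ "{-1..1}"]) (auto intro!: \<eta>' continuous_intros \<eta>c)
  \<comment> \<open>Integration by parts with unit mass of \<open>\<eta>\<close>. This value makes
    the divergence term cancel in the limit.\<close>
  have z\<eta>': "(LINT z|lborel. z * pd 1 \<eta> z) = -1"
  proof -
    have "(LINT z|lborel. z * pd 1 \<eta> z + \<eta> z) = 0"
    proof (rule integral_derivative_eq_0[of "\<lambda>z. z * \<eta> z" _ 1])
      show "((\<lambda>z. z * \<eta> z) has_real_derivative z * pd 1 \<eta> z + \<eta> z) (at z)" for z
        using DERIV_mult[OF DERIV_ident smooth_has_real_derivative[OF \<eta>(2)], of z] by (simp add: algebra_simps)
    qed (auto intro!: continuous_intros \<eta>c simp: \<eta>(4))
    then show ?thesis using \<eta>i z\<eta>'i \<eta>(5) by simp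
  qed
  \<comment> \<open>The derivative of a bump of width \<open>1 / (n + 1)\<close> costs a factor
    \<open>n + 1\<close>, so the path must be accurate to the square of the width for the mismatch
    to vanish.\<close>
  have "\<exists>Y Y'. smooth Y \<and> smooth Y' \<and> (\<forall>t. (Y has_real_derivative Y' t) (at t)) \<and>
    (\<forall>t\<in>{0..T}. \<bar>Y t - X t\<bar> \<le> 1 / real (Suc n) ^ 2 \<and> \<bar>Y' t - (A t + B t * X t)\<bar> \<le> 1 / real (Suc n) ^ 2)" for n
  proof -
    have "0 < 1 / real (Suc n) ^ 2" by simp
    moreover have "continuous_on {0..T} (\<lambda>t. A t + B t * X t)" by (intro continuous_intros AB Xc)
    ultimately obtain Y Y' where "smooth Y" "smooth Y'" "\<And>t. (Y has_real_derivative Y' t) (at t)"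
      "\<And>t. t \<in> {0..T} \<Longrightarrow> \<bar>Y t - X t\<bar> \<le> 1 / real (Suc n) ^ 2"
      "\<And>t. t \<in> {0..T} \<Longrightarrow> \<bar>Y' t - (A t + B t * X t)\<bar> \<le> 1 / real (Suc n) ^ 2"
      using C1_approx_smooth[OF X] by blast
    then show ?thesis by (intro exI[of _ Y] exI[of _ Y']) blast
  qed
  then obtain Y Y' where Y: "\<And>n. smooth (Y n)" "\<And>n. smooth (Y' n)" "\<And>n t. (Y n has_real_derivative Y' n t) (at t)"
    and YX: "\<And>n t. t \<in> {0..T} \<Longrightarrow> \<bar>Y n t - X t\<bar> \<le> 1 / real (Suc n) ^ 2"
    and Y'X: "\<And>n t. t \<in> {0..T} \<Longrightarrow> \<bar>Y' n t - (A t + B t * X t)\<bar> \<le> 1 / real (Suc n) ^ 2"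
    by metis
  have cf: "continuous_on U (\<lambda>z::real \<times> real. h (fst z))" "continuous_on U (\<lambda>z::real \<times> real. h (snd z))"
    if "continuous_on UNIV h" for h :: "real \<Rightarrow> real" and U
    by (rule continuous_on_compose2[OF that]; auto intro: continuous_intros)+
  have weak: "(LINT t|lborel. W (t, x t) * pd 1 \<theta> t) = - (LINT t|lborel. G (t, x t) * \<theta> t)"
    if test: "test_fun {0<..<T} \<theta>" for \<theta>
  proof -
    from test_funD[OF test] obtain S where \<theta>: "smooth \<theta>" "compact S" "S \<subseteq> {0<..<T}"
      "\<And>z. z \<notin> S \<Longrightarrow> \<theta> z = 0" "\<And>z b. z \<notin> S \<Longrightarrow> pd b \<theta> z = 0" by metis
    have \<theta>c: "continuous_on UNIV \<theta>" "continuous_on UNIV (pd 1 \<theta>)"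
      by (intro smooth_continuous \<theta> smooth_pd; simp)+
    define e where "e = (\<lambda>n t. real (Suc n) * (a t + b t * Y n t - Y' n t))"
    \<comment> \<open>With the path error separated in \<open>e\<close>, the velocity contributes
      only \<open>b (\<eta> + z \<eta>')\<close> in the moving coordinate, and this has mean zero in
      \<open>z\<close>.\<close>
    define F1 where "F1 = (\<lambda>p. pd 1 \<theta> (fst p) * \<eta> (snd p) + b (fst p) * (\<theta> (fst p) * (\<eta> (snd p) + snd p * pd 1 \<eta> (snd p))))"
    define F2 where "F2 = (\<lambda>p. \<theta> (fst p) * pd 1 \<eta> (snd p))"
    define F3 where "F3 = (\<lambda>p. \<theta> (fst p) * \<eta> (snd p))"
    define pt where "pt = (\<lambda>n p. (fst p, Y n (fst p) + 1 / real (Suc n) * snd p))"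
    have KS: "compact (S \<times> {-1..1::real})" by (intro compact_Times \<theta>) auto
    have F0: "F1 p = 0" "F2 p = 0" "F3 p = 0" if "p \<notin> S \<times> {-1..1}" for p
    proof -
      have "fst p \<notin> S \<or> \<bar>snd p\<bar> > 1" using that by (cases p) auto
      then show "F1 p = 0" "F2 p = 0" "F3 p = 0"
        using \<eta>(4)[of "snd p"] by (auto simp: F1_def F2_def F3_def \<theta> \<eta>')
    qed
    have Fc: "continuous_on UNIV F1" "continuous_on UNIV F2" "continuous_on UNIV F3"
      unfolding F1_def F2_def F3_def by (intro continuous_intros cf \<theta>c \<eta>c ab)+
    have Fi: "integrable lborel F1" "integrable lborel F2" "integrable lborel F3"
      by (rule integrable_continuous_compact[OF _ KS], (intro Fc F0; assumption)+)+
    have ptc: "continuous_on UNIV (pt n)" for n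
      unfolding pt_def by (intro continuous_intros cf smooth_continuous Y)
    have ec: "continuous_on UNIV (\<lambda>p::real \<times> real. e n (fst p))" for n
      unfolding e_def by (intro continuous_intros cf smooth_continuous Y ab)
    have [measurable]: "(\<lambda>p. W (pt n p)) \<in> borel_measurable borel" "(\<lambda>p. G (pt n p)) \<in> borel_measurable borel"
        "(\<lambda>p::real \<times> real. e n (fst p)) \<in> borel_measurable borel" for n
      by (intro borel_measurable_continuous_onI continuous_on_compose2[OF Wc ptc] continuous_on_compose2[OF Gc ptc] ec; simp)+
    have xpc: "continuous_on UNIV (\<lambda>p::real \<times> real. (fst p, x (fst p)))" by (intro continuous_intros cf xc)
    have Wx: "continuous_on UNIV (\<lambda>p::real \<times> real. W (fst p, x (fst p)))"
      and Gx: "continuous_on UNIV (\<lambda>p::real \<times> real. G (fst p, x (fst p)))"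
      by (rule continuous_on_compose2[OF Wc xpc] continuous_on_compose2[OF Gc xpc]; simp)+
    have [measurable]: "F1 \<in> borel_measurable borel" "F2 \<in> borel_measurable borel" "F3 \<in> borel_measurable borel"
      "(\<lambda>p::real \<times> real. W (fst p, x (fst p))) \<in> borel_measurable borel" "(\<lambda>p::real \<times> real. G (fst p, x (fst p))) \<in> borel_measurable borel"
      by (intro borel_measurable_continuous_onI Fc Wx Gx)+
    \<comment> \<open>The half-width of the bump and the error of the path are each at most
      \<open>1 / (n + 1)\<close>, so the bump stays in the tube of radius \<open>r\<close> around
      \<open>X\<close>.\<close>
    have identity: "(LINT p|lborel. W (pt n p) * (F1 p + e n (fst p) * F2 p)) = - (LINT p|lborel. G (pt n p) * F3 p)"
      if n: "2 / real (Suc n) < r" for n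
    proof -
      have "1 / (real (Suc n))\<^sup>2 \<le> 1 / real (Suc n)"
        by (intro divide_left_mono) (auto simp: power2_eq_square)
      then have YX': "\<bar>y - X t\<bar> < r" if "t \<in> {0..T}" "\<bar>y - Y n t\<bar> \<le> 1 / real (Suc n)" for t y
        using YX[OF that(1), of n] that(2) n by linarith
      have c: "real (Suc n) > 0" by simp
      have "(LINT p|lborel. W (fst p, Y n (fst p) + 1 / real (Suc n) * snd p) *
        (pd 1 \<theta> (fst p) * \<eta> (snd p) + b (fst p) * (\<theta> (fst p) * \<eta> (snd p)) +
         (a (fst p) + b (fst p) * (Y n (fst p) + 1 / real (Suc n) * snd p) - Y' n (fst p)) * (\<theta> (fst p) * (real (Suc n) * pd 1 \<eta> (snd p))))) =
      - (LINT p|lborel. G (fst p, Y n (fst p) + 1 / real (Suc n) * snd p) * (\<theta> (fst p) * \<eta> (snd p)))"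
      proof (rule weak_transport_along_smooth_path[OF wd Wc _ Gc ab Y \<theta> \<eta>(2,4) c])
        show "W z = w z" if "z \<in> cyl T" for z
          using that cl_id cx_id by (cases z) (auto simp: W_def cyl_def Omega_def)
        show "y \<in> Omega" if "t \<in> S" "\<bar>y - Y n t\<bar> \<le> 1 / real (Suc n)" for t y
        proof -
          have "t \<in> {0..T}" using that \<theta>(3) by auto
          with YX'[OF this that(2)] tube[OF this] show ?thesis by (auto simp: Omega_def)
        qed
        show "AE z\<in>cyl T in lborel. \<bar>snd z - Y n (fst z)\<bar> \<le> 1 / real (Suc n) \<longrightarrow>
           g1 z + (a (fst z) + b (fst z) * snd z) * g2 z = G z"
          using eq
        proof eventually_elim
          case (elim z)
          then show ?case
            using YX'[of "fst z" "snd z"] cl_id cx_id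
            by (cases z) (auto simp: a_def b_def G_def cyl_def Omega_def)
        qed
      qed
      moreover have "pd 1 \<theta> (fst p) * \<eta> (snd p) + b (fst p) * (\<theta> (fst p) * \<eta> (snd p)) +
         (a (fst p) + b (fst p) * (Y n (fst p) + 1 / real (Suc n) * snd p) - Y' n (fst p)) * (\<theta> (fst p) * (real (Suc n) * pd 1 \<eta> (snd p)))
         = F1 p + e n (fst p) * F2 p" for p
        unfolding F1_def e_def F2_def by (simp add: field_simps del: of_nat_Suc)
      ultimately show ?thesis by (simp add: pt_def F3_def del: of_nat_Suc)
    qed
    have e_bound: "\<bar>e n t\<bar> \<le> (CB + 1) * (1 / real (Suc n))" if "t \<in> {0..T}" for n t
    proof -
      have "e n t = real (Suc n) * (B t * (Y n t - X t) - (Y' n t - (A t + B t * X t)))"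
        using that by (simp add: e_def a_def b_def cl_id algebra_simps)
      also have "\<bar>\<dots>\<bar> \<le> real (Suc n) * ((CB + 1) * (1 / (real (Suc n))\<^sup>2))"
      proof -
        have "\<bar>B t * (Y n t - X t)\<bar> \<le> CB * (1 / (real (Suc n))\<^sup>2)"
          unfolding abs_mult using CB YX that by (intro mult_mono) auto
        with Y'X[OF that, of n] have "\<bar>B t * (Y n t - X t) - (Y' n t - (A t + B t * X t))\<bar> \<le> (CB + 1) * (1 / (real (Suc n))\<^sup>2)"
          unfolding distrib_right mult_1 by linarith
        then show ?thesis unfolding abs_mult by (intro mult_mono) auto
      qed
      finally show ?thesis by (simp add: power2_eq_square del: of_nat_Suc)
    qed
    have inv0: "(\<lambda>n. 1 / real (Suc n)) \<longlonglongrightarrow> 0"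
      by (intro LIMSEQ_Suc[of "\<lambda>n. 1 / real n"] lim_1_over_n)
    have pt_lim: "(\<lambda>n. pt n p) \<longlonglongrightarrow> (fst p, x (fst p))" if "fst p \<in> {0..T}" for p
    proof -
      have "(\<lambda>n. (1 / real (Suc n)) * (1 / real (Suc n))) \<longlonglongrightarrow> 0 * 0" by (intro tendsto_mult inv0)
      then have "(\<lambda>n. 1 / (real (Suc n))\<^sup>2) \<longlonglongrightarrow> 0" by (simp add: power2_eq_square)
      then have "(\<lambda>n. Y n (fst p) - X (fst p)) \<longlonglongrightarrow> 0"
        by (rule Lim_null_comparison[rotated]) (use YX[OF that] in auto)
      then have "(\<lambda>n. Y n (fst p)) \<longlonglongrightarrow> X (fst p)" by (simp add: LIM_zero_iff)
      then have "(\<lambda>n. Y n (fst p) + 1 / real (Suc n) * snd p) \<longlonglongrightarrow> X (fst p) + 0 * snd p"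
        by (intro tendsto_intros inv0)
      then show ?thesis unfolding pt_def using that by (intro tendsto_intros) (simp add: x_def cl_id)
    qed
    have S_T: "fst p \<in> {0..T}" if "p \<in> S \<times> {-1..1}" for p :: "real \<times> real"
      using that \<theta>(3) by (cases p) auto
    have lim1: "(\<lambda>n. LINT p|lborel. W (pt n p) * (F1 p + e n (fst p) * F2 p)) \<longlonglongrightarrow> (LINT p|lborel. W (fst p, x (fst p)) * F1 p)"
    proof (rule integral_dominated_convergence[where w = "\<lambda>p. CW * (\<bar>F1 p\<bar> + (CB + 1) * \<bar>F2 p\<bar>)"])
      show "integrable lborel (\<lambda>p. CW * (\<bar>F1 p\<bar> + (CB + 1) * \<bar>F2 p\<bar>))" using Fi by simp
      show "AE p in lborel. (\<lambda>n. W (pt n p) * (F1 p + e n (fst p) * F2 p)) \<longlonglongrightarrow> W (fst p, x (fst p)) * F1 p"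
      proof (intro always_eventually allI)
        fix p
        show "(\<lambda>n. W (pt n p) * (F1 p + e n (fst p) * F2 p)) \<longlonglongrightarrow> W (fst p, x (fst p)) * F1 p"
        proof (cases "p \<in> S \<times> {-1..1}")
          case True
          have "(\<lambda>n. (CB + 1) * (1 / real (Suc n))) \<longlonglongrightarrow> (CB + 1) * 0" by (intro tendsto_mult_left inv0)
          then have "(\<lambda>n. (CB + 1) * (1 / real (Suc n))) \<longlonglongrightarrow> 0" by (simp only: mult_zero_right)
          then have "(\<lambda>n. e n (fst p)) \<longlonglongrightarrow> 0"
            by (rule Lim_null_comparison[rotated]) (use e_bound[OF S_T[OF True]] in auto)
          moreover have "(\<lambda>n. W (pt n p)) \<longlonglongrightarrow> W (fst p, x (fst p))"
            using Wc by (intro isCont_tendsto_compose[of _ W] pt_lim S_T True) (auto simp: continuous_on_eq_continuous_at)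
          ultimately have "(\<lambda>n. W (pt n p) * (F1 p + e n (fst p) * F2 p)) \<longlonglongrightarrow> W (fst p, x (fst p)) * (F1 p + 0 * F2 p)"
            by (intro tendsto_intros)
          then show ?thesis by simp
        qed (simp add: F0)
      qed
      show "AE p in lborel. norm (W (pt n p) * (F1 p + e n (fst p) * F2 p)) \<le> CW * (\<bar>F1 p\<bar> + (CB + 1) * \<bar>F2 p\<bar>)" for n
      proof (intro always_eventually allI)
        fix p
        show "norm (W (pt n p) * (F1 p + e n (fst p) * F2 p)) \<le> CW * (\<bar>F1 p\<bar> + (CB + 1) * \<bar>F2 p\<bar>)"
        proof (cases "p \<in> S \<times> {-1..1}")
          case True
          have "\<bar>e n (fst p)\<bar> \<le> (CB + 1) * (1 / real (Suc n))" by (rule e_bound[OF S_T[OF True]])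
          also have "\<dots> \<le> (CB + 1) * 1" using CB by (intro mult_left_mono) auto
          finally have "\<bar>F1 p + e n (fst p) * F2 p\<bar> \<le> \<bar>F1 p\<bar> + (CB + 1) * \<bar>F2 p\<bar>"
            by (intro order_trans[OF abs_triangle_ineq] add_mono) (auto simp: abs_mult intro: mult_right_mono)
          then show ?thesis using CW by (simp add: abs_mult mult_mono)
        qed (simp add: F0)
      qed
    qed measurable
    have lim2: "(\<lambda>n. LINT p|lborel. G (pt n p) * F3 p) \<longlonglongrightarrow> (LINT p|lborel. G (fst p, x (fst p)) * F3 p)"
    proof (rule integral_dominated_convergence[where w = "\<lambda>p. CG * \<bar>F3 p\<bar>"])
      show "integrable lborel (\<lambda>p. CG * \<bar>F3 p\<bar>)" using Fi by simp
      show "AE p in lborel. (\<lambda>n. G (pt n p) * F3 p) \<longlonglongrightarrow> G (fst p, x (fst p)) * F3 p"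
      proof (intro always_eventually allI)
        fix p
        show "(\<lambda>n. G (pt n p) * F3 p) \<longlonglongrightarrow> G (fst p, x (fst p)) * F3 p"
        proof (cases "p \<in> S \<times> {-1..1}")
          case True
          then show ?thesis
            using Gc by (intro tendsto_mult_right isCont_tendsto_compose[of _ G] pt_lim S_T) (auto simp: continuous_on_eq_continuous_at)
        qed (simp add: F0)
      qed
      show "AE p in lborel. norm (G (pt n p) * F3 p) \<le> CG * \<bar>F3 p\<bar>" for n
        by (intro always_eventually allI) (simp add: abs_mult mult_right_mono CG del: split_paired_All)
    qed measurable
    have "eventually (\<lambda>n. 2 * (1 / real (Suc n)) < r) sequentially"
      using tendsto_mult_left[OF inv0, of 2] r by (intro order_tendstoD(2)[of _ "2 * 0"]) auto
    then have "eventually (\<lambda>n. - (LINT p|lborel. W (pt n p) * (F1 p + e n (fst p) * F2 p)) = (LINT p|lborel. G (pt n p) * F3 p)) sequentially"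
      by eventually_elim (simp add: identity del: of_nat_Suc)
    from Lim_transform_eventually[OF tendsto_minus[OF lim1] this] lim2
    have "- (LINT p|lborel. W (fst p, x (fst p)) * F1 p) = (LINT p|lborel. G (fst p, x (fst p)) * F3 p)"
      by (rule LIMSEQ_unique)
    moreover have prod_int: "(LINT p|lborel. H p) = (LINT t|lborel. LINT z|lborel. H (t, z))"
      if "continuous_on UNIV H" "\<And>p. p \<notin> S \<times> {-1..1} \<Longrightarrow> H p = 0" for H :: "real \<times> real \<Rightarrow> real"
      using lborel_pair.integral_fst'[of H] integrable_continuous_compact[OF that(1) KS that(2)]
      by (simp add: lborel_prod)
    have "(LINT p|lborel. W (fst p, x (fst p)) * F1 p) = (LINT t|lborel. W (t, x t) * pd 1 \<theta> t)"
    proof -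
      have "(LINT z|lborel. F1 (t, z)) = pd 1 \<theta> t" for t
      proof -
        have "(LINT z|lborel. F1 (t, z)) = pd 1 \<theta> t * (LINT z|lborel. \<eta> z) +
          b t * (\<theta> t * ((LINT z|lborel. \<eta> z) + (LINT z|lborel. z * pd 1 \<eta> z)))"
          using \<eta>i z\<eta>'i by (simp add: F1_def)
        then show ?thesis by (simp add: \<eta>(5) z\<eta>')
      qed
      then show ?thesis
        by (subst prod_int) (auto intro!: continuous_intros Wx Fc simp: F0)
    qed
    moreover have "(LINT p|lborel. G (fst p, x (fst p)) * F3 p) = (LINT t|lborel. G (t, x t) * \<theta> t)"
    proof -
      have "(LINT z|lborel. F3 (t, z)) = \<theta> t" for t
        using \<eta>i by (simp add: F3_def \<eta>(5))
      then show ?thesis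
        by (subst prod_int) (auto intro!: continuous_intros Gx Fc simp: F0)
    qed
    ultimately show ?thesis by simp
  qed
  have tx: "continuous_on UNIV (\<lambda>t. (t, x t))" by (intro continuous_intros xc)
  have "((\<lambda>s. W (s, x s)) has_real_derivative G (t, x t)) (at t within {0..T})"
    by (rule dubois_reymond[OF T _ _ weak t])
       (auto intro!: continuous_on_compose2[OF Wc tx] continuous_on_compose2[OF Gc tx])
  moreover have "G (t, x t) = \<Gamma> (t, X t)" "W (s, x s) = w (s, X s)" if "s \<in> {0..T}" for s
    using that t tube[OF t] tube[OF that] r by (auto simp: G_def W_def x_def cl_id cx_id)
  ultimately show ?thesis
    using has_field_derivative_transform_within[of "\<lambda>s. W (s, x s)" "\<Gamma> (t, X t)" t "{0..T}" 1 "\<lambda>s. w (s, X s)"] t by auto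
qed

section \<open>Empirical measures of separated bubbles\<close>

lemma open_indicator_limit:
  fixes U :: "'a::metric_space set"
  assumes "open U"
  obtains \<beta> :: "nat \<Rightarrow> 'a \<Rightarrow> real" where "\<And>j. continuous_on UNIV (\<beta> j)" "\<And>j x. 0 \<le> \<beta> j x"
    "\<And>j x. \<beta> j x \<le> indicator U x" "\<And>x. (\<lambda>j. \<beta> j x) \<longlonglongrightarrow> indicator U x"
proof (cases "U = UNIV")
  case True
  show thesis by (rule that[of "\<lambda>_ _. 1"]) (auto simp: True)
next
  case False
  then have ne: "- U \<noteq> {}" by blast
  have cl: "closed (- U)" using assms by (simp add: closed_Compl)
  show thesis
  proof (rule that[of "\<lambda>j x. min 1 (real j * infdist x (- U))"])
    show "continuous_on UNIV (\<lambda>x. min 1 (real j * infdist x (- U)))" for j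
      by (intro continuous_intros)
    show "min 1 (real j * infdist x (- U)) \<le> indicator U x" for j x
      by (auto simp: indicator_def)
    show "(\<lambda>j. min 1 (real j * infdist x (- U))) \<longlonglongrightarrow> indicator U x" for x
    proof (cases "x \<in> U")
      case True
      then have pos: "infdist x (- U) > 0" by (intro infdist_pos_not_in_closed cl ne) auto
      obtain k where k: "real k \<ge> 1 / infdist x (- U)" using real_arch_simple by blast
      have "min 1 (real j * infdist x (- U)) = 1" if "j \<ge> k" for j
      proof -
        have "real j \<ge> 1 / infdist x (- U)" using that k by linarith
        then show ?thesis using pos by (simp add: field_simps)
      qed
      then show ?thesis using True by (intro tendsto_eventually eventually_sequentiallyI[of k]) auto
    qed simp
  qed (simp add: infdist_nonneg)
qed

lemma uniformly_continuous_compact_support: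
  fixes f :: "'a::euclidean_space \<Rightarrow> real"
  assumes f: "continuous_on UNIV f" and S: "compact S" "\<And>x. x \<notin> S \<Longrightarrow> f x = 0"
  shows "uniformly_continuous_on UNIV f"
  unfolding uniformly_continuous_on_def
proof (intro allI impI)
  fix e :: real assume e: "e > 0"
  obtain r where r: "\<And>x. x \<in> S \<Longrightarrow> norm x \<le> r"
    using compact_imp_bounded[OF S(1)] by (auto simp: bounded_iff)
  have "uniformly_continuous_on (cball 0 (r + 1)) f"
    by (intro compact_uniformly_continuous continuous_on_subset[OF f]) auto
  then obtain \<delta> where \<delta>: "\<delta> > 0"
    "\<And>x y. norm x \<le> r + 1 \<Longrightarrow> norm y \<le> r + 1 \<Longrightarrow> dist y x < \<delta> \<Longrightarrow> dist (f y) (f x) < e"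
    unfolding uniformly_continuous_on_def using e by (auto simp: dist_norm)
  have "dist (f y) (f x) < e" if xy: "dist y x < min \<delta> 1" for x y
  proof (cases "norm x \<le> r + 1 \<and> norm y \<le> r + 1")
    case False
    have "\<bar>norm x - norm y\<bar> < 1" using xy norm_triangle_ineq3[of y x] by (simp add: dist_norm abs_minus_commute)
    with False have "x \<notin> S" "y \<notin> S" using r by force+
    then show ?thesis using e by (simp add: S)
  qed (use \<delta> xy in auto)
  then show "\<exists>\<delta>>0. \<forall>x\<in>UNIV. \<forall>y\<in>UNIV. dist y x < \<delta> \<longrightarrow> dist (f y) (f x) < e"
    using \<delta>(1) by (intro exI[of _ "min \<delta> 1"]) auto
qed

text \<open>The dependence of the integrand on \<open>x\<close> is moved into the kernel: the image
  of \<open>K x\<close> under \<open>y \<mapsto> (x, y)\<close> is a measurable kernel on the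
  product, and \<open>f\<close> becomes a fixed integrand.\<close>

lemma borel_measurable_kernel_integral:
  fixes f :: "'a \<times> 'b \<Rightarrow> real"
  assumes f[measurable]: "f \<in> borel_measurable (M \<Otimes>\<^sub>M L)"
    and K[measurable]: "K \<in> measurable M (subprob_algebra L)"
  shows "(\<lambda>x. LINT y|K x. f (x, y)) \<in> borel_measurable M"
proof -
  note integral_measurable_subprob_algebra[measurable]
  note measurable_distr2[measurable]
  have "(\<lambda>x. integral\<^sup>L (distr (K x) (M \<Otimes>\<^sub>M L) (\<lambda>y. (x, y))) f) \<in> borel_measurable M"
    by measurable
  then show ?thesis
    by (rule measurable_cong[THEN iffD1, rotated]) (simp add: integral_distr)
qed

text \<open>Only the geometry of the bubbles and the convergence of their empirical measures enter
  here, not the equations of motion. \<open>n\<close> numbers the members of the sequence and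
  \<open>N n\<close> is the number of bubbles. Time ranges over the whole line, so that continuity
  and measurability carry no restriction to an interval.\<close>

locale separated_bubbles =
  fixes d T :: real and N :: "nat \<Rightarrow> nat" and c R :: "nat \<Rightarrow> nat \<Rightarrow> real \<Rightarrow> real"
    and S :: "real \<Rightarrow> (real \<times> real) measure"
  assumes d: "d > 0" and T: "T > 0"
    and N: "\<And>n. N n \<ge> 1" "filterlim N at_top sequentially"
    and c_cont: "\<And>n k. k \<in> {1..N n} \<Longrightarrow> continuous_on UNIV (c n k)"
    and R_cont: "\<And>n k. k \<in> {1..N n} \<Longrightarrow> continuous_on UNIV (R n k)"
    and radius: "\<And>n k t. k \<in> {1..N n} \<Longrightarrow> d \<le> real (N n) * R n k t \<and> real (N n) * R n k t \<le> 1 / d"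
    and inside: "\<And>n k t. k \<in> {1..N n} \<Longrightarrow> -1 < c n k t - R n k t \<and> c n k t + R n k t < 1"
    and ordered: "\<And>n k l t. k \<in> {1..N n} \<Longrightarrow> l \<in> {1..N n} \<Longrightarrow> k < l \<Longrightarrow> c n k t + R n k t \<le> c n l t - R n l t"
    and S: "\<And>t. prob_on (phase d) (S t)"
    and S_lim: "\<And>(\<beta> :: real \<times> real \<Rightarrow> real) t. continuous_on UNIV \<beta> \<Longrightarrow>
      (\<lambda>n. (\<Sum>k\<in>{1..N n}. \<beta> (c n k t, real (N n) * R n k t)) / real (N n)) \<longlonglongrightarrow> (LINT y|S t. \<beta> y)"
    and S_cont: "\<And>\<beta> :: real \<times> real \<Rightarrow> real. continuous_on UNIV \<beta> \<Longrightarrow> continuous_on UNIV (\<lambda>t. LINT y|S t. \<beta> y)"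
begin

definition emp :: "nat \<Rightarrow> real \<Rightarrow> (real \<times> real \<Rightarrow> real) \<Rightarrow> real" where
  "emp n t \<beta> = (\<Sum>k\<in>{1..N n}. \<beta> (c n k t, real (N n) * R n k t)) / real (N n)"

definition bub :: "nat \<Rightarrow> nat \<Rightarrow> real \<Rightarrow> real set" where
  "bub n k t = {c n k t - R n k t<..<c n k t + R n k t}"

text \<open>The mass \<open>1/N\<close> of a bubble divided by its least length
  \<open>2 d / N\<close>.\<close>

definition Cd :: real where "Cd = 1 / (2 * d)"

lemma Cd_pos: "Cd > 0" using d by (simp add: Cd_def)

lemma Npos: "real (N n) > 0" using N(1)[of n] by simp

lemma S_sets[simp]: "sets (S t) = sets borel" and S_prob: "prob_space (S t)"
  and S_phase: "AE y in S t. y \<in> phase d"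
proof -
  show s: "sets (S t) = sets borel" and p: "prob_space (S t)" using S by (auto simp: prob_on_def)
  interpret prob_space "S t" by (rule p)
  have "phase d \<in> sets (S t)" by (simp add: s phase_def borel_closed closed_Times)
  then show "AE y in S t. y \<in> phase d" using S[of t] prob_eq_1[of "phase d"] by (simp add: prob_on_def)
qed

lemma S_space[simp]: "space (S t) = UNIV"
  using sets_eq_imp_space_eq[OF S_sets] by simp

lemma S_measurable[simp]: "borel_measurable (S t) = borel_measurable borel"
  by (intro measurable_cong_sets) auto

lemma R_pos: "k \<in> {1..N n} \<Longrightarrow> R n k t > 0"
  using radius[of k n t] d Npos[of n] by (smt (verit) mult_nonneg_nonpos)

lemma R_small: "k \<in> {1..N n} \<Longrightarrow> R n k t \<le> 1 / (d * real (N n))"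
  using radius[of k n t] d Npos[of n] by (simp add: field_simps)

lemma weight: "k \<in> {1..N n} \<Longrightarrow> 0 \<le> 1 / (2 * real (N n) * R n k t)"
  "k \<in> {1..N n} \<Longrightarrow> 1 / (2 * real (N n) * R n k t) \<le> Cd"
  using radius[of k n t] R_pos[of k n t] Npos[of n] d
  by (auto simp: Cd_def intro!: divide_left_mono)

lemma bub_disjoint:
  assumes "k \<in> {1..N n}" "l \<in> {1..N n}" "k \<noteq> l"
  shows "bub n k t \<inter> bub n l t = {}"
  using ordered[of k n l t] ordered[of l n k t] assms by (cases "k < l") (auto simp: bub_def)

lemma bub_subset: "k \<in> {1..N n} \<Longrightarrow> bub n k t \<subseteq> {-1..1}"
  using inside[of k n t] by (auto simp: bub_def)

lemma sum_indicator_le_1: "(\<Sum>k\<in>{1..N n}. indicator (bub n k t) x) \<le> (indicator {-1..1} x :: real)"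
proof (cases "\<exists>k\<in>{1..N n}. x \<in> bub n k t")
  case True
  then obtain k where k: "k \<in> {1..N n}" "x \<in> bub n k t" by blast
  have "(\<Sum>l\<in>{1..N n}. indicator (bub n l t) x) = (\<Sum>l\<in>{1..N n}. if l = k then 1 else (0::real))"
    using bub_disjoint[OF _ k(1), of _ t] k(2) by (intro sum.cong refl) (auto simp: indicator_def)
  then show ?thesis using k bub_subset[OF k(1), of t] by (simp add: indicator_def subset_iff)
next
  case False
  then show ?thesis by (simp add: indicator_def)
qed

lemma bub_average_error:
  assumes b: "continuous_on UNIV (b :: real \<Rightarrow> real)" and k: "k \<in> {1..N n}"
    and osc: "\<And>x y. \<bar>x - y\<bar> \<le> 1 / (d * real (N n)) \<Longrightarrow> \<bar>b x - b y\<bar> \<le> w"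
  shows "\<bar>2 * R n k t * b (c n k t) - (LINT x:bub n k t|lborel. b x)\<bar> \<le> 2 * R n k t * w"
proof -
  have i: "set_integrable lborel (bub n k t) b"
  proof (rule set_integrable_subset)
    show "set_integrable lborel {c n k t - R n k t..c n k t + R n k t} b"
      by (rule borel_integrable_atLeastAtMost'[OF continuous_on_subset[OF b subset_UNIV]])
  qed (auto simp: bub_def)
  have mb: "measure lborel (bub n k t) = 2 * R n k t" using R_pos[OF k, of t] by (simp add: bub_def)
  have ic: "set_integrable lborel (bub n k t) (\<lambda>_. a)" for a :: real
    using R_pos[OF k, of t] by (simp add: set_integrable_def bub_def)
  have const: "(LINT x:bub n k t|lborel. a) = 2 * R n k t * a" for a
    by (simp add: set_lebesgue_integral_def mb)
  have "\<bar>LINT x:bub n k t|lborel. b (c n k t) - b x\<bar> \<le> (LINT x:bub n k t|lborel. w)"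
    unfolding set_lebesgue_integral_def
  proof (rule order_trans[OF integral_abs_bound integral_mono])
    show "integrable lborel (\<lambda>x. \<bar>indicator (bub n k t) x *\<^sub>R (b (c n k t) - b x)\<bar>)"
      using set_integral_diff(1)[OF ic i] by (simp add: set_integrable_def)
    show "integrable lborel (\<lambda>x. indicator (bub n k t) x *\<^sub>R w)"
      using ic by (simp add: set_integrable_def)
    show "\<bar>indicator (bub n k t) x *\<^sub>R (b (c n k t) - b x)\<bar> \<le> indicator (bub n k t) x *\<^sub>R w" for x
    proof (cases "x \<in> bub n k t")
      case True
      then have "\<bar>c n k t - x\<bar> \<le> R n k t" by (auto simp: bub_def)
      with R_small[OF k, of t] have "\<bar>c n k t - x\<bar> \<le> 1 / (d * real (N n))" by linarith
      from osc[OF this] True show ?thesis by simp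
    qed simp
  qed
  then show ?thesis by (simp add: set_integral_diff(2)[OF ic i] const)
qed

section \<open>Density bound for the position marginal of the limit measure\<close>

lemma inv_N_tendsto: "(\<lambda>n. 1 / (d * real (N n))) \<longlonglongrightarrow> 0"
proof -
  have "filterlim (\<lambda>n. d * real (N n)) at_top sequentially"
    by (intro filterlim_tendsto_pos_mult_at_top[OF tendsto_const d] filterlim_compose[OF filterlim_real_sequentially N(2)])
  then show ?thesis by (rule tendsto_divide_0[OF tendsto_const filterlim_at_top_imp_at_infinity])
qed

text \<open>For large \<open>n\<close> the value of \<open>b\<close> at a centre differs by at most
  \<open>w\<close> from its mean over the bubble. The means carry weights at most \<open>Cd\<close>
  and the bubbles are disjoint, so the empirical average is at most \<open>Cd\<close> times one
  integral, up to \<open>w\<close>.\<close>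

lemma S_integral_le_continuous:
  fixes b :: "real \<Rightarrow> real"
  assumes b: "continuous_on UNIV b" and nn: "\<And>x. 0 \<le> b x" and unif: "uniformly_continuous_on UNIV b"
  shows "(LINT y|S t. b (fst y)) \<le> Cd * (LINT x:{-1..1}|lborel. b x)"
proof (rule field_le_epsilon)
  fix w :: real assume w: "w > 0"
  obtain \<delta> where \<delta>: "\<delta> > 0" "\<And>x y. \<bar>x - y\<bar> < \<delta> \<Longrightarrow> \<bar>b x - b y\<bar> < w"
    using unif w unfolding uniformly_continuous_on_def by (auto simp: dist_real_def)
  have ib: "set_integrable lborel {-1..1} b"
    by (rule borel_integrable_atLeastAtMost'[OF continuous_on_subset[OF b]]) auto
  have ev: "eventually (\<lambda>n. 1 / (d * real (N n)) < \<delta>) sequentially"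
    using inv_N_tendsto \<delta>(1) by (rule order_tendstoD)
  have "eventually (\<lambda>n. emp n t (\<lambda>y. b (fst y)) \<le> Cd * (LINT x:{-1..1}|lborel. b x) + w) sequentially"
    using ev
  proof eventually_elim
    case (elim n)
    have osc: "\<bar>b x - b y\<bar> \<le> w" if "\<bar>x - y\<bar> \<le> 1 / (d * real (N n))" for x y
      using \<delta>(2)[of x y] that elim by simp
    have ik: "set_integrable lborel (bub n k t) b" if "k \<in> {1..N n}" for k
      by (rule set_integrable_subset[OF ib]) (use bub_subset[OF that] in \<open>auto simp: bub_def\<close>)
    have "b (c n k t) / real (N n) \<le> Cd * (LINT x:bub n k t|lborel. b x) + w / real (N n)" if k: "k \<in> {1..N n}" for k
    proof -
      have Ik: "0 \<le> (LINT x:bub n k t|lborel. b x)" using nn by (simp add: set_lebesgue_integral_def)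
      have "2 * R n k t * b (c n k t) \<le> (LINT x:bub n k t|lborel. b x) + 2 * R n k t * w"
        using bub_average_error[OF b k osc, of t] by linarith
      then have "b (c n k t) / real (N n) \<le> 1 / (2 * real (N n) * R n k t) * (LINT x:bub n k t|lborel. b x) + w / real (N n)"
        using R_pos[OF k, of t] Npos[of n] by (simp add: field_simps)
      also have "\<dots> \<le> Cd * (LINT x:bub n k t|lborel. b x) + w / real (N n)"
        by (intro add_mono mult_right_mono weight k Ik) simp
      finally show ?thesis .
    qed
    then have "emp n t (\<lambda>y. b (fst y)) \<le> (\<Sum>k\<in>{1..N n}. Cd * (LINT x:bub n k t|lborel. b x) + w / real (N n))"
      unfolding emp_def sum_divide_distrib by (intro sum_mono) simp
    also have "\<dots> = Cd * (\<Sum>k\<in>{1..N n}. LINT x:bub n k t|lborel. b x) + w"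
      using Npos[of n] by (simp add: sum.distrib sum_distrib_left)
    also have "(\<Sum>k\<in>{1..N n}. LINT x:bub n k t|lborel. b x) = (LINT x|lborel. (\<Sum>k\<in>{1..N n}. indicator (bub n k t) x) * b x)"
      using ik unfolding set_lebesgue_integral_def set_integrable_def sum_distrib_right
      by (subst Bochner_Integration.integral_sum) auto
    also have "\<dots> \<le> (LINT x|lborel. indicator {-1..1} x * b x)"
    proof (rule integral_mono)
      show "integrable lborel (\<lambda>x. (\<Sum>k\<in>{1..N n}. indicator (bub n k t) x) * b x)"
        using ik unfolding set_integrable_def sum_distrib_right by (intro Bochner_Integration.integrable_sum) auto
      show "integrable lborel (\<lambda>x. indicator {-1..1} x * b x)" using ib by (simp add: set_integrable_def)
    qed (intro mult_right_mono sum_indicator_le_1 nn)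
    finally show ?case using Cd_pos by (simp add: set_lebesgue_integral_def)
  qed
  moreover have "(\<lambda>n. emp n t (\<lambda>y. b (fst y))) \<longlonglongrightarrow> (LINT y|S t. b (fst y))"
    unfolding emp_def by (rule S_lim) (rule continuous_on_compose2[OF b], auto intro: continuous_intros)
  ultimately show "(LINT y|S t. b (fst y)) \<le> Cd * (LINT x:{-1..1}|lborel. b x) + w"
    by (intro tendsto_upperbound) auto
qed

text \<open>The bound passes from continuous functions to open sets by approximation of the
  indicator from below, and from open sets to Borel sets by outer regularity of Lebesgue
  measure.\<close>

lemma S_emeasure_le:
  assumes A: "A \<in> sets borel"
  shows "emeasure (S t) (A \<times> UNIV) \<le> ennreal Cd * emeasure lborel A"
proof -
  interpret prob_space "S t" by (rule S_prob)
  have mT: "A \<times> (UNIV :: real set) \<in> sets borel" if "A \<in> sets borel" for A :: "real set"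
    unfolding borel_prod[symmetric] using that by (intro pair_measureI) auto
  have op: "emeasure (S t) (U \<times> UNIV) \<le> ennreal Cd * emeasure lborel U" if U: "open U" for U
  proof -
    \<comment> \<open>The cut-off makes the Lebesgue measure finite and the approximants compactly
      supported. It loses nothing for \<open>S t\<close>, which is carried by positions in
      \<open>{-1..1}\<close>.\<close>
    define V where "V = U \<inter> {-2<..<2}"
    have V: "open V" "V \<in> sets borel" "V \<subseteq> U" using U by (auto simp: V_def)
    have Vfin: "emeasure lborel V < \<infinity>"
    proof -
      have "emeasure lborel V \<le> emeasure lborel {-2<..<2::real}" by (rule emeasure_mono) (auto simp: V_def)
      then show ?thesis by (auto intro: order.strict_trans1)
    qed
    obtain \<beta> where \<beta>: "\<And>j. continuous_on UNIV (\<beta> j)" "\<And>j x. 0 \<le> \<beta> j x"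
      "\<And>j x. \<beta> j x \<le> indicator V x" "\<And>x. (\<lambda>j. \<beta> j x) \<longlonglongrightarrow> (indicator V x :: real)"
      using open_indicator_limit[OF V(1)] by blast
    have [measurable]: "\<beta> j \<in> borel_measurable borel" for j
      by (intro borel_measurable_continuous_onI \<beta>)
    have unif: "uniformly_continuous_on UNIV (\<beta> j)" for j
    proof (rule uniformly_continuous_compact_support[OF \<beta>(1) compact_Icc])
      show "\<beta> j x = 0" if "x \<notin> {-2..2}" for x
        using \<beta>(2,3)[of j x] that by (auto simp: V_def)
    qed
    have "(\<lambda>j. LINT y|S t. \<beta> j (fst y)) \<longlonglongrightarrow> (LINT y|S t. indicator (V \<times> UNIV) y)"
    proof (rule integral_dominated_convergence[where w = "\<lambda>_. 1"])
      show "AE y in S t. (\<lambda>j. \<beta> j (fst y)) \<longlonglongrightarrow> indicator (V \<times> UNIV) y"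
      proof (intro always_eventually allI)
        fix y show "(\<lambda>j. \<beta> j (fst y)) \<longlonglongrightarrow> indicator (V \<times> UNIV) y"
          using \<beta>(4)[of "fst y"] by (simp add: indicator_def mem_Times_iff)
      qed
      show "AE y in S t. norm (\<beta> j (fst y)) \<le> 1" for j
      proof (intro always_eventually allI)
        fix y show "norm (\<beta> j (fst y)) \<le> 1"
          using \<beta>(2,3)[of j "fst y"] by (cases "fst y \<in> V") auto
      qed
      show "(\<lambda>y. \<beta> j (fst y)) \<in> borel_measurable (S t)" for j
        by (simp, intro borel_measurable_continuous_onI continuous_on_compose2[OF \<beta>(1)])
           (auto intro: continuous_intros)
    qed (use mT[OF V(2)] in auto)
    moreover have "(LINT y|S t. indicator (V \<times> UNIV) y) = measure (S t) (V \<times> UNIV)"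
      by simp
    moreover have "(LINT y|S t. \<beta> j (fst y)) \<le> Cd * measure lborel V" for j
    proof -
      have "(LINT x:{-1..1}|lborel. \<beta> j x) \<le> (LINT x|lborel. indicator V x)"
        unfolding set_lebesgue_integral_def
      proof (rule integral_mono)
        show "integrable lborel (\<lambda>x. indicator {-1..1} x *\<^sub>R \<beta> j x)"
          using borel_integrable_atLeastAtMost'[OF continuous_on_subset[OF \<beta>(1)]] by (auto simp: set_integrable_def)
        show "integrable lborel (indicator V :: real \<Rightarrow> real)" using Vfin V by auto
        show "indicator {-1..1} x *\<^sub>R \<beta> j x \<le> indicator V x" for x
          using \<beta>(2,3)[of j x] by (auto simp: indicator_def split: if_splits)
      qed
      then have "Cd * (LINT x:{-1..1}|lborel. \<beta> j x) \<le> Cd * (LINT x|lborel. indicator V x)"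
        using Cd_pos by (intro mult_left_mono) auto
      with S_integral_le_continuous[OF \<beta>(1,2) unif, of t j] show ?thesis by simp
    qed
    ultimately have "measure (S t) (V \<times> UNIV) \<le> Cd * measure lborel V"
      by (intro LIMSEQ_le_const2) auto
    then have "ennreal (measure (S t) (V \<times> UNIV)) \<le> ennreal (Cd * measure lborel V)" by (rule ennreal_leI)
    then have "emeasure (S t) (V \<times> UNIV) \<le> ennreal Cd * emeasure lborel V"
      using Vfin Cd_pos by (simp add: emeasure_eq_measure emeasure_eq_ennreal_measure ennreal_mult less_top)
    also have "\<dots> \<le> ennreal Cd * emeasure lborel U"
      using V U by (intro mult_left_mono emeasure_mono) auto
    finally have "emeasure (S t) (V \<times> UNIV) \<le> ennreal Cd * emeasure lborel U" .
    moreover have "emeasure (S t) (V \<times> UNIV) = emeasure (S t) (U \<times> UNIV)"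
    proof (rule emeasure_eq_AE)
      show "AE y in S t. (y \<in> V \<times> UNIV) = (y \<in> U \<times> UNIV)"
        using S_phase[of t] by eventually_elim (auto simp: phase_def V_def)
    qed (use mT U V in auto)
    ultimately show ?thesis by simp
  qed
  show ?thesis
  proof (cases "emeasure lborel A = \<infinity>")
    case True
    then show ?thesis using Cd_pos by (simp add: ennreal_mult_top)
  next
    case False
    show ?thesis
    proof (rule ennreal_le_epsilon)
      fix e :: real assume e: "e > 0"
      then have e': "e / Cd > 0" using Cd_pos by simp
      obtain U where U: "open U" "A \<subseteq> U" "emeasure lborel (U - A) < ennreal (e / Cd)"
        using outer_regular_lborel[OF A e'] by blast
      have "emeasure (S t) (A \<times> UNIV) \<le> emeasure (S t) (U \<times> UNIV)"
        using U mT A by (intro emeasure_mono) auto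
      also have "\<dots> \<le> ennreal Cd * emeasure lborel U" by (rule op[OF U(1)])
      also have "emeasure lborel U = emeasure lborel A + emeasure lborel (U - A)"
        using U A by (subst plus_emeasure) (auto simp: Un_absorb1)
      also have "ennreal Cd * (emeasure lborel A + emeasure lborel (U - A)) \<le> ennreal Cd * (emeasure lborel A + ennreal (e / Cd))"
        using U(3) by (intro mult_left_mono add_mono) auto
      also have "\<dots> = ennreal Cd * emeasure lborel A + ennreal e"
        using Cd_pos e by (simp add: distrib_left flip: ennreal_mult)
      finally show "emeasure (S t) (A \<times> UNIV) \<le> ennreal Cd * emeasure lborel A + ennreal e" .
    qed
  qed
qed

lemma S_nn_integral_le:
  assumes f: "f \<in> borel_measurable borel"
  shows "(\<integral>\<^sup>+y. f (fst y) \<partial>S t) \<le> ennreal Cd * (\<integral>\<^sup>+x. f x \<partial>lborel)"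
proof -
  have fst_m: "fst \<in> measurable (S t) (borel :: real measure)"
    unfolding measurable_cong_sets[OF S_sets refl]
    by (rule borel_measurable_continuous_onI[OF linear_continuous_on[OF bounded_linear_fst]])
  note [measurable] = f
  have "(\<integral>\<^sup>+y. f (fst y) \<partial>S t) = (\<integral>\<^sup>+x. f x \<partial>distr (S t) borel fst)"
    by (rule nn_integral_distr[OF fst_m, symmetric]) (simp add: f)
  also have "\<dots> \<le> (\<integral>\<^sup>+x. f x \<partial>density lborel (\<lambda>_. ennreal Cd))"
  proof (rule nn_integral_mono_measure)
    have "emeasure (distr (S t) borel fst) A \<le> emeasure (density lborel (\<lambda>_. ennreal Cd)) A"
      if "A \<in> sets borel" for A
    proof -
      have "fst -` A \<inter> space (S t) = A \<times> UNIV" by auto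
      then show ?thesis
        using S_emeasure_le[OF that, of t] that by (simp add: emeasure_distr[OF fst_m] emeasure_density nn_integral_cmult_indicator)
    qed
    then show "distr (S t) borel fst \<le> density lborel (\<lambda>_. ennreal Cd)"
      by (auto simp: le_measure_iff le_fun_def) (metis emeasure_notin_sets sets_distr zero_le)
  qed simp
  also have "\<dots> = ennreal Cd * (\<integral>\<^sup>+x. f x \<partial>lborel)"
    by (subst nn_integral_density) (auto simp: nn_integral_cmult)
  finally show ?thesis .
qed

text \<open>Integrals of continuous functions are continuous in \<open>t\<close>; approximation from
  below makes the measure of an open set measurable in \<open>t\<close>, and boxes generate the
  Borel sets.\<close>

lemma S_kernel: "S \<in> measurable lborel (subprob_algebra borel)"
proof (rule measurable_subprob_algebra_generated[OF _ Int_stable_boxes])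
  show "sets borel = sigma_sets UNIV (range (\<lambda>(a, b). box a b :: (real \<times> real) set))"
    by (simp add: borel_eq_box)
  show "subprob_space (S t)" for t by (intro prob_space_imp_subprob_space S_prob)
  have op: "(\<lambda>t. emeasure (S t) U) \<in> borel_measurable lborel" if U: "open U" for U :: "(real \<times> real) set"
  proof -
    obtain \<beta> where \<beta>: "\<And>j. continuous_on UNIV (\<beta> j)" "\<And>j x. 0 \<le> \<beta> j x"
      "\<And>j x. \<beta> j x \<le> indicator U x" "\<And>x. (\<lambda>j. \<beta> j x) \<longlonglongrightarrow> (indicator U x :: real)"
      using open_indicator_limit[OF U] by blast
    have [measurable]: "\<beta> j \<in> borel_measurable borel" for j
      by (intro borel_measurable_continuous_onI \<beta>)
    have lim: "(\<lambda>j. LINT y|S t. \<beta> j y) \<longlonglongrightarrow> measure (S t) U" for t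
    proof -
      interpret prob_space "S t" by (rule S_prob)
      have "(\<lambda>j. LINT y|S t. \<beta> j y) \<longlonglongrightarrow> (LINT y|S t. indicator U y)"
      proof (rule integral_dominated_convergence[where w = "\<lambda>_. 1"])
        show "AE y in S t. norm (\<beta> j y) \<le> 1" for j
        proof (intro always_eventually allI)
          fix y show "norm (\<beta> j y) \<le> 1"
            using \<beta>(2,3)[of j y] by (cases "y \<in> U") auto
        qed
      qed (use \<beta>(4) U in auto)
      then show ?thesis by simp
    qed
    have "(\<lambda>t. measure (S t) U) \<in> borel_measurable lborel"
      by (rule borel_measurable_LIMSEQ_real[OF lim])
         (use borel_measurable_continuous_onI[OF S_cont[OF \<beta>(1)]] in simp)
    moreover have "emeasure (S t) U = ennreal (measure (S t) U)" for t
    proof -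
      interpret prob_space "S t" by (rule S_prob)
      show ?thesis by (rule emeasure_eq_measure)
    qed
    ultimately show ?thesis by simp
  qed
  show "(\<lambda>t. emeasure (S t) A) \<in> borel_measurable lborel"
    if "A \<in> range (\<lambda>(a, b). box a b :: (real \<times> real) set)" for A
    using that
  proof (rule rangeE)
    fix p assume "A = (case p of (a, b) \<Rightarrow> box a b)"
    then show ?thesis using op[OF open_box] by (cases p) (simp only: case_prod_conv)
  qed
  show "(\<lambda>t. emeasure (S t) UNIV) \<in> borel_measurable lborel" by (rule op) simp
qed auto

text \<open>The density bound, applied in each time slice and integrated by Tonelli, gives meaning
  to the product of \<open>S\<close> with a field known only up to null sets. The estimate makes the
  pairing continuous in the \<open>L1\<close> norm of the field.\<close>

lemma integrable_against_S:
  fixes f :: "real \<times> real \<Rightarrow> real" and \<psi> :: "real \<times> real \<times> real \<Rightarrow> real"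
  assumes f: "integrable lborel f" and \<psi>: "\<psi> \<in> borel_measurable borel" and \<Psi>: "\<And>z. \<bar>\<psi> z\<bar> \<le> \<Psi>"
  shows "AE t in lborel. integrable (S t) (\<lambda>y. f (t, fst y) * \<psi> (t, y))"
    and "integrable lborel (\<lambda>t. LINT y|S t. f (t, fst y) * \<psi> (t, y))"
    and "\<bar>LINT t|lborel. LINT y|S t. f (t, fst y) * \<psi> (t, y)\<bar> \<le> Cd * \<Psi> * (LINT z|lborel. \<bar>f z\<bar>)"
proof -
  have \<Psi>0: "\<Psi> \<ge> 0" using \<Psi>[of 0] by linarith
  have [measurable]: "f \<in> borel_measurable (lborel \<Otimes>\<^sub>M lborel)"
    using f by (simp add: lborel_prod)
  have [measurable]: "f \<in> borel_measurable (borel \<Otimes>\<^sub>M borel)"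
    using f by (simp add: borel_prod)
  have [measurable]: "f \<in> borel_measurable borel"
    using f by simp
  have [measurable]: "\<psi> \<in> borel_measurable (borel \<Otimes>\<^sub>M (borel \<Otimes>\<^sub>M borel))"
    using \<psi> by (simp add: borel_prod)
  define F where "F = (\<lambda>p. f (fst p, fst (snd p)) * \<psi> p)"
  have F: "F \<in> borel_measurable (borel \<Otimes>\<^sub>M borel)"
    unfolding F_def borel_prod[symmetric] by measurable
  then have F': "F \<in> borel_measurable (lborel \<Otimes>\<^sub>M borel)"
    by (simp cong: measurable_cong_sets sets_pair_measure_cong)
  have Ft: "(\<lambda>y. F (t, y)) \<in> borel_measurable (S t)" for t
    using measurable_Pair2[OF F, of t] by simp
  define h where "h = (\<lambda>t. \<integral>\<^sup>+y. ennreal \<bar>F (t, y)\<bar> \<partial>S t)"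
  have fm: "(\<lambda>x. ennreal \<bar>f (t, x)\<bar>) \<in> borel_measurable borel" for t by measurable
  have h_le: "h t \<le> ennreal (Cd * \<Psi>) * (\<integral>\<^sup>+x. ennreal \<bar>f (t, x)\<bar> \<partial>lborel)" for t
  proof -
    have "h t \<le> (\<integral>\<^sup>+y. ennreal \<Psi> * ennreal \<bar>f (t, fst y)\<bar> \<partial>S t)"
      unfolding h_def F_def using \<Psi>0
      by (intro nn_integral_mono)
         (auto simp: abs_mult mult.commute[of \<Psi>] simp flip: ennreal_mult intro!: ennreal_leI mult_left_mono \<Psi>)
    also have "\<dots> = ennreal \<Psi> * (\<integral>\<^sup>+y. ennreal \<bar>f (t, fst y)\<bar> \<partial>S t)"
      by (rule nn_integral_cmult) (use measurable_compose[OF _ fm[of t], of fst borel] in \<open>simp add: borel_prod[symmetric]\<close>)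
    also have "\<dots> \<le> ennreal \<Psi> * (ennreal Cd * (\<integral>\<^sup>+x. ennreal \<bar>f (t, x)\<bar> \<partial>lborel))"
      by (intro mult_left_mono S_nn_integral_le fm) auto
    finally show ?thesis using \<Psi>0 Cd_pos by (simp add: ennreal_mult mult_ac)
  qed
  have hm: "h \<in> borel_measurable lborel"
  proof -
    have "(\<lambda>(t, y). ennreal \<bar>F (t, y)\<bar>) \<in> borel_measurable (lborel \<Otimes>\<^sub>M borel)"
      using F' by (auto intro!: measurable_compose[OF _ measurable_ennreal] simp: case_prod_beta')
    from nn_integral_measurable_subprob_algebra2[OF this S_kernel] show ?thesis by (simp add: h_def)
  qed
  have "(\<integral>\<^sup>+t. h t \<partial>lborel) \<le> (\<integral>\<^sup>+t. ennreal (Cd * \<Psi>) * (\<integral>\<^sup>+x. ennreal \<bar>f (t, x)\<bar> \<partial>lborel) \<partial>lborel)"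
    by (intro nn_integral_mono h_le)
  also have "\<dots> = ennreal (Cd * \<Psi>) * (\<integral>\<^sup>+t. (\<integral>\<^sup>+x. ennreal \<bar>f (t, x)\<bar> \<partial>lborel) \<partial>lborel)"
    by (intro nn_integral_cmult) measurable
  also have "(\<integral>\<^sup>+t. (\<integral>\<^sup>+x. ennreal \<bar>f (t, x)\<bar> \<partial>lborel) \<partial>lborel) = (\<integral>\<^sup>+z. ennreal \<bar>f z\<bar> \<partial>lborel)"
    by (subst lborel.nn_integral_fst) (simp_all add: lborel_prod)
  also have "\<dots> = ennreal (LINT z|lborel. \<bar>f z\<bar>)"
    by (rule nn_integral_eq_integral) (use f in auto)
  also have "ennreal (Cd * \<Psi>) * \<dots> = ennreal (Cd * \<Psi> * (LINT z|lborel. \<bar>f z\<bar>))"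
    using Cd_pos \<Psi>0 by (simp add: ennreal_mult)
  finally have h_int: "(\<integral>\<^sup>+t. h t \<partial>lborel) \<le> ennreal (Cd * \<Psi> * (LINT z|lborel. \<bar>f z\<bar>))" .
  then have "(\<integral>\<^sup>+t. h t \<partial>lborel) \<noteq> \<infinity>" by (auto simp: top_unique)
  then have h_fin: "AE t in lborel. h t \<noteq> \<infinity>" by (intro nn_integral_PInf_AE hm)
  then show "AE t in lborel. integrable (S t) (\<lambda>y. f (t, fst y) * \<psi> (t, y))"
  proof eventually_elim
    case (elim t)
    then have "integrable (S t) (\<lambda>y. F (t, y))"
      by (intro integrableI_bounded Ft) (simp add: h_def less_top)
    then show ?case by (simp add: F_def)
  qed
  have le_h: "ennreal \<bar>LINT y|S t. F (t, y)\<bar> \<le> h t" for t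
    using integral_norm_bound_ennreal[of "S t" "\<lambda>y. F (t, y)"] Ft[of t]
    by (cases "integrable (S t) (\<lambda>y. F (t, y))") (auto simp: h_def not_integrable_integral_eq)
  have int: "integrable lborel (\<lambda>t. LINT y|S t. F (t, y))"
  proof (rule integrableI_bounded)
    show "(\<lambda>t. LINT y|S t. F (t, y)) \<in> borel_measurable lborel"
      by (rule borel_measurable_kernel_integral[OF F' S_kernel])
    have "(\<integral>\<^sup>+t. ennreal (norm (LINT y|S t. F (t, y))) \<partial>lborel) \<le> (\<integral>\<^sup>+t. h t \<partial>lborel)"
      using le_h by (intro nn_integral_mono) simp
    also have "\<dots> < \<infinity>" using h_int by (auto simp: order_le_less_trans)
    finally show "(\<integral>\<^sup>+t. ennreal (norm (LINT y|S t. F (t, y))) \<partial>lborel) < \<infinity>" .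
  qed
  then show "integrable lborel (\<lambda>t. LINT y|S t. f (t, fst y) * \<psi> (t, y))" by (simp add: F_def)
  have "ennreal \<bar>LINT t|lborel. LINT y|S t. F (t, y)\<bar> \<le> (\<integral>\<^sup>+t. ennreal \<bar>LINT y|S t. F (t, y)\<bar> \<partial>lborel)"
    using integral_norm_bound_ennreal[OF int] by simp
  also have "\<dots> \<le> (\<integral>\<^sup>+t. h t \<partial>lborel)" by (intro nn_integral_mono le_h)
  also note h_int
  finally show "\<bar>LINT t|lborel. LINT y|S t. f (t, fst y) * \<psi> (t, y)\<bar> \<le> Cd * \<Psi> * (LINT z|lborel. \<bar>f z\<bar>)"
    using Cd_pos \<Psi>0 by (subst (asm) ennreal_le_iff) (auto simp: F_def)
qed

section \<open>Pairings of a field with the empirical and the limit measures\<close>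

definition limit_pairing :: "(real \<times> real \<Rightarrow> real) \<Rightarrow> (real \<times> real \<times> real \<Rightarrow> real) \<Rightarrow> real" where
  "limit_pairing f \<psi> = (LINT t|lborel. LINT y|S t. f (t, fst y) * \<psi> (t, y))"

definition emp_pairing :: "nat \<Rightarrow> (real \<times> real \<Rightarrow> real) \<Rightarrow> (real \<times> real \<times> real \<Rightarrow> real) \<Rightarrow> real" where
  "emp_pairing n f \<psi> = (LINT t|lborel. emp n t (\<lambda>y. f (t, fst y) * \<psi> (t, y)))"

lemma emp_bound:
  assumes "\<And>y. \<bar>\<beta> y\<bar> \<le> B"
  shows "\<bar>emp n t \<beta>\<bar> \<le> B"
proof -
  have "\<bar>\<Sum>k\<in>{1..N n}. \<beta> (c n k t, real (N n) * R n k t)\<bar> \<le> (\<Sum>k\<in>{1..N n}. B)"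
    by (rule order_trans[OF sum_abs sum_mono]) (rule assms)
  then show ?thesis using Npos[of n] by (simp add: emp_def abs_divide pos_divide_le_eq mult.commute)
qed

lemma emp_measurable:
  fixes F :: "'e::euclidean_space \<times> real \<times> real \<Rightarrow> real"
  assumes [measurable]: "F \<in> borel_measurable borel" "h \<in> borel_measurable borel"
  shows "(\<lambda>z. emp n (h z) (\<lambda>y. F (z, y))) \<in> borel_measurable borel"
proof -
  have [measurable]: "c n k \<in> borel_measurable borel" "R n k \<in> borel_measurable borel" if "k \<in> {1..N n}" for k
    by (intro borel_measurable_continuous_onI c_cont R_cont that)+
  have [measurable]: "F \<in> borel_measurable (borel \<Otimes>\<^sub>M (borel \<Otimes>\<^sub>M borel))"
    using assms(1) by (simp add: borel_prod)
  show ?thesis unfolding emp_def by measurable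
qed

text \<open>For a continuous field the empirical averages converge at every time; the compact
  support in time provides the dominating function.\<close>

lemma emp_pairing_continuous:
  assumes b: "continuous_on UNIV b" "compact K" "\<And>z. z \<notin> K \<Longrightarrow> b z = 0"
    and \<psi>: "continuous_on UNIV \<psi>" and \<Psi>: "\<And>z. \<bar>\<psi> z\<bar> \<le> \<Psi>"
  shows "(\<lambda>n. emp_pairing n b \<psi>) \<longlonglongrightarrow> limit_pairing b \<psi>"
    and "integrable lborel (\<lambda>t. emp n t (\<lambda>y. b (t, fst y) * \<psi> (t, y)))"
proof -
  obtain B where B: "0 \<le> B" "\<And>z. z \<in> K \<Longrightarrow> \<bar>b z\<bar> \<le> B"
    using bounded_continuous_compact[OF continuous_on_subset[OF b(1) subset_UNIV] b(2)] by blast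
  have Bz: "\<bar>b z\<bar> \<le> B" for z using B b(3)[of z] by (cases "z \<in> K") auto
  obtain M where M: "\<And>z. z \<in> K \<Longrightarrow> \<bar>fst z\<bar> \<le> M"
  proof -
    have "compact (fst ` K)" by (intro compact_continuous_image continuous_intros b)
    then show thesis using that compact_imp_bounded by (fastforce simp: bounded_iff)
  qed
  have b0: "b (t, x) = 0" if "t \<notin> {-M..M}" for t x
    using b(3)[of "(t, x)"] M[of "(t, x)"] that by (cases "(t, x) \<in> K") (auto simp: abs_le_iff)
  define F where "F = (\<lambda>p. b (fst p, fst (snd p)) * \<psi> p)"
  have Fc: "continuous_on UNIV F"
    unfolding F_def
    by (intro continuous_intros \<psi> continuous_on_compose2[OF b(1)]) auto
  have Fm: "F \<in> borel_measurable borel" by (rule borel_measurable_continuous_onI[OF Fc])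
  have em: "(\<lambda>t. emp n t (\<lambda>y. F (t, y))) \<in> borel_measurable lborel" for n
    using emp_measurable[OF Fm, of "\<lambda>t. t" n] by simp
  have \<Psi>0: "\<Psi> \<ge> 0" using \<Psi>[of 0] by linarith
  have ebound: "\<bar>emp n t (\<lambda>y. F (t, y))\<bar> \<le> indicator {-M..M} t * (B * \<Psi>)" for n t
  proof (cases "t \<in> {-M..M}")
    case True
    have "\<bar>F (t, y)\<bar> \<le> B * \<Psi>" for y
      unfolding F_def abs_mult by (intro mult_mono Bz \<Psi> B) auto
    then show ?thesis using True emp_bound[of "\<lambda>y. F (t, y)" "B * \<Psi>"] by simp
  qed (simp add: F_def b0 emp_def)
  have wi: "integrable lborel (\<lambda>t. indicator {-M..M} t * (B * \<Psi>))"
    by (auto intro!: integrable_mult_left integrable_real_indicator simp: emeasure_lborel_Icc_eq)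
  show "integrable lborel (\<lambda>t. emp n t (\<lambda>y. b (t, fst y) * \<psi> (t, y)))"
    by (rule Bochner_Integration.integrable_bound[OF wi])
       (use em[of n] order_trans[OF ebound abs_ge_self] in \<open>auto simp: F_def\<close>)
  have "(\<lambda>n. LINT t|lborel. emp n t (\<lambda>y. F (t, y))) \<longlonglongrightarrow> (LINT t|lborel. LINT y|S t. F (t, y))"
  proof (rule integral_dominated_convergence[OF _ _ wi])
    show "(\<lambda>t. LINT y|S t. F (t, y)) \<in> borel_measurable lborel"
    proof (rule borel_measurable_kernel_integral[OF _ S_kernel])
      have "F \<in> borel_measurable (borel \<Otimes>\<^sub>M borel)" using Fm by (simp add: borel_prod)
      then show "F \<in> borel_measurable (lborel \<Otimes>\<^sub>M borel)"
        by (simp cong: measurable_cong_sets sets_pair_measure_cong)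
    qed
    show "AE t in lborel. (\<lambda>n. emp n t (\<lambda>y. F (t, y))) \<longlonglongrightarrow> (LINT y|S t. F (t, y))"
      unfolding emp_def
      by (intro always_eventually allI S_lim continuous_on_compose2[OF Fc]) (auto intro: continuous_intros)
  qed (use em ebound in auto)
  then show "(\<lambda>n. emp_pairing n b \<psi>) \<longlonglongrightarrow> limit_pairing b \<psi>"
    by (simp add: emp_pairing_def limit_pairing_def F_def)
qed

end

text \<open>The \<open>+ 1\<close> spares a case distinction when the constant \<open>a\<close> to
  be absorbed may vanish.\<close>

lemma scaled_epsilon:
  fixes a e k :: real
  assumes "0 \<le> a" "0 < e" "0 < k"
  shows "0 < e / (k * (a + 1))" "a * (e / (k * (a + 1))) \<le> e / k"
proof -
  show "0 < e / (k * (a + 1))" using assms by (intro divide_pos_pos mult_pos_pos) auto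
  have "a * (e / (k * (a + 1))) = (a / (a + 1)) * (e / k)" by simp
  also have "\<dots> \<le> 1 * (e / k)" using assms by (intro mult_right_mono) auto
  finally show "a * (e / (k * (a + 1))) \<le> e / k" by simp
qed

lemma AE_section_integrable:
  fixes f :: "real \<times> real \<Rightarrow> real"
  assumes "integrable lborel f"
  shows "AE t in lborel. integrable lborel (\<lambda>x. f (t, x))"
  using lborel_pair.AE_integrable_fst'[of f] assms by (simp add: lborel_prod)

lemma lborel_integral_fst:
  fixes f :: "real \<times> real \<Rightarrow> real"
  assumes "integrable lborel f"
  shows "integrable lborel (\<lambda>t. LINT x|lborel. f (t, x))" "(LINT t|lborel. LINT x|lborel. f (t, x)) = (LINT z|lborel. f z)"
  using lborel_pair.integral_fst'[of f] lborel_pair.integrable_fst'[of f] assms by (simp_all add: lborel_prod)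

lemma integrable_times_bounded:
  fixes f h :: "'z \<Rightarrow> real"
  assumes "integrable M f" "h \<in> borel_measurable M" "\<And>z. \<bar>h z\<bar> \<le> B"
  shows "integrable M (\<lambda>z. f z * h z)" "\<bar>LINT z|M. f z * h z\<bar> \<le> B * (LINT z|M. \<bar>f z\<bar>)"
proof -
  have le: "\<bar>f z * h z\<bar> \<le> B * \<bar>f z\<bar>" for z
    using mult_left_mono[OF assms(3)[of z], of "\<bar>f z\<bar>"] by (simp add: abs_mult mult.commute)
  have i: "integrable M (\<lambda>z. B * \<bar>f z\<bar>)" using assms(1) by simp
  show int: "integrable M (\<lambda>z. f z * h z)"
    by (rule Bochner_Integration.integrable_bound[OF i])
       (use assms order_trans[OF le abs_ge_self] in auto)
  have "\<bar>LINT z|M. f z * h z\<bar> \<le> (LINT z|M. \<bar>f z * h z\<bar>)" by (rule integral_abs_bound)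
  also have "\<dots> \<le> (LINT z|M. B * \<bar>f z\<bar>)" using int i le by (intro integral_mono) auto
  finally show "\<bar>LINT z|M. f z * h z\<bar> \<le> B * (LINT z|M. \<bar>f z\<bar>)" by simp
qed

section \<open>Pairing with strongly convergent fields\<close>

context separated_bubbles
begin

lemma limit_pairing_diff:
  assumes f: "integrable lborel f" and g: "integrable lborel g" and \<psi>: "\<psi> \<in> borel_measurable borel" and \<Psi>: "\<And>z. \<bar>\<psi> z\<bar> \<le> \<Psi>"
  shows "\<bar>limit_pairing f \<psi> - limit_pairing g \<psi>\<bar> \<le> Cd * \<Psi> * (LINT z|lborel. \<bar>f z - g z\<bar>)"
proof -
  have fg: "integrable lborel (\<lambda>z. f z - g z)" using f g by simp
  note If = integrable_against_S[OF f \<psi> \<Psi>] and Ig = integrable_against_S[OF g \<psi> \<Psi>] and Ifg = integrable_against_S[OF fg \<psi> \<Psi>]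
  have "limit_pairing f \<psi> - limit_pairing g \<psi> =
      (LINT t|lborel. (LINT y|S t. f (t, fst y) * \<psi> (t, y)) - (LINT y|S t. g (t, fst y) * \<psi> (t, y)))"
    unfolding limit_pairing_def using If(2) Ig(2) by simp
  also have "\<dots> = (LINT t|lborel. LINT y|S t. (f (t, fst y) - g (t, fst y)) * \<psi> (t, y))"
  proof (rule integral_cong_AE)
    show "AE t in lborel. (LINT y|S t. f (t, fst y) * \<psi> (t, y)) - (LINT y|S t. g (t, fst y) * \<psi> (t, y)) =
        (LINT y|S t. (f (t, fst y) - g (t, fst y)) * \<psi> (t, y))"
      using If(1) Ig(1) by eventually_elim (simp add: left_diff_distrib)
  qed (use If(2) Ig(2) Ifg(2) in auto)
  finally show ?thesis using Ifg(3) by simp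
qed

text \<open>Density of the measure obtained by distributing the weight \<open>\<psi> / N\<close> of
  each bubble evenly over its length \<open>2 R\<close>. Disjointness of the bubbles bounds it
  uniformly in \<open>n\<close>.\<close>

definition spread :: "nat \<Rightarrow> (real \<times> real \<times> real \<Rightarrow> real) \<Rightarrow> real \<times> real \<Rightarrow> real" where
  "spread n \<psi> = (\<lambda>(t, x). \<Sum>k\<in>{1..N n}. indicator (bub n k t) x *
     (\<psi> (t, c n k t, real (N n) * R n k t) / (2 * real (N n) * R n k t)))"

lemma spread_bound:
  assumes "\<And>z. \<bar>\<psi> z\<bar> \<le> \<Psi>"
  shows "\<bar>spread n \<psi> z\<bar> \<le> Cd * \<Psi>"
proof (cases z)
  case (Pair t x)
  have \<Psi>0: "\<Psi> \<ge> 0" using assms[of 0] by linarith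
  have "\<bar>spread n \<psi> z\<bar> \<le> (\<Sum>k\<in>{1..N n}. indicator (bub n k t) x * (Cd * \<Psi>))"
    unfolding spread_def Pair prod.case
  proof (rule order_trans[OF sum_abs sum_mono])
    fix k assume k: "k \<in> {1..N n}"
    have "\<bar>\<psi> (t, c n k t, real (N n) * R n k t) / (2 * real (N n) * R n k t)\<bar>
        = \<bar>\<psi> (t, c n k t, real (N n) * R n k t)\<bar> * (1 / (2 * real (N n) * R n k t))"
      using R_pos[OF k, of t] by (simp add: abs_mult)
    also have "\<dots> \<le> \<Psi> * Cd"
      by (intro mult_mono assms weight[OF k] \<Psi>0)
    finally have "\<bar>\<psi> (t, c n k t, real (N n) * R n k t) / (2 * real (N n) * R n k t)\<bar> \<le> Cd * \<Psi>"
      by (simp only: mult.commute)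
    then show "\<bar>indicator (bub n k t) x * (\<psi> (t, c n k t, real (N n) * R n k t) / (2 * real (N n) * R n k t))\<bar>
        \<le> indicator (bub n k t) x * (Cd * \<Psi>)"
      unfolding abs_mult by (intro mult_mono) auto
  qed
  also have "\<dots> = (\<Sum>k\<in>{1..N n}. indicator (bub n k t) x) * (Cd * \<Psi>)"
    by (rule sum_distrib_right[symmetric])
  also have "\<dots> \<le> 1 * (Cd * \<Psi>)"
  proof (intro mult_right_mono)
    show "(\<Sum>k\<in>{1..N n}. indicator (bub n k t) x) \<le> (1::real)"
      by (rule order_trans[OF sum_indicator_le_1]) (simp add: indicator_def)
  qed (use Cd_pos \<Psi>0 in auto)
  finally show ?thesis by simp
qed

lemma spread_measurable:
  assumes \<psi>[measurable]: "\<psi> \<in> borel_measurable borel"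
  shows "spread n \<psi> \<in> borel_measurable borel"
proof -
  have [measurable]: "c n k \<in> borel_measurable borel" "R n k \<in> borel_measurable borel" if "k \<in> {1..N n}" for k
    by (intro borel_measurable_continuous_onI c_cont R_cont that)+
  have [measurable]: "\<psi> \<in> borel_measurable (borel \<Otimes>\<^sub>M (borel \<Otimes>\<^sub>M borel))"
    using \<psi> by (simp add: borel_prod)
  have "(\<lambda>z. indicator (bub n k (fst z)) (snd z) :: real) = (\<lambda>z. if c n k (fst z) - R n k (fst z) < snd z \<and> snd z < c n k (fst z) + R n k (fst z) then 1 else 0)" for k
    by (auto simp: bub_def indicator_def fun_eq_iff)
  note eq = this
  have [measurable]: "(\<lambda>z. indicator (bub n k (fst z)) (snd z) :: real) \<in> borel_measurable (borel \<Otimes>\<^sub>M borel)"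
    if k: "k \<in> {1..N n}" for k
  proof -
    have [measurable]: "c n k \<in> borel_measurable borel" "R n k \<in> borel_measurable borel"
      by (intro borel_measurable_continuous_onI c_cont R_cont k)+
    show ?thesis unfolding eq by measurable
  qed
  have "spread n \<psi> \<in> borel_measurable (borel \<Otimes>\<^sub>M borel)"
    unfolding spread_def case_prod_beta' by measurable
  then show ?thesis by (simp add: borel_prod)
qed

lemma spread_section:
  assumes "integrable lborel (\<lambda>x. f (t, x))"
  shows "(LINT x|lborel. f (t, x) * spread n \<psi> (t, x)) =
    (\<Sum>k\<in>{1..N n}. (\<psi> (t, c n k t, real (N n) * R n k t) / (2 * real (N n) * R n k t)) * (LINT x:bub n k t|lborel. f (t, x)))"
proof -
  have i: "integrable lborel (\<lambda>x. indicator (bub n k t) x * f (t, x))" for k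
    using integrable_times_bounded(1)[OF assms, of "indicator (bub n k t)" 1] by (simp add: bub_def mult.commute)
  have "(LINT x|lborel. f (t, x) * spread n \<psi> (t, x)) = (LINT x|lborel. (\<Sum>k\<in>{1..N n}.
     (\<psi> (t, c n k t, real (N n) * R n k t) / (2 * real (N n) * R n k t)) * (indicator (bub n k t) x * f (t, x))))"
    by (simp add: spread_def sum_distrib_left mult_ac)
  also have "\<dots> = (\<Sum>k\<in>{1..N n}. (\<psi> (t, c n k t, real (N n) * R n k t) / (2 * real (N n) * R n k t)) * (LINT x|lborel. indicator (bub n k t) x * f (t, x)))"
    using i by (subst Bochner_Integration.integral_sum) auto
  finally show ?thesis by (simp add: set_lebesgue_integral_def)
qed

text \<open>The mean value property at the midpoint, which holds for functions affine in each
  bubble. It is the one property of the fields through which point values at centres are traded for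
  integrals.\<close>

definition bub_average :: "nat \<Rightarrow> (real \<times> real \<Rightarrow> real) \<Rightarrow> bool" where
  "bub_average n f \<longleftrightarrow> (\<forall>t. \<forall>k\<in>{1..N n}. (LINT x:bub n k t|lborel. f (t, x)) = 2 * R n k t * f (t, c n k t))"

text \<open>An empirical pairing sees the field only on the null set of the centre curves; the mean
  value property rewrites it as a Lebesgue integral, which is stable under \<open>L1\<close>
  convergence. The time slices of \<open>f\<close> are integrable only for almost every
  \<open>t\<close>, hence the almost-everywhere comparison.\<close>

lemma emp_pairing_spread:
  assumes f: "integrable lborel f" and avg: "bub_average n f"
    and \<psi>: "\<psi> \<in> borel_measurable borel" and \<Psi>: "\<And>z. \<bar>\<psi> z\<bar> \<le> \<Psi>"
  shows "integrable lborel (\<lambda>t. emp n t (\<lambda>y. f (t, fst y) * \<psi> (t, y)))"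
    and "emp_pairing n f \<psi> = (LINT z|lborel. f z * spread n \<psi> z)"
proof -
  have i: "integrable lborel (\<lambda>z. f z * spread n \<psi> z)"
    using spread_measurable[OF \<psi>] by (intro integrable_times_bounded(1)[OF f _ spread_bound[OF \<Psi>]]) simp
  have eq: "AE t in lborel. emp n t (\<lambda>y. f (t, fst y) * \<psi> (t, y)) = (LINT x|lborel. f (t, x) * spread n \<psi> (t, x))"
    using AE_section_integrable[OF f]
  proof eventually_elim
    case (elim t)
    show ?case
      unfolding spread_section[where f = f and t = t, OF elim] emp_def sum_divide_distrib
    proof (rule sum.cong)
      fix k assume k: "k \<in> {1..N n}"
      then show "f (t, fst (c n k t, real (N n) * R n k t)) * \<psi> (t, c n k t, real (N n) * R n k t) / real (N n) =
         \<psi> (t, c n k t, real (N n) * R n k t) / (2 * real (N n) * R n k t) * (LINT x:bub n k t|lborel. f (t, x))"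
        using avg R_pos[OF k, of t] by (simp add: bub_average_def)
    qed simp
  qed
  have m: "(\<lambda>t. emp n t (\<lambda>y. f (t, fst y) * \<psi> (t, y))) \<in> borel_measurable lborel"
  proof -
    have [measurable]: "f \<in> borel_measurable (borel \<Otimes>\<^sub>M borel)" using f by (simp add: borel_prod)
    have [measurable]: "\<psi> \<in> borel_measurable (borel \<Otimes>\<^sub>M (borel \<Otimes>\<^sub>M borel))" using \<psi> by (simp add: borel_prod)
    have "(\<lambda>p. f (fst p, fst (snd p)) * \<psi> p) \<in> borel_measurable (borel \<Otimes>\<^sub>M (borel \<Otimes>\<^sub>M borel))" by measurable
    then have "(\<lambda>p. f (fst p, fst (snd p)) * \<psi> p) \<in> borel_measurable borel" by (simp add: borel_prod)
    from emp_measurable[OF this, of "\<lambda>t. t" n] show ?thesis by simp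
  qed
  note I = lborel_integral_fst[OF i]
  have m': "(\<lambda>t. LINT x|lborel. f (t, x) * spread n \<psi> (t, x)) \<in> borel_measurable lborel"
    using I(1) by auto
  show "integrable lborel (\<lambda>t. emp n t (\<lambda>y. f (t, fst y) * \<psi> (t, y)))"
    using integrable_cong_AE[OF m m' eq] I(1) by blast
  show "emp_pairing n f \<psi> = (LINT z|lborel. f z * spread n \<psi> z)"
    unfolding emp_pairing_def I(2)[symmetric] by (rule integral_cong_AE[OF m m' eq])
qed

text \<open>Identifies the limit of the densities \<open>spread\<close> on continuous functions with
  compact support: evaluation at a centre and averaging over the bubble differ by the oscillation of
  \<open>b\<close> at the scale of a bubble radius, which tends to 0.\<close>

lemma spread_continuous_limit:
  assumes b: "continuous_on UNIV b" "compact K" "\<And>z. z \<notin> K \<Longrightarrow> b z = 0"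
    and \<psi>: "continuous_on UNIV \<psi>" and \<Psi>: "\<And>z. \<bar>\<psi> z\<bar> \<le> \<Psi>"
  shows "(\<lambda>n. LINT z|lborel. b z * spread n \<psi> z) \<longlonglongrightarrow> limit_pairing b \<psi>"
proof -
  have \<Psi>0: "\<Psi> \<ge> 0" using \<Psi>[of 0] by linarith
  have \<psi>m: "\<psi> \<in> borel_measurable borel" by (rule borel_measurable_continuous_onI[OF \<psi>])
  have bi: "integrable lborel b" by (rule integrable_continuous_compact[OF b])
  have i: "integrable lborel (\<lambda>z. b z * spread n \<psi> z)" for n
    using spread_measurable[OF \<psi>m] by (intro integrable_times_bounded(1)[OF bi _ spread_bound[OF \<Psi>]]) simp
  obtain M where M: "M \<ge> 0" "\<And>z. z \<in> K \<Longrightarrow> \<bar>fst z\<bar> \<le> M"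
  proof -
    obtain C where "0 \<le> C" "\<And>z. z \<in> K \<Longrightarrow> \<bar>fst z\<bar> \<le> C"
      using bounded_continuous_compact[OF _ b(2), of fst] continuous_on_fst[OF continuous_on_id] by (auto simp: id_def)
    then show thesis by (rule that)
  qed
  have b0: "b (t, x) = 0" if "t \<notin> {-M..M}" for t x
    using b(3)[of "(t, x)"] M(2)[of "(t, x)"] that by (cases "(t, x) \<in> K") (auto simp: abs_le_iff)
  have btc: "continuous_on UNIV (\<lambda>x. b (t, x))" for t
    by (rule continuous_on_compose2[OF b(1)]) (auto intro: continuous_intros)
  have unif: "uniformly_continuous_on UNIV b" by (rule uniformly_continuous_compact_support[OF b])
  have "(\<lambda>n. emp_pairing n b \<psi> - (LINT z|lborel. b z * spread n \<psi> z)) \<longlonglongrightarrow> 0"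
  proof (rule tendstoI)
    fix e :: real assume e: "e > 0"
    \<comment> \<open>\<open>2 * M\<close> is the length of a time interval containing the support
      of \<open>b\<close>, and \<open>\<Psi>\<close> bounds the test function; \<open>w\<close> is
      the admissible oscillation.\<close>
    define w where "w = e / (2 * (2 * M * \<Psi> + 1))"
    have w: "w > 0" "2 * M * \<Psi> * w < e"
      using scaled_epsilon[of "2 * M * \<Psi>" e 2] M(1) \<Psi>0 e by (auto simp: w_def)
    obtain \<delta> where \<delta>: "\<delta> > 0" "\<And>x y. dist x y < \<delta> \<Longrightarrow> dist (b x) (b y) < w"
      using unif w(1) unfolding uniformly_continuous_on_def by (metis UNIV_I dist_commute)
    have "eventually (\<lambda>n. 1 / (d * real (N n)) < \<delta>) sequentially"
      using inv_N_tendsto \<delta>(1) by (rule order_tendstoD)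
    then show "eventually (\<lambda>n. dist (emp_pairing n b \<psi> - (LINT z|lborel. b z * spread n \<psi> z)) 0 < e) sequentially"
    proof eventually_elim
      case (elim n)
      have osc: "\<bar>b (t, x) - b (t, y)\<bar> \<le> w" if "\<bar>x - y\<bar> \<le> 1 / (d * real (N n))" for t x y
        using \<delta>(2)[of "(t, x)" "(t, y)"] that elim by (simp add: dist_prod_def dist_real_def)
      have bt: "integrable lborel (\<lambda>x. b (t, x))" for t
      proof (rule integrable_continuous_compact[OF btc, of "snd ` K"])
        show "compact (snd ` K)" by (intro compact_continuous_image continuous_intros b)
        show "b (t, x) = 0" if "x \<notin> snd ` K" for x using b(3)[of "(t, x)"] that by force
      qed
      have pt: "\<bar>emp n t (\<lambda>y. b (t, fst y) * \<psi> (t, y)) - (LINT x|lborel. b (t, x) * spread n \<psi> (t, x))\<bar>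
          \<le> indicator {-M..M} t * (\<Psi> * w)" for t
      proof (cases "t \<in> {-M..M}")
        case True
        have summand: "\<bar>b (t, c n k t) * \<psi> (t, c n k t, real (N n) * R n k t) / real (N n) -
            \<psi> (t, c n k t, real (N n) * R n k t) / (2 * real (N n) * R n k t) * (LINT x:bub n k t|lborel. b (t, x))\<bar> \<le> \<Psi> * w / real (N n)"
          if k: "k \<in> {1..N n}" for k
        proof -
          have "b (t, c n k t) * \<psi> (t, c n k t, real (N n) * R n k t) / real (N n) -
            \<psi> (t, c n k t, real (N n) * R n k t) / (2 * real (N n) * R n k t) * (LINT x:bub n k t|lborel. b (t, x))
            = \<psi> (t, c n k t, real (N n) * R n k t) * ((2 * R n k t * b (t, c n k t) - (LINT x:bub n k t|lborel. b (t, x))) / (2 * real (N n) * R n k t))"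
            using R_pos[OF k, of t] Npos[of n] by (simp add: field_simps)
          also have "\<bar>\<dots>\<bar> \<le> \<Psi> * (2 * R n k t * w / (2 * real (N n) * R n k t))"
          proof -
            have D: "2 * real (N n) * R n k t > 0" using R_pos[OF k, of t] Npos[of n] by simp
            have "\<bar>(2 * R n k t * b (t, c n k t) - (LINT x:bub n k t|lborel. b (t, x))) / (2 * real (N n) * R n k t)\<bar>
                \<le> 2 * R n k t * w / (2 * real (N n) * R n k t)"
              unfolding abs_divide abs_of_pos[OF D]
              by (rule divide_right_mono[OF bub_average_error[OF btc k osc]]) (use D in auto)
            then show ?thesis unfolding abs_mult by (intro mult_mono \<Psi> \<Psi>0) auto
          qed
          also have "\<dots> = \<Psi> * w / real (N n)" using R_pos[OF k, of t] Npos[of n] by simp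
          finally show ?thesis .
        qed
        have eq: "emp n t (\<lambda>y. b (t, fst y) * \<psi> (t, y)) - (LINT x|lborel. b (t, x) * spread n \<psi> (t, x)) =
          (\<Sum>k\<in>{1..N n}. b (t, c n k t) * \<psi> (t, c n k t, real (N n) * R n k t) / real (N n) -
            \<psi> (t, c n k t, real (N n) * R n k t) / (2 * real (N n) * R n k t) * (LINT x:bub n k t|lborel. b (t, x)))"
          by (simp add: spread_section[where f = b and t = t, OF bt] emp_def sum_divide_distrib sum_subtractf)
        have "\<bar>emp n t (\<lambda>y. b (t, fst y) * \<psi> (t, y)) - (LINT x|lborel. b (t, x) * spread n \<psi> (t, x))\<bar>
            \<le> (\<Sum>k\<in>{1..N n}. \<Psi> * w / real (N n))"
          unfolding eq by (rule order_trans[OF sum_abs sum_mono]) (rule summand)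
        then show ?thesis using True Npos[of n] by simp
      qed (simp add: b0 emp_def)
      have ie: "integrable lborel (\<lambda>t. emp n t (\<lambda>y. b (t, fst y) * \<psi> (t, y)))"
        by (rule emp_pairing_continuous(2)[OF b \<psi> \<Psi>])
      have iw: "integrable lborel (\<lambda>t. indicator {-M..M} t * (\<Psi> * w))"
        by (auto intro!: integrable_mult_left integrable_real_indicator simp: emeasure_lborel_Icc_eq)
      have "\<bar>emp_pairing n b \<psi> - (LINT z|lborel. b z * spread n \<psi> z)\<bar> =
         \<bar>LINT t|lborel. emp n t (\<lambda>y. b (t, fst y) * \<psi> (t, y)) - (LINT x|lborel. b (t, x) * spread n \<psi> (t, x))\<bar>"
        using ie lborel_integral_fst[OF i[of n]] by (simp add: emp_pairing_def)
      also have "\<dots> \<le> (LINT t|lborel. indicator {-M..M} t * (\<Psi> * w))"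
        using ie lborel_integral_fst(1)[OF i[of n]] iw pt
        by (intro order_trans[OF integral_abs_bound integral_mono]) auto
      also have "\<dots> = 2 * M * \<Psi> * w" using M(1) by simp
      also have "\<dots> < e" by (rule w(2))
      finally show ?case by simp
    qed
  qed
  from tendsto_diff[OF emp_pairing_continuous(1)[OF b \<psi> \<Psi>] this] show ?thesis by simp
qed

text \<open>The limit field is replaced by a continuous \<open>b\<close> close to it in
  \<open>L1\<close>. Both the densities \<open>spread\<close> and the limit pairing have
  \<open>L1\<close> constant \<open>Cd * \<Psi>\<close>, so this costs little uniformly in
  \<open>n\<close>, and for \<open>b\<close> the limit is known.\<close>

lemma emp_pairing_strong_limit:
  assumes f: "\<And>n. integrable lborel (f n)" "integrable lborel g" "\<And>n. bub_average n (f n)"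
    and conv: "(\<lambda>n. LINT z|lborel. \<bar>f n z - g z\<bar>) \<longlonglongrightarrow> 0"
    and \<psi>: "continuous_on UNIV \<psi>" and \<Psi>: "\<And>z. \<bar>\<psi> z\<bar> \<le> \<Psi>"
  shows "(\<lambda>n. emp_pairing n (f n) \<psi>) \<longlonglongrightarrow> limit_pairing g \<psi>"
proof (rule tendstoI)
  fix e :: real assume e: "e > 0"
  have \<Psi>0: "\<Psi> \<ge> 0" using \<Psi>[of 0] by linarith
  have \<psi>m: "\<psi> \<in> borel_measurable borel" by (rule borel_measurable_continuous_onI[OF \<psi>])
  define A where "A = Cd * \<Psi>"
  have A: "A \<ge> 0" using Cd_pos \<Psi>0 by (simp add: A_def)
  define E where "E = e / (8 * (A + 1))"
  have E: "E > 0" "A * E \<le> e / 8"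
    using scaled_epsilon[of A e 8] A e by (auto simp: E_def)
  obtain b K where b: "continuous_on UNIV b" "compact K" "\<And>z. z \<notin> K \<Longrightarrow> b z = 0"
    "integrable lborel b" "(LINT z|lborel. \<bar>g z - b z\<bar>) < E"
    using integrable_approx_continuous[OF f(2) E(1)] by blast
  have ev1: "eventually (\<lambda>n. (LINT z|lborel. \<bar>f n z - g z\<bar>) < E) sequentially"
    using conv E(1) by (rule order_tendstoD)
  have ev2: "eventually (\<lambda>n. dist (LINT z|lborel. b z * spread n \<psi> z) (limit_pairing b \<psi>) < e / 8) sequentially"
    by (rule tendstoD[OF spread_continuous_limit[OF b(1-3) \<psi> \<Psi>]]) (use e in auto)
  show "eventually (\<lambda>n. dist (emp_pairing n (f n) \<psi>) (limit_pairing g \<psi>) < e) sequentially"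
    using ev1 ev2
  proof eventually_elim
    case (elim n)
    have h: "spread n \<psi> \<in> borel_measurable lborel" using spread_measurable[OF \<psi>m] by simp
    have "emp_pairing n (f n) \<psi> - (LINT z|lborel. b z * spread n \<psi> z) = (LINT z|lborel. (f n z - b z) * spread n \<psi> z)"
      using integrable_times_bounded(1)[OF f(1)[of n] h spread_bound[OF \<Psi>]] integrable_times_bounded(1)[OF b(4) h spread_bound[OF \<Psi>]]
      by (simp add: emp_pairing_spread(2)[OF f(1,3) \<psi>m \<Psi>] left_diff_distrib)
    also have "\<bar>\<dots>\<bar> \<le> A * (LINT z|lborel. \<bar>f n z - b z\<bar>)"
      unfolding A_def by (rule integrable_times_bounded(2)[OF _ h spread_bound[OF \<Psi>]]) (use f b in auto)
    also have "\<dots> \<le> A * (2 * E)"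
    proof (rule mult_left_mono[OF _ A])
      have "(LINT z|lborel. \<bar>f n z - b z\<bar>) \<le> (LINT z|lborel. \<bar>f n z - g z\<bar> + \<bar>g z - b z\<bar>)"
        using f b by (intro integral_mono) auto
      also have "\<dots> \<le> 2 * E" using elim(1) b f by simp
      finally show "(LINT z|lborel. \<bar>f n z - b z\<bar>) \<le> 2 * E" .
    qed
    finally have 1: "\<bar>emp_pairing n (f n) \<psi> - (LINT z|lborel. b z * spread n \<psi> z)\<bar> \<le> 2 * (A * E)" by simp
    have "\<bar>limit_pairing g \<psi> - limit_pairing b \<psi>\<bar> \<le> A * (LINT z|lborel. \<bar>g z - b z\<bar>)"
      unfolding A_def by (rule limit_pairing_diff[OF f(2) b(4) \<psi>m \<Psi>])
    also have "\<dots> \<le> A * E" using b(5) A by (intro mult_left_mono) auto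
    finally have 2: "\<bar>limit_pairing g \<psi> - limit_pairing b \<psi>\<bar> \<le> A * E" .
    show ?case using 1 2 elim(2) E(2) e unfolding dist_real_def by linarith
  qed
qed

end

text \<open>Takes the place of the Cauchy-Schwarz inequality; the free weight \<open>l\<close> can
  be adapted to a norm bound.\<close>

lemma young:
  fixes a b l :: real
  assumes "l > 0"
  shows "\<bar>a * b\<bar> \<le> l / 2 * a\<^sup>2 + 1 / (2 * l) * b\<^sup>2"
proof -
  have "0 \<le> (l * \<bar>a\<bar> - \<bar>b\<bar>)\<^sup>2" by simp
  then have "2 * l * (\<bar>a\<bar> * \<bar>b\<bar>) \<le> l\<^sup>2 * a\<^sup>2 + b\<^sup>2"
    by (simp add: power2_diff power_mult_distrib mult_ac)
  then have "\<bar>a\<bar> * \<bar>b\<bar> \<le> (l\<^sup>2 * a\<^sup>2 + b\<^sup>2) / (2 * l)"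
    using assms by (simp add: pos_le_divide_eq mult_ac)
  also have "\<dots> = l / 2 * a\<^sup>2 + 1 / (2 * l) * b\<^sup>2"
    using assms by (simp add: add_divide_distrib power2_eq_square)
  finally show ?thesis by (simp add: abs_mult)
qed

section \<open>Pairing with weakly convergent fields\<close>

context separated_bubbles
begin

text \<open>In contrast to \<open>spread\<close>, the averaging scale of \<open>\<kappa>\<close> is independent of \<open>n\<close>, so that
  \<open>smear\<close> converges pointwise.\<close>

definition smear :: "nat \<Rightarrow> (real \<Rightarrow> real) \<Rightarrow> (real \<times> real \<times> real \<Rightarrow> real) \<Rightarrow> real \<times> real \<Rightarrow> real" where
  "smear n \<kappa> \<psi> = (\<lambda>(t, x). emp n t (\<lambda>y. \<kappa> (x - fst y) * \<psi> (t, y)))"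

definition smear_lim :: "(real \<Rightarrow> real) \<Rightarrow> (real \<times> real \<times> real \<Rightarrow> real) \<Rightarrow> real \<times> real \<Rightarrow> real" where
  "smear_lim \<kappa> \<psi> = (\<lambda>(t, x). LINT y|S t. \<kappa> (x - fst y) * \<psi> (t, y))"

text \<open>The two bounds serve different purposes. \<open>B * \<Psi>\<close> depends on the scale
  of \<open>\<kappa>\<close> and only provides domination; the condition on \<open>\<rho>\<close>
  confines the support to the closed cylinder. The bound \<open>Cd * \<Psi>\<close> of the limit is
  independent of the scale, since the position marginal has density at most \<open>Cd\<close> and
  the kernel has mass 1.\<close>

lemma smear_properties:
  assumes \<kappa>: "continuous_on UNIV \<kappa>" "\<And>x. 0 \<le> \<kappa> x" "\<And>x. \<bar>x\<bar> \<ge> \<delta> \<Longrightarrow> \<kappa> x = 0" "(LINT x|lborel. \<kappa> x) = 1" "\<And>x. \<kappa> x \<le> B"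
    and \<psi>: "continuous_on UNIV \<psi>" and \<Psi>: "\<And>z. \<bar>\<psi> z\<bar> \<le> \<Psi>"
    and supp: "\<And>t x r. \<psi> (t, x, r) \<noteq> 0 \<Longrightarrow> t \<in> {0..T} \<and> \<bar>x\<bar> \<le> 1 - \<rho>" and \<rho>: "\<delta> \<le> \<rho>"
  shows "smear n \<kappa> \<psi> \<in> borel_measurable borel" "\<bar>smear n \<kappa> \<psi> z\<bar> \<le> indicator ({0..T} \<times> {-1..1}) z * (B * \<Psi>)"
    and "(\<lambda>n. smear n \<kappa> \<psi> z) \<longlonglongrightarrow> smear_lim \<kappa> \<psi> z"
    and "smear_lim \<kappa> \<psi> \<in> borel_measurable borel" "\<bar>smear_lim \<kappa> \<psi> z\<bar> \<le> Cd * \<Psi>"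
proof -
  have \<Psi>0: "\<Psi> \<ge> 0" using \<Psi>[of 0] by linarith
  have B0: "B \<ge> 0" using order_trans[OF \<kappa>(2,5)] .
  have [measurable]: "\<kappa> \<in> borel_measurable borel" by (rule borel_measurable_continuous_onI[OF \<kappa>(1)])
  have \<psi>m: "\<psi> \<in> borel_measurable borel" by (rule borel_measurable_continuous_onI[OF \<psi>])
  have [measurable]: "\<psi> \<in> borel_measurable (borel \<Otimes>\<^sub>M (borel \<Otimes>\<^sub>M borel))" using \<psi>m by (simp add: borel_prod)
  show meas: "smear n \<kappa> \<psi> \<in> borel_measurable borel" for n
  proof -
    have "(\<lambda>p. \<kappa> (snd (fst p) - fst (snd p)) * \<psi> (fst (fst p), snd p)) \<in>
        borel_measurable ((borel \<Otimes>\<^sub>M borel) \<Otimes>\<^sub>M (borel \<Otimes>\<^sub>M borel) :: ((real \<times> real) \<times> real \<times> real) measure)"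
      by measurable
    then have "(\<lambda>p. \<kappa> (snd (fst p) - fst (snd p)) * \<psi> (fst (fst p), snd p)) \<in>
        borel_measurable (borel :: ((real \<times> real) \<times> real \<times> real) measure)"
      by (simp add: borel_prod)
    from emp_measurable[OF this, of fst n] show ?thesis
      by (simp add: smear_def case_prod_beta' borel_measurable_continuous_onI[OF linear_continuous_on[OF bounded_linear_fst]])
  qed
  show "\<bar>smear n \<kappa> \<psi> z\<bar> \<le> indicator ({0..T} \<times> {-1..1}) z * (B * \<Psi>)" for n z
  proof (cases z)
    case (Pair t x)
    show ?thesis
    proof (cases "t \<in> {0..T} \<and> x \<in> {-1..1}")
      case True
      have "\<bar>\<kappa> (x - fst y) * \<psi> (t, y)\<bar> \<le> B * \<Psi>" for y
        unfolding abs_mult using \<kappa>(2,5) \<Psi> B0 by (intro mult_mono) auto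
      from emp_bound[where n = n and t = t, OF this] show ?thesis using True by (simp add: smear_def Pair)
    next
      case False
      have "\<kappa> (x - y) * \<psi> (t, y, r) = 0" for y r
      proof (rule ccontr)
        assume "\<kappa> (x - y) * \<psi> (t, y, r) \<noteq> 0"
        then have "t \<in> {0..T}" "\<bar>y\<bar> \<le> 1 - \<rho>" "\<bar>x - y\<bar> < \<delta>" using supp[of t y r] \<kappa>(3)[of "x - y"] by force+
        with False \<rho> show False by auto
      qed
      then have "(\<lambda>y. \<kappa> (x - fst y) * \<psi> (t, y)) = (\<lambda>_. 0)" by auto
      then have "smear n \<kappa> \<psi> z = emp n t (\<lambda>_. 0)" by (simp only: smear_def Pair prod.case)
      then show ?thesis using B0 \<Psi>0 by (simp add: emp_def)
    qed
  qed
  have cont: "continuous_on UNIV (\<lambda>y. \<kappa> (x - fst y) * \<psi> (t, y))" for t x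
    by (intro continuous_intros continuous_on_compose2[OF \<kappa>(1)] continuous_on_compose2[OF \<psi>]) auto
  show lim: "(\<lambda>n. smear n \<kappa> \<psi> z) \<longlonglongrightarrow> smear_lim \<kappa> \<psi> z" for z
    using S_lim[OF cont] by (cases z) (simp add: smear_def smear_lim_def emp_def)
  show "smear_lim \<kappa> \<psi> \<in> borel_measurable borel"
    by (rule borel_measurable_LIMSEQ_real[OF lim meas])
  show "\<bar>smear_lim \<kappa> \<psi> z\<bar> \<le> Cd * \<Psi>"
  proof (cases z)
    case (Pair t x)
    interpret prob_space "S t" by (rule S_prob)
    define k where "k = (\<lambda>y. \<kappa> (x - y))"
    have k: "continuous_on UNIV k"
      unfolding k_def by (intro continuous_on_compose2[OF \<kappa>(1)] continuous_intros) auto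
    have km: "(\<lambda>y. k (fst y)) \<in> borel_measurable borel"
      by (intro borel_measurable_continuous_onI continuous_on_compose2[OF k] continuous_intros) auto
    have ki: "integrable (S t) (\<lambda>y. k (fst y))"
      by (rule integrable_const_bound[where B = B]) (use km \<kappa>(2,5) in \<open>auto simp: k_def\<close>)
    have "\<bar>smear_lim \<kappa> \<psi> z\<bar> \<le> (LINT y|S t. \<Psi> * k (fst y))"
    proof -
      have "integrable (S t) (\<lambda>y. k (fst y) * \<psi> (t, y))"
        by (rule integrable_times_bounded(1)[OF ki _ \<Psi>])
           (simp, intro borel_measurable_continuous_onI continuous_on_compose2[OF \<psi>] continuous_intros, auto)
      moreover have "\<bar>k (fst y) * \<psi> (t, y)\<bar> \<le> \<Psi> * k (fst y)" for y
        using mult_left_mono[OF \<Psi>[of "(t, y)"] \<kappa>(2)[of "x - fst y"]] \<kappa>(2)[of "x - fst y"]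
        by (simp add: k_def abs_mult mult.commute)
      ultimately have "\<bar>LINT y|S t. k (fst y) * \<psi> (t, y)\<bar> \<le> (LINT y|S t. \<Psi> * k (fst y))"
        using ki by (intro order_trans[OF integral_abs_bound integral_mono]) auto
      then show ?thesis by (simp add: smear_lim_def Pair k_def)
    qed
    also have "\<dots> = \<Psi> * (LINT y|S t. k (fst y))" by simp
    also have "\<dots> \<le> \<Psi> * (Cd * 1)"
    proof (rule mult_left_mono[OF _ \<Psi>0])
      have k0: "k y = 0" if "y \<notin> {x - \<bar>\<delta>\<bar>..x + \<bar>\<delta>\<bar>}" for y
        unfolding k_def using that by (intro \<kappa>(3)) auto
      have kl: "integrable lborel k" by (rule integrable_continuous_compact[OF k _ k0]) auto
      have "(LINT y|S t. k (fst y)) \<le> Cd * (LINT y:{-1..1}|lborel. k y)"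
        by (rule S_integral_le_continuous[OF k _ uniformly_continuous_compact_support[OF k _ k0]]) (auto simp: k_def \<kappa>(2))
      also have "(LINT y:{-1..1}|lborel. k y) \<le> (LINT y|lborel. k y)"
        unfolding set_lebesgue_integral_def
        by (rule integral_mono)
           (use kl integrable_times_bounded(1)[OF kl, of "indicator {-1..1}" 1] in \<open>auto simp: k_def \<kappa>(2) indicator_def mult.commute\<close>)
      also have "(LINT y|lborel. k y) = 1"
        using lborel_integral_real_affine[of "-1" \<kappa> x] \<kappa>(4) by (simp add: k_def)
      finally show "(LINT y|S t. k (fst y)) \<le> Cd * 1" using Cd_pos by simp
    qed
    finally show ?thesis by (simp add: mult.commute)
  qed
qed

text \<open>Weak times strong convergence: pointwise convergent functions with a common bound and a
  common support of finite measure converge in \<open>L2\<close>, and the uniform \<open>L2\<close>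
  bound on \<open>v\<close> absorbs their error through Young's inequality.\<close>

lemma smear_pairing_weak_limit:
  assumes v: "\<And>n. integrable lborel (v n)" "\<And>n. integrable lborel (\<lambda>z. (v n z)\<^sup>2)" "\<And>n. (LINT z|lborel. (v n z)\<^sup>2) \<le> K"
    and weak: "\<And>h. h \<in> borel_measurable borel \<Longrightarrow> (\<exists>B. \<forall>z. \<bar>h z\<bar> \<le> B) \<Longrightarrow>
      (\<lambda>n. LINT z|lborel. v n z * h z) \<longlonglongrightarrow> (LINT z|lborel. g z * h z)"
    and h: "\<And>n. h n \<in> borel_measurable borel" "h' \<in> borel_measurable borel"
    and hb: "\<And>n z. \<bar>h n z\<bar> \<le> indicator A z * B" and A: "A \<in> sets lborel" "emeasure lborel A < \<infinity>"
    and lim: "\<And>z. (\<lambda>n. h n z) \<longlonglongrightarrow> h' z"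
  shows "(\<lambda>n. LINT z|lborel. v n z * h n z) \<longlonglongrightarrow> (LINT z|lborel. (g z :: real) * h' (z :: 'z::euclidean_space))"
proof -
  have h'b: "\<bar>h' z\<bar> \<le> indicator A z * B" for z
    by (rule LIMSEQ_le_const2[OF tendsto_rabs[OF lim]]) (use hb in auto)
  have K0: "K \<ge> 0" by (rule order_trans[OF _ v(3)[of 0]]) simp
  have [measurable]: "h n \<in> borel_measurable borel" "h' \<in> borel_measurable borel" for n by (fact h)+
  have wi: "integrable lborel (\<lambda>z. indicator A z * (2 * B)\<^sup>2)" using A by auto
  have sq: "(h n z - h' z)\<^sup>2 \<le> indicator A z * (2 * B)\<^sup>2" for n z
  proof (cases "z \<in> A")
    case True
    then have "\<bar>h n z - h' z\<bar> \<le> 2 * B" using hb[of n z] h'b[of z] by simp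
    from power_mono[OF this abs_ge_zero, of 2] show ?thesis using True by simp
  qed (use hb[of n z] h'b[of z] in simp)
  have sqi: "integrable lborel (\<lambda>z. (h n z - h' z)\<^sup>2)" for n
    by (rule Bochner_Integration.integrable_bound[OF wi]) (use sq in auto)
  have "(\<lambda>n. LINT z|lborel. (h n z - h' z)\<^sup>2) \<longlonglongrightarrow> (LINT z::'z|lborel. 0)"
  proof (rule integral_dominated_convergence[OF _ _ wi])
    show "AE z in lborel. (\<lambda>n. (h n z - h' z)\<^sup>2) \<longlonglongrightarrow> 0"
    proof (intro always_eventually allI)
      fix z
      have "(\<lambda>n. (h n z - h' z)\<^sup>2) \<longlonglongrightarrow> (h' z - h' z)\<^sup>2" by (intro tendsto_intros lim)
      then show "(\<lambda>n. (h n z - h' z)\<^sup>2) \<longlonglongrightarrow> 0" by simp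
    qed
  qed (use sq in auto)
  then have sq_lim: "(\<lambda>n. LINT z|lborel. (h n z - h' z)\<^sup>2) \<longlonglongrightarrow> 0" by simp
  have hB: "\<bar>h n z\<bar> \<le> \<bar>B\<bar>" "\<bar>h' z\<bar> \<le> \<bar>B\<bar>" for n z
    using hb[of n z] h'b[of z] by (cases "z \<in> A"; simp)+
  have iv: "integrable lborel (\<lambda>z. v n z * h n z)" "integrable lborel (\<lambda>z. v n z * h' z)" for n
    by (rule integrable_times_bounded(1)[OF v(1), where B = "\<bar>B\<bar>"]; use hB in simp)+
  have "(\<lambda>n. LINT z|lborel. v n z * (h n z - h' z)) \<longlonglongrightarrow> 0"
  proof (rule tendstoI)
    fix e :: real assume e: "e > 0"
    define l where "l = e / (1 * (K + 1))"
    have l: "l > 0" "K * l \<le> e" using scaled_epsilon[OF K0 e, of 1] by (simp_all add: l_def)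
    have "eventually (\<lambda>n. (LINT z|lborel. (h n z - h' z)\<^sup>2) < e * l) sequentially"
      using sq_lim by (rule order_tendstoD) (use e l in simp)
    then show "eventually (\<lambda>n. dist (LINT z|lborel. v n z * (h n z - h' z)) 0 < e) sequentially"
    proof eventually_elim
      case (elim n)
      have pt: "\<bar>v n z * (h n z - h' z)\<bar> \<le> l / 2 * (v n z)\<^sup>2 + 1 / (2 * l) * (h n z - h' z)\<^sup>2" for z
        by (rule young[OF l(1)])
      have "\<bar>LINT z|lborel. v n z * (h n z - h' z)\<bar> \<le> (LINT z|lborel. l / 2 * (v n z)\<^sup>2 + 1 / (2 * l) * (h n z - h' z)\<^sup>2)"
        using iv v(2) sqi pt by (intro order_trans[OF integral_abs_bound integral_mono]) (auto simp: right_diff_distrib)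
      also have "\<dots> = l / 2 * (LINT z|lborel. (v n z)\<^sup>2) + 1 / (2 * l) * (LINT z|lborel. (h n z - h' z)\<^sup>2)"
        using v(2) sqi by simp
      also have "\<dots> < e / 2 + e / 2"
      proof (rule add_le_less_mono)
        have "l / 2 * (LINT z|lborel. (v n z)\<^sup>2) \<le> l / 2 * K" using l v(3) by (intro mult_left_mono) auto
        then show "l / 2 * (LINT z|lborel. (v n z)\<^sup>2) \<le> e / 2" using l(2) by (simp add: mult.commute)
        show "1 / (2 * l) * (LINT z|lborel. (h n z - h' z)\<^sup>2) < e / 2" using elim l(1) by (simp add: field_simps)
      qed
      finally show ?case by simp
    qed
  qed
  then have "(\<lambda>n. (LINT z|lborel. v n z * (h n z - h' z)) + (LINT z|lborel. v n z * h' z)) \<longlonglongrightarrow> 0 + (LINT z|lborel. g z * h' z)"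
    by (intro tendsto_add weak h) (use hB in auto)
  then show ?thesis using iv by (simp add: right_diff_distrib)
qed

lemma AE_lborel_neq: "AE t in lborel. t \<noteq> (a::real)"
  using AE_lborel_singleton[of a] by simp

text \<open>Moving an average over the scale \<open>\<delta>\<close> from the test function to the
  field replaces the value at a centre by a nearby mean, at the cost of the modulus
  \<open>W\<close>. Centres that matter keep distance \<open>\<rho>\<close> from the walls, so these
  means involve only points of \<open>Omega\<close>.\<close>

lemma emp_pairing_smear_error:
  assumes v: "integrable lborel v" "integrable lborel (\<lambda>t. emp n t (\<lambda>y. v (t, fst y) * \<psi> (t, y)))"
    and mod: "\<And>t x y. t \<in> {0<..<T} \<Longrightarrow> x \<in> Omega \<Longrightarrow> y \<in> Omega \<Longrightarrow> \<bar>x - y\<bar> \<le> \<delta> \<Longrightarrow> \<bar>v (t, x) - v (t, y)\<bar> \<le> W t"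
    and W: "integrable lborel (\<lambda>t. indicator {0..T} t * W t)" "\<And>t. 0 \<le> W t"
    and \<kappa>: "continuous_on UNIV \<kappa>" "\<And>x. 0 \<le> \<kappa> x" "\<And>x. \<bar>x\<bar> \<ge> \<delta> \<Longrightarrow> \<kappa> x = 0" "(LINT x|lborel. \<kappa> x) = 1" "\<And>x. \<kappa> x \<le> B"
    and \<psi>: "continuous_on UNIV \<psi>" and \<Psi>: "\<And>z. \<bar>\<psi> z\<bar> \<le> \<Psi>"
    and supp: "\<And>t x r. \<psi> (t, x, r) \<noteq> 0 \<Longrightarrow> t \<in> {0..T} \<and> \<bar>x\<bar> \<le> 1 - \<rho>" and \<rho>: "\<delta> \<le> \<rho>" "\<delta> > 0"
  shows "\<bar>emp_pairing n v \<psi> - (LINT z|lborel. v z * smear n \<kappa> \<psi> z)\<bar> \<le> \<Psi> * (LINT t|lborel. indicator {0..T} t * W t)"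
proof -
  have \<Psi>0: "\<Psi> \<ge> 0" using \<Psi>[of 0] by linarith
  have B0: "B \<ge> 0" using order_trans[OF \<kappa>(2,5)] .
  have sm: "smear n \<kappa> \<psi> \<in> borel_measurable borel"
    "\<bar>smear n \<kappa> \<psi> z\<bar> \<le> indicator ({0..T} \<times> {-1..1}) z * (B * \<Psi>)" for z
    by (intro smear_properties(1,2)[OF \<kappa> \<psi> \<Psi> _ \<rho>(1)]; use supp in blast)+
  have smB: "\<bar>smear n \<kappa> \<psi> z\<bar> \<le> B * \<Psi>" for z
    by (rule order_trans[OF sm(2)]) (use B0 \<Psi>0 in \<open>auto simp: indicator_def\<close>)
  have i: "integrable lborel (\<lambda>z. v z * smear n \<kappa> \<psi> z)"
    using sm(1) by (intro integrable_times_bounded(1)[OF v(1) _ smB]) simp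
  have [measurable]: "\<kappa> \<in> borel_measurable borel" by (rule borel_measurable_continuous_onI[OF \<kappa>(1)])
  have \<kappa>i: "integrable lborel \<kappa>"
    by (rule integrable_continuous_compact[OF \<kappa>(1), of "{-\<delta>..\<delta>}"]) (auto intro!: \<kappa>(3))
  have \<kappa>s: "integrable lborel (\<lambda>y. \<kappa> (y - a))" "(LINT y|lborel. \<kappa> (y - a)) = 1" for a
    using lborel_integrable_real_affine[OF \<kappa>i, of 1 "-a"] lborel_integral_real_affine[of 1 \<kappa> "-a"] \<kappa>(4)
    by (simp_all add: algebra_simps)
  have "AE t in lborel. \<bar>emp n t (\<lambda>y. v (t, fst y) * \<psi> (t, y)) - (LINT x|lborel. v (t, x) * smear n \<kappa> \<psi> (t, x))\<bar>
      \<le> \<Psi> * (indicator {0..T} t * W t)"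
    using AE_section_integrable[OF v(1)] AE_lborel_neq[of 0] AE_lborel_neq[of T]
  proof eventually_elim
    case (elim t)
    have ik: "integrable lborel (\<lambda>y. v (t, y) * \<kappa> (y - a))" for a
      by (rule integrable_times_bounded(1)[OF elim(1), where B = B]) (use \<kappa>(2,5) in auto)
    have "(LINT x|lborel. v (t, x) * smear n \<kappa> \<psi> (t, x)) =
       (LINT x|lborel. (\<Sum>k\<in>{1..N n}. \<psi> (t, c n k t, real (N n) * R n k t) * (v (t, x) * \<kappa> (x - c n k t))) / real (N n))"
      by (simp add: smear_def emp_def sum_distrib_left mult_ac)
    also have "\<dots> = (\<Sum>k\<in>{1..N n}. \<psi> (t, c n k t, real (N n) * R n k t) * (LINT x|lborel. v (t, x) * \<kappa> (x - c n k t))) / real (N n)"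
      using ik by (simp add: Bochner_Integration.integral_sum)
    finally have "emp n t (\<lambda>y. v (t, fst y) * \<psi> (t, y)) - (LINT x|lborel. v (t, x) * smear n \<kappa> \<psi> (t, x)) =
      (\<Sum>k\<in>{1..N n}. \<psi> (t, c n k t, real (N n) * R n k t) * (v (t, c n k t) - (LINT x|lborel. v (t, x) * \<kappa> (x - c n k t)))) / real (N n)"
      by (simp add: emp_def diff_divide_distrib right_diff_distrib sum_subtractf mult.commute)
    moreover have "\<bar>\<psi> (t, c n k t, real (N n) * R n k t) * (v (t, c n k t) - (LINT x|lborel. v (t, x) * \<kappa> (x - c n k t)))\<bar>
        \<le> \<Psi> * (indicator {0..T} t * W t)" if k: "k \<in> {1..N n}" for k
    proof (cases "\<psi> (t, c n k t, real (N n) * R n k t) = 0")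
      case False
      from supp[OF False] have t: "t \<in> {0..T}" and ck: "\<bar>c n k t\<bar> \<le> 1 - \<rho>" by auto
      have t': "t \<in> {0<..<T}" using t elim by auto
      have cO: "c n k t \<in> Omega" using ck \<rho> by (auto simp: Omega_def)
      have "v (t, c n k t) - (LINT x|lborel. v (t, x) * \<kappa> (x - c n k t)) =
          (LINT x|lborel. (v (t, c n k t) - v (t, x)) * \<kappa> (x - c n k t))"
        using ik[of "c n k t"] \<kappa>s[of "c n k t"] by (simp add: left_diff_distrib)
      also have "\<bar>\<dots>\<bar> \<le> (LINT x|lborel. W t * \<kappa> (x - c n k t))"
      proof (rule order_trans[OF integral_abs_bound integral_mono])
        show "integrable lborel (\<lambda>x. \<bar>(v (t, c n k t) - v (t, x)) * \<kappa> (x - c n k t)\<bar>)"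
          using ik[of "c n k t"] \<kappa>s[of "c n k t"] by (simp add: left_diff_distrib)
        show "integrable lborel (\<lambda>x. W t * \<kappa> (x - c n k t))" using \<kappa>s by simp
        show "\<bar>(v (t, c n k t) - v (t, x)) * \<kappa> (x - c n k t)\<bar> \<le> W t * \<kappa> (x - c n k t)" for x
        proof (cases "\<bar>x - c n k t\<bar> \<ge> \<delta>")
          case False
          then have "x \<in> Omega" using ck \<rho> by (auto simp: Omega_def abs_less_iff)
          with False have "\<bar>v (t, c n k t) - v (t, x)\<bar> \<le> W t" by (intro mod[OF t' cO]) auto
          then show ?thesis using \<kappa>(2) by (simp add: abs_mult mult_right_mono)
        qed (simp add: \<kappa>(3))
      qed
      also have "\<dots> = W t" using \<kappa>s by simp
      finally show ?thesis
        unfolding abs_mult using t \<Psi>0 by (intro mult_mono \<Psi>) auto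
    qed (use \<Psi>0 W in \<open>auto intro!: mult_nonneg_nonneg\<close>)
    then have "\<bar>\<Sum>k\<in>{1..N n}. \<psi> (t, c n k t, real (N n) * R n k t) * (v (t, c n k t) - (LINT x|lborel. v (t, x) * \<kappa> (x - c n k t)))\<bar>
        \<le> (\<Sum>k\<in>{1..N n}. \<Psi> * (indicator {0..T} t * W t))"
      by (intro order_trans[OF sum_abs sum_mono])
    ultimately show ?case using Npos[of n] by (simp add: abs_divide pos_divide_le_eq mult.commute)
  qed
  then have "(LINT t|lborel. \<bar>emp n t (\<lambda>y. v (t, fst y) * \<psi> (t, y)) - (LINT x|lborel. v (t, x) * smear n \<kappa> \<psi> (t, x))\<bar>)
      \<le> (LINT t|lborel. \<Psi> * (indicator {0..T} t * W t))"
    using v(2) lborel_integral_fst(1)[OF i] W(1) by (intro integral_mono_AE) auto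
  then have "\<bar>LINT t|lborel. emp n t (\<lambda>y. v (t, fst y) * \<psi> (t, y)) - (LINT x|lborel. v (t, x) * smear n \<kappa> \<psi> (t, x))\<bar>
      \<le> \<Psi> * (LINT t|lborel. indicator {0..T} t * W t)"
    by (intro order_trans[OF integral_abs_bound]) simp
  then show ?thesis
    using v(2) lborel_integral_fst[OF i] by (simp add: emp_pairing_def)
qed

text \<open>A continuous \<open>b\<close> close to \<open>g\<close> in \<open>L1\<close> is
  subtracted first; its own pairing converges. The remainder \<open>f n - b\<close> is smeared at a
  scale fixed before \<open>n\<close>, its pairing converges weakly times strongly, and the limit is
  small because \<open>g - b\<close> is small in \<open>L1\<close> and \<open>smear_lim\<close> has
  a bound free of the scale. Thus the smearing scale need not be sent to 0 in the limit
  measure.\<close>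

lemma emp_pairing_weak_limit:
  assumes f: "\<And>n. integrable lborel (f n)" "integrable lborel g" "\<And>n. bub_average n (f n)"
    and weak: "\<And>h. h \<in> borel_measurable borel \<Longrightarrow> (\<exists>B. \<forall>z. \<bar>h z\<bar> \<le> B) \<Longrightarrow>
      (\<lambda>n. LINT z|lborel. f n z * h z) \<longlonglongrightarrow> (LINT z|lborel. g z * h z)"
    and L2: "\<And>n. integrable lborel (\<lambda>z. (f n z)\<^sup>2)" "\<And>n. (LINT z|lborel. (f n z)\<^sup>2) \<le> K"
    and Q: "\<And>n. integrable lborel (Q n)" "\<And>n t. 0 \<le> Q n t" "\<And>n. (LINT t|lborel. Q n t) \<le> K"
    and mod: "\<And>n t x y s. t \<in> {0<..<T} \<Longrightarrow> x \<in> Omega \<Longrightarrow> y \<in> Omega \<Longrightarrow> s > 0 \<Longrightarrow> \<bar>x - y\<bar> \<le> s\<^sup>2 \<Longrightarrow>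
       \<bar>f n (t, x) - f n (t, y)\<bar> \<le> s * (Q n t + 1)"
    and \<psi>: "continuous_on UNIV \<psi>" and \<Psi>: "\<And>z. \<bar>\<psi> z\<bar> \<le> \<Psi>"
    and supp: "\<And>t x r. \<psi> (t, x, r) \<noteq> 0 \<Longrightarrow> t \<in> {0..T} \<and> \<bar>x\<bar> \<le> 1 - \<rho>" and \<rho>: "\<rho> > 0"
  shows "(\<lambda>n. emp_pairing n (f n) \<psi>) \<longlonglongrightarrow> limit_pairing g \<psi>"
proof (rule tendstoI)
  fix e :: real assume e: "e > 0"
  have \<Psi>0: "\<Psi> \<ge> 0" using \<Psi>[of 0] by linarith
  have K0: "K \<ge> 0" by (rule order_trans[OF _ L2(2)[of 0]]) simp
  have \<psi>m: "\<psi> \<in> borel_measurable borel" by (rule borel_measurable_continuous_onI[OF \<psi>])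
  define A where "A = Cd * \<Psi>"
  have A: "A \<ge> 0" using Cd_pos \<Psi>0 by (simp add: A_def)
  define E where "E = e / (8 * (A + 1))"
  have E: "E > 0" "A * E \<le> e / 8" using scaled_epsilon[of A e 8] A e by (auto simp: E_def)
  define w where "w = e / (8 * (\<Psi> * T + 1))"
  have w: "w > 0" "\<Psi> * T * w \<le> e / 8" using scaled_epsilon[of "\<Psi> * T" e 8] \<Psi>0 T e by (auto simp: w_def)
  obtain b S' where b: "continuous_on UNIV b" "compact S'" "\<And>z. z \<notin> S' \<Longrightarrow> b z = 0"
    "integrable lborel b" "(LINT z|lborel. \<bar>g z - b z\<bar>) < E"
    using integrable_approx_continuous[OF f(2) E(1)] by blast
  have unif: "uniformly_continuous_on UNIV b" by (rule uniformly_continuous_compact_support[OF b(1-3)])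
  obtain \<delta>b where \<delta>b: "\<delta>b > 0" "\<And>x y. dist x y < \<delta>b \<Longrightarrow> dist (b x) (b y) < w"
    using unif w(1) unfolding uniformly_continuous_on_def by (metis UNIV_I dist_commute)
  define s0 where "s0 = e / (8 * (\<Psi> * (K + T) + 1))"
  have s0: "s0 > 0" "\<Psi> * (K + T) * s0 \<le> e / 8"
    using scaled_epsilon[of "\<Psi> * (K + T)" e 8] \<Psi>0 K0 T e by (auto simp: s0_def)
  \<comment> \<open>The modulus has Hoelder exponent one half, so the spatial scale is the square of
    \<open>s\<close>. The bound \<open>s0\<close> makes the modulus term small; the square root
    keeps the scale below the margin \<open>\<rho>\<close> at the walls and below the continuity
    scale of \<open>b\<close>.\<close>
  define s where "s = min s0 (sqrt (min \<rho> (\<delta>b / 2)))"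
  define \<delta> where "\<delta> = s\<^sup>2"
  have s: "s > 0" "s \<le> s0" using s0 \<rho> \<delta>b by (auto simp: s_def)
  have \<delta>: "\<delta> > 0" "\<delta> \<le> \<rho>" "\<delta> < \<delta>b"
  proof -
    show "\<delta> > 0" using s by (simp add: \<delta>_def)
    have "\<delta> \<le> (sqrt (min \<rho> (\<delta>b / 2)))\<^sup>2" unfolding \<delta>_def using s(1) by (intro power_mono) (auto simp: s_def)
    also have "\<dots> = min \<rho> (\<delta>b / 2)" using \<rho> \<delta>b by simp
    finally show "\<delta> \<le> \<rho>" "\<delta> < \<delta>b" using \<delta>b by auto
  qed
  obtain \<eta> :: "real \<Rightarrow> real" where \<eta>: "smooth \<eta>" "\<And>x. 0 \<le> \<eta> x" "\<And>x. \<bar>x\<bar> \<ge> 1 \<Longrightarrow> \<eta> x = 0"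
    "integrable lborel \<eta>" "(LINT x|lborel. \<eta> x) = 1" using mollifier_exists by blast
  obtain B' where B': "0 \<le> B'" "\<And>x. x \<in> {-1..1} \<Longrightarrow> \<bar>\<eta> x\<bar> \<le> B'"
    using bounded_continuous_compact[OF smooth_continuous[OF \<eta>(1)] compact_Icc] by blast
  define \<kappa> where "\<kappa> = (\<lambda>x. \<eta> (x / \<delta>) / \<delta>)"
  have \<kappa>: "continuous_on UNIV \<kappa>" "\<And>x. 0 \<le> \<kappa> x" "\<And>x. \<bar>x\<bar> \<ge> \<delta> \<Longrightarrow> \<kappa> x = 0" "(LINT x|lborel. \<kappa> x) = 1" "\<And>x. \<kappa> x \<le> B' / \<delta>"
  proof -
    show "continuous_on UNIV \<kappa>" unfolding \<kappa>_def using \<delta>(1)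
      by (intro continuous_intros continuous_on_compose2[OF smooth_continuous[OF \<eta>(1), of UNIV]]) auto
    show "0 \<le> \<kappa> x" for x using \<delta>(1) \<eta>(2) by (simp add: \<kappa>_def)
    show "\<kappa> x = 0" if "\<bar>x\<bar> \<ge> \<delta>" for x using that \<delta>(1) by (simp add: \<kappa>_def \<eta>(3) abs_divide)
    show "(LINT x|lborel. \<kappa> x) = 1"
      using lborel_integral_real_affine[of \<delta> \<kappa> 0] \<delta>(1) \<eta>(5) by (simp add: \<kappa>_def)
    have "\<eta> x \<le> B'" for x
    proof (cases "\<bar>x\<bar> \<ge> 1")
      case False
      then have "\<bar>\<eta> x\<bar> \<le> B'" by (intro B'(2)) auto
      then show ?thesis by simp
    qed (simp add: \<eta>(3) B'(1))
    then show "\<kappa> x \<le> B' / \<delta>" for x using \<delta>(1) by (simp add: \<kappa>_def divide_right_mono)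
  qed
  define v where "v = (\<lambda>n z. f n z - b z)"
  have vi: "integrable lborel (v n)" for n using f b by (simp add: v_def)
  have b2: "integrable lborel (\<lambda>z. (b z)\<^sup>2)"
    by (rule integrable_continuous_compact[of _ S']) (use b in \<open>auto intro!: continuous_intros\<close>)
  have v2le: "(v n z)\<^sup>2 \<le> 2 * (f n z)\<^sup>2 + 2 * (b z)\<^sup>2" for n z
  proof -
    have "0 \<le> (f n z + b z)\<^sup>2" by simp
    then show ?thesis by (simp add: v_def power2_eq_square algebra_simps)
  qed
  have v2: "integrable lborel (\<lambda>z. (v n z)\<^sup>2)" for n
  proof (rule Bochner_Integration.integrable_bound)
    show "integrable lborel (\<lambda>z. 2 * (f n z)\<^sup>2 + 2 * (b z)\<^sup>2)" using L2(1)[of n] b2 by simp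
  qed (use vi[of n] v2le in auto)
  have v2K: "(LINT z|lborel. (v n z)\<^sup>2) \<le> 2 * K + 2 * (LINT z|lborel. (b z)\<^sup>2)" for n
  proof -
    have "(LINT z|lborel. (v n z)\<^sup>2) \<le> (LINT z|lborel. 2 * (f n z)\<^sup>2 + 2 * (b z)\<^sup>2)"
      using v2 L2(1) b2 v2le by (intro integral_mono) auto
    also have "\<dots> \<le> 2 * K + 2 * (LINT z|lborel. (b z)\<^sup>2)" using L2(1)[of n] L2(2)[of n] b2 by simp
    finally show ?thesis .
  qed
  have bh: "integrable lborel (\<lambda>z. a z * h z)"
    if "integrable lborel a" "h \<in> borel_measurable borel" "\<exists>B. \<forall>z. \<bar>h z\<bar> \<le> B" for a h :: "real \<times> real \<Rightarrow> real"
    using that integrable_times_bounded(1)[OF that(1), of h] by auto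
  have sm: "smear n \<kappa> \<psi> \<in> borel_measurable borel"
    "\<bar>smear n \<kappa> \<psi> z\<bar> \<le> indicator ({0..T} \<times> {-1..1}) z * (B' / \<delta> * \<Psi>)"
    "(\<lambda>n. smear n \<kappa> \<psi> z) \<longlonglongrightarrow> smear_lim \<kappa> \<psi> z"
    "smear_lim \<kappa> \<psi> \<in> borel_measurable borel" "\<bar>smear_lim \<kappa> \<psi> z\<bar> \<le> Cd * \<Psi>" for n z
    by (intro smear_properties[OF \<kappa> \<psi> \<Psi> _ \<delta>(2)]; use supp in blast)+
  have "(\<lambda>n. LINT z|lborel. v n z * smear n \<kappa> \<psi> z) \<longlonglongrightarrow> (LINT z|lborel. (g z - b z) * smear_lim \<kappa> \<psi> z)"
  proof (rule smear_pairing_weak_limit[OF vi v2 v2K _ sm(1,4,2) _ _ sm(3)])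
    show "(\<lambda>n. LINT z|lborel. v n z * h z) \<longlonglongrightarrow> (LINT z|lborel. (g z - b z) * h z)"
      if h: "h \<in> borel_measurable borel" "\<exists>B. \<forall>z. \<bar>h z\<bar> \<le> B" for h
      using tendsto_diff[OF weak[OF h] tendsto_const[of "LINT z|lborel. b z * h z"]] bh[OF f(1) h] bh[OF f(2) h] bh[OF b(4) h]
      by (simp add: v_def left_diff_distrib)
    show "{0..T} \<times> {-1..1::real} \<in> sets lborel"
      by (simp, intro borel_closed closed_Times) auto
    show "emeasure lborel ({0..T} \<times> {-1..1::real}) < \<infinity>"
      by (intro emeasure_bounded_finite bounded_Times) auto
  qed
  then have ev1: "eventually (\<lambda>n. dist (LINT z|lborel. v n z * smear n \<kappa> \<psi> z) (LINT z|lborel. (g z - b z) * smear_lim \<kappa> \<psi> z) < e / 8) sequentially"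
    by (rule tendstoD) (use e in auto)
  have ev2: "eventually (\<lambda>n. dist (emp_pairing n b \<psi>) (limit_pairing b \<psi>) < e / 8) sequentially"
    by (rule tendstoD[OF emp_pairing_continuous(1)[OF b(1-3) \<psi> \<Psi>]]) (use e in auto)
  have gb: "\<bar>LINT z|lborel. (g z - b z) * smear_lim \<kappa> \<psi> z\<bar> \<le> A * E"
  proof -
    have "\<bar>LINT z|lborel. (g z - b z) * smear_lim \<kappa> \<psi> z\<bar> \<le> A * (LINT z|lborel. \<bar>g z - b z\<bar>)"
      unfolding A_def by (rule integrable_times_bounded(2)[OF _ _ sm(5)]) (use f b sm(4) in auto)
    also have "\<dots> \<le> A * E" using b(5) A by (intro mult_left_mono) auto
    finally show ?thesis .
  qed
  have lb: "\<bar>limit_pairing g \<psi> - limit_pairing b \<psi>\<bar> \<le> A * E"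
  proof -
    have "\<bar>limit_pairing g \<psi> - limit_pairing b \<psi>\<bar> \<le> A * (LINT z|lborel. \<bar>g z - b z\<bar>)"
      unfolding A_def by (rule limit_pairing_diff[OF f(2) b(4) \<psi>m \<Psi>])
    also have "\<dots> \<le> A * E" using b(5) A by (intro mult_left_mono) auto
    finally show ?thesis .
  qed
  show "eventually (\<lambda>n. dist (emp_pairing n (f n) \<psi>) (limit_pairing g \<psi>) < e) sequentially"
    using ev1 ev2
  proof eventually_elim
    case (elim n)
    define W where "W = (\<lambda>t. s * (Q n t + 1) + w)"
    note ef = emp_pairing_spread(1)[OF f(1)[of n] f(3)[of n] \<psi>m \<Psi>]
    note eb = emp_pairing_continuous(2)[OF b(1-3) \<psi> \<Psi>, of n]
    have ev_eq: "(\<lambda>t. emp n t (\<lambda>y. v n (t, fst y) * \<psi> (t, y))) =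
        (\<lambda>t. emp n t (\<lambda>y. f n (t, fst y) * \<psi> (t, y)) - emp n t (\<lambda>y. b (t, fst y) * \<psi> (t, y)))"
      by (simp add: emp_def v_def left_diff_distrib sum_subtractf diff_divide_distrib)
    have iv: "integrable lborel (\<lambda>t. emp n t (\<lambda>y. v n (t, fst y) * \<psi> (t, y)))"
      unfolding ev_eq using ef eb by simp
    have Qi: "integrable lborel (\<lambda>t. indicator {0..T} t * Q n t)"
      using integrable_times_bounded(1)[OF Q(1), of "indicator {0..T}" 1] by (simp add: mult.commute)
    have Ii: "integrable lborel (\<lambda>t. indicator {0..T} t * a)" for a :: real
      by (auto intro!: integrable_mult_left integrable_real_indicator simp: emeasure_lborel_Icc_eq)
    have W_eq: "indicator {0..T} t * W t = s * (indicator {0..T} t * Q n t) + indicator {0..T} t * (s + w)" for t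
      by (simp add: W_def algebra_simps)
    have Wi: "integrable lborel (\<lambda>t. indicator {0..T} t * W t)"
      unfolding W_eq using Qi Ii by simp
    have "\<bar>emp_pairing n (v n) \<psi> - (LINT z|lborel. v n z * smear n \<kappa> \<psi> z)\<bar> \<le> \<Psi> * (LINT t|lborel. indicator {0..T} t * W t)"
    proof (rule emp_pairing_smear_error[OF vi iv _ Wi _ \<kappa> \<psi> \<Psi> supp \<delta>(2,1)])
      fix t x y assume a: "t \<in> {0<..<T}" "x \<in> Omega" "y \<in> Omega" "\<bar>x - y\<bar> \<le> \<delta>"
      have "\<bar>f n (t, x) - f n (t, y)\<bar> \<le> s * (Q n t + 1)"
        using a s(1) by (intro mod) (auto simp: \<delta>_def)
      moreover have "\<bar>b (t, x) - b (t, y)\<bar> < w"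
        using \<delta>b(2)[of "(t, x)" "(t, y)"] a(4) \<delta>(3) by (simp add: dist_prod_def dist_real_def)
      ultimately show "\<bar>v n (t, x) - v n (t, y)\<bar> \<le> W t" by (simp add: v_def W_def)
    next
      show "0 \<le> W t" for t using s(1) w(1) Q(2)[of n t] by (simp add: W_def)
    qed
    also have "\<dots> \<le> e / 4"
    proof -
      have "(LINT t|lborel. indicator {0..T} t * Q n t) \<le> (LINT t|lborel. Q n t)"
        using Qi Q by (intro integral_mono) (auto simp: indicator_def)
      also have "\<dots> \<le> K" by (rule Q(3))
      finally have "(LINT t|lborel. indicator {0..T} t * W t) \<le> s * K + T * (s + w)"
        unfolding W_eq using Qi Ii s(1) T by simp
      then have "\<Psi> * (LINT t|lborel. indicator {0..T} t * W t) \<le> \<Psi> * (K + T) * s + \<Psi> * T * w"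
        using mult_left_mono[OF _ \<Psi>0] by (fastforce simp: algebra_simps)
      also have "\<dots> \<le> \<Psi> * (K + T) * s0 + \<Psi> * T * w"
        using s(2) \<Psi>0 K0 T by (intro add_right_mono mult_left_mono) auto
      finally show ?thesis using s0(2) w(2) by linarith
    qed
    finally have 1: "\<bar>emp_pairing n (v n) \<psi> - (LINT z|lborel. v n z * smear n \<kappa> \<psi> z)\<bar> \<le> e / 4" .
    have 2: "emp_pairing n (v n) \<psi> = emp_pairing n (f n) \<psi> - emp_pairing n b \<psi>"
      unfolding emp_pairing_def ev_eq using ef eb by simp
    show ?case using 1 2 elim gb lb E(2) e unfolding dist_real_def by linarith
  qed
qed

end

section \<open>Consequences of the microscopic equations\<close>

lemma weak_d_has_weak_deriv: "has_L2_deriv U b f \<Longrightarrow> has_weak_deriv U b f (weak_d U b f)"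
  unfolding has_L2_deriv_def weak_d_def by (metis someI)

text \<open>Local integrability speaks only of compact subsets; an exhaustion of the open set by
  compact sets recovers measurability on all of it.\<close>

lemma loc_integrable_measurable:
  assumes f: "loc_integrable U f" and U: "open U"
  shows "(\<lambda>z. indicator U z * f z) \<in> borel_measurable borel"
proof -
  obtain C where C: "\<And>n. compact (C n)" "\<And>n. C n \<subseteq> U" "\<And>n. C n \<subseteq> interior (C (Suc n))"
    "\<Union> (range C) = U" "\<And>K. compact K \<Longrightarrow> K \<subseteq> U \<Longrightarrow> \<exists>N. \<forall>n\<ge>N. K \<subseteq> C n"
    by (rule open_Union_compact_subsets[OF U]) (rule that)
  show ?thesis
  proof (rule borel_measurable_LIMSEQ_real[where u = "\<lambda>n z. indicator (C n) z * f z"])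
    show "(\<lambda>z. indicator (C n) z * f z) \<in> borel_measurable borel" for n
    proof -
      have "integrable lborel (\<lambda>z. indicator (C n) z * f z)"
        using f C(1,2) by (simp add: loc_integrable_def set_integrable_def)
      then show ?thesis by (auto dest: borel_measurable_integrable)
    qed
    show "(\<lambda>n. indicator (C n) z * f z) \<longlonglongrightarrow> indicator U z * f z" for z
    proof (cases "z \<in> U")
      case True
      then obtain N where "\<And>n. n \<ge> N \<Longrightarrow> z \<in> C n" using C(5)[of "{z}"] by auto
      then show ?thesis using True by (intro tendsto_eventually eventually_sequentiallyI[of N]) auto
    next
      case False
      then have "z \<notin> C n" for n using C(2)[of n] by blast
      then show ?thesis using False by simp
    qed
  qed
qed

text \<open>The profile that rises affinely from 0 to 1 across one gap. The extended gas stress,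
  constant in bubbles and affine in gaps, is a combination of such profiles.\<close>

definition ramp :: "real \<Rightarrow> real \<Rightarrow> real \<Rightarrow> real" where
  "ramp p r x = max 0 (min 1 ((x - p) / (r - p)))"

lemma ramp_simps:
  assumes "p < r"
  shows "x \<le> p \<Longrightarrow> ramp p r x = 0" "r \<le> x \<Longrightarrow> ramp p r x = 1" "p \<le> x \<Longrightarrow> x \<le> r \<Longrightarrow> ramp p r x = (x - p) / (r - p)"
  using assms by (auto simp: ramp_def divide_nonpos_pos pos_le_divide_eq max_def min_def)

text \<open>The fundamental theorem is applied to \<open>(x - p) \<phi>\<close> on the rising part
  and to \<open>\<phi>\<close> on the plateau; the two boundary terms at \<open>r\<close>
  cancel.\<close>

lemma ramp_integral_by_parts:
  fixes \<phi> \<phi>' :: "real \<Rightarrow> real"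
  assumes \<phi>: "\<And>x. (\<phi> has_real_derivative \<phi>' x) (at x)" and \<phi>': "continuous_on UNIV \<phi>'"
    and M: "\<And>x. \<bar>x\<bar> \<ge> M \<Longrightarrow> \<phi> x = 0" "\<And>x. \<bar>x\<bar> \<ge> M \<Longrightarrow> \<phi>' x = 0" and pr: "p < r"
  shows "(LINT x|lborel. ramp p r x * \<phi>' x) = - (LINT x|lborel. indicator {p<..<r} x / (r - p) * \<phi> x)"
proof -
  define L where "L = \<bar>M\<bar> + \<bar>r\<bar>"
  have L: "r \<le> L" "\<bar>L\<bar> \<ge> M" by (auto simp: L_def)
  have \<phi>c: "continuous_on UNIV \<phi>"
    using \<phi> by (auto intro!: continuous_at_imp_continuous_on DERIV_isCont)
  have I1: "(LINT x|lborel. indicator {p..r} x *\<^sub>R ((x - p) * \<phi>' x + \<phi> x)) = (r - p) * \<phi> r - (p - p) * \<phi> p"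
  proof (rule integral_FTC_Icc)
    show "((\<lambda>x. (x - p) * \<phi> x) has_vector_derivative (x - p) * \<phi>' x + \<phi> x) (at x within {p..r})" for x
      unfolding has_real_derivative_iff_has_vector_derivative[symmetric]
      using has_field_derivative_at_within[OF \<phi>[of x]] by (auto intro!: derivative_eq_intros)
  qed (use pr in \<open>auto intro!: continuous_intros continuous_on_subset[OF \<phi>'] continuous_on_subset[OF \<phi>c]\<close>)
  have I2: "(LINT x|lborel. indicator {r..L} x *\<^sub>R \<phi>' x) = \<phi> L - \<phi> r"
    by (rule integral_FTC_Icc)
       (use L \<phi> in \<open>auto simp: has_real_derivative_iff_has_vector_derivative
          intro: has_vector_derivative_at_within continuous_on_subset[OF \<phi>']\<close>)
  have i: "integrable lborel (\<lambda>x. indicator {a..b} x *\<^sub>R h x)" if "continuous_on UNIV h" for a b and h :: "real \<Rightarrow> real"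
    by (rule borel_integrable_compact) (use that in \<open>auto intro: continuous_on_subset\<close>)
  have i1: "integrable lborel (\<lambda>x. indicator {p..r} x *\<^sub>R ((x - p) * \<phi>' x + \<phi> x))"
    by (intro i continuous_intros \<phi>' \<phi>c)
  note i2 = i[OF \<phi>c, of p r] and i3 = i[OF \<phi>', of r L]
  have [measurable]: "\<phi> \<in> borel_measurable borel" "\<phi>' \<in> borel_measurable borel"
    by (intro borel_measurable_continuous_onI \<phi>c \<phi>')+
  have "(LINT x|lborel. ramp p r x * \<phi>' x) = (LINT x|lborel. 1 / (r - p) * (indicator {p..r} x *\<^sub>R ((x - p) * \<phi>' x + \<phi> x))
      - 1 / (r - p) * (indicator {p..r} x *\<^sub>R \<phi> x) + indicator {r..L} x *\<^sub>R \<phi>' x)"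
  proof (rule integral_cong_AE)
    show "AE x in lborel. ramp p r x * \<phi>' x = 1 / (r - p) * (indicator {p..r} x *\<^sub>R ((x - p) * \<phi>' x + \<phi> x))
      - 1 / (r - p) * (indicator {p..r} x *\<^sub>R \<phi> x) + indicator {r..L} x *\<^sub>R \<phi>' x"
      using AE_lborel_singleton[of r]
    proof eventually_elim
      case (elim x)
      consider "x < p" | "p \<le> x" "x < r" | "r < x" "x \<le> L" | "L < x" using elim by force
      then show ?case
      proof cases
        case 4
        then have "\<bar>x\<bar> \<ge> M" by (auto simp: L_def)
        then show ?thesis using 4 L(1) by (simp add: M(2))
      qed (use pr L in \<open>auto simp: ramp_simps add_divide_distrib\<close>)
    qed
  qed (auto simp: ramp_def)
  also have "\<dots> = - (LINT x|lborel. 1 / (r - p) * (indicator {p..r} x *\<^sub>R \<phi> x))"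
    using i1 i2 i3 pr by (simp add: I1[unfolded real_scaleR_def] I2[unfolded real_scaleR_def] M(1)[OF L(2)])
  also have "(LINT x|lborel. 1 / (r - p) * (indicator {p..r} x *\<^sub>R \<phi> x)) = (LINT x|lborel. indicator {p<..<r} x / (r - p) * \<phi> x)"
  proof (rule integral_cong_AE)
    show "AE x in lborel. 1 / (r - p) * (indicator {p..r} x *\<^sub>R \<phi> x) = indicator {p<..<r} x / (r - p) * \<phi> x"
      using AE_lborel_singleton[of p] AE_lborel_singleton[of r] by eventually_elim (auto simp: indicator_def)
  qed auto
  finally show ?thesis .
qed

lemma ramp_increment:
  assumes pr: "p < r" and xy: "x \<le> y"
  shows "ramp p r y - ramp p r x = (LINT z|lborel. indicator {p<..<r} z / (r - p) * indicator {x..y} z)"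
proof -
  have "(LINT z|lborel. indicator {p<..<r} z / (r - p) * indicator {x..y} z) = (LINT z|lborel. 1 / (r - p) * indicator {max p x..min r y} z)"
  proof (rule integral_cong_AE)
    show "AE z in lborel. indicator {p<..<r} z / (r - p) * indicator {x..y} z = 1 / (r - p) * indicator {max p x..min r y} z"
      using AE_lborel_singleton[of p] AE_lborel_singleton[of r] by eventually_elim (auto simp: indicator_def)
  qed auto
  also have "\<dots> = 1 / (r - p) * max 0 (min r y - max p x)"
    by (cases "max p x \<le> min r y") auto
  also have "\<dots> = ramp p r y - ramp p r x"
  proof -
    consider "y \<le> p" | "r \<le> x" | "x \<le> p" "p \<le> y" "y \<le> r" | "x \<le> p" "r \<le> y" | "p \<le> x" "y \<le> r" | "p \<le> x" "x \<le> r" "r \<le> y"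
      using xy by linarith
    then show ?thesis
    proof cases
      case 6
      then show ?thesis using pr xy by (auto simp: ramp_simps max_def min_def field_simps)
    qed (use pr xy in \<open>auto simp: ramp_simps max_def min_def diff_divide_distrib\<close>)
  qed
  finally show ?thesis ..
qed

text \<open>A single member of the family. Here \<open>n\<close> is the number of bubbles, whereas
  in \<open>separated_bubbles\<close> it is the index in the sequence. The data hypotheses are
  reduced to positive masses and the values of the extended initial data inside the bubbles.\<close>

locale micro_solution =
  fixes P :: phys and n :: nat and T d :: real and rho0 u0 :: "real \<Rightarrow> real" and D :: micro_data and s :: micro_sol
    and K rho_lo rho_hi :: real
  assumes P: "phys_ok P" and n: "n \<ge> 1" and T: "T > 0" and d: "d > 0"
    and sol: "classical_solution P n T rho0 u0 D s"
    and bounds: "uniform_bounds P T K d rho_lo rho_hi n D s"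
    and ext: "extended_solution P n T rho0 D s"
    and mass_pos: "\<And>k. k \<in> {1..n} \<Longrightarrow> mass D k > 0"
    and init: "\<And>k x. k \<in> {1..n} \<Longrightarrow> x \<in> bubble (c_init D) (R_init D) k \<Longrightarrow>
      f_g_init D x = 1 / (2 * n * R_init D k) \<and> rho_g_init D x = mass D k / (2 * R_init D k)"
begin

lemma mu_g_pos: "mu_g P > 0" using P by (simp add: phys_ok_def)

section \<open>Geometry of the ordered bubbles and gaps\<close>

lemma rad_pos: "t \<in> {0..T} \<Longrightarrow> k \<in> {1..n} \<Longrightarrow> rad s k t > 0"
  and gap_pos: "t \<in> {0..T} \<Longrightarrow> k \<le> n \<Longrightarrow> xp s t k < xm n s t (k + 1)"
  using sol by (auto simp: classical_solution_def Let_def)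

lemma xp_eq: "k \<ge> 1 \<Longrightarrow> xp s t k = cen s k t + rad s k t" "xp s t 0 = -1"
  and xm_eq: "k \<le> n \<Longrightarrow> xm n s t k = cen s k t - rad s k t" "xm n s t (n + 1) = 1"
  by (auto simp: x_plus_def x_minus_def cs_def Rs_def)

lemma xm_less_xp: "t \<in> {0..T} \<Longrightarrow> k \<in> {1..n} \<Longrightarrow> xm n s t k < xp s t k"
  using rad_pos[of t k] by (simp add: xp_eq xm_eq)

lemma xp_mono:
  assumes t: "t \<in> {0..T}" and "j \<le> k" "k \<le> n"
  shows "xp s t j \<le> xp s t k"
  using assms(2,3)
proof (induction k rule: dec_induct)
  case (step m)
  then have "xp s t m < xm n s t (Suc m)" "xm n s t (Suc m) < xp s t (Suc m)"
    using gap_pos[OF t, of m] xm_less_xp[OF t, of "Suc m"] by auto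
  then show ?case using step by linarith
qed simp

lemma xp_less_xm:
  assumes t: "t \<in> {0..T}" and "j < k" "k \<le> n + 1"
  shows "xp s t j < xm n s t k"
proof -
  have "xp s t j \<le> xp s t (k - 1)" using assms by (intro xp_mono) auto
  also have "\<dots> < xm n s t k" using gap_pos[OF t, of "k - 1"] assms by simp
  finally show ?thesis .
qed

lemma xm_mono:
  assumes t: "t \<in> {0..T}" and "1 \<le> j" "j \<le> k" "k \<le> n + 1"
  shows "xm n s t j \<le> xm n s t k"
proof (cases "j = k")
  case False
  then have "xm n s t j < xp s t j" "xp s t j < xm n s t k"
    using assms xm_less_xp[OF t, of j] xp_less_xm[OF t, of j k] by auto
  then show ?thesis by simp
qed simp

lemma ordered: "t \<in> {0..T} \<Longrightarrow> k \<in> {1..n} \<Longrightarrow> l \<in> {1..n} \<Longrightarrow> k < l \<Longrightarrow>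
    cen s k t + rad s k t \<le> cen s l t - rad s l t"
  using xp_less_xm[of t k l] by (simp add: xp_eq xm_eq)

lemma inside: "t \<in> {0..T} \<Longrightarrow> k \<in> {1..n} \<Longrightarrow> -1 < cen s k t - rad s k t \<and> cen s k t + rad s k t < 1"
  using xp_less_xm[of t 0 k] xp_less_xm[of t k "n + 1"] xp_eq(1)[of k t] xm_eq(1)[of k t] xm_eq(2)[of t] xp_eq(2)[of t]
  by auto

lemma radius: "t \<in> {0..T} \<Longrightarrow> k \<in> {1..n} \<Longrightarrow> d \<le> n * rad s k t \<and> n * rad s k t \<le> 1 / d"
  using bounds by (auto simp: uniform_bounds_def Let_def)

lemma closure_bubble:
  "t \<in> {0..T} \<Longrightarrow> k \<in> {1..n} \<Longrightarrow> closure (bubble (cs s t) (Rs s t) k) = {xm n s t k..xp s t k}"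
  using rad_pos[of t k] by (simp add: bubble_def cs_def Rs_def xp_eq xm_eq)

lemma gap_eq: "gap n (cs s t) (Rs s t) k = {xp s t k<..<xm n s t (k + 1)}"
  by (simp add: gap_def)

lemma not_in_gap:
  assumes "t \<in> {0..T}" "k \<in> {1..n}" "j \<le> n" "x \<in> {xm n s t k..xp s t k}"
  shows "x \<notin> {xp s t j<..<xm n s t (j + 1)}"
  using xm_mono[of t "j + 1" k] xp_mono[of t k j] assms by (cases "j < k") auto

lemma in_bubble_iff:
  assumes t: "t \<in> {0..T}" and k: "k \<in> {1..n}" "j \<in> {1..n}" and x: "x \<in> {xm n s t k..xp s t k}"
  shows "x \<in> {xm n s t j..xp s t j} \<longleftrightarrow> j = k"
  using xp_less_xm[OF t, of j k] xp_less_xm[OF t, of k j] k x by (cases j k rule: linorder_cases) auto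

lemma not_in_bubble:
  assumes t: "t \<in> {0..T}" and k: "k \<in> {1..n}" and j: "j \<le> n" and x: "x \<in> {xp s t j<..<xm n s t (j + 1)}"
  shows "x \<notin> {xm n s t k..xp s t k}"
  using not_in_gap[OF t k j] x by blast

lemma in_gap_iff:
  assumes t: "t \<in> {0..T}" and k: "k \<le> n" "j \<le> n" and x: "x \<in> {xp s t k<..<xm n s t (k + 1)}"
  shows "x \<in> {xp s t j<..<xm n s t (j + 1)} \<longleftrightarrow> j = k"
proof (cases j k rule: linorder_cases)
  case less
  then have "xm n s t (j + 1) < xp s t (j + 1)" "xp s t (j + 1) \<le> xp s t k"
    using xm_less_xp[OF t, of "j + 1"] xp_mono[OF t, of "j + 1" k] k by auto
  then show ?thesis using x less by auto
next
  case greater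
  then have "xm n s t (k + 1) < xp s t (k + 1)" "xp s t (k + 1) \<le> xp s t j"
    using xm_less_xp[OF t, of "k + 1"] xp_mono[OF t, of "k + 1" j] k by auto
  then show ?thesis using x greater by auto
qed (use x in auto)

lemma location:
  assumes t: "t \<in> {0..T}" and x: "x \<in> Omega"
  obtains k where "k \<in> {1..n}" "x \<in> {xm n s t k..xp s t k}" | k where "k \<le> n" "x \<in> {xp s t k<..<xm n s t (k + 1)}"
proof -
  \<comment> \<open>The last bubble whose right end is at or left of \<open>x\<close>. The
    convention \<open>xp s t 0 = -1\<close> puts the index 0 into the set, so the maximum
    exists.\<close>
  define j where "j = Max {k. k \<le> n \<and> xp s t k \<le> x}"
  have fin: "finite {k. k \<le> n \<and> xp s t k \<le> x}" by simp
  have "0 \<in> {k. k \<le> n \<and> xp s t k \<le> x}" using x by (simp add: xp_eq Omega_def)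
  then have "j \<in> {k. k \<le> n \<and> xp s t k \<le> x}" unfolding j_def using fin by (intro Max_in) auto
  then have j: "j \<le> n" "xp s t j \<le> x" by auto
  have nxt: "x < xp s t (j + 1)" if "j < n"
  proof (rule ccontr)
    assume "\<not> x < xp s t (j + 1)"
    with that have "j + 1 \<in> {k. k \<le> n \<and> xp s t k \<le> x}" by simp
    then have "j + 1 \<le> j" unfolding j_def using fin by (intro Max_ge)
    then show False by simp
  qed
  consider "x = xp s t j" | "xp s t j < x" "x < xm n s t (j + 1)" | "x \<ge> xm n s t (j + 1)" using j by linarith
  then show thesis
  proof cases
    case 1
    then have "j \<noteq> 0" using x xp_eq(2)[of t] by (intro notI) (auto simp: Omega_def)
    then show thesis using that(1)[of j] xm_less_xp[OF t, of j] 1 j by auto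
  next
    case 2
    then show thesis using that(2)[of j] j by auto
  next
    case 3
    then have "j < n" using x j xm_eq(2)[of t] by (cases "j = n") (auto simp: Omega_def)
    then show thesis using that(1)[of "j + 1"] 3 nxt by auto
  qed
qed

section \<open>Values of the extended fields in bubbles and gaps\<close>

lemma u_ext_bubble:
  assumes t: "t \<in> {0..T}" and k: "k \<in> {1..n}" and x: "x \<in> {xm n s t k..xp s t k}"
  shows "u_ext n T s (t, x) = tder T (cen s k) t + tder T (rad s k) t / rad s k t * (x - cen s k t)"
proof -
  have ind: "indicator (closure (bubble (cs s t) (Rs s t) j)) x = (if j = k then 1 else (0::real))" if "j \<in> {1..n}" for j
    using in_bubble_iff[OF t k that x] by (simp add: closure_bubble[OF t that] indicator_def)
  have "x \<in> closure (bubble (cs s t) (Rs s t) k)" using closure_bubble[OF t k] x by simp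
  then have "x \<notin> fluid_at n s t" using k by (auto simp: fluid_at_def fluid_def)
  moreover have "(\<Sum>j\<in>{1..n}. indicator (closure (bubble (cs s t) (Rs s t) j)) x *
        (tder T (cen s j) t + tder T (rad s j) t / rad s j t * (x - cen s j t))) =
     (\<Sum>j\<in>{1..n}. if j = k then tder T (cen s k) t + tder T (rad s k) t / rad s k t * (x - cen s k t) else 0)"
    by (rule sum.cong[OF refl]) (simp add: ind del: atLeastAtMost_iff)
  ultimately show ?thesis using k by (simp add: u_ext_def)
qed

abbreviation "\<Sigma> \<equiv> bubble_stress P n T D s"

lemma stress_g_ext_bubble:
  assumes t: "t \<in> {0..T}" and k: "k \<in> {1..n}" and x: "x \<in> {xm n s t k..xp s t k}"
  shows "stress_g_ext P n T D s (t, x) = \<Sigma> k t"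
proof -
  have ind: "indicator (closure (bubble (cs s t) (Rs s t) j)) x = (if j = k then 1 else (0::real))" if "j \<in> {1..n}" for j
    using in_bubble_iff[OF t k that x] by (simp add: closure_bubble[OF t that] indicator_def)
  have gap0: "indicator (gap n (cs s t) (Rs s t) j) x = (0::real)" if "j \<le> n" for j
    using not_in_gap[OF t k that x] by (simp add: gap_eq)
  have "(\<Sum>j\<in>{1..n}. indicator (closure (bubble (cs s t) (Rs s t) j)) x * \<Sigma> j t) = (\<Sum>j\<in>{1..n}. if j = k then \<Sigma> k t else 0)"
    by (rule sum.cong[OF refl]) (simp add: ind del: atLeastAtMost_iff)
  moreover have "(\<Sum>j\<in>{1..n - 1}. indicator (gap n (cs s t) (Rs s t) j) x * A j) = 0" for A :: "nat \<Rightarrow> real"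
    by (rule sum.neutral) (auto simp: gap0)
  ultimately show ?thesis using k by (simp add: stress_g_ext_def gap0)
qed

lemma stress_g_ext_gap:
  assumes t: "t \<in> {0..T}" and k: "k \<le> n" and x: "x \<in> {xp s t k<..<xm n s t (k + 1)}"
  shows "stress_g_ext P n T D s (t, x) =
    (if k = 0 then \<Sigma> 1 t else if k = n then \<Sigma> n t
     else affine_interp (xp s t k) (\<Sigma> k t) (xm n s t (k + 1)) (\<Sigma> (k + 1) t) x)"
proof -
  have ind: "indicator (closure (bubble (cs s t) (Rs s t) j)) x = (0::real)" if "j \<in> {1..n}" for j
    using not_in_bubble[OF t that k x] by (simp add: closure_bubble[OF t that] indicator_def)
  have gp: "indicator (gap n (cs s t) (Rs s t) j) x = (if j = k then 1 else (0::real))" if "j \<le> n" for j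
    using in_gap_iff[OF t k that x] by (simp add: gap_eq indicator_def)
  have "(\<Sum>j\<in>{1..n}. indicator (closure (bubble (cs s t) (Rs s t) j)) x * \<Sigma> j t) = 0"
    by (rule sum.neutral) (simp add: ind)
  moreover have "(\<Sum>j\<in>{1..n - 1}. indicator (gap n (cs s t) (Rs s t) j) x * A j) = (if k \<in> {1..n - 1} then A k else 0)"
    for A :: "nat \<Rightarrow> real"
  proof -
    have "(\<Sum>j\<in>{1..n - 1}. indicator (gap n (cs s t) (Rs s t) j) x * A j) = (\<Sum>j\<in>{1..n - 1}. if j = k then A k else 0)"
      by (rule sum.cong[OF refl]) (auto simp: gp)
    then show ?thesis by simp
  qed
  ultimately show ?thesis using k n by (auto simp: stress_g_ext_def gp)
qed

subsection \<open>Regularity in time\<close>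

lemma H2_time_D:
  assumes "H2_time T f" "t \<in> {0..T}"
  shows "(f has_real_derivative tder T f t) (at t within {0..T})"
  using assms unfolding H2_time_def differentiable_on_def tder_def
  by (auto simp: has_real_derivative_iff_has_vector_derivative vector_derivative_works[symmetric])

lemma cen_deriv: "k \<in> {1..n} \<Longrightarrow> t \<in> {0..T} \<Longrightarrow> (cen s k has_real_derivative tder T (cen s k) t) (at t within {0..T})"
  and rad_deriv: "k \<in> {1..n} \<Longrightarrow> t \<in> {0..T} \<Longrightarrow> (rad s k has_real_derivative tder T (rad s k) t) (at t within {0..T})"
  and tder_cen_cont: "k \<in> {1..n} \<Longrightarrow> continuous_on {0..T} (tder T (cen s k))"
  and tder_rad_cont: "k \<in> {1..n} \<Longrightarrow> continuous_on {0..T} (tder T (rad s k))"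
  using sol by (auto simp: classical_solution_def Let_def H2_time_def intro!: H2_time_D)

lemma cen_cont: "k \<in> {1..n} \<Longrightarrow> continuous_on {0..T} (cen s k)"
  and rad_cont: "k \<in> {1..n} \<Longrightarrow> continuous_on {0..T} (rad s k)"
  by (rule DERIV_continuous_on[OF cen_deriv] DERIV_continuous_on[OF rad_deriv]; assumption)+

text \<open>The value of \<open>kappa\<close> after cancellation of the radius, which the linear gas
  pressure makes possible; it is visibly constant in time.\<close>

definition "kap k = (a_g P)\<^sup>2 * mass D k / 2 + gamma_s_bar P / (2 * n)"

lemma kappa_eq: "R \<noteq> 0 \<Longrightarrow> kappa P n (mass D k) R = kap k"
  using n by (simp add: kappa_def p_g_def gamma_s_def kap_def field_simps)

lemma stress_eq: "t \<in> {0..T} \<Longrightarrow> k \<in> {1..n} \<Longrightarrow> \<Sigma> k t = (mu_g P * tder T (rad s k) t - kap k) / rad s k t"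
  using rad_pos[of t k] by (simp add: bubble_stress_def kappa_eq diff_divide_distrib)

lemma stress_cont: "k \<in> {1..n} \<Longrightarrow> continuous_on {0..T} (\<Sigma> k)"
proof -
  assume k: "k \<in> {1..n}"
  have "continuous_on {0..T} (\<lambda>t. (mu_g P * tder T (rad s k) t - kap k) / rad s k t)"
    by (intro continuous_intros tder_rad_cont rad_cont k) (use rad_pos[OF _ k] in force)
  then show ?thesis by (rule continuous_on_cong[THEN iffD1, OF refl stress_eq[symmetric], rotated -1]) (use k in auto)
qed

lemma rad_ode: "t \<in> {0..T} \<Longrightarrow> k \<in> {1..n} \<Longrightarrow> tder T (rad s k) t = (rad s k t * \<Sigma> k t + kap k) / mu_g P"
  using rad_pos[of t k] mu_g_pos by (simp add: stress_eq)

subsection \<open>The extended gas density in a bubble\<close>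

text \<open>A point with fixed relative position \<open>y\<close> in the bubble moves with the
  extended velocity, and around its path both the velocity and the stress are given by continuous
  functions of time. \<open>w\<close>, \<open>v\<close> and \<open>f\<close> are kept general so
  that the result covers the density and the covolume.\<close>

lemma transport_in_bubble:
  assumes w: "transport_solution T (u_ext n T s) w (\<lambda>z. - (w z / mu_g P) * (stress_g_ext P n T D s z + p_g P (v z) + a * f z)) w0"
    and V: "continuous_on ({0..T} \<times> {-1..1}) v" "continuous_on ({0..T} \<times> {-1..1}) f"
    and k: "k \<in> {1..n}" and y: "\<bar>y\<bar> < 1" and t: "t \<in> {0..T}"
  shows "((\<lambda>\<tau>. w (\<tau>, cen s k \<tau> + rad s k \<tau> * y)) has_real_derivative
    - (w (t, cen s k t + rad s k t * y) / mu_g P) *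
      (\<Sigma> k t + p_g P (v (t, cen s k t + rad s k t * y)) + a * f (t, cen s k t + rad s k t * y))) (at t within {0..T})"
proof -
  define X where "X = (\<lambda>\<tau>. cen s k \<tau> + rad s k \<tau> * y)"
  define B where "B = (\<lambda>\<tau>. tder T (rad s k) \<tau> / rad s k \<tau>)"
  \<comment> \<open>The velocity \<open>c' + B (x - c)\<close> of the bubble in the form
    \<open>A + B x\<close>.\<close>
  define A where "A = (\<lambda>\<tau>. tder T (cen s k) \<tau> - B \<tau> * cen s k \<tau>)"
  define G where "G = (\<lambda>z. - (w z / mu_g P) * (\<Sigma> k (fst z) + p_g P (v z) + a * f z))"
  \<comment> \<open>A lower bound, uniform in time, for the distance of the path from the bubble
    boundary: relative distance \<open>1 - \<bar>y\<bar>\<close> times the least radius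
    \<open>d / n\<close>.\<close>
  define r where "r = (1 - \<bar>y\<bar>) * (d / n)"
  have wc: "continuous_on ({0..T} \<times> {-1..1}) w" using w by (simp add: transport_solution_def)
  have wd: "has_weak_deriv (cyl T) (1,0) w (weak_d (cyl T) (1,0) w)" "has_weak_deriv (cyl T) (0,1) w (weak_d (cyl T) (0,1) w)"
    using w by (auto simp: transport_solution_def H1_tx_def intro: weak_d_has_weak_deriv)
  have Rr: "(1 - \<bar>y\<bar>) * rad s k \<tau> \<ge> r" if "\<tau> \<in> {0..T}" for \<tau>
    unfolding r_def using radius[OF that k] y n by (intro mult_left_mono) (auto simp: field_simps)
  have Bc: "continuous_on {0..T} B"
    unfolding B_def by (intro continuous_intros tder_rad_cont rad_cont k) (use rad_pos[OF _ k] in force)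
  have "((\<lambda>\<tau>. w (\<tau>, X \<tau>)) has_real_derivative G (t, X t)) (at t within {0..T})"
  proof (rule weak_transport_along_characteristic[OF T wd wc _ _ Bc _ _ _ _ t])
    show "continuous_on ({0..T} \<times> {-1..1}) G"
      unfolding G_def p_g_def
      by (intro continuous_intros wc V continuous_on_compose2[OF stress_cont[OF k]]) (use mu_g_pos in auto)
    show "continuous_on {0..T} A"
      unfolding A_def by (intro continuous_intros tder_cen_cont Bc cen_cont k)
    show "r > 0" unfolding r_def using y d n by simp
    show "(X has_real_derivative A \<tau> + B \<tau> * X \<tau>) (at \<tau> within {0..T})" if "\<tau> \<in> {0..T}" for \<tau>
    proof -
      have "(X has_real_derivative tder T (cen s k) \<tau> + tder T (rad s k) \<tau> * y) (at \<tau> within {0..T})"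
        unfolding X_def using cen_deriv[OF k that] rad_deriv[OF k that] by (auto intro!: derivative_eq_intros)
      moreover have "A \<tau> + B \<tau> * X \<tau> = tder T (cen s k) \<tau> + tder T (rad s k) \<tau> * y"
        using rad_pos[OF that k] by (simp add: A_def B_def X_def field_simps)
      ultimately show ?thesis by simp
    qed
    have dist: "\<bar>X \<tau> - cen s k \<tau>\<bar> \<le> rad s k \<tau> - r" if "\<tau> \<in> {0..T}" for \<tau>
      using Rr[OF that] rad_pos[OF that k] by (simp add: X_def abs_mult algebra_simps)
    show "-1 < X \<tau> - r \<and> X \<tau> + r < 1" if "\<tau> \<in> {0..T}" for \<tau>
      using dist[OF that] inside[OF that k] by linarith
    have "AE z\<in>cyl T in lborel. weak_d (cyl T) (1,0) w z + u_ext n T s z * weak_d (cyl T) (0,1) w z =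
       - (w z / mu_g P) * (stress_g_ext P n T D s z + p_g P (v z) + a * f z)"
      using w by (simp add: transport_solution_def)
    then show "AE z\<in>cyl T in lborel. \<bar>snd z - X (fst z)\<bar> < r \<longrightarrow>
        weak_d (cyl T) (1,0) w z + (A (fst z) + B (fst z) * snd z) * weak_d (cyl T) (0,1) w z = G z"
    proof eventually_elim
      case (elim z)
      show ?case
      proof (intro impI)
        assume z: "z \<in> cyl T" "\<bar>snd z - X (fst z)\<bar> < r"
        obtain \<tau> x where [simp]: "z = (\<tau>, x)" by (cases z)
        have \<tau>: "\<tau> \<in> {0..T}" using z by (auto simp: cyl_def)
        have x: "x \<in> {xm n s \<tau> k..xp s \<tau> k}"
          using dist[OF \<tau>] z(2) k by (simp add: xp_eq xm_eq) linarith
        show "weak_d (cyl T) (1,0) w z + (A (fst z) + B (fst z) * snd z) * weak_d (cyl T) (0,1) w z = G z"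
        proof -
          have "A \<tau> + B \<tau> * x = u_ext n T s (\<tau>, x)"
            by (simp add: u_ext_bubble[OF \<tau> k x] A_def B_def right_diff_distrib)
          then show ?thesis
            using elim z(1) by (simp add: stress_g_ext_bubble[OF \<tau> k x] G_def)
        qed
      qed
    qed
  qed
  then show ?thesis by (simp add: X_def G_def)
qed

text \<open>Integrating factor \<open>exp (- Q)\<close>, where \<open>Q\<close> is a primitive of
  the coefficient, frozen outside the interval.\<close>

lemma linear_ode_zero:
  fixes E h :: "real \<Rightarrow> real"
  assumes h: "continuous_on {0..T} h" and E: "\<And>t. t \<in> {0..T} \<Longrightarrow> (E has_real_derivative h t * E t) (at t within {0..T})"
    and 0: "E 0 = 0" and t: "t \<in> {0..T}"
  shows "E t = 0"
proof -
  define h' where "h' = (\<lambda>t. h (max 0 (min T t)))"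
  have "continuous_on UNIV h'"
    unfolding h'_def by (rule continuous_on_compose2[OF h]) (use T in \<open>auto intro!: continuous_intros\<close>)
  then obtain Q where Q: "\<And>x. (Q has_real_derivative h' x) (at x)" using antiderivative_exists by blast
  have "\<exists>c. \<forall>t\<in>{0..T}. E t * exp (- Q t) = c"
  proof (rule has_field_derivative_zero_constant)
    fix x assume x: "x \<in> {0..T}"
    have "max 0 (min T x) = x" using x by auto
    then have "h' x = h x" by (simp add: h'_def)
    then have "(Q has_real_derivative h x) (at x within {0..T})"
      using has_field_derivative_at_within[OF Q[of x]] by simp
    with E[OF x] show "((\<lambda>t. E t * exp (- Q t)) has_real_derivative 0) (at x within {0..T})"
      by (auto intro!: derivative_eq_intros)
  qed simp
  then obtain c where c: "\<And>t. t \<in> {0..T} \<Longrightarrow> E t * exp (- Q t) = c" by blast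
  from c[of 0] 0 T have "c = 0" by simp
  with c[OF t] show ?thesis by simp
qed

text \<open>Along the affine flow of a bubble, density \<open>p\<close> and covolume \<open>q\<close> satisfy
  \<open>(p R)' = -(p/\<mu>\<^sub>g) E\<close> and \<open>(q R)' = -(q/\<mu>\<^sub>g) E\<close> with the same defect \<open>E = a\<^sub>g\<^sup>2 p R + \<gamma> q R - \<kappa>\<close>.
  Hence \<open>E\<close> solves a homogeneous linear equation, and \<open>E = 0\<close> at \<open>t = 0\<close> by the choice of the data.\<close>

lemma rho_g_ext_bubble:
  assumes t: "t \<in> {0..T}" and k: "k \<in> {1..n}" and x: "x \<in> {xm n s t k<..<xp s t k}"
  shows "rho_g_ext s (t, x) = mass D k / (2 * rad s k t)"
proof -
  \<comment> \<open>The relative position of \<open>x\<close> in the bubble is carried along by the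
    affine flow, so the path through \<open>(t, x)\<close> can be followed back to the initial
    bubble, where the data are known.\<close>
  define y where "y = (x - cen s k t) / rad s k t"
  define X where "X = (\<lambda>\<tau>. cen s k \<tau> + rad s k \<tau> * y)"
  have y: "\<bar>y\<bar> < 1" using x k rad_pos[OF t k] by (simp add: y_def xp_eq xm_eq abs_less_iff field_simps)
  have Xt: "X t = x" using rad_pos[OF t k] by (simp add: X_def y_def)
  define p where "p = (\<lambda>\<tau>. rho_g_ext s (\<tau>, X \<tau>))"
  define q where "q = (\<lambda>\<tau>. f_g_ext s (\<tau>, X \<tau>))"
  define R where "R = rad s k"
  note ex = ext[unfolded extended_solution_def]
  have rc: "continuous_on ({0..T} \<times> {-1..1}) (rho_g_ext s)" and fc: "continuous_on ({0..T} \<times> {-1..1}) (f_g_ext s)"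
    using ex by (auto simp: transport_solution_def)
  have dp: "(p has_real_derivative - (p \<tau> / mu_g P) * (\<Sigma> k \<tau> + p_g P (p \<tau>) + gamma_s_bar P * q \<tau>)) (at \<tau> within {0..T})"
    and dq: "(q has_real_derivative - (q \<tau> / mu_g P) * (\<Sigma> k \<tau> + p_g P (p \<tau>) + gamma_s_bar P * q \<tau>)) (at \<tau> within {0..T})"
    if "\<tau> \<in> {0..T}" for \<tau>
    unfolding p_def q_def X_def
    by (rule transport_in_bubble[OF _ rc fc k y that, where ?w0.0 = "rho_g_init D"];
        use ex in blast)
       (rule transport_in_bubble[OF _ rc fc k y that, where ?w0.0 = "f_g_init D"]; use ex in blast)
  define E where "E = (\<lambda>\<tau>. (a_g P)\<^sup>2 * p \<tau> * R \<tau> + gamma_s_bar P * q \<tau> * R \<tau> - kap k)"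
  have dpR: "((\<lambda>\<tau>. p \<tau> * R \<tau>) has_real_derivative - (p \<tau> / mu_g P) * E \<tau>) (at \<tau> within {0..T})"
    and dqR: "((\<lambda>\<tau>. q \<tau> * R \<tau>) has_real_derivative - (q \<tau> / mu_g P) * E \<tau>) (at \<tau> within {0..T})"
    if \<tau>: "\<tau> \<in> {0..T}" for \<tau>
  proof -
    have eq: "- (a / mu_g P) * (\<Sigma> k \<tau> + p_g P (p \<tau>) + gamma_s_bar P * q \<tau>) * rad s k \<tau> + tder T (rad s k) \<tau> * a = - (a / mu_g P) * E \<tau>" for a
      unfolding rad_ode[OF \<tau> k] E_def p_g_def R_def using mu_g_pos by (simp add: field_simps)
    show "((\<lambda>\<tau>. p \<tau> * R \<tau>) has_real_derivative - (p \<tau> / mu_g P) * E \<tau>) (at \<tau> within {0..T})"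
      unfolding R_def by (rule DERIV_cong[OF DERIV_mult[OF dp[OF \<tau>] rad_deriv[OF k \<tau>]] eq])
    show "((\<lambda>\<tau>. q \<tau> * R \<tau>) has_real_derivative - (q \<tau> / mu_g P) * E \<tau>) (at \<tau> within {0..T})"
      unfolding R_def by (rule DERIV_cong[OF DERIV_mult[OF dq[OF \<tau>] rad_deriv[OF k \<tau>]] eq])
  qed
  have T0: "0 \<in> {0..T}" using T by simp
  have R0: "R 0 > 0" using rad_pos[OF T0 k] by (simp add: R_def)
  have in0: "cen s k 0 = c_init D k" "rad s k 0 = R_init D k"
    using sol k by (auto simp: classical_solution_def Let_def)
  have X0: "X 0 \<in> bubble (c_init D) (R_init D) k"
  proof -
    have "\<bar>R 0 * y\<bar> < R 0 * 1" unfolding abs_mult using R0 y by (intro mult_strict_left_mono[of _ _ "R 0", THEN order_le_less_trans[rotated]]) auto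
    then show ?thesis by (auto simp: bubble_def X_def in0[symmetric] R_def)
  qed
  have XO: "X 0 \<in> {-1..1}" using X0 inside[OF T0 k] by (auto simp: bubble_def in0[symmetric])
  have "p 0 = rho_g_init D (X 0)" "q 0 = f_g_init D (X 0)"
    using ex XO by (auto simp: transport_solution_def p_def q_def)
  then have p0: "p 0 = mass D k / (2 * R 0)" and q0: "q 0 = 1 / (2 * n * R 0)"
    using init[OF k X0] in0 by (auto simp: R_def)
  have pc: "continuous_on {0..T} p" and qc: "continuous_on {0..T} q"
    by (rule DERIV_continuous_on[OF dp] DERIV_continuous_on[OF dq]; assumption)+
  have E0: "E \<tau> = 0" if "\<tau> \<in> {0..T}" for \<tau>
  proof (rule linear_ode_zero[OF _ _ _ that])
    show "continuous_on {0..T} (\<lambda>\<tau>. - (((a_g P)\<^sup>2 * p \<tau> + gamma_s_bar P * q \<tau>) / mu_g P))"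
      by (intro continuous_intros pc qc) (use mu_g_pos in auto)
    show "(E has_real_derivative - (((a_g P)\<^sup>2 * p t + gamma_s_bar P * q t) / mu_g P) * E t) (at t within {0..T})"
      if "t \<in> {0..T}" for t
    proof -
      have "((\<lambda>\<tau>. (a_g P)\<^sup>2 * (p \<tau> * R \<tau>) + gamma_s_bar P * (q \<tau> * R \<tau>) - kap k) has_real_derivative
         (a_g P)\<^sup>2 * (- (p t / mu_g P) * E t) + gamma_s_bar P * (- (q t / mu_g P) * E t) - 0) (at t within {0..T})"
        by (intro DERIV_diff DERIV_add DERIV_cmult dpR dqR that DERIV_const)
      moreover have "(\<lambda>\<tau>. (a_g P)\<^sup>2 * (p \<tau> * R \<tau>) + gamma_s_bar P * (q \<tau> * R \<tau>) - kap k) = E"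
        by (simp add: E_def mult.assoc)
      moreover have "(a_g P)\<^sup>2 * (- (p t / mu_g P) * E t) + gamma_s_bar P * (- (q t / mu_g P) * E t) - 0 =
          - (((a_g P)\<^sup>2 * p t + gamma_s_bar P * q t) / mu_g P) * E t"
        using mu_g_pos by (simp add: field_simps)
      ultimately show ?thesis by simp
    qed
    show "E 0 = 0" using R0 n by (simp add: E_def p0 q0 kap_def field_simps)
  qed
  have "\<exists>c. \<forall>\<tau>\<in>{0..T}. p \<tau> * R \<tau> = c"
    by (rule has_field_derivative_zero_constant) (use dpR E0 in auto)
  then have "p t * R t = p 0 * R 0" using t T0 by metis
  also have "\<dots> = mass D k / 2" using R0 by (simp add: p0)
  finally have "p t * R t = mass D k / 2" .
  then show ?thesis using rad_pos[OF t k] Xt by (simp add: p_def R_def field_simps)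
qed

subsection \<open>The space derivative of the extended gas stress\<close>

definition gap_slope :: "nat \<Rightarrow> real \<Rightarrow> real" where
  "gap_slope k t = (\<Sigma> (k + 1) t - \<Sigma> k t) / (xm n s t (k + 1) - xp s t k)"

text \<open>Candidate for the weak space derivative of the extended gas stress. The stress is
  constant in the bubbles and in the two outermost gaps, hence the range of
  \<open>k\<close>.\<close>

definition slope :: "real \<times> real \<Rightarrow> real" where
  "slope = (\<lambda>(t, x). \<Sum>k\<in>{1..n - 1}. indicator {xp s t k<..<xm n s t (k + 1)} x * gap_slope k t)"

lemma gap_pos': "t \<in> {0..T} \<Longrightarrow> k \<in> {1..n - 1} \<Longrightarrow> xp s t k < xm n s t (k + 1)"
  using gap_pos[of t k] by auto

text \<open>Replaces the case distinction by a formula linear in the ramps, to which integration by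
  parts and increments apply term by term. Behind \<open>x\<close> every ramp equals 1, and the
  stress differences telescope.\<close>

lemma stress_g_ext_ramps:
  assumes t: "t \<in> {0..T}" and x: "x \<in> Omega"
  shows "stress_g_ext P n T D s (t, x) =
    \<Sigma> 1 t + (\<Sum>k\<in>{1..n - 1}. (\<Sigma> (k + 1) t - \<Sigma> k t) * ramp (xp s t k) (xm n s t (k + 1)) x)"
proof -
  have tel: "(\<Sum>k\<in>{1..<j}. \<Sigma> (k + 1) t - \<Sigma> k t) = \<Sigma> j t - \<Sigma> 1 t" if "j \<ge> 1" for j
    using sum_Suc_diff'[of 1 j "\<lambda>k. \<Sigma> k t"] that by simp
  have below: "ramp (xp s t k) (xm n s t (k + 1)) x = 1" if "k \<in> {1..n - 1}" "xm n s t (k + 1) \<le> x" for k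
    using ramp_simps(2)[OF gap_pos'[OF t that(1)] that(2)] .
  have above: "ramp (xp s t k) (xm n s t (k + 1)) x = 0" if "k \<in> {1..n - 1}" "x \<le> xp s t k" for k
    using ramp_simps(1)[OF gap_pos'[OF t that(1)] that(2)] .
  \<comment> \<open>\<open>x\<close> lies between the left end of bubble \<open>j\<close> and the
    right end of bubble \<open>j + 1\<close>: earlier ramps are complete, later ones have not
    started, and only that of gap \<open>j\<close> may be in progress.\<close>
  have split: "(\<Sum>k\<in>{1..n - 1}. A k * ramp (xp s t k) (xm n s t (k + 1)) x) =
      (\<Sum>k\<in>{1..<j}. A k) + (if j \<in> {1..n - 1} then A j * ramp (xp s t j) (xm n s t (j + 1)) x else 0)"
    if j: "j \<le> n" "j > 0 \<Longrightarrow> xm n s t j \<le> x" "j < n \<Longrightarrow> x \<le> xp s t (j + 1)" for j and A :: "nat \<Rightarrow> real"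
  proof -
    have lo: "ramp (xp s t k) (xm n s t (k + 1)) x = 1" if "k \<in> {1..n - 1}" "k < j" for k
      using below[OF that(1)] xm_mono[OF t, of "k + 1" j] j that by auto
    have hi: "ramp (xp s t k) (xm n s t (k + 1)) x = 0" if "k \<in> {1..n - 1}" "j < k" for k
    proof -
      have "j < n" using that by auto
      then have "x \<le> xp s t (j + 1)" by (rule j(3))
      also have "\<dots> \<le> xp s t k" using that by (intro xp_mono[OF t]) auto
      finally show ?thesis by (rule above[OF that(1)])
    qed
    have "(\<Sum>k\<in>{1..n - 1}. A k * ramp (xp s t k) (xm n s t (k + 1)) x) =
       (\<Sum>k\<in>{1..n - 1}. (if k < j then A k else 0) + (if k = j then A j * ramp (xp s t j) (xm n s t (j + 1)) x else 0))"
      by (rule sum.cong[OF refl]) (use lo hi in \<open>force simp: not_less\<close>)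
    also have "\<dots> = (\<Sum>k\<in>{1..n - 1}. if k < j then A k else 0) + (if j \<in> {1..n - 1} then A j * ramp (xp s t j) (xm n s t (j + 1)) x else 0)"
      by (simp add: sum.distrib)
    also have "(\<Sum>k\<in>{1..n - 1}. if k < j then A k else 0) = (\<Sum>k\<in>{1..<j}. A k)"
      using j(1) by (subst sum.inter_filter[symmetric]) (auto intro!: sum.cong)
    finally show ?thesis .
  qed
  show ?thesis
  proof (cases rule: location[OF t x])
    case (1 k)
    have 2: "(if k \<in> {1..n - 1} then (\<Sigma> (k + 1) t - \<Sigma> k t) * ramp (xp s t k) (xm n s t (k + 1)) x else 0) = 0"
      using above[of k] 1 by auto
    have "x \<le> xp s t (k + 1)" if "k < n" using 1 that xp_mono[OF t, of k "k + 1"] by auto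
    then show ?thesis
      using stress_g_ext_bubble[OF t 1] split[of k "\<lambda>k. \<Sigma> (k + 1) t - \<Sigma> k t"] tel[of k] 1 2 by auto
  next
    case (2 k)
    have a: "xm n s t k \<le> x" if "k > 0" using 2 that xm_less_xp[OF t, of k] by auto
    have b: "x \<le> xp s t (k + 1)" if "k < n" using 2 that xm_less_xp[OF t, of "k + 1"] by auto
    have r: "ramp (xp s t k) (xm n s t (k + 1)) x = (x - xp s t k) / (xm n s t (k + 1) - xp s t k)"
      using 2 gap_pos[OF t, of k] by (intro ramp_simps(3)) auto
    have sp: "(\<Sum>k\<in>{1..n - 1}. (\<Sigma> (k + 1) t - \<Sigma> k t) * ramp (xp s t k) (xm n s t (k + 1)) x) =
      (\<Sum>k\<in>{1..<k}. \<Sigma> (k + 1) t - \<Sigma> k t) +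
      (if k \<in> {1..n - 1} then (\<Sigma> (k + 1) t - \<Sigma> k t) * ramp (xp s t k) (xm n s t (k + 1)) x else 0)"
      by (rule split[where A = "\<lambda>k. \<Sigma> (k + 1) t - \<Sigma> k t", OF 2(1) a b])
    consider "k = 0" | "k = n" "k > 0" | "k \<in> {1..n - 1}" "k \<noteq> n" "k > 0" using 2(1) n by fastforce
    then show ?thesis
    proof cases
      case 1
      then show ?thesis unfolding sp stress_g_ext_gap[OF t 2] by simp
    next
      case 2
      then show ?thesis unfolding sp stress_g_ext_gap[OF t \<open>k \<le> n\<close> \<open>x \<in> {xp s t k<..<xm n s t (k + 1)}\<close>]
        using tel[of k] n by auto
    next
      case 3
      then show ?thesis unfolding sp stress_g_ext_gap[OF t 2] r
        using tel[of k] by (auto simp: affine_interp_def)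
    qed
  qed
qed

lemma xp_cont: "k \<in> {1..n} \<Longrightarrow> continuous_on {0..T} (\<lambda>t. xp s t k)"
  and xm_cont: "k \<in> {1..n} \<Longrightarrow> continuous_on {0..T} (\<lambda>t. xm n s t k)"
  by (auto simp: xp_eq xm_eq intro!: continuous_intros cen_cont rad_cont)

lemma gap_slope_cont:
  assumes "k \<in> {1..n - 1}"
  shows "continuous_on {0..T} (gap_slope k)"
proof -
  have k: "k \<in> {1..n}" "k + 1 \<in> {1..n}" using assms by auto
  show ?thesis
    unfolding gap_slope_def
    by (intro continuous_intros stress_cont xp_cont xm_cont k) (use gap_pos'[OF _ assms] in force)
qed

lemma open_cyl: "open (cyl T)"
  unfolding cyl_def Omega_def by (intro open_Times) auto

lemma emeasure_cyl: "emeasure lborel (cyl T) < \<infinity>"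
  unfolding cyl_def Omega_def by (intro emeasure_bounded_finite bounded_Times) auto

definition slope0 :: "real \<times> real \<Rightarrow> real" where
  "slope0 z = indicator (cyl T) z * slope z"

lemma slope_measurable: "slope0 \<in> borel_measurable borel"
proof -
  define cl where "cl = (\<lambda>t. max 0 (min T t))"
  have cl: "cl t \<in> {0..T}" "continuous_on UNIV cl" for t
    using T by (auto simp: cl_def intro!: continuous_intros)
  have ext: "(\<lambda>t. h (cl t)) \<in> borel_measurable borel" if "continuous_on {0..T} h" for h :: "real \<Rightarrow> real"
    by (intro borel_measurable_continuous_onI continuous_on_compose2[OF that cl(2)]) (use cl in blast)
  define sl where "sl = (\<lambda>z. \<Sum>k\<in>{1..n - 1}. (if xp s (cl (fst z)) k < snd z \<and> snd z < xm n s (cl (fst z)) (k + 1) then 1 else 0) * gap_slope k (cl (fst z)))"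
  have "sl \<in> borel_measurable (borel \<Otimes>\<^sub>M borel)"
    unfolding sl_def
  proof (rule borel_measurable_sum)
    fix k assume k: "k \<in> {1..n - 1}"
    then have kk: "k \<in> {1..n}" "k + 1 \<in> {1..n}" by auto
    note [measurable] = ext[OF xp_cont[OF kk(1)]] ext[OF xm_cont[OF kk(2)]] ext[OF gap_slope_cont[OF k]]
    show "(\<lambda>z. (if xp s (cl (fst z)) k < snd z \<and> snd z < xm n s (cl (fst z)) (k + 1) then 1 else 0) * gap_slope k (cl (fst z)))
       \<in> borel_measurable (borel \<Otimes>\<^sub>M borel)" by measurable
  qed
  then have [measurable]: "sl \<in> borel_measurable borel" by (simp add: borel_prod)
  have [measurable]: "cyl T \<in> sets borel" using open_cyl by simp
  have "slope0 = (\<lambda>z. indicator (cyl T) z * sl z)"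
  proof
    fix z show "slope0 z = indicator (cyl T) z * sl z"
    proof (cases "z \<in> cyl T")
      case True
      then have "cl (fst z) = fst z" by (auto simp: cl_def cyl_def)
      then show ?thesis
      proof -
        have "indicator {p<..<r} x = (if p < x \<and> x < r then 1 else (0::real))" for p r x :: real by (simp add: indicator_def)
        then have "slope z = sl z"
          using \<open>cl (fst z) = fst z\<close> by (cases z) (simp only: slope_def sl_def prod.case fst_conv snd_conv)
        then show ?thesis by (simp add: slope0_def)
      qed
    qed (simp add: slope0_def)
  qed
  then show ?thesis by simp
qed

text \<open>The constant depends on the individual solution and serves only for integrability; the
  bound uniform in the number of bubbles is the one in \<open>L2\<close>.\<close>

lemma slope_bounded: "\<exists>C\<ge>0. \<forall>z\<in>cyl T. \<bar>slope z\<bar> \<le> C"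
proof -
  have "\<forall>k\<in>{1..n - 1}. \<exists>C\<ge>0. \<forall>t\<in>{0..T}. \<bar>gap_slope k t\<bar> \<le> C"
    using bounded_continuous_compact[OF gap_slope_cont compact_Icc] by metis
  then obtain C where C: "\<And>k. k \<in> {1..n - 1} \<Longrightarrow> 0 \<le> C k" "\<And>k t. k \<in> {1..n - 1} \<Longrightarrow> t \<in> {0..T} \<Longrightarrow> \<bar>gap_slope k t\<bar> \<le> C k"
    by metis
  have "\<bar>slope z\<bar> \<le> (\<Sum>k\<in>{1..n - 1}. C k)" if "z \<in> cyl T" for z
  proof -
    obtain t x where z: "z = (t, x)" by (cases z)
    have t: "t \<in> {0..T}" using that z by (auto simp: cyl_def)
    have "\<bar>indicator {xp s t k<..<xm n s t (k + 1)} x * gap_slope k t\<bar> \<le> C k" if "k \<in> {1..n - 1}" for k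
      using C(1)[OF that] C(2)[OF that t] by (auto simp: indicator_def)
    then show ?thesis unfolding slope_def z prod.case by (intro order_trans[OF sum_abs sum_mono])
  qed
  moreover have "0 \<le> (\<Sum>k\<in>{1..n - 1}. C k)" using C(1) by (intro sum_nonneg)
  ultimately show ?thesis by blast
qed

lemma slope0_integrable: "integrable lborel slope0" "integrable lborel (\<lambda>z. (slope0 z)\<^sup>2)"
proof -
  obtain C where C: "C \<ge> 0" "\<And>z. z \<in> cyl T \<Longrightarrow> \<bar>slope z\<bar> \<le> C" using slope_bounded by blast
  have [measurable]: "slope0 \<in> borel_measurable borel" by (rule slope_measurable)
  have i: "integrable lborel (\<lambda>z. indicator (cyl T) z * a)" for a :: real
    using emeasure_cyl open_cyl by (auto intro!: integrable_mult_left integrable_real_indicator)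
  show "integrable lborel slope0"
    by (rule Bochner_Integration.integrable_bound[OF i[of C]])
       (use C in \<open>auto simp: slope0_def indicator_def intro!: always_eventually\<close>)
  have "norm ((slope0 z)\<^sup>2) \<le> norm (indicator (cyl T) z * C\<^sup>2)" for z
    using power_mono[OF C(2)[of z] abs_ge_zero, of 2] by (auto simp: slope0_def indicator_def)
  then show "integrable lborel (\<lambda>z. (slope0 z)\<^sup>2)"
    by (intro Bochner_Integration.integrable_bound[OF i[of "C\<^sup>2"]]) auto
qed

abbreviation "stress_g \<equiv> stress_g_ext P n T D s"

lemma L2H1_stress: "L2H1 T stress_g"
  using bounds by (simp add: uniform_bounds_def Let_def)

lemma slope_section:
  assumes "t \<in> {0<..<T}"
  shows "slope (t, x) = (\<Sum>k\<in>{1..n - 1}. (\<Sigma> (k + 1) t - \<Sigma> k t) * (indicator {xp s t k<..<xm n s t (k + 1)} x / (xm n s t (k + 1) - xp s t k)))"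
  by (simp add: slope_def gap_slope_def mult.commute)

text \<open>By Fubini it suffices to integrate by parts in each time slice, where the stress is a
  constant plus ramps. The constant pairs with the derivative of a compactly supported function and
  drops out.\<close>

lemma slope_weak_deriv: "has_weak_deriv (cyl T) (0,1) stress_g slope"
  unfolding has_weak_deriv_def
proof (intro conjI allI impI)
  show a: "loc_integrable (cyl T) stress_g"
    using L2H1_stress by (auto simp: L2H1_def has_L2_deriv_def has_weak_deriv_def)
  show l: "loc_integrable (cyl T) slope"
    unfolding loc_integrable_def
  proof (intro allI impI)
    fix C assume C: "compact C \<and> C \<subseteq> cyl T"
    then have "set_integrable lborel C slope0"
      unfolding set_integrable_def
      using integrable_times_bounded(1)[OF slope0_integrable(1), of "indicator C" 1]
      by (simp add: mult.commute compact_imp_closed borel_closed)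
    moreover have "indicator C z * slope0 z = indicator C z * slope z" for z
      using C by (auto simp: slope0_def indicator_def)
    ultimately show "set_integrable lborel C slope" by (simp add: set_integrable_def)
  qed
  fix \<phi> assume test: "test_fun (cyl T) \<phi>"
  from test_funD[OF test] obtain S where S: "smooth \<phi>" "compact S" "S \<subseteq> cyl T"
    "\<And>z. z \<notin> S \<Longrightarrow> \<phi> z = 0" "\<And>z b. z \<notin> S \<Longrightarrow> pd b \<phi> z = 0" by metis
  have \<phi>c: "continuous_on UNIV (pd (0,1) \<phi>)"
    by (intro smooth_continuous smooth_pd S) (simp add: Basis_prod_def)
  have i1: "integrable lborel (\<lambda>z. indicator (cyl T) z * (stress_g z * pd (0,1) \<phi> z))"
    using loc_integrable_times[OF a S(2,3,5) \<phi>c] by (simp add: set_integrable_def)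
  have i2: "integrable lborel (\<lambda>z. indicator (cyl T) z * (slope z * \<phi> z))"
    using loc_integrable_times[OF l S(2,3,4) smooth_continuous[OF S(1)]] by (simp add: set_integrable_def)
  have sec: "(LINT x|lborel. indicator (cyl T) (t, x) * (stress_g (t, x) * pd (0,1) \<phi> (t, x))) =
     - (LINT x|lborel. indicator (cyl T) (t, x) * (slope (t, x) * \<phi> (t, x)))" for t
  proof (cases "t \<in> {0<..<T}")
    case True
    then have t: "t \<in> {0..T}" by auto
    define f where "f = (\<lambda>x. \<phi> (t, x))"
    define f' where "f' = (\<lambda>x. pd (0,1) \<phi> (t, x))"
    have out: "(t, x) \<notin> S" if "\<bar>x\<bar> \<ge> 1" for x using that S(3) by (force simp: cyl_def Omega_def)
    have f0: "f x = 0" "f' x = 0" if "\<bar>x\<bar> \<ge> 1" for x using out[OF that] S by (auto simp: f_def f'_def)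
    have f'c: "continuous_on UNIV f'" unfolding f'_def
      by (rule continuous_on_compose2[OF \<phi>c]) (auto intro: continuous_intros)
    have fc: "continuous_on UNIV f" unfolding f_def
      by (rule continuous_on_compose2[OF smooth_continuous[OF S(1), of UNIV]]) (auto intro: continuous_intros)
    have fd: "(f has_real_derivative f' x) (at x)" for x
    proof -
      have "((\<lambda>x. \<phi> (t, x)) has_derivative (\<lambda>h. pd (0, h) \<phi> (t, x))) (at x)"
        by (rule has_derivative_compose[OF _ smooth_pd_has_derivative[OF S(1)], where f = "\<lambda>x. (t, x)" and f' = "\<lambda>h. (0, h)"])
           (auto intro!: derivative_eq_intros)
      moreover have "pd (0, h) \<phi> (t, x) = f' x * h" for h
        using linear_cmul[OF has_derivative_linear[OF smooth_pd_has_derivative[OF S(1), of "(t, x)"]], of h "(0, 1)"]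
        by (simp add: f'_def mult.commute)
      ultimately show ?thesis by (simp add: f_def has_field_derivative_def)
    qed
    have [measurable]: "f \<in> borel_measurable borel" "f' \<in> borel_measurable borel"
      by (intro borel_measurable_continuous_onI fc f'c)+
    have fi: "integrable lborel f" "integrable lborel f'"
      by (rule integrable_continuous_compact[of _ "{-1..1}"]; use fc f'c f0 in auto)+
    have i3: "integrable lborel (\<lambda>x. ramp p r x * f' x)" for p r
    proof -
      have [measurable]: "ramp p r \<in> borel_measurable borel" unfolding ramp_def by measurable
      have "integrable lborel (\<lambda>x. f' x * ramp p r x)"
        by (rule integrable_times_bounded(1)[OF fi(2), where B = 1]) (simp, simp add: ramp_def)
      then show ?thesis by (simp only: mult.commute)
    qed
    have i4: "integrable lborel (\<lambda>x. indicator {p<..<r} x / (r - p) * f x)" for p r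
      using integrable_times_bounded(1)[OF fi(1), of "\<lambda>x. indicator {p<..<r} x / (r - p)" "\<bar>1 / (r - p)\<bar>"]
      by (simp add: mult.commute indicator_def)
    have "(LINT x|lborel. indicator (cyl T) (t, x) * (stress_g (t, x) * pd (0,1) \<phi> (t, x))) =
      (LINT x|lborel. \<Sigma> 1 t * f' x + (\<Sum>k\<in>{1..n - 1}. (\<Sigma> (k + 1) t - \<Sigma> k t) * (ramp (xp s t k) (xm n s t (k + 1)) x * f' x)))"
    proof (rule Bochner_Integration.integral_cong)
      fix x
      show "indicator (cyl T) (t, x) * (stress_g (t, x) * pd (0,1) \<phi> (t, x)) =
         \<Sigma> 1 t * f' x + (\<Sum>k\<in>{1..n - 1}. (\<Sigma> (k + 1) t - \<Sigma> k t) * (ramp (xp s t k) (xm n s t (k + 1)) x * f' x))"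
      proof (cases "x \<in> Omega")
        case x: True
        then have "(t, x) \<in> cyl T" using True by (simp add: cyl_def)
        then show ?thesis
          by (simp add: stress_g_ext_ramps[OF t x] f'_def distrib_right sum_distrib_right mult.assoc)
      next
        case False
        then have "f' x = 0" by (intro f0) (auto simp: Omega_def)
        then show ?thesis using False by (simp add: cyl_def)
      qed
    qed simp
    also have "\<dots> = \<Sigma> 1 t * (LINT x|lborel. f' x) + (\<Sum>k\<in>{1..n - 1}. (\<Sigma> (k + 1) t - \<Sigma> k t) * (LINT x|lborel. ramp (xp s t k) (xm n s t (k + 1)) x * f' x))"
      using fi i3 by (simp add: Bochner_Integration.integral_sum)
    also have "(LINT x|lborel. f' x) = 0" by (rule integral_derivative_eq_0[OF fd f'c f0(1)])
    also have "(\<Sum>k\<in>{1..n - 1}. (\<Sigma> (k + 1) t - \<Sigma> k t) * (LINT x|lborel. ramp (xp s t k) (xm n s t (k + 1)) x * f' x)) =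
       (\<Sum>k\<in>{1..n - 1}. (\<Sigma> (k + 1) t - \<Sigma> k t) * - (LINT x|lborel. indicator {xp s t k<..<xm n s t (k + 1)} x / (xm n s t (k + 1) - xp s t k) * f x))"
      by (intro sum.cong refl arg_cong2[of _ _ _ _ "(*)"] ramp_integral_by_parts[OF fd f'c f0] gap_pos'[OF t])
    also have "\<Sigma> 1 t * 0 + \<dots> = - (LINT x|lborel. (\<Sum>k\<in>{1..n - 1}. (\<Sigma> (k + 1) t - \<Sigma> k t) * (indicator {xp s t k<..<xm n s t (k + 1)} x / (xm n s t (k + 1) - xp s t k) * f x)))"
      by (simp only: i4 Bochner_Integration.integral_sum integrable_mult_right integral_mult_right_zero
          mult_minus_right sum_negf mult_zero_right add_0)
    also have "(LINT x|lborel. (\<Sum>k\<in>{1..n - 1}. (\<Sigma> (k + 1) t - \<Sigma> k t) * (indicator {xp s t k<..<xm n s t (k + 1)} x / (xm n s t (k + 1) - xp s t k) * f x))) =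
       (LINT x|lborel. indicator (cyl T) (t, x) * (slope (t, x) * \<phi> (t, x)))"
    proof (rule Bochner_Integration.integral_cong)
      fix x
      show "(\<Sum>k\<in>{1..n - 1}. (\<Sigma> (k + 1) t - \<Sigma> k t) * (indicator {xp s t k<..<xm n s t (k + 1)} x / (xm n s t (k + 1) - xp s t k) * f x)) =
         indicator (cyl T) (t, x) * (slope (t, x) * \<phi> (t, x))"
      proof (cases "x \<in> Omega")
        case x: True
        then have "(t, x) \<in> cyl T" using True by (simp add: cyl_def)
        then show ?thesis by (simp add: slope_section[OF True] f_def sum_distrib_right mult.assoc)
      next
        case False
        then have "f x = 0" by (intro f0) (auto simp: Omega_def)
        then show ?thesis using False by (simp add: cyl_def)
      qed
    qed simp
    finally show ?thesis .
  qed (auto simp: cyl_def)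
  have "(LINT z:cyl T|lborel. stress_g z * pd (0,1) \<phi> z) = (LINT t|lborel. - (LINT x|lborel. indicator (cyl T) (t, x) * (slope (t, x) * \<phi> (t, x))))"
    unfolding set_lebesgue_integral_def using lborel_integral_fst(2)[OF i1] by (simp add: sec)
  also have "\<dots> = - (LINT z:cyl T|lborel. slope z * \<phi> z)"
    unfolding set_lebesgue_integral_def using lborel_integral_fst(2)[OF i2] by simp
  finally show "(LINT z:cyl T|lborel. stress_g z * pd (0,1) \<phi> z) = - (LINT z:cyl T|lborel. slope z * \<phi> z)" .
qed

text \<open>The hypothesis bounds \<open>weak_d\<close>; uniqueness of weak derivatives transfers
  the bound to the explicit \<open>slope0\<close>.\<close>

lemma stress_L2_bounds:
  "integrable lborel (\<lambda>z. (indicator (cyl T) z * stress_g z)\<^sup>2)" "(LINT z|lborel. (indicator (cyl T) z * stress_g z)\<^sup>2) \<le> K"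
  "(LINT z|lborel. (slope0 z)\<^sup>2) \<le> K"
proof -
  have sq: "(indicator (cyl T) z * f z)\<^sup>2 = indicator (cyl T) z *\<^sub>R (f z)\<^sup>2" for f :: "real \<times> real \<Rightarrow> real" and z
    by (simp add: indicator_def)
  show "integrable lborel (\<lambda>z. (indicator (cyl T) z * stress_g z)\<^sup>2)"
    using L2H1_stress by (simp add: sq L2H1_def L2_on_def set_integrable_def)
  have wd: "has_weak_deriv (cyl T) (0,1) stress_g (weak_d (cyl T) (0,1) stress_g)"
    using L2H1_stress by (auto simp: L2H1_def intro: weak_d_has_weak_deriv)
  have "loc_integrable (cyl T) (weak_d (cyl T) (0,1) stress_g)" using wd by (simp add: has_weak_deriv_def)
  from loc_integrable_measurable[OF this open_cyl]
  have m: "(\<lambda>z. indicator (cyl T) z * weak_d (cyl T) (0,1) stress_g z) \<in> borel_measurable borel" .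
  have "(LINT z|lborel. (slope0 z)\<^sup>2) = (LINT z|lborel. (indicator (cyl T) z * weak_d (cyl T) (0,1) stress_g z)\<^sup>2)"
  proof (rule integral_cong_AE)
    show "AE z in lborel. (slope0 z)\<^sup>2 = (indicator (cyl T) z * weak_d (cyl T) (0,1) stress_g z)\<^sup>2"
      using weak_deriv_unique_cyl[OF slope_weak_deriv wd] by eventually_elim (auto simp: slope0_def indicator_def)
  qed (use slope_measurable m in auto)
  also have "\<dots> = (LINT z:cyl T|lborel. (weak_d (cyl T) (0,1) stress_g z)\<^sup>2)"
    unfolding set_lebesgue_integral_def sq ..
  finally have sl: "(LINT z|lborel. (slope0 z)\<^sup>2) = (LINT z:cyl T|lborel. (weak_d (cyl T) (0,1) stress_g z)\<^sup>2)" .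
  have st: "(LINT z|lborel. (indicator (cyl T) z * stress_g z)\<^sup>2) = (LINT z:cyl T|lborel. (stress_g z)\<^sup>2)"
    unfolding set_lebesgue_integral_def sq ..
  have "L2H1_sq T (stress_f_ext n s) + L2H1_sq T stress_g + (LINT t:{0<..<T}|lborel.
          \<Sum>k\<in>{1..n}. mass D k * ((tder2 T (rad s k) t)\<^sup>2 + (tder2 T (cen s k) t)\<^sup>2)) \<le> K"
    using bounds by (simp add: uniform_bounds_def Let_def)
  moreover have "L2H1_sq T (stress_f_ext n s) \<ge> 0"
    unfolding L2H1_sq_def set_lebesgue_integral_def by (intro add_nonneg_nonneg Bochner_Integration.integral_nonneg) auto
  \<comment> \<open>The inertial term may be dropped from the joint bound \<open>K\<close> because
    the masses are positive.\<close>
  moreover have "(LINT t:{0<..<T}|lborel. \<Sum>k\<in>{1..n}. mass D k * ((tder2 T (rad s k) t)\<^sup>2 + (tder2 T (cen s k) t)\<^sup>2)) \<ge> 0"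
    unfolding set_lebesgue_integral_def
  proof (intro Bochner_Integration.integral_nonneg scaleR_nonneg_nonneg sum_nonneg mult_nonneg_nonneg)
    show "mass D k \<ge> 0" if "k \<in> {1..n}" for k using mass_pos[OF that] by simp
  qed auto
  ultimately have "L2H1_sq T stress_g \<le> K" by linarith
  moreover have "(LINT z|lborel. (indicator (cyl T) z * stress_g z)\<^sup>2) \<ge> 0" "(LINT z|lborel. (slope0 z)\<^sup>2) \<ge> 0"
    by (intro Bochner_Integration.integral_nonneg; simp)+
  ultimately show "(LINT z|lborel. (indicator (cyl T) z * stress_g z)\<^sup>2) \<le> K" "(LINT z|lborel. (slope0 z)\<^sup>2) \<le> K"
    unfolding sl st L2H1_sq_def by linarith+
qed

text \<open>The increment is the integral of the slope, estimated by Young's inequality with weight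
  \<open>l\<close> on an interval of length at most \<open>l^2\<close>. Having the slice energy
  itself, not its square root, on the right makes the modulus integrable in time with a bound linear
  in \<open>K\<close>.\<close>

lemma stress_modulus:
  assumes t: "t \<in> {0<..<T}" and xy: "x \<in> Omega" "y \<in> Omega" and l: "l > 0" "\<bar>x - y\<bar> \<le> l\<^sup>2"
  shows "\<bar>stress_g (t, x) - stress_g (t, y)\<bar> \<le> l * ((LINT z|lborel. (slope0 (t, z))\<^sup>2) + 1)"
proof -
  have main: "\<bar>stress_g (t, y) - stress_g (t, x)\<bar> \<le> l * ((LINT z|lborel. (slope0 (t, z))\<^sup>2) + 1)"
    if xy: "x \<in> Omega" "y \<in> Omega" "x \<le> y" "y - x \<le> l\<^sup>2" for x y
  proof -
    have t': "t \<in> {0..T}" using t by auto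
    have i: "integrable lborel (\<lambda>z. indicator {p<..<r} z / (r - p) * indicator {x..y} z)" for p r :: real
    proof -
      have "integrable lborel (\<lambda>z. indicator {p<..<r} z / (r - p))"
        by (cases "p \<le> r") (auto intro!: integrable_divide integrable_real_indicator)
      then show ?thesis by (rule integrable_times_bounded(1)[where B = 1]) (auto simp: indicator_def)
    qed
    have sl0: "slope0 (t, z) = slope (t, z)" if "z \<in> {x..y}" for z
      using that xy t by (auto simp: slope0_def cyl_def Omega_def)
    have sq_t: "(\<lambda>z. slope0 (t, z)) = (\<lambda>z. \<Sum>k\<in>{1..n - 1}. gap_slope k t * (indicator Omega z * indicator {xp s t k<..<xm n s t (k + 1)} z))"
      using t by (auto simp: slope0_def slope_def cyl_def indicator_def fun_eq_iff sum_distrib_left intro!: sum.cong)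
    have "stress_g (t, y) - stress_g (t, x) = (\<Sum>k\<in>{1..n - 1}. (\<Sigma> (k + 1) t - \<Sigma> k t) *
        (ramp (xp s t k) (xm n s t (k + 1)) y - ramp (xp s t k) (xm n s t (k + 1)) x))"
      unfolding stress_g_ext_ramps[OF t' xy(1)] stress_g_ext_ramps[OF t' xy(2)]
      by (simp add: right_diff_distrib sum_subtractf)
    also have "\<dots> = (\<Sum>k\<in>{1..n - 1}. (\<Sigma> (k + 1) t - \<Sigma> k t) *
        (LINT z|lborel. indicator {xp s t k<..<xm n s t (k + 1)} z / (xm n s t (k + 1) - xp s t k) * indicator {x..y} z))"
      by (intro sum.cong refl arg_cong2[of _ _ _ _ "(*)"] ramp_increment gap_pos'[OF t'] xy)
    also have "\<dots> = (LINT z|lborel. (\<Sum>k\<in>{1..n - 1}. (\<Sigma> (k + 1) t - \<Sigma> k t) *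
        (indicator {xp s t k<..<xm n s t (k + 1)} z / (xm n s t (k + 1) - xp s t k) * indicator {x..y} z)))"
      by (simp only: i Bochner_Integration.integral_sum integrable_mult_right integral_mult_right_zero)
    also have "\<dots> = (LINT z|lborel. slope0 (t, z) * indicator {x..y} z)"
    proof (rule Bochner_Integration.integral_cong)
      fix z
      show "(\<Sum>k\<in>{1..n - 1}. (\<Sigma> (k + 1) t - \<Sigma> k t) *
        (indicator {xp s t k<..<xm n s t (k + 1)} z / (xm n s t (k + 1) - xp s t k) * indicator {x..y} z)) = slope0 (t, z) * indicator {x..y} z"
        using sl0[of z] slope_section[OF t, of z] by (cases "z \<in> {x..y}") auto
    qed simp
    finally have eq: "stress_g (t, y) - stress_g (t, x) = (LINT z|lborel. slope0 (t, z) * indicator {x..y} z)" .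
    obtain C where C: "C \<ge> 0" "\<And>z. z \<in> cyl T \<Longrightarrow> \<bar>slope z\<bar> \<le> C" using slope_bounded by blast
    have ms: "(\<lambda>z. slope0 (t, z)) \<in> borel_measurable borel"
      unfolding sq_t Omega_def by measurable
    have si: "integrable lborel (\<lambda>z. (slope0 (t, z))\<^sup>2)"
    proof (rule Bochner_Integration.integrable_bound)
      show "integrable lborel (\<lambda>z. indicator Omega z * C\<^sup>2)"
        unfolding Omega_def by (auto intro!: integrable_mult_left integrable_real_indicator)
      have "norm ((slope0 (t, z))\<^sup>2) \<le> norm (indicator Omega z * C\<^sup>2)" for z
        using power_mono[OF C(2)[of "(t, z)"] abs_ge_zero, of 2] t by (auto simp: slope0_def cyl_def indicator_def)
      then show "AE z in lborel. norm ((slope0 (t, z))\<^sup>2) \<le> norm (indicator Omega z * C\<^sup>2)" by simp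
    qed (use ms in measurable)
    have xi: "integrable lborel (indicator {x..y} :: real \<Rightarrow> real)"
      by (rule integrable_real_indicator) (auto simp: emeasure_lborel_Icc_eq)
    have "\<bar>LINT z|lborel. slope0 (t, z) * indicator {x..y} z\<bar> \<le> (LINT z|lborel. l / 2 * (slope0 (t, z))\<^sup>2 + 1 / (2 * l) * indicator {x..y} z)"
    proof (rule order_trans[OF integral_abs_bound integral_mono])
      have pt: "\<bar>slope0 (t, z) * indicator {x..y} z\<bar> \<le> l / 2 * (slope0 (t, z))\<^sup>2 + 1 / (2 * l) * indicator {x..y} z" for z
        using young[OF l(1), of "slope0 (t, z)" 1] l(1) by (cases "z \<in> {x..y}") (auto simp del: atLeastAtMost_iff)
      then show "\<bar>slope0 (t, z) * indicator {x..y} z\<bar> \<le> l / 2 * (slope0 (t, z))\<^sup>2 + 1 / (2 * l) * indicator {x..y} z" for z .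
      show b: "integrable lborel (\<lambda>z. l / 2 * (slope0 (t, z))\<^sup>2 + 1 / (2 * l) * indicator {x..y} z)" using si xi by simp
      have "integrable lborel (\<lambda>z. slope0 (t, z) * indicator {x..y} z)"
        by (rule Bochner_Integration.integrable_bound[OF b]) (use ms order_trans[OF pt abs_ge_self] in auto)
      then show "integrable lborel (\<lambda>z. \<bar>slope0 (t, z) * indicator {x..y} z\<bar>)" by simp
    qed
    also have "\<dots> = l / 2 * (LINT z|lborel. (slope0 (t, z))\<^sup>2) + 1 / (2 * l) * (y - x)"
      using si xi xy by simp
    also have "\<dots> \<le> l * (LINT z|lborel. (slope0 (t, z))\<^sup>2) + l"
    proof (rule add_mono)
      show "l / 2 * (LINT z|lborel. (slope0 (t, z))\<^sup>2) \<le> l * (LINT z|lborel. (slope0 (t, z))\<^sup>2)"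
        using l(1) by (intro mult_right_mono Bochner_Integration.integral_nonneg) auto
      have "1 / (2 * l) * (y - x) \<le> 1 / (2 * l) * l\<^sup>2" using l(1) xy by (intro mult_left_mono) auto
      also have "\<dots> \<le> l" using l(1) by (simp add: power2_eq_square)
      finally show "1 / (2 * l) * (y - x) \<le> l" .
    qed
    finally show ?thesis by (simp add: eq distrib_left)
  qed
  show ?thesis
  proof (cases "x \<le> y")
    case True
    then show ?thesis using main[of x y] xy l(2) by (simp add: abs_minus_commute)
  next
    case False
    then show ?thesis using main[of y x] xy l(2) by simp
  qed
qed

end

section \<open>Convergence in the space-time cylinder\<close>

lemma cyl_sets: "cyl T \<in> sets borel"
  unfolding cyl_def Omega_def by (intro borel_open open_Times) auto

lemma cyl_finite: "emeasure lborel (cyl T) < \<infinity>"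
  unfolding cyl_def Omega_def by (intro emeasure_bounded_finite bounded_Times) auto

lemma cyl_indicator_integrable: "integrable lborel (indicator (cyl T) :: real \<times> real \<Rightarrow> real)"
  using cyl_sets cyl_finite by (auto intro!: integrable_real_indicator)

lemma L2_on_cyl:
  assumes "L2_on (cyl T) f"
  shows "integrable lborel (\<lambda>z. indicator (cyl T) z * f z)"
    "integrable lborel (\<lambda>z. (indicator (cyl T) z * f z)\<^sup>2)"
    "\<And>l. l > 0 \<Longrightarrow> (LINT z|lborel. \<bar>indicator (cyl T) z * f z\<bar>) \<le>
      l / 2 * measure lborel (cyl T) + 1 / (2 * l) * (LINT z:cyl T|lborel. (f z)\<^sup>2)"
proof -
  define F where "F = (\<lambda>z. indicator (cyl T) z * f z)"
  have sq: "(F z)\<^sup>2 = indicator (cyl T) z *\<^sub>R (f z)\<^sup>2" for z by (simp add: F_def indicator_def)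
  have m: "F \<in> borel_measurable lborel" using assms by (simp add: L2_on_def set_borel_measurable_def F_def)
  show sqi: "integrable lborel (\<lambda>z. (indicator (cyl T) z * f z)\<^sup>2)"
    using assms sq unfolding F_def by (simp add: L2_on_def set_integrable_def)
  have pt: "\<bar>F z\<bar> \<le> l / 2 * indicator (cyl T) z + 1 / (2 * l) * (F z)\<^sup>2" if "l > 0" for l z
    using young[OF that, of 1 "F z"] by (cases "z \<in> cyl T") (auto simp: F_def)
  have bi: "integrable lborel (\<lambda>z. l / 2 * indicator (cyl T) z + 1 / (2 * l) * (F z)\<^sup>2)" for l
    using cyl_indicator_integrable sqi unfolding F_def by simp
  have Fi: "integrable lborel F"
    by (rule Bochner_Integration.integrable_bound[OF bi[of 1] m]) (use order_trans[OF pt[of 1] abs_ge_self] in auto)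
  then show "integrable lborel (\<lambda>z. indicator (cyl T) z * f z)" by (simp add: F_def)
  fix l :: real assume l: "l > 0"
  have "(LINT z|lborel. \<bar>F z\<bar>) \<le> (LINT z|lborel. l / 2 * indicator (cyl T) z + 1 / (2 * l) * (F z)\<^sup>2)"
    using Fi bi pt[OF l] by (intro integral_mono) auto
  also have "\<dots> = l / 2 * measure lborel (cyl T) + 1 / (2 * l) * (LINT z|lborel. (F z)\<^sup>2)"
    using cyl_indicator_integrable sqi unfolding F_def by simp
  also have "(LINT z|lborel. (F z)\<^sup>2) = (LINT z:cyl T|lborel. (f z)\<^sup>2)"
    unfolding set_lebesgue_integral_def sq ..
  finally show "(LINT z|lborel. \<bar>indicator (cyl T) z * f z\<bar>) \<le>
      l / 2 * measure lborel (cyl T) + 1 / (2 * l) * (LINT z:cyl T|lborel. (f z)\<^sup>2)" by (simp add: F_def)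
qed

lemma L2_on_lincomb:
  assumes "L2_on U f" "L2_on U g" "U \<in> sets borel"
  shows "L2_on U (\<lambda>z. a * f z + b * g z)"
proof -
  define F where "F = (\<lambda>z. indicator U z *\<^sub>R f z)"
  define G where "G = (\<lambda>z. indicator U z *\<^sub>R g z)"
  have m: "F \<in> borel_measurable lborel" "G \<in> borel_measurable lborel"
    using assms by (auto simp: L2_on_def set_borel_measurable_def F_def G_def)
  have sq: "integrable lborel (\<lambda>z. (F z)\<^sup>2)" "integrable lborel (\<lambda>z. (G z)\<^sup>2)"
  proof -
    have "(F z)\<^sup>2 = indicator U z *\<^sub>R (f z)\<^sup>2" "(G z)\<^sup>2 = indicator U z *\<^sub>R (g z)\<^sup>2" for z by (auto simp: F_def G_def indicator_def)
    then show "integrable lborel (\<lambda>z. (F z)\<^sup>2)" "integrable lborel (\<lambda>z. (G z)\<^sup>2)"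
      using assms by (auto simp: L2_on_def set_integrable_def)
  qed
  have le: "(a * F z + b * G z)\<^sup>2 \<le> 2 * a\<^sup>2 * (F z)\<^sup>2 + 2 * b\<^sup>2 * (G z)\<^sup>2" for z
  proof -
    have "0 \<le> (a * F z - b * G z)\<^sup>2" by simp
    then show ?thesis by (simp add: power2_eq_square algebra_simps)
  qed
  have "integrable lborel (\<lambda>z. (a * F z + b * G z)\<^sup>2)"
  proof (rule Bochner_Integration.integrable_bound)
    show "integrable lborel (\<lambda>z. 2 * a\<^sup>2 * (F z)\<^sup>2 + 2 * b\<^sup>2 * (G z)\<^sup>2)" using sq by simp
    show "AE z in lborel. norm ((a * F z + b * G z)\<^sup>2) \<le> norm (2 * a\<^sup>2 * (F z)\<^sup>2 + 2 * b\<^sup>2 * (G z)\<^sup>2)"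
      using order_trans[OF le abs_ge_self] by simp
  qed (use m in measurable)
  moreover have "(a * F z + b * G z)\<^sup>2 = indicator U z *\<^sub>R (a * f z + b * g z)\<^sup>2" for z
    by (simp add: F_def G_def indicator_def)
  moreover have "(\<lambda>z. indicator U z *\<^sub>R (a * f z + b * g z)) = (\<lambda>z. a * F z + b * G z)"
    by (auto simp: F_def G_def indicator_def fun_eq_iff)
  ultimately show ?thesis
    using m by (simp add: L2_on_def set_integrable_def set_borel_measurable_def)
qed

text \<open>The cylinder has finite measure \<open>V\<close>; Young's inequality with
  \<open>l\<close> of order \<open>e / (V + 1)\<close> converts small squares into small
  \<open>L1\<close> norms.\<close>

lemma conv_L2_imp_L1:
  assumes conv: "conv_L2 (cyl T) w g" and w: "\<And>n. L2_on (cyl T) (w n)"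
  shows "(\<lambda>n. LINT z|lborel. \<bar>indicator (cyl T) z * w n z - indicator (cyl T) z * g z\<bar>) \<longlonglongrightarrow> 0"
proof (rule tendstoI)
  fix e :: real assume e: "e > 0"
  define V where "V = measure lborel (cyl T)"
  define l where "l = e / (1 * (V + 1))"
  have l: "l > 0" "V * l \<le> e" using scaled_epsilon[of V e 1] e by (simp_all add: l_def V_def)
  have g: "L2_on (cyl T) g" and lim: "(\<lambda>n. LINT z:cyl T|lborel. (w n z - g z)\<^sup>2) \<longlonglongrightarrow> 0"
    using conv by (auto simp: conv_L2_def)
  have "eventually (\<lambda>n. (LINT z:cyl T|lborel. (w n z - g z)\<^sup>2) < e * l) sequentially"
    using lim by (rule order_tendstoD) (use e l in simp)
  then show "eventually (\<lambda>n. dist (LINT z|lborel. \<bar>indicator (cyl T) z * w n z - indicator (cyl T) z * g z\<bar>) 0 < e) sequentially"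
  proof eventually_elim
    case (elim n)
    have "L2_on (cyl T) (\<lambda>z. w n z - g z)" using L2_on_lincomb[OF w[of n] g cyl_sets, of 1 "-1"] by simp
    note this = L2_on_cyl(3)[OF this l(1)]
    then have "(LINT z|lborel. \<bar>indicator (cyl T) z * w n z - indicator (cyl T) z * g z\<bar>) \<le>
        l / 2 * V + 1 / (2 * l) * (LINT z:cyl T|lborel. (w n z - g z)\<^sup>2)"
      by (simp add: V_def right_diff_distrib)
    also have "\<dots> < e / 2 + e / 2"
      using l elim by (intro add_le_less_mono) (auto simp: field_simps)
    finally have "(LINT z|lborel. \<bar>indicator (cyl T) z * w n z - indicator (cyl T) z * g z\<bar>) < e" by simp
    moreover have "0 \<le> (LINT z|lborel. \<bar>indicator (cyl T) z * w n z - indicator (cyl T) z * g z\<bar>)"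
      by (intro Bochner_Integration.integral_nonneg) auto
    ultimately show ?case by (simp add: dist_real_def)
  qed
qed

text \<open>Weak convergence is tested by bounded functionals on \<open>L2H1\<close>, and
  integration against a bounded \<open>h\<close> is one of them: the cylinder has finite measure and
  the norm controls the \<open>L2\<close> part.\<close>

lemma weak_conv_L2H1_bounded:
  assumes conv: "weak_conv_L2H1 T w g" and w: "\<And>n. L2H1 T (w n)"
    and h: "h \<in> borel_measurable borel" "\<exists>B. \<forall>z. \<bar>h z\<bar> \<le> B"
  shows "(\<lambda>n. LINT z|lborel. indicator (cyl T) z * w n z * h z) \<longlonglongrightarrow> (LINT z|lborel. indicator (cyl T) z * g z * h z)"
proof -
  obtain B where B: "\<And>z. \<bar>h z\<bar> \<le> B" using h(2) by blast
  have B0: "B \<ge> 0" using B[of 0] by linarith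
  define L where "L = (\<lambda>v. LINT z|lborel. indicator (cyl T) z * v z * h z)"
  have L2: "L2_on (cyl T) v" if "L2H1 T v" for v using that by (simp add: L2H1_def)
  have i: "integrable lborel (\<lambda>z. indicator (cyl T) z * v z * h z)" if "L2H1 T v" for v
    by (rule integrable_times_bounded(1)[OF L2_on_cyl(1)[OF L2[OF that]] _ B]) (use h in simp)
  define V where "V = measure lborel (cyl T)"
  have bound: "\<bar>L v\<bar> \<le> B * ((V + 1) / 2) * sqrt (L2H1_sq T v)" if v: "L2H1 T v" for v
  proof -
    define A where "A = (LINT z|lborel. \<bar>indicator (cyl T) z * v z\<bar>)"
    define Dv where "Dv = (LINT z:cyl T|lborel. (v z)\<^sup>2)"
    define X where "X = L2H1_sq T v"
    have D0: "Dv \<ge> 0" "Dv \<le> X"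
      unfolding Dv_def X_def L2H1_sq_def set_lebesgue_integral_def
      by (auto intro!: Bochner_Integration.integral_nonneg)
    have Al: "A \<le> l / 2 * V + 1 / (2 * l) * Dv" if "l > 0" for l
      unfolding A_def V_def Dv_def by (rule L2_on_cyl(3)[OF L2[OF v] that])
    have "A \<le> (V + 1) / 2 * sqrt X"
    \<comment> \<open>The weight \<open>sqrt X\<close> balances the two terms of Young's inequality
      and gives a multiple of the norm. It is not admissible for \<open>X = 0\<close>, where
      arbitrarily small weights show that the left side vanishes.\<close>
    proof (cases "X > 0")
      case True
      have "A \<le> sqrt X / 2 * V + 1 / (2 * sqrt X) * Dv" by (rule Al) (use True in simp)
      also have "\<dots> \<le> sqrt X / 2 * V + 1 / (2 * sqrt X) * X"
        using D0 True by (intro add_left_mono mult_left_mono) auto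
      also have "1 / (2 * sqrt X) * X = sqrt X / 2"
        using True real_div_sqrt[of X] by simp
      also have "sqrt X / 2 * V + sqrt X / 2 = (V + 1) / 2 * sqrt X" by (simp add: algebra_simps add_divide_distrib)
      finally show ?thesis .
    next
      case False
      then have 0: "X = 0" "Dv = 0" using D0 by auto
      have "A \<le> 0"
      proof (rule field_le_epsilon)
        fix e :: real assume e: "e > 0"
        define l where "l = e / (1 * (V + 1))"
        have l: "l > 0" "V * l \<le> e" using scaled_epsilon[of V e 1] e by (simp_all add: l_def V_def)
        have "A \<le> V * l / 2" using Al[OF l(1)] 0 by (simp add: mult.commute)
        then show "A \<le> 0 + e" using l(2) e by simp
      qed
      then show ?thesis by (simp add: 0)
    qed
    then have "B * A \<le> B * ((V + 1) / 2 * sqrt X)" by (rule mult_left_mono[OF _ B0])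
    moreover have "\<bar>L v\<bar> \<le> B * A"
      unfolding L_def A_def by (rule integrable_times_bounded(2)[OF L2_on_cyl(1)[OF L2[OF v]] _ B]) (use h in simp)
    ultimately show ?thesis by (simp add: X_def mult.assoc)
  qed
  have "bdd_functional_L2H1 T L"
    unfolding bdd_functional_L2H1_def
  proof (intro conjI allI impI)
    fix v w' :: "real \<times> real \<Rightarrow> real" and a b :: real assume "L2H1 T v \<and> L2H1 T w'"
    then have iv: "integrable lborel (\<lambda>z. indicator (cyl T) z * v z * h z)" "integrable lborel (\<lambda>z. indicator (cyl T) z * w' z * h z)"
      using i by auto
    have "L (\<lambda>z. a * v z + b * w' z) = (LINT z|lborel. a * (indicator (cyl T) z * v z * h z) + b * (indicator (cyl T) z * w' z * h z))"
      unfolding L_def by (rule Bochner_Integration.integral_cong) (simp_all add: algebra_simps)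
    also have "\<dots> = a * L v + b * L w'" using iv by (simp add: L_def)
    finally show "L (\<lambda>z. a * v z + b * w' z) = a * L v + b * L w'" .
  next
    show "\<exists>C. \<forall>v. L2H1 T v \<longrightarrow> \<bar>L v\<bar> \<le> C * sqrt (L2H1_sq T v)" using bound by blast
  qed
  then have "(\<lambda>n. L (w n)) \<longlonglongrightarrow> L g" using conv by (simp add: weak_conv_L2H1_def)
  then show ?thesis by (simp add: L_def)
qed

section \<open>The limit equation\<close>

lemma affine_mean:
  fixes a b c R :: real
  assumes R: "R > 0" and f: "\<And>x. x \<in> {c - R<..<c + R} \<Longrightarrow> f x = a + b * (x - c)"
  shows "(LINT x:{c - R<..<c + R}|lborel. f x) = 2 * R * a"
proof -
  have "(LINT x:{c - R<..<c + R}|lborel. f x) = (LINT x:{c - R<..<c + R}|lborel. a + b * (x - c))"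
    by (rule set_lebesgue_integral_cong) (auto simp: f)
  also have "\<dots> = (LINT x|lborel. indicator {c - R..c + R} x *\<^sub>R (a + b * (x - c)))"
    unfolding set_lebesgue_integral_def
  proof (rule integral_cong_AE)
    show "AE x in lborel. indicator {c - R<..<c + R} x *\<^sub>R (a + b * (x - c)) = indicator {c - R..c + R} x *\<^sub>R (a + b * (x - c))"
      using AE_lborel_singleton[of "c - R"] AE_lborel_singleton[of "c + R"] by eventually_elim (auto simp: indicator_def)
  qed auto
  also have "\<dots> = (a * (c + R) + b * ((c + R) - c)\<^sup>2 / 2) - (a * (c - R) + b * ((c - R) - c)\<^sup>2 / 2)"
  proof (rule integral_FTC_Icc)
    show "((\<lambda>x. a * x + b * (x - c)\<^sup>2 / 2) has_vector_derivative a + b * (x - c)) (at x within {c - R..c + R})" for x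
      unfolding has_real_derivative_iff_has_vector_derivative[symmetric]
      by (auto intro!: derivative_eq_intros)
  qed (use R in \<open>auto intro!: continuous_intros\<close>)
  also have "\<dots> = 2 * R * a" by (simp add: algebra_simps)
  finally show ?thesis .
qed

section \<open>Evolution of a bubble through field values at its centre\<close>

context micro_solution
begin

lemma center_in_bubble: "t \<in> {0..T} \<Longrightarrow> k \<in> {1..n} \<Longrightarrow> cen s k t \<in> {xm n s t k<..<xp s t k}"
  using rad_pos[of t k] by (simp add: xp_eq xm_eq)

lemma tder_cen_eq: "t \<in> {0..T} \<Longrightarrow> k \<in> {1..n} \<Longrightarrow> tder T (cen s k) t = u_ext n T s (t, cen s k t)"
  using u_ext_bubble[of t k "cen s k t"] center_in_bubble[of t k] by auto

text \<open>The gas part of \<open>kap\<close> is the radius times the pressure of the extended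
  density at the centre. The tension part \<open>gamma_s_bar / (2 n)\<close>, multiplied by
  \<open>n\<close>, becomes the constant \<open>gamma_s_bar / 2\<close> of the limit
  equation.\<close>

lemma tder_rad_eq:
  assumes "t \<in> {0..T}" "k \<in> {1..n}"
  shows "n * tder T (rad s k) t = 1 / mu_g P * (n * rad s k t *
    (stress_g_ext P n T D s (t, cen s k t) + p_g P (rho_g_ext s (t, cen s k t))) + gamma_s_bar P / 2)"
proof -
  have st: "stress_g_ext P n T D s (t, cen s k t) = \<Sigma> k t"
    using stress_g_ext_bubble[OF assms, of "cen s k t"] center_in_bubble[OF assms] by auto
  have "rad s k t * p_g P (rho_g_ext s (t, cen s k t)) = (a_g P)\<^sup>2 * mass D k / 2"
    using rho_g_ext_bubble[OF assms center_in_bubble[OF assms]] rad_pos[OF assms] by (simp add: p_g_def)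
  then have kap: "kap k = rad s k t * p_g P (rho_g_ext s (t, cen s k t)) + gamma_s_bar P / (2 * n)"
    by (simp add: kap_def)
  show ?thesis
    unfolding rad_ode[OF assms] kap st using mu_g_pos n by (simp add: field_simps)
qed

lemma phase_point: "t \<in> {0..T} \<Longrightarrow> k \<in> {1..n} \<Longrightarrow> (cen s k t, real n * rad s k t) \<in> phase d"
  using inside[of t k] radius[of t k] rad_pos[of t k] by (simp add: phase_def)

lemma bubble_distr_integral:
  assumes t: "t \<in> {0..T}" and \<beta>: "continuous_on (phase d) \<beta>"
  shows "(LINT y:phase d|bubble_distr n s t. \<beta> y) = (\<Sum>k\<in>{1..n}. \<beta> (cen s k t, real n * rad s k t)) / real n"
proof -
  have m: "(\<lambda>y. indicator (phase d) y *\<^sub>R \<beta> y) \<in> borel_measurable borel"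
    by (rule borel_measurable_continuous_on_indicator[OF _ \<beta>])
       (unfold phase_def, intro borel_closed closed_Times closed_atLeastAtMost)
  have "(LINT y:phase d|bubble_distr n s t. \<beta> y) =
     (LINT k|uniform_count_measure {1..n}. indicator (phase d) (cen s k t, real n * rad s k t) *\<^sub>R \<beta> (cen s k t, real n * rad s k t))"
    unfolding set_lebesgue_integral_def bubble_distr_def
    by (rule integral_distr[OF _ m]) (simp add: measurable_def sets_uniform_count_measure space_uniform_count_measure)
  also have "\<dots> = (\<Sum>k\<in>{1..n}. \<beta> (cen s k t, real n * rad s k t)) / real n"
  proof -
    have "(\<Sum>k\<in>{1..n}. indicator (phase d) (cen s k t, real n * rad s k t) *\<^sub>R \<beta> (cen s k t, real n * rad s k t)) =
        (\<Sum>k\<in>{1..n}. \<beta> (cen s k t, real n * rad s k t))"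
      by (rule sum.cong[OF refl]) (use phase_point[OF t] in simp)
    moreover have "card {1..n} = n" by simp
    ultimately show ?thesis by (simp only: integral_uniform_count_measure[OF finite_atLeastAtMost])
  qed
  finally show ?thesis .
qed

lemma trajectory_identity:
  assumes \<phi>: "test_fun ({0<..<T} \<times> Omega \<times> {0<..}) \<phi>" and k: "k \<in> {1..n}"
  shows "(LINT t|lborel. indicator {0..T} t *
      (pd (1,0,0) \<phi> (t, cen s k t, n * rad s k t) + tder T (cen s k) t * pd (0,1,0) \<phi> (t, cen s k t, n * rad s k t)
        + n * tder T (rad s k) t * pd (0,0,1) \<phi> (t, cen s k t, n * rad s k t))) = 0"
    and "integrable lborel (\<lambda>t. indicator {0..T} t *
      (pd (1,0,0) \<phi> (t, cen s k t, n * rad s k t) + tder T (cen s k) t * pd (0,1,0) \<phi> (t, cen s k t, n * rad s k t)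
        + n * tder T (rad s k) t * pd (0,0,1) \<phi> (t, cen s k t, n * rad s k t)))"
proof -
  from test_funD[OF \<phi>] obtain S where S: "smooth \<phi>" "compact S" "S \<subseteq> {0<..<T} \<times> Omega \<times> {0<..}"
    "\<And>z. z \<notin> S \<Longrightarrow> \<phi> z = 0" "\<And>z b. z \<notin> S \<Longrightarrow> pd b \<phi> z = 0" by metis
  define g where "g = (\<lambda>t. pd (1,0,0) \<phi> (t, cen s k t, n * rad s k t) + tder T (cen s k) t * pd (0,1,0) \<phi> (t, cen s k t, n * rad s k t)
        + n * tder T (rad s k) t * pd (0,0,1) \<phi> (t, cen s k t, n * rad s k t))"
  have path: "continuous_on {0..T} (\<lambda>t. (t, cen s k t, n * rad s k t))"
    by (intro continuous_intros cen_cont rad_cont k)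
  have pdc: "continuous_on {0..T} (\<lambda>t. pd b \<phi> (t, cen s k t, n * rad s k t))" if "b \<in> Basis" for b
    by (rule continuous_on_compose2[OF smooth_continuous[OF smooth_pd[OF S(1) that], of UNIV] path]) auto
  have gc: "continuous_on {0..T} g"
    unfolding g_def
    by (intro continuous_intros pdc tder_cen_cont tder_rad_cont k) (auto simp: Basis_prod_def zero_prod_def)
  have "(LINT t|lborel. indicator {0..T} t *\<^sub>R g t) = \<phi> (T, cen s k T, n * rad s k T) - \<phi> (0, cen s k 0, n * rad s k 0)"
  proof (rule integral_FTC_Icc)
    fix t assume "0 \<le> t" "t \<le> T"
    then have t: "t \<in> {0..T}" by simp
    define c' where "c' = tder T (cen s k) t"
    define r' where "r' = n * tder T (rad s k) t"
    define z where "z = (t, cen s k t, n * rad s k t)"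
    have "((\<lambda>t. (t, cen s k t, n * rad s k t)) has_derivative (\<lambda>h. (h, c' * h, r' * h))) (at t within {0..T})"
      unfolding c'_def r'_def
      using cen_deriv[OF k t] rad_deriv[OF k t]
      by (auto simp: has_field_derivative_def intro!: derivative_eq_intros)
    from has_derivative_compose[OF this smooth_pd_has_derivative[OF S(1), of "(t, cen s k t, n * rad s k t)"]]
    have 1: "((\<lambda>t. \<phi> (t, cen s k t, n * rad s k t)) has_derivative (\<lambda>h. pd (h, c' * h, r' * h) \<phi> z)) (at t within {0..T})"
      by (simp add: z_def)
    have lin: "linear (\<lambda>b. pd b \<phi> z)" by (rule has_derivative_linear[OF smooth_pd_has_derivative[OF S(1)]])
    have "pd (h, c' * h, r' * h) \<phi> z = h *\<^sub>R g t" for h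
    proof -
      have "(h, c' * h, r' * h) = h *\<^sub>R ((1,0,0) + (c' *\<^sub>R (0,1,0) + r' *\<^sub>R (0,0,1)))" by (simp add: mult.commute)
      then have "pd (h, c' * h, r' * h) \<phi> z = h *\<^sub>R (pd (1,0,0) \<phi> z + (c' *\<^sub>R pd (0,1,0) \<phi> z + r' *\<^sub>R pd (0,0,1) \<phi> z))"
        by (simp only: linear_cmul[OF lin] linear_add[OF lin])
      then show ?thesis by (simp add: g_def z_def c'_def r'_def)
    qed
    with 1 show "((\<lambda>t. \<phi> (t, cen s k t, n * rad s k t)) has_vector_derivative g t) (at t within {0..T})"
      by (simp add: has_vector_derivative_def)
  qed (use T gc in auto)
  moreover have "\<phi> (T, y) = 0" "\<phi> (0, y) = 0" for y
  proof -
    have "(T, y) \<notin> S" "(0, y) \<notin> S" using S(3) by auto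
    then show "\<phi> (T, y) = 0" "\<phi> (0, y) = 0" using S(4) by auto
  qed
  ultimately show "(LINT t|lborel. indicator {0..T} t *
      (pd (1,0,0) \<phi> (t, cen s k t, n * rad s k t) + tder T (cen s k) t * pd (0,1,0) \<phi> (t, cen s k t, n * rad s k t)
        + n * tder T (rad s k) t * pd (0,0,1) \<phi> (t, cen s k t, n * rad s k t))) = 0"
    by (simp add: g_def)
  show "integrable lborel (\<lambda>t. indicator {0..T} t *
      (pd (1,0,0) \<phi> (t, cen s k t, n * rad s k t) + tder T (cen s k) t * pd (0,1,0) \<phi> (t, cen s k t, n * rad s k t)
        + n * tder T (rad s k) t * pd (0,0,1) \<phi> (t, cen s k t, n * rad s k t)))"
    using borel_integrable_compact[OF compact_Icc gc] by (simp add: g_def)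
qed

end

section \<open>Integrability of the limit fluxes\<close>

context separated_bubbles
begin

text \<open>\<open>integrable_against_S\<close> treats a field of \<open>(t, x)\<close> times a
  bounded function of \<open>(t, x, r)\<close>. A flux of linear growth in such a field, on the
  range of radii carried by \<open>S\<close>, is brought into this form.\<close>

lemma flux_integrable_bounded:
  fixes F :: "real \<times> real \<times> real \<Rightarrow> real" and g :: "real \<times> real \<Rightarrow> real"
  assumes g: "integrable lborel g"
    and F: "(\<lambda>p. indicator (cyl T) (fst p, fst (snd p)) * F p) \<in> borel_measurable borel"
    and bound: "\<And>t x r. (t, x) \<in> cyl T \<Longrightarrow> r \<in> {d..1/d} \<Longrightarrow> \<bar>F (t, x, r)\<bar> \<le> C * (\<bar>g (t, x)\<bar> + 1)" and C: "C \<ge> 0"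
  shows "flux_integrable T S F"
proof -
  define h where "h = (\<lambda>z. \<bar>g z\<bar> + indicator (cyl T) z)"
  \<comment> \<open>On the cylinder, \<open>\<bar>F\<bar>\<close> is factored as
    \<open>\<bar>g\<bar> + 1\<close>, which is integrable there, times a quotient bounded by
    \<open>C\<close>; the \<open>1\<close> keeps the denominator positive.\<close>
  define \<psi> where "\<psi> = (\<lambda>p. indicator (UNIV \<times> UNIV \<times> {d..1/d}) p * \<bar>indicator (cyl T) (fst p, fst (snd p)) * F p\<bar> / (\<bar>g (fst p, fst (snd p))\<bar> + 1))"
  have h: "integrable lborel h" unfolding h_def using g cyl_indicator_integrable by simp
  have gm: "g \<in> borel_measurable (borel \<Otimes>\<^sub>M borel)" using g by (simp add: borel_prod)
  have "(\<lambda>p. g (fst p, fst (snd p))) \<in> borel_measurable (borel \<Otimes>\<^sub>M (borel \<Otimes>\<^sub>M borel) :: (real \<times> real \<times> real) measure)"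
    using gm by measurable
  then have [measurable]: "(\<lambda>p. g (fst p, fst (snd p))) \<in> borel_measurable (borel :: (real \<times> real \<times> real) measure)"
    by (simp add: borel_prod)
  have [measurable]: "(UNIV :: real set) \<times> (UNIV :: real set) \<times> {d..1/d} \<in> sets borel"
    by (intro borel_closed closed_Times) auto
  note [measurable] = F
  have \<psi>: "\<psi> \<in> borel_measurable borel" unfolding \<psi>_def by measurable
  have \<Psi>: "\<bar>\<psi> p\<bar> \<le> C" for p
  proof (cases "p \<in> UNIV \<times> UNIV \<times> {d..1/d} \<and> (fst p, fst (snd p)) \<in> cyl T")
    case True
    then have "\<bar>F p\<bar> \<le> C * (\<bar>g (fst p, fst (snd p))\<bar> + 1)"
      using bound[of "fst p" "fst (snd p)" "snd (snd p)"] by (cases p) auto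
    then show ?thesis using True by (simp add: \<psi>_def abs_divide pos_divide_le_eq add_nonneg_pos)
  qed (use C in \<open>auto simp: \<psi>_def indicator_def\<close>)
  have prod: "h (t, x) * \<psi> (t, x, r) = indicator (cyl T) (t, x) * \<bar>F (t, x, r)\<bar>" if "r \<in> {d..1/d}" for t x r
  proof (cases "(t, x) \<in> cyl T")
    case True
    then show ?thesis using that by (simp add: h_def \<psi>_def add_nonneg_eq_0_iff del: atLeastAtMost_iff)
  qed (simp add: \<psi>_def)
  have Fm: "(\<lambda>y. indicator (Omega \<times> {0<..}) y *\<^sub>R F (t, y)) \<in> borel_measurable borel" if t: "t \<in> {0<..<T}" for t
  proof -
    have "(\<lambda>y. (t, y)) \<in> borel_measurable (borel :: (real \<times> real) measure)"
      by (intro borel_measurable_continuous_onI continuous_intros)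
    from measurable_compose[OF this F]
    have [measurable]: "(\<lambda>y. indicator (cyl T) (t, fst y) * F (t, y)) \<in> borel_measurable borel" by simp
    have [measurable]: "Omega \<times> {0::real<..} \<in> sets borel" unfolding Omega_def by (intro borel_open open_Times) auto
    have "(\<lambda>y. indicator (Omega \<times> {0<..}) y *\<^sub>R F (t, y)) = (\<lambda>y. indicator (Omega \<times> {0<..}) y * (indicator (cyl T) (t, fst y) * F (t, y)))"
      using t by (auto simp: fun_eq_iff indicator_def cyl_def)
    then show ?thesis by simp
  qed
  have AEp: "AE y in S t. \<bar>indicator (Omega \<times> {0<..}) y *\<^sub>R F (t, y)\<bar> = h (t, fst y) * \<psi> (t, y)" if t: "t \<in> {0<..<T}" for t
    using S_phase[of t]
  proof eventually_elim
    case (elim y)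
    then have "snd y \<in> {d..1/d}" by (auto simp: phase_def)
    then show ?case using prod[of "snd y" t "fst y"] t d by (cases y) (auto simp: indicator_def cyl_def)
  qed
  have \<psi>t: "(\<lambda>y. h (t, fst y) * \<psi> (t, y)) \<in> borel_measurable borel" for t
  proof -
    have hm: "h \<in> borel_measurable borel" using h by auto
    have "(\<lambda>y. (t, fst y)) \<in> borel_measurable (borel :: (real \<times> real) measure)"
      "(\<lambda>y. (t, y)) \<in> borel_measurable (borel :: (real \<times> real) measure)"
      by (intro borel_measurable_continuous_onI continuous_intros)+
    from measurable_compose[OF this(1) hm] measurable_compose[OF this(2) \<psi>] show ?thesis by simp
  qed
  have sets_S: "borel_measurable (S t) = borel_measurable borel" for t by simp
  have abs_eq: "(LINT y:Omega \<times> {0<..}|S t. \<bar>F (t, y)\<bar>) = (LINT y|S t. h (t, fst y) * \<psi> (t, y))" if t: "t \<in> {0<..<T}" for t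
  proof -
    have "(LINT y:Omega \<times> {0<..}|S t. \<bar>F (t, y)\<bar>) = (LINT y|S t. \<bar>indicator (Omega \<times> {0<..}) y *\<^sub>R F (t, y)\<bar>)"
      unfolding set_lebesgue_integral_def by (simp add: abs_mult)
    also have "\<dots> = (LINT y|S t. h (t, fst y) * \<psi> (t, y))"
      by (rule integral_cong_AE[OF _ _ AEp[OF t]]) (use Fm[OF t] \<psi>t[of t] in \<open>auto simp del: real_scaleR_def\<close>)
    finally show ?thesis .
  qed
  show ?thesis
    unfolding flux_integrable_def
  proof
    show "AE t\<in>{0<..<T} in lborel. set_integrable (S t) (Omega \<times> {0<..}) (\<lambda>y. F (t, y))"
      using integrable_against_S(1)[OF h \<psi> \<Psi>]
    proof eventually_elim
      case (elim t)
      show ?case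
      proof
        assume t: "t \<in> {0<..<T}"
        have "integrable (S t) (\<lambda>y. \<bar>indicator (Omega \<times> {0<..}) y *\<^sub>R F (t, y)\<bar>)"
          by (rule integrable_cong_AE_imp[OF elim])
             (use Fm[OF t] AEp[OF t] in \<open>auto simp del: real_scaleR_def elim: eventually_mono\<close>)
        then show "set_integrable (S t) (Omega \<times> {0<..}) (\<lambda>y. F (t, y))"
          unfolding set_integrable_def by (subst (asm) integrable_abs_iff) (use Fm[OF t] in simp)
      qed
    qed
    have "(\<lambda>t. indicator {0<..<T} t *\<^sub>R (LINT y:Omega \<times> {0<..}|S t. \<bar>F (t, y)\<bar>)) =
        (\<lambda>t. (LINT y|S t. h (t, fst y) * \<psi> (t, y)) * indicator {0<..<T} t)"
      using abs_eq by (auto simp: fun_eq_iff indicator_def)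
    then show "set_integrable lborel {0<..<T} (\<lambda>t. LINT y:Omega \<times> {0<..}|S t. \<bar>F (t, y)\<bar>)"
      unfolding set_integrable_def
      using integrable_times_bounded(1)[OF integrable_against_S(2)[OF h \<psi> \<Psi>], of "indicator {0<..<T}" 1] by simp
  qed
qed

end

lemma prob_on_integral:
  assumes M: "prob_on (phase d) M" and \<beta>: "\<beta> \<in> borel_measurable borel"
  shows "(LINT y:phase d|M. \<beta> y) = (LINT y|M. (\<beta> y :: real))"
  unfolding set_lebesgue_integral_def
proof (rule integral_cong_AE)
  interpret prob_space M using M by (simp add: prob_on_def)
  have s: "sets M = sets borel" using M by (simp add: prob_on_def)
  have ph: "phase d \<in> sets borel" by (simp add: phase_def borel_closed closed_Times)
  have "AE y in M. y \<in> phase d" using M prob_eq_1[of "phase d"] by (simp add: prob_on_def s ph)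
  then show "AE y in M. indicator (phase d) y *\<^sub>R \<beta> y = \<beta> y" by eventually_elim simp
  show "\<beta> \<in> borel_measurable M" using \<beta> by (simp add: measurable_cong_sets[OF s refl])
  have "(\<lambda>y. indicator (phase d) y *\<^sub>R \<beta> y) \<in> borel_measurable borel" using \<beta> ph by simp
  then show "(\<lambda>y. indicator (phase d) y *\<^sub>R \<beta> y) \<in> borel_measurable M" by (simp add: measurable_cong_sets[OF s refl])
qed

lemma lift_borel_measurable:
  assumes "g \<in> borel_measurable (borel :: (real \<times> real) measure)"
  shows "(\<lambda>p. g (fst p, fst (snd p))) \<in> borel_measurable (borel :: (real \<times> real \<times> real) measure)"
proof -
  have "(\<lambda>p. (fst p, fst (snd p))) \<in> borel_measurable (borel :: (real \<times> real \<times> real) measure)"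
    by (intro borel_measurable_continuous_onI continuous_intros)
  from measurable_compose[OF this assms] show ?thesis .
qed

section \<open>The sequence of solutions and its limit fields\<close>

locale micro_sequence =
  fixes P :: phys and T d :: real and rho0 u0 :: "real \<Rightarrow> real" and K rho_lo rho_hi :: real
    and N :: "nat \<Rightarrow> nat" and D :: "nat \<Rightarrow> micro_data" and s :: "nat \<Rightarrow> micro_sol"
    and S :: "real \<Rightarrow> (real \<times> real) measure"
  assumes micro: "\<And>n. micro_solution P (N n) T d rho0 u0 (D n) (s n) K rho_lo rho_hi"
    and N_lim: "filterlim N at_top sequentially"
    and S_prob_on: "\<And>t. t \<in> {0..T} \<Longrightarrow> prob_on (phase d) (S t)"
    and S_unif: "\<And>\<beta> :: real \<times> real \<Rightarrow> real. continuous_on (phase d) \<beta> \<Longrightarrow>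
       uniform_limit {0..T} (\<lambda>n t. LINT y:phase d|bubble_distr (N n) (s n) t. \<beta> y)
         (\<lambda>t. LINT y:phase d|S t. \<beta> y) sequentially"
begin

lemma distr_continuous:
  fixes \<beta> :: "real \<times> real \<Rightarrow> real"
  assumes \<beta>: "continuous_on (phase d) \<beta>"
  shows "continuous_on {0..T} (\<lambda>t. LINT y:phase d|bubble_distr (N n) (s n) t. \<beta> y)"
proof -
  interpret m: micro_solution P "N n" T d rho0 u0 "D n" "s n" K rho_lo rho_hi by (rule micro)
  have "continuous_on {0..T} (\<lambda>t. (\<Sum>k\<in>{1..N n}. \<beta> (cen (s n) k t, real (N n) * rad (s n) k t)) / real (N n))"
    using m.n
    by (intro continuous_intros continuous_on_compose2[OF \<beta>] m.cen_cont m.rad_cont)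
       (auto intro: m.phase_point)
  then show ?thesis
    by (rule continuous_on_eq) (simp add: m.bubble_distr_integral[OF _ \<beta>])
qed

text \<open>The empirical averages are continuous in time because the trajectories are, and uniform
  convergence preserves this.\<close>

lemma limit_continuous:
  fixes \<beta> :: "real \<times> real \<Rightarrow> real"
  assumes \<beta>: "continuous_on (phase d) \<beta>"
  shows "continuous_on {0..T} (\<lambda>t. LINT y:phase d|S t. \<beta> y)"
  by (rule uniform_limit_theorem[OF _ S_unif[OF \<beta>]]) (simp_all add: distr_continuous[OF \<beta>])

text \<open>Freezing the trajectories outside \<open>[0,T]\<close> makes them continuous on the whole line.\<close>

definition cl :: "real \<Rightarrow> real" where "cl t = max 0 (min T t)"

lemma T_pos: "T > 0" and d_pos: "d > 0"
  using micro_solution.T[OF micro[of 0]] micro_solution.d[OF micro[of 0]] by auto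

lemma cl_in: "cl t \<in> {0..T}" and cl_cont: "continuous_on A cl" and cl_eq: "t \<in> {0..T} \<Longrightarrow> cl t = t"
  using T_pos by (auto simp: cl_def[abs_def] intro!: continuous_intros)

sublocale separated_bubbles d T N "\<lambda>n k t. cen (s n) k (cl t)" "\<lambda>n k t. rad (s n) k (cl t)" "\<lambda>t. S (cl t)"
proof
  note m = micro_solution.cen_cont[OF micro] micro_solution.rad_cont[OF micro]
  show "d > 0" "T > 0" by (rule d_pos T_pos)+
  show "N n \<ge> 1" for n by (rule micro_solution.n[OF micro])
  show "filterlim N at_top sequentially" by (rule N_lim)
  show "continuous_on UNIV (\<lambda>t. cen (s n) k (cl t))" "continuous_on UNIV (\<lambda>t. rad (s n) k (cl t))"
    if "k \<in> {1..N n}" for n k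
    by (rule continuous_on_compose2[OF m(1)[OF that] cl_cont] continuous_on_compose2[OF m(2)[OF that] cl_cont]; use cl_in in blast)+
  show "d \<le> real (N n) * rad (s n) k (cl t) \<and> real (N n) * rad (s n) k (cl t) \<le> 1 / d"
    "-1 < cen (s n) k (cl t) - rad (s n) k (cl t) \<and> cen (s n) k (cl t) + rad (s n) k (cl t) < 1"
    if "k \<in> {1..N n}" for n k t
    using micro_solution.radius[OF micro cl_in that] micro_solution.inside[OF micro cl_in that] by auto
  show "cen (s n) k (cl t) + rad (s n) k (cl t) \<le> cen (s n) l (cl t) - rad (s n) l (cl t)"
    if "k \<in> {1..N n}" "l \<in> {1..N n}" "k < l" for n k l t
    by (rule micro_solution.ordered[OF micro cl_in that])
  show "prob_on (phase d) (S (cl t))" for t by (rule S_prob_on[OF cl_in])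
  fix \<beta> :: "real \<times> real \<Rightarrow> real" assume \<beta>: "continuous_on UNIV \<beta>"
  have \<beta>p: "continuous_on (phase d) \<beta>" by (rule continuous_on_subset[OF \<beta>]) simp
  have eq: "(LINT y:phase d|S (cl t). \<beta> y) = (LINT y|S (cl t). \<beta> y)" for t
    by (rule prob_on_integral[OF S_prob_on[OF cl_in] borel_measurable_continuous_onI[OF \<beta>]])
  show "(\<lambda>n. (\<Sum>k\<in>{1..N n}. \<beta> (cen (s n) k (cl t), real (N n) * rad (s n) k (cl t))) / real (N n)) \<longlonglongrightarrow> (LINT y|S (cl t). \<beta> y)" for t
    using tendsto_uniform_limitI[OF S_unif[OF \<beta>p] cl_in, of t]
    by (simp only: micro_solution.bubble_distr_integral[OF micro cl_in \<beta>p] eq)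
  show "continuous_on UNIV (\<lambda>t. LINT y|S (cl t). \<beta> y)"
    using continuous_on_compose2[OF limit_continuous[OF \<beta>p] cl_cont, of UNIV] cl_in by (simp add: eq image_subset_iff)
qed

lemma bub_average_affine:
  assumes "\<And>t k. t \<in> {0<..<T} \<Longrightarrow> k \<in> {1..N n} \<Longrightarrow>
    \<exists>b. \<forall>x\<in>{cen (s n) k t - rad (s n) k t<..<cen (s n) k t + rad (s n) k t}. w (t, x) = w (t, cen (s n) k t) + b * (x - cen (s n) k t)"
  shows "bub_average n (\<lambda>z. indicator (cyl T) z * w z)"
  unfolding bub_average_def
proof (intro allI ballI)
  fix t k assume k: "k \<in> {1..N n}"
  let ?c = "cen (s n) k (cl t)" let ?R = "rad (s n) k (cl t)"
  show "(LINT x:bub n k t|lborel. indicator (cyl T) (t, x) * w (t, x)) = 2 * ?R * (indicator (cyl T) (t, ?c) * w (t, ?c))"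
  proof (cases "t \<in> {0<..<T}")
    case True
    then have cl: "cl t = t" by (simp add: cl_eq)
    obtain b where b: "\<And>x. x \<in> bub n k t \<Longrightarrow> w (t, x) = w (t, ?c) + b * (x - ?c)"
      using assms[OF True k] unfolding bub_def cl by blast
    have sub: "x \<in> bub n k t \<Longrightarrow> x \<in> Omega" for x
      using inside[OF k, of t] by (auto simp: bub_def Omega_def)
    have c: "?c \<in> Omega" by (rule sub) (use R_pos[OF k, of t] in \<open>simp add: bub_def\<close>)
    show ?thesis
    proof -
      have ind: "indicator (cyl T) (t, x) = (1::real)" if "x \<in> Omega" for x using True that by (simp add: cyl_def)
      have "(LINT x:bub n k t|lborel. indicator (cyl T) (t, x) * w (t, x)) = 2 * ?R * w (t, ?c)"
        unfolding bub_def
      proof (rule affine_mean[OF R_pos[OF k, of t]])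
        fix x assume "x \<in> {?c - ?R<..<?c + ?R}"
        then have x: "x \<in> bub n k t" by (simp only: bub_def)
        show "indicator (cyl T) (t, x) * w (t, x) = w (t, ?c) + b * (x - ?c)" by (simp only: ind[OF sub[OF x]] b[OF x] mult_1)
      qed
      then show ?thesis by (simp only: ind[OF c] mult_1)
    qed
  next
    case False
    then have "indicator (cyl T) (t, x) = (0::real)" for x by (auto simp: cyl_def)
    then show ?thesis by (simp add: set_lebesgue_integral_def)
  qed
qed

lemma flux_integrable_limit: "flux_integrable T (\<lambda>t. S (cl t)) F \<Longrightarrow> flux_integrable T S F"
proof -
  assume *: "flux_integrable T (\<lambda>t. S (cl t)) F"
  have cl: "t \<in> {0<..<T} \<Longrightarrow> cl t = t" for t by (simp add: cl_eq)
  have "set_integrable lborel {0<..<T} (\<lambda>t. LINT y:Omega \<times> {0<..}|S t. \<bar>F (t,y)\<bar>) =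
        set_integrable lborel {0<..<T} (\<lambda>t. LINT y:Omega \<times> {0<..}|S (cl t). \<bar>F (t,y)\<bar>)"
    by (rule set_integrable_cong) (simp_all add: cl)
  moreover have "AE t\<in>{0<..<T} in lborel. set_integrable (S t) (Omega \<times> {0<..}) (\<lambda>y. F (t,y))"
    using *[unfolded flux_integrable_def, THEN conjunct1] by eventually_elim (simp add: cl)
  ultimately show ?thesis using * by (simp add: flux_integrable_def)
qed

end

text \<open>For density and stress, square integrability at every index comes from the single
  solutions; for the velocity, convergence in \<open>conv_L2\<close> gives it only eventually, hence
  the separate assumption \<open>u_L2\<close>.\<close>

locale micro_limit = micro_sequence +
  fixes u_bar rho_bar Sigma_bar :: "real \<times> real \<Rightarrow> real"
  assumes u_lim: "conv_L2 (cyl T) (\<lambda>n. u_ext (N n) T (s n)) u_bar"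
    and u_L2: "\<And>n. L2_on (cyl T) (u_ext (N n) T (s n))"
    and rho_lim: "conv_L2 (cyl T) (\<lambda>n. rho_g_ext (s n)) rho_bar"
    and stress_lim: "weak_conv_L2H1 T (\<lambda>n. stress_g_ext P (N n) T (D n) (s n)) Sigma_bar"
begin

text \<open>Extension by zero, so that all pairings are taken over the plane. The truncated constant
  1 acts as the field in the terms without an unknown: the time derivative and the surface
  tension.\<close>

definition trunc :: "(real \<times> real \<Rightarrow> real) \<Rightarrow> real \<times> real \<Rightarrow> real" where
  "trunc w z = indicator (cyl T) z * w z"

abbreviation "stress_n n \<equiv> stress_g_ext P (N n) T (D n) (s n)"

lemma rho_L2: "L2_on (cyl T) (rho_g_ext (s n))"
  using micro_solution.ext[OF micro[of n]] by (simp add: extended_solution_def transport_solution_def H1_tx_def)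

lemma stress_L2: "L2_on (cyl T) (stress_n n)"
  using micro_solution.L2H1_stress[OF micro] by (simp add: L2H1_def)

lemma limit_L2: "L2_on (cyl T) u_bar" "L2_on (cyl T) rho_bar" "L2_on (cyl T) Sigma_bar"
  using u_lim rho_lim stress_lim by (auto simp: conv_L2_def weak_conv_L2H1_def L2H1_def)

lemma trunc_integrable: "L2_on (cyl T) w \<Longrightarrow> integrable lborel (trunc w)"
  using L2_on_cyl(1)[of T w] by (simp add: trunc_def[abs_def])

lemma one_integrable: "integrable lborel (trunc (\<lambda>_. 1))"
  using cyl_indicator_integrable by (simp add: trunc_def[abs_def])

lemma trunc_average: "bub_average n (trunc (\<lambda>_. 1))" "bub_average n (trunc (u_ext (N n) T (s n)))"
  "bub_average n (trunc (rho_g_ext (s n)))" "bub_average n (trunc (stress_n n))"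
proof -
  interpret m: micro_solution P "N n" T d rho0 u0 "D n" "s n" K rho_lo rho_hi by (rule micro)
  note m.xp_eq(1)[simp] m.xm_eq(1)[simp]
  show "bub_average n (trunc (\<lambda>_. 1))" unfolding trunc_def[abs_def] by (rule bub_average_affine) (auto intro: exI[of _ 0])
  show "bub_average n (trunc (u_ext (N n) T (s n)))" unfolding trunc_def[abs_def]
  proof (rule bub_average_affine)
    fix t k assume "t \<in> {0<..<T}" and k: "k \<in> {1..N n}"
    then have t: "t \<in> {0..T}" by simp
    show "\<exists>b. \<forall>x\<in>{cen (s n) k t - rad (s n) k t<..<cen (s n) k t + rad (s n) k t}.
        u_ext (N n) T (s n) (t, x) = u_ext (N n) T (s n) (t, cen (s n) k t) + b * (x - cen (s n) k t)"
    proof (intro exI ballI)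
      fix x assume "x \<in> {cen (s n) k t - rad (s n) k t<..<cen (s n) k t + rad (s n) k t}"
      then have "x \<in> {xm (N n) (s n) t k..xp (s n) t k}" using k by simp
      from m.u_ext_bubble[OF t k this] show "u_ext (N n) T (s n) (t, x) =
          u_ext (N n) T (s n) (t, cen (s n) k t) + tder T (rad (s n) k) t / rad (s n) k t * (x - cen (s n) k t)"
        by (simp only: m.tder_cen_eq[OF t k])
    qed
  qed
  show "bub_average n (trunc (rho_g_ext (s n)))" unfolding trunc_def[abs_def]
  proof (rule bub_average_affine)
    fix t k assume "t \<in> {0<..<T}" and k: "k \<in> {1..N n}"
    then have t: "t \<in> {0..T}" by simp
    show "\<exists>b. \<forall>x\<in>{cen (s n) k t - rad (s n) k t<..<cen (s n) k t + rad (s n) k t}.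
        rho_g_ext (s n) (t, x) = rho_g_ext (s n) (t, cen (s n) k t) + b * (x - cen (s n) k t)"
      using m.rho_g_ext_bubble[OF t k] m.center_in_bubble[OF t k] k by (intro exI[of _ 0] ballI) (simp add: m.xp_eq m.xm_eq)
  qed
  show "bub_average n (trunc (stress_n n))" unfolding trunc_def[abs_def]
  proof (rule bub_average_affine)
    fix t k assume "t \<in> {0<..<T}" and k: "k \<in> {1..N n}"
    then have t: "t \<in> {0..T}" by simp
    show "\<exists>b. \<forall>x\<in>{cen (s n) k t - rad (s n) k t<..<cen (s n) k t + rad (s n) k t}.
        stress_n n (t, x) = stress_n n (t, cen (s n) k t) + b * (x - cen (s n) k t)"
      using m.stress_g_ext_bubble[OF t k] m.center_in_bubble[OF t k] k by (intro exI[of _ 0] ballI) (simp add: m.xp_eq m.xm_eq)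
  qed
qed

lemma flux_u: "flux_integrable T S (\<lambda>(t,x,r). u_bar (t,x))"
proof (rule flux_integrable_limit, rule flux_integrable_bounded[of "trunc u_bar" _ 1])
  show i: "integrable lborel (trunc u_bar)" by (rule trunc_integrable[OF limit_L2(1)])
  have "trunc u_bar \<in> borel_measurable borel" using i by auto
  from lift_borel_measurable[OF this]
  show "(\<lambda>p. indicator (cyl T) (fst p, fst (snd p)) * (case p of (t,x,r) \<Rightarrow> u_bar (t,x))) \<in> borel_measurable (borel :: (real \<times> real \<times> real) measure)"
    by (simp add: trunc_def[abs_def] case_prod_unfold)
qed (auto simp: trunc_def)

lemma mu_pos: "mu_g P > 0" and gamma_pos: "gamma_s_bar P > 0"
  using micro_solution.P[OF micro[of 0]] by (auto simp: phys_ok_def)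

lemma flux_r: "flux_integrable T S (\<lambda>(t,x,r). 1 / mu_g P * (r * (Sigma_bar (t,x) + p_g P (rho_bar (t,x))) + gamma_s_bar P / 2))"
proof (rule flux_integrable_limit,
    rule flux_integrable_bounded[of "\<lambda>z. trunc Sigma_bar z + (a_g P)\<^sup>2 * trunc rho_bar z" _ "1 / mu_g P * (1 / d + gamma_s_bar P / 2)"])
  let ?g = "\<lambda>z. trunc Sigma_bar z + (a_g P)\<^sup>2 * trunc rho_bar z"
  show i: "integrable lborel ?g" using trunc_integrable[OF limit_L2(3)] trunc_integrable[OF limit_L2(2)] by simp
  have "?g \<in> borel_measurable borel" using borel_measurable_integrable[OF i] by simp
  note [measurable] = lift_borel_measurable[OF this]
  have "indicator (cyl T) \<in> borel_measurable (borel :: (real \<times> real) measure)" using cyl_sets by simp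
  note [measurable] = lift_borel_measurable[OF this]
  have [measurable]: "(\<lambda>p. snd (snd p)) \<in> borel_measurable (borel :: (real \<times> real \<times> real) measure)"
    by (intro borel_measurable_continuous_onI continuous_intros)
  have "(\<lambda>p. 1 / mu_g P * (snd (snd p) * ?g (fst p, fst (snd p)) + gamma_s_bar P / 2 * indicator (cyl T) (fst p, fst (snd p)))) \<in> borel_measurable borel"
    by measurable
  also have "(\<lambda>p. 1 / mu_g P * (snd (snd p) * ?g (fst p, fst (snd p)) + gamma_s_bar P / 2 * indicator (cyl T) (fst p, fst (snd p)))) =
      (\<lambda>p. indicator (cyl T) (fst p, fst (snd p)) *
      (case p of (t,x,r) \<Rightarrow> 1 / mu_g P * (r * (Sigma_bar (t,x) + p_g P (rho_bar (t,x))) + gamma_s_bar P / 2)))"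
    by (rule ext) (simp add: trunc_def p_g_def case_prod_unfold indicator_def)
  finally show "(\<lambda>p. indicator (cyl T) (fst p, fst (snd p)) *
      (case p of (t,x,r) \<Rightarrow> 1 / mu_g P * (r * (Sigma_bar (t,x) + p_g P (rho_bar (t,x))) + gamma_s_bar P / 2))) \<in> borel_measurable borel" .
  show "0 \<le> 1 / mu_g P * (1 / d + gamma_s_bar P / 2)" using mu_pos gamma_pos d_pos by simp
  fix t x r :: real assume z: "(t,x) \<in> cyl T" and r: "r \<in> {d..1/d}"
  have "\<bar>r * ?g (t,x)\<bar> \<le> 1 / d * \<bar>?g (t,x)\<bar>"
    unfolding abs_mult using r d_pos by (intro mult_right_mono) auto
  then have "\<bar>r * ?g (t,x) + gamma_s_bar P / 2\<bar> \<le> 1 / d * \<bar>?g (t,x)\<bar> + gamma_s_bar P / 2 * 1"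
    using gamma_pos by linarith
  moreover have "0 \<le> 1 / d" "0 \<le> gamma_s_bar P / 2 * \<bar>?g (t,x)\<bar>" using d_pos gamma_pos by simp_all
  ultimately have "\<bar>r * ?g (t,x) + gamma_s_bar P / 2\<bar> \<le> (1 / d + gamma_s_bar P / 2) * (\<bar>?g (t,x)\<bar> + 1)"
    unfolding distrib_left distrib_right by linarith
  then have "1 / mu_g P * \<bar>r * ?g (t,x) + gamma_s_bar P / 2\<bar> \<le> 1 / mu_g P * ((1 / d + gamma_s_bar P / 2) * (\<bar>?g (t,x)\<bar> + 1))"
    using mu_pos by (intro mult_left_mono) auto
  moreover have "r * ?g (t,x) = r * (Sigma_bar (t,x) + p_g P (rho_bar (t,x)))" using z by (simp add: trunc_def p_g_def)
  ultimately show "\<bar>case (t,x,r) of (t,x,r) \<Rightarrow> 1 / mu_g P * (r * (Sigma_bar (t,x) + p_g P (rho_bar (t,x))) + gamma_s_bar P / 2)\<bar>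
      \<le> 1 / mu_g P * (1 / d + gamma_s_bar P / 2) * (\<bar>?g (t,x)\<bar> + 1)"
    using mu_pos by (simp add: abs_mult mult.assoc)
qed

end

lemma compact_support_bounded:
  fixes f :: "'a::euclidean_space \<Rightarrow> real"
  assumes "continuous_on UNIV f" "compact S" "\<And>z. z \<notin> S \<Longrightarrow> f z = 0"
  shows "\<exists>B. \<forall>z. \<bar>f z\<bar> \<le> B"
proof -
  obtain B where "0 \<le> B" "\<And>z. z \<in> S \<Longrightarrow> \<bar>f z\<bar> \<le> B"
    using bounded_continuous_compact[OF continuous_on_subset[OF assms(1) subset_UNIV] assms(2)] by blast
  then show ?thesis using assms(3) by (intro exI[of _ B] allI) (metis abs_zero)
qed

text \<open>The last claim gives the positive margin between the spatial support and the walls that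
  smearing requires; it is the minimum of \<open>1 - \<bar>x\<bar>\<close> over the compact support,
  attained when that support is nonempty.\<close>

lemma test_derivative:
  fixes T :: real and \<phi> :: "real \<times> real \<times> real \<Rightarrow> real"
  assumes \<phi>: "test_fun ({0<..<T} \<times> Omega \<times> {0<..}) \<phi>" and b: "b \<in> Basis"
  shows "continuous_on UNIV (pd b \<phi>)" "continuous_on UNIV (\<lambda>p. snd (snd p) * pd b \<phi> p)"
    "\<exists>B. \<forall>z. \<bar>pd b \<phi> z\<bar> \<le> B" "\<exists>B. \<forall>z. \<bar>snd (snd z) * pd b \<phi> z\<bar> \<le> B"
    "z \<notin> {0<..<T} \<times> Omega \<times> {0<..} \<Longrightarrow> pd b \<phi> z = 0"
    "\<exists>\<rho>>0. \<forall>t x r. pd b \<phi> (t,x,r) \<noteq> 0 \<longrightarrow> t \<in> {0..T} \<and> \<bar>x\<bar> \<le> 1 - \<rho>"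
proof -
  from test_funD[OF \<phi>] obtain S where S: "smooth \<phi>" "compact S" "S \<subseteq> {0<..<T} \<times> Omega \<times> {0<..}"
    "\<And>z. z \<notin> S \<Longrightarrow> \<phi> z = 0" "\<And>z b. z \<notin> S \<Longrightarrow> pd b \<phi> z = 0" by metis
  show c: "continuous_on UNIV (pd b \<phi>)" by (rule smooth_continuous[OF smooth_pd[OF S(1) b]])
  then show c': "continuous_on UNIV (\<lambda>p. snd (snd p) * pd b \<phi> p)" by (intro continuous_intros)
  show "\<exists>B. \<forall>z. \<bar>pd b \<phi> z\<bar> \<le> B" by (rule compact_support_bounded[OF c S(2,5)])
  show "\<exists>B. \<forall>z. \<bar>snd (snd z) * pd b \<phi> z\<bar> \<le> B" by (rule compact_support_bounded[OF c' S(2)]) (simp add: S(5))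
  show "z \<notin> {0<..<T} \<times> Omega \<times> {0<..} \<Longrightarrow> pd b \<phi> z = 0" using S(3,5) by blast
  show "\<exists>\<rho>>0. \<forall>t x r. pd b \<phi> (t,x,r) \<noteq> 0 \<longrightarrow> t \<in> {0..T} \<and> \<bar>x\<bar> \<le> 1 - \<rho>"
  proof (cases "S = {}")
    case True
    then have "pd b \<phi> z = 0" for z using S(5) by blast
    then show ?thesis by (intro exI[of _ 1]) simp
  next
    case False
    have "continuous_on S (\<lambda>p. 1 - \<bar>fst (snd p)\<bar>)" by (intro continuous_intros)
    from continuous_attains_inf[OF S(2) False this] obtain p0 where
      p0: "p0 \<in> S" "\<And>p. p \<in> S \<Longrightarrow> 1 - \<bar>fst (snd p0)\<bar> \<le> 1 - \<bar>fst (snd p)\<bar>" by blast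
    have "t \<in> {0..T} \<and> \<bar>x\<bar> \<le> 1 - (1 - \<bar>fst (snd p0)\<bar>)" if "pd b \<phi> (t,x,r) \<noteq> 0" for t x r
    proof -
      have p: "(t,x,r) \<in> S" using that S(5) by blast
      then have "t \<in> {0<..<T}" using S(3) by blast
      then show ?thesis using p0(2)[OF p] by auto
    qed
    moreover have "1 - \<bar>fst (snd p0)\<bar> > 0" using subsetD[OF S(3) p0(1)] by (auto simp: Omega_def)
    ultimately show ?thesis by blast
  qed
qed

lemma Basis_time_space_radius: "(1,0,0) \<in> (Basis :: (real \<times> real \<times> real) set)"
  "(0,1,0) \<in> (Basis :: (real \<times> real \<times> real) set)" "(0,0,1) \<in> (Basis :: (real \<times> real \<times> real) set)"
  by (auto simp: Basis_prod_def zero_prod_def)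

section \<open>Weak form for finitely many bubbles and passage to the limit\<close>

context micro_limit
begin

text \<open>The radial flux is split so that each pairing consists of a single field of
  \<open>(t, x)\<close> and a continuous bounded function of \<open>(t, x, r)\<close>; the factor
  \<open>r\<close> therefore goes with the test function.\<close>

lemma weak_form_n:
  assumes \<phi>: "test_fun ({0<..<T} \<times> Omega \<times> {0<..}) \<phi>"
  shows "emp_pairing n (trunc (\<lambda>_. 1)) (pd (1,0,0) \<phi>) + emp_pairing n (trunc (u_ext (N n) T (s n))) (pd (0,1,0) \<phi>) +
    1 / mu_g P * (emp_pairing n (trunc (stress_n n)) (\<lambda>p. snd (snd p) * pd (0,0,1) \<phi> p) +
      (a_g P)\<^sup>2 * emp_pairing n (trunc (rho_g_ext (s n))) (\<lambda>p. snd (snd p) * pd (0,0,1) \<phi> p) +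
      gamma_s_bar P / 2 * emp_pairing n (trunc (\<lambda>_. 1)) (pd (0,0,1) \<phi>)) = 0"
proof -
  interpret m: micro_solution P "N n" T d rho0 u0 "D n" "s n" K rho_lo rho_hi by (rule micro)
  have i: "integrable lborel (\<lambda>t. emp n t (\<lambda>y. trunc w (t, fst y) * \<psi> (t, y)))"
    if w: "integrable lborel (trunc w)" "bub_average n (trunc w)" and \<psi>: "continuous_on UNIV \<psi>" "\<exists>B. \<forall>z. \<bar>\<psi> z\<bar> \<le> B"
    for w and \<psi> :: "real \<times> real \<times> real \<Rightarrow> real"
  proof -
    obtain B where "\<And>z. \<bar>\<psi> z\<bar> \<le> B" using \<psi>(2) by blast
    from emp_pairing_spread(1)[OF w borel_measurable_continuous_onI[OF \<psi>(1)] this] show ?thesis .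
  qed
  define p where "p = (\<lambda>k t. (t, cen (s n) k t, real (N n) * rad (s n) k t))"
  define e1 where "e1 = (\<lambda>t. emp n t (\<lambda>y. trunc (\<lambda>_. 1) (t, fst y) * pd (1,0,0) \<phi> (t, y)))"
  define e2 where "e2 = (\<lambda>t. emp n t (\<lambda>y. trunc (u_ext (N n) T (s n)) (t, fst y) * pd (0,1,0) \<phi> (t, y)))"
  define e3 where "e3 = (\<lambda>t. emp n t (\<lambda>y. trunc (stress_n n) (t, fst y) * (snd (snd (t, y)) * pd (0,0,1) \<phi> (t, y))))"
  define e4 where "e4 = (\<lambda>t. emp n t (\<lambda>y. trunc (rho_g_ext (s n)) (t, fst y) * (snd (snd (t, y)) * pd (0,0,1) \<phi> (t, y))))"
  define e5 where "e5 = (\<lambda>t. emp n t (\<lambda>y. trunc (\<lambda>_. 1) (t, fst y) * pd (0,0,1) \<phi> (t, y)))"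
  note td = test_derivative[OF \<phi> Basis_time_space_radius(1)] test_derivative[OF \<phi> Basis_time_space_radius(2)]
    test_derivative[OF \<phi> Basis_time_space_radius(3)]
  have ei: "integrable lborel e1" "integrable lborel e2" "integrable lborel e3" "integrable lborel e4" "integrable lborel e5"
    unfolding e1_def e2_def e3_def e4_def e5_def
    by (rule i one_integrable trunc_integrable rho_L2 u_L2 stress_L2 trunc_average td)+
  define X where "X = (\<lambda>k t. indicator {0..T} t * (pd (1,0,0) \<phi> (p k t) + tder T (cen (s n) k) t * pd (0,1,0) \<phi> (p k t)
        + real (N n) * tder T (rad (s n) k) t * pd (0,0,1) \<phi> (p k t)))"
  have X: "(LINT t|lborel. X k t) = 0" "integrable lborel (X k)" if "k \<in> {1..N n}" for k
    using m.trajectory_identity[OF \<phi> that] by (simp_all add: X_def p_def)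
  define h where "h = (\<lambda>t. e1 t + e2 t + 1 / mu_g P * (e3 t + (a_g P)\<^sup>2 * e4 t + gamma_s_bar P / 2 * e5 t))"
  \<comment> \<open>The endpoints form a null set and are set aside: \<open>trunc\<close> cuts off
    to the open time interval, \<open>X\<close> to the closed one.\<close>
  have hX: "h t = (\<Sum>k\<in>{1..N n}. X k t) / real (N n)" if neq: "t \<noteq> 0" "t \<noteq> T" for t
  proof (cases "t \<in> {0<..<T}")
    case True
    then have t: "t \<in> {0..T}" by simp
    have cl: "cl t = t" by (rule cl_eq[OF t])
    define A where "A = (\<lambda>k. pd (1,0,0) \<phi> (p k t))"
    define B where "B = (\<lambda>k. u_ext (N n) T (s n) (t, cen (s n) k t) * pd (0,1,0) \<phi> (p k t))"
    define C where "C = (\<lambda>k. stress_n n (t, cen (s n) k t) * (real (N n) * rad (s n) k t * pd (0,0,1) \<phi> (p k t)))"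
    define E where "E = (\<lambda>k. rho_g_ext (s n) (t, cen (s n) k t) * (real (N n) * rad (s n) k t * pd (0,0,1) \<phi> (p k t)))"
    define G where "G = (\<lambda>k. pd (0,0,1) \<phi> (p k t))"
    have tr: "trunc w (t, cen (s n) k t) = w (t, cen (s n) k t)" if "k \<in> {1..N n}" for w k
      using m.inside[OF t that] m.rad_pos[OF t that] True by (simp add: trunc_def cyl_def Omega_def)
    have s: "e1 t = sum A {1..N n} / real (N n)" "e2 t = sum B {1..N n} / real (N n)" "e3 t = sum C {1..N n} / real (N n)"
      "e4 t = sum E {1..N n} / real (N n)" "e5 t = sum G {1..N n} / real (N n)"
      unfolding e1_def e2_def e3_def e4_def e5_def emp_def cl A_def B_def C_def E_def G_def p_def
      by (intro arg_cong[where f = "\<lambda>x. x / real (N n)"] sum.cong refl; simp add: tr)+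
    have "X k t = A k + B k + 1 / mu_g P * (C k + (a_g P)\<^sup>2 * E k + gamma_s_bar P / 2 * G k)" if k: "k \<in> {1..N n}" for k
    proof -
      have "X k t = A k + B k + real (N n) * tder T (rad (s n) k) t * G k"
        using t by (simp add: X_def A_def B_def G_def m.tder_cen_eq[OF t k])
      also have "real (N n) * tder T (rad (s n) k) t * G k = 1 / mu_g P * (C k + (a_g P)\<^sup>2 * E k + gamma_s_bar P / 2 * G k)"
        unfolding m.tder_rad_eq[OF t k] by (simp add: C_def E_def G_def p_g_def algebra_simps)
      finally show ?thesis .
    qed
    then have "(\<Sum>k\<in>{1..N n}. X k t) = (\<Sum>k\<in>{1..N n}. A k + B k + 1 / mu_g P * (C k + (a_g P)\<^sup>2 * E k + gamma_s_bar P / 2 * G k))"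
      by (rule sum.cong[OF refl])
    also have "\<dots> = sum A {1..N n} + sum B {1..N n} + 1 / mu_g P * (sum C {1..N n} + (a_g P)\<^sup>2 * sum E {1..N n} + gamma_s_bar P / 2 * sum G {1..N n})"
      by (simp only: sum.distrib sum_distrib_left[symmetric])
    finally show ?thesis
      unfolding h_def s by (simp add: add_divide_distrib distrib_left mult.assoc)
  next
    case False
    then have "t \<notin> {0..T}" using neq by auto
    moreover have "trunc w (t, x) = 0" for w x using False by (auto simp: trunc_def cyl_def)
    ultimately show ?thesis by (simp add: h_def e1_def e2_def e3_def e4_def e5_def emp_def X_def)
  qed
  have "AE t in lborel. h t = (\<Sum>k\<in>{1..N n}. X k t) / real (N n)"
    using AE_lborel_neq[of 0] AE_lborel_neq[of T] by eventually_elim (rule hX)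
  moreover have hi: "integrable lborel h" unfolding h_def using ei by simp
  moreover have Xi: "integrable lborel (\<lambda>t. (\<Sum>k\<in>{1..N n}. X k t) / real (N n))"
    by (rule integrable_divide, rule Bochner_Integration.integrable_sum) (rule X(2))
  ultimately have "(LINT t|lborel. h t) = (LINT t|lborel. (\<Sum>k\<in>{1..N n}. X k t) / real (N n))"
    by (intro integral_cong_AE) auto
  also have "\<dots> = 0" using X by simp
  finally have "(LINT t|lborel. h t) = 0" .
  then show ?thesis using ei unfolding h_def emp_pairing_def e1_def e2_def e3_def e4_def e5_def by simp
qed

lemma weak_form_limit:
  assumes \<phi>: "test_fun ({0<..<T} \<times> Omega \<times> {0<..}) \<phi>"
  shows "limit_pairing (trunc (\<lambda>_. 1)) (pd (1,0,0) \<phi>) + limit_pairing (trunc u_bar) (pd (0,1,0) \<phi>) +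
    1 / mu_g P * (limit_pairing (trunc Sigma_bar) (\<lambda>p. snd (snd p) * pd (0,0,1) \<phi> p) +
      (a_g P)\<^sup>2 * limit_pairing (trunc rho_bar) (\<lambda>p. snd (snd p) * pd (0,0,1) \<phi> p) +
      gamma_s_bar P / 2 * limit_pairing (trunc (\<lambda>_. 1)) (pd (0,0,1) \<phi>)) = 0"
    (is "?l = 0")
proof -
  note td = test_derivative[OF \<phi> Basis_time_space_radius(1)] test_derivative[OF \<phi> Basis_time_space_radius(2)]
    test_derivative[OF \<phi> Basis_time_space_radius(3)]
  have strong: "(\<lambda>n. emp_pairing n (trunc (w n)) \<psi>) \<longlonglongrightarrow> limit_pairing (trunc g) \<psi>"
    if w: "\<And>n. integrable lborel (trunc (w n))" "integrable lborel (trunc g)" "\<And>n. bub_average n (trunc (w n))"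
      and conv: "(\<lambda>n. LINT z|lborel. \<bar>trunc (w n) z - trunc g z\<bar>) \<longlonglongrightarrow> 0"
      and \<psi>: "continuous_on UNIV \<psi>" "\<exists>B. \<forall>z. \<bar>\<psi> z\<bar> \<le> B"
    for w g and \<psi> :: "real \<times> real \<times> real \<Rightarrow> real"
  proof -
    obtain B where B: "\<And>z. \<bar>\<psi> z\<bar> \<le> B" using \<psi>(2) by blast
    show ?thesis by (rule emp_pairing_strong_limit[OF w conv \<psi>(1) B])
  qed
  note L1 = conv_L2_imp_L1[OF u_lim u_L2] conv_L2_imp_L1[OF rho_lim rho_L2]
  have one: "(\<lambda>n. emp_pairing n (trunc (\<lambda>_. 1)) \<psi>) \<longlonglongrightarrow> limit_pairing (trunc (\<lambda>_. 1)) \<psi>"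
    if "continuous_on UNIV \<psi>" "\<exists>B. \<forall>z. \<bar>\<psi> z\<bar> \<le> B" for \<psi> :: "real \<times> real \<times> real \<Rightarrow> real"
    by (rule strong[OF one_integrable one_integrable trunc_average(1) _ that]) simp
  have st: "(\<lambda>n. emp_pairing n (trunc (stress_n n)) (\<lambda>p. snd (snd p) * pd (0,0,1) \<phi> p)) \<longlonglongrightarrow>
      limit_pairing (trunc Sigma_bar) (\<lambda>p. snd (snd p) * pd (0,0,1) \<phi> p)"
  proof -
    obtain B where B: "\<And>z. \<bar>snd (snd z) * pd (0,0,1) \<phi> z\<bar> \<le> B" using test_derivative(4)[OF \<phi> Basis_time_space_radius(3)] by blast
    obtain \<rho> where \<rho>: "\<rho> > 0" "\<And>t x r. pd (0,0,1) \<phi> (t,x,r) \<noteq> 0 \<Longrightarrow> t \<in> {0..T} \<and> \<bar>x\<bar> \<le> 1 - \<rho>"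
      using test_derivative(6)[OF \<phi> Basis_time_space_radius(3)] by blast
    \<comment> \<open>At a fixed time the modulus of the stress is governed by the energy
      \<open>Q n t\<close> of that slice, whose time integral is at most \<open>K\<close> for every
      \<open>n\<close>.\<close>
    define slo where "slo = (\<lambda>n. micro_solution.slope0 P (N n) T (D n) (s n))"
    define Q where "Q = (\<lambda>n t. LINT x|lborel. (slo n (t, x))\<^sup>2)"
    have sq: "integrable lborel (\<lambda>z. (slo n z)\<^sup>2)" "(LINT z|lborel. (slo n z)\<^sup>2) \<le> K" for n
      unfolding slo_def by (rule micro_solution.slope0_integrable(2)[OF micro] micro_solution.stress_L2_bounds(3)[OF micro])+
    show ?thesis
    proof (rule emp_pairing_weak_limit[where Q = Q and K = K, OF trunc_integrable[OF stress_L2] trunc_integrable[OF limit_L2(3)] trunc_average(4)])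
      show "(\<lambda>n. LINT z|lborel. trunc (stress_n n) z * h z) \<longlonglongrightarrow> (LINT z|lborel. trunc Sigma_bar z * h z)"
        if "h \<in> borel_measurable borel" "\<exists>B. \<forall>z. \<bar>h z\<bar> \<le> B" for h
        unfolding trunc_def by (rule weak_conv_L2H1_bounded[OF stress_lim micro_solution.L2H1_stress[OF micro] that])
      show "integrable lborel (\<lambda>z. (trunc (stress_n n) z)\<^sup>2)" "(LINT z|lborel. (trunc (stress_n n) z)\<^sup>2) \<le> K" for n
        unfolding trunc_def by (rule micro_solution.stress_L2_bounds[OF micro])+
      show "integrable lborel (Q n)" "(LINT t|lborel. Q n t) \<le> K" for n
        unfolding Q_def using lborel_integral_fst[OF sq(1)[of n]] sq(2)[of n] by simp_all
      show "0 \<le> Q n t" for n t unfolding Q_def by (intro Bochner_Integration.integral_nonneg) simp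
      show "\<bar>trunc (stress_n n) (t, x) - trunc (stress_n n) (t, y)\<bar> \<le> l * (Q n t + 1)"
        if "t \<in> {0<..<T}" "x \<in> Omega" "y \<in> Omega" "l > 0" "\<bar>x - y\<bar> \<le> l\<^sup>2" for n t x y l
        using micro_solution.stress_modulus[OF micro that] that(1-3) by (simp add: trunc_def cyl_def Q_def slo_def)
      show "t \<in> {0..T} \<and> \<bar>x\<bar> \<le> 1 - \<rho>" if "snd (snd (t,x,r)) * pd (0,0,1) \<phi> (t,x,r) \<noteq> 0" for t x r :: real
        using that by (intro \<rho>(2)[of t x r]) simp
    qed (rule td(14) B \<rho>(1))+
  qed
  have "(\<lambda>n. emp_pairing n (trunc (\<lambda>_. 1)) (pd (1,0,0) \<phi>) + emp_pairing n (trunc (u_ext (N n) T (s n))) (pd (0,1,0) \<phi>) +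
    1 / mu_g P * (emp_pairing n (trunc (stress_n n)) (\<lambda>p. snd (snd p) * pd (0,0,1) \<phi> p) +
      (a_g P)\<^sup>2 * emp_pairing n (trunc (rho_g_ext (s n))) (\<lambda>p. snd (snd p) * pd (0,0,1) \<phi> p) +
      gamma_s_bar P / 2 * emp_pairing n (trunc (\<lambda>_. 1)) (pd (0,0,1) \<phi>))) \<longlonglongrightarrow> ?l"
    by (intro tendsto_intros st one td strong trunc_integrable u_L2 rho_L2 limit_L2 trunc_average)
       (unfold trunc_def, (rule L1)+)
  then show ?thesis unfolding weak_form_n[OF \<phi>] by (simp add: LIMSEQ_const_iff)
qed

lemma limit_equation:
  "transport_distributional T S (\<lambda>(t,x,r). u_bar (t,x))
    (\<lambda>(t,x,r). 1 / mu_g P * (r * (Sigma_bar (t,x) + p_g P (rho_bar (t,x))) + gamma_s_bar P / 2))"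
  unfolding transport_distributional_def
proof (intro conjI allI impI flux_u flux_r)
  fix \<phi> :: "real \<times> real \<times> real \<Rightarrow> real" assume \<phi>: "test_fun ({0<..<T} \<times> Omega \<times> {0<..}) \<phi>"
  note td = test_derivative[OF \<phi> Basis_time_space_radius(1)] test_derivative[OF \<phi> Basis_time_space_radius(2)]
    test_derivative[OF \<phi> Basis_time_space_radius(3)]
  have zero: "pd (1,0,0) \<phi> z = 0" "pd (0,1,0) \<phi> z = 0" "pd (0,0,1) \<phi> z = 0" if "z \<notin> {0<..<T} \<times> Omega \<times> {0<..}" for z
    using test_derivative(5)[OF \<phi> _ that] Basis_time_space_radius by auto
  define r :: "real \<times> real \<times> real \<Rightarrow> real" where "r = (\<lambda>p. snd (snd p))"
  define F where "F = (\<lambda>w \<psi> (p :: real \<times> real \<times> real). trunc w (fst p, fst (snd p)) * (\<psi> p :: real))"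
  define J where "J = (\<lambda>w \<psi> t. LINT y|S (cl t). F w \<psi> (t, y))"
  have mF: "F w \<psi> \<in> borel_measurable borel" if "integrable lborel (trunc w)" "continuous_on UNIV \<psi>" for w \<psi>
  proof -
    have "trunc w \<in> borel_measurable borel" using that(1) by auto
    from lift_borel_measurable[OF this] borel_measurable_continuous_onI[OF that(2)] show ?thesis unfolding F_def by simp
  qed
  have iF: "AE t in lborel. integrable (S (cl t)) (\<lambda>y. F w \<psi> (t, y))" "integrable lborel (J w \<psi>)"
    if w: "integrable lborel (trunc w)" and \<psi>: "continuous_on UNIV \<psi>" "\<exists>B. \<forall>z. \<bar>\<psi> z\<bar> \<le> B" for w \<psi>
  proof -
    obtain B where B: "\<And>z. \<bar>\<psi> z\<bar> \<le> B" using \<psi>(2) by blast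
    show "AE t in lborel. integrable (S (cl t)) (\<lambda>y. F w \<psi> (t, y))" "integrable lborel (J w \<psi>)"
      using integrable_against_S(1,2)[OF w borel_measurable_continuous_onI[OF \<psi>(1)] B] by (simp_all add: F_def J_def)
  qed
  define \<psi> where "\<psi> = (\<lambda>p. r p * pd (0,0,1) \<phi> p)"
  have \<psi>: "continuous_on UNIV \<psi>" "\<exists>B. \<forall>z. \<bar>\<psi> z\<bar> \<le> B" using td(14,16) by (simp_all add: \<psi>_def r_def)
  define a where "a = F (\<lambda>_. 1) (pd (1,0,0) \<phi>)"
  define b where "b = F u_bar (pd (0,1,0) \<phi>)"
  define c where "c = F Sigma_bar \<psi>"
  define e where "e = F rho_bar \<psi>"
  define f where "f = F (\<lambda>_. 1) (pd (0,0,1) \<phi>)"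
  define H where "H = (\<lambda>p. a p + b p + 1 / mu_g P * (c p + (a_g P)\<^sup>2 * e p + gamma_s_bar P / 2 * f p))"
  note ints = one_integrable trunc_integrable[OF limit_L2(1)] trunc_integrable[OF limit_L2(2)] trunc_integrable[OF limit_L2(3)]
  have meas [measurable]: "a \<in> borel_measurable borel" "b \<in> borel_measurable borel" "c \<in> borel_measurable borel"
    "e \<in> borel_measurable borel" "f \<in> borel_measurable borel"
    unfolding a_def b_def c_def e_def f_def by (rule mF ints \<psi> td)+
  have "H \<in> borel_measurable borel" unfolding H_def by measurable
  then have "H \<in> borel_measurable (lborel \<Otimes>\<^sub>M borel)"
    by (simp add: borel_prod measurable_cong_sets[OF sets_pair_measure_cong[OF sets_lborel refl] refl])
  from borel_measurable_kernel_integral[OF this S_kernel]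
  have Hm: "(\<lambda>t. LINT y|S (cl t). H (t, y)) \<in> borel_measurable lborel" .
  have AEi: "AE t in lborel. integrable (S (cl t)) (\<lambda>y. a (t, y))" "AE t in lborel. integrable (S (cl t)) (\<lambda>y. b (t, y))"
    "AE t in lborel. integrable (S (cl t)) (\<lambda>y. c (t, y))" "AE t in lborel. integrable (S (cl t)) (\<lambda>y. e (t, y))"
    "AE t in lborel. integrable (S (cl t)) (\<lambda>y. f (t, y))"
    unfolding a_def b_def c_def e_def f_def by (rule iF ints \<psi> td)+
  define Ja where "Ja = J (\<lambda>_. 1) (pd (1,0,0) \<phi>)"
  define Jb where "Jb = J u_bar (pd (0,1,0) \<phi>)"
  define Jc where "Jc = J Sigma_bar \<psi>"
  define Je where "Je = J rho_bar \<psi>"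
  define Jf where "Jf = J (\<lambda>_. 1) (pd (0,0,1) \<phi>)"
  have Ji: "integrable lborel Ja" "integrable lborel Jb" "integrable lborel Jc" "integrable lborel Je" "integrable lborel Jf"
    unfolding Ja_def Jb_def Jc_def Je_def Jf_def by (rule iF ints \<psi> td)+
  define R where "R = (\<lambda>t. Ja t + Jb t + 1 / mu_g P * (Jc t + (a_g P)\<^sup>2 * Je t + gamma_s_bar P / 2 * Jf t))"
  have Ri: "integrable lborel R" unfolding R_def using Ji by simp
  \<comment> \<open>The inner integral may be split only at times where all five terms are
    integrable, which is almost every time.\<close>
  have HR: "AE t in lborel. (LINT y|S (cl t). H (t, y)) = R t"
    using AEi
  proof eventually_elim
    case (elim t)
    then show ?case
      unfolding H_def R_def Ja_def Jb_def Jc_def Je_def Jf_def J_def a_def[symmetric] b_def[symmetric] c_def[symmetric] e_def[symmetric] f_def[symmetric]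
      by simp
  qed
  have "(LINT t|lborel. LINT y|S (cl t). H (t, y)) = (LINT t|lborel. R t)"
    by (rule integral_cong_AE[OF _ _ HR]) (use Hm Ri in auto)
  also have "\<dots> = limit_pairing (trunc (\<lambda>_. 1)) (pd (1,0,0) \<phi>) + limit_pairing (trunc u_bar) (pd (0,1,0) \<phi>) +
    1 / mu_g P * (limit_pairing (trunc Sigma_bar) (\<lambda>p. snd (snd p) * pd (0,0,1) \<phi> p) +
      (a_g P)\<^sup>2 * limit_pairing (trunc rho_bar) (\<lambda>p. snd (snd p) * pd (0,0,1) \<phi> p) +
      gamma_s_bar P / 2 * limit_pairing (trunc (\<lambda>_. 1)) (pd (0,0,1) \<phi>))"
  proof -
    have "limit_pairing (trunc w) \<zeta> = (LINT t|lborel. J w \<zeta> t)" for w \<zeta> by (simp add: limit_pairing_def J_def F_def)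
    then have "limit_pairing (trunc (\<lambda>_. 1)) (pd (1,0,0) \<phi>) = (LINT t|lborel. Ja t)"
      "limit_pairing (trunc u_bar) (pd (0,1,0) \<phi>) = (LINT t|lborel. Jb t)"
      "limit_pairing (trunc Sigma_bar) (\<lambda>p. snd (snd p) * pd (0,0,1) \<phi> p) = (LINT t|lborel. Jc t)"
      "limit_pairing (trunc rho_bar) (\<lambda>p. snd (snd p) * pd (0,0,1) \<phi> p) = (LINT t|lborel. Je t)"
      "limit_pairing (trunc (\<lambda>_. 1)) (pd (0,0,1) \<phi>) = (LINT t|lborel. Jf t)"
      by (simp_all only: Ja_def Jb_def Jc_def Je_def Jf_def \<psi>_def r_def)
    then show ?thesis unfolding R_def using Ji by simp
  qed
  also have "\<dots> = 0" by (rule weak_form_limit[OF \<phi>])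
  finally have H0: "(LINT t|lborel. LINT y|S (cl t). H (t, y)) = 0" .
  let ?G = "\<lambda>t y. pd (1,0,0) \<phi> (t,y) + (case (t,y) of (t,x,r) \<Rightarrow> u_bar (t,x)) * pd (0,1,0) \<phi> (t,y) +
     (case (t,y) of (t,x,r) \<Rightarrow> 1 / mu_g P * (r * (Sigma_bar (t,x) + p_g P (rho_bar (t,x))) + gamma_s_bar P / 2)) * pd (0,0,1) \<phi> (t,y)"
  have GH: "indicator (Omega \<times> {0<..}) y * ?G t y = H (t, y)" if t: "t \<in> {0<..<T}" for t y
  proof (cases "y \<in> Omega \<times> {0<..}")
    case True
    then have "trunc w (t, fst y) = w (t, fst y)" for w using t by (auto simp: trunc_def cyl_def)
    then show ?thesis using True
      by (simp add: H_def a_def b_def c_def e_def f_def F_def \<psi>_def r_def p_g_def case_prod_unfold algebra_simps)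
  next
    case False
    then have "(t, y) \<notin> {0<..<T} \<times> Omega \<times> {0<..}" by simp
    then show ?thesis using False by (simp add: zero H_def a_def b_def c_def e_def f_def F_def \<psi>_def)
  qed
  have "indicator {0<..<T} t * (LINT y|S t. indicator (Omega \<times> {0<..}) y * ?G t y) = (LINT y|S (cl t). H (t, y))" for t
  proof (cases "t \<in> {0<..<T}")
    case True
    then show ?thesis by (simp only: GH[OF True]) (simp add: cl_eq)
  next
    case False
    then have "trunc w (t, x) = 0" for w x by (auto simp: trunc_def cyl_def)
    then have "H (t, y) = 0" for y by (simp add: H_def a_def b_def c_def e_def f_def F_def \<psi>_def)
    then show ?thesis using False by simp
  qed
  then show "(LINT t:{0<..<T}|lborel. LINT y:Omega \<times> {0<..}|S t. ?G t y) = 0"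
    using H0 by (simp only: set_lebesgue_integral_def real_scaleR_def)
qed

end

theorem proposition26:
  fixes P :: phys and I :: macro_data
    and D :: "nat \<Rightarrow> micro_data" and s :: "nat \<Rightarrow> micro_sol"
    and T K M_inf d_inf rho_lo rho_hi :: real
    and \<sigma> :: "nat \<Rightarrow> nat"
    and alpha_f_bar rho_f_bar rho_g_bar f_g_bar u_bar Sigma_f_bar Sigma_g_bar :: "real \<times> real \<Rightarrow> real"
    and S_bar :: "real \<Rightarrow> (real \<times> real) measure"
  assumes "phys_ok P" and "macro_data_ok I"
    and "M_inf > 0" and "d_inf > 0" and "micro_data_ok P I M_inf d_inf D"
    and "T > 0" and "K > 0" and "rho_lo > 0" and "rho_hi > 0"
    and "\<And>N. N \<ge> 1 \<Longrightarrow> classical_solution P N T (rhof0 I) (u0 I) (D N) (s N)"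
    and "\<And>N. N \<ge> 1 \<Longrightarrow> uniform_bounds P T K d_inf rho_lo rho_hi N (D N) (s N)"
    and "\<And>N. N \<ge> 1 \<Longrightarrow> extended_solution P N T (rhof0 I) (D N) (s N)"
    and "\<exists>C. \<forall>N\<ge>1. LinfH1_le T (rho_f_ext (s N)) C \<and> LinfH1_le T (rho_g_ext (s N)) C \<and>
           LinfH1_le T (f_g_ext (s N)) C"
    and "strict_mono \<sigma>"
    and "weak_star_conv_Linf (cyl T) (\<lambda>n. chi (\<sigma> n) (s (\<sigma> n))) alpha_f_bar"
    and "conv_L2 (cyl T) (\<lambda>n. rho_f_ext (s (\<sigma> n))) rho_f_bar"
    and "conv_L2 (cyl T) (\<lambda>n. rho_g_ext (s (\<sigma> n))) rho_g_bar"
    and "conv_L2 (cyl T) (\<lambda>n. f_g_ext (s (\<sigma> n))) f_g_bar"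
    and "conv_L2 (cyl T) (\<lambda>n. u_ext (\<sigma> n) T (s (\<sigma> n))) u_bar"
    and "weak_conv_L2H1 T (\<lambda>n. stress_f_ext (\<sigma> n) (s (\<sigma> n))) Sigma_f_bar"
    and "weak_conv_L2H1 T (\<lambda>n. stress_g_ext P (\<sigma> n) T (D (\<sigma> n)) (s (\<sigma> n))) Sigma_g_bar"
    and "\<And>t. t \<in> {0..T} \<Longrightarrow> prob_on (phase d_inf) (S_bar t)"
    and "\<And>\<beta> :: real \<times> real \<Rightarrow> real. continuous_on (phase d_inf) \<beta> \<Longrightarrow>
           uniform_limit {0..T} (\<lambda>n t. LINT y:phase d_inf|bubble_distr (\<sigma> n) (s (\<sigma> n)) t. \<beta> y)
             (\<lambda>t. LINT y:phase d_inf|S_bar t. \<beta> y) sequentially"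
  shows "(\<forall>\<beta>::real \<times> real \<Rightarrow> real. continuous_on (phase d_inf) \<beta> \<longrightarrow>
            continuous_on {0..T} (\<lambda>t. LINT y:phase d_inf|S_bar t. \<beta> y)) \<and>
         transport_distributional T S_bar
           (\<lambda>(t,x,r). u_bar (t,x))
           (\<lambda>(t,x,r). 1 / mu_g P *
              (r * (Sigma_g_bar (t,x) + p_g P (rho_g_bar (t,x))) + gamma_s_bar P / 2))"
proof -
  have L2u: "eventually (\<lambda>n. L2_on (cyl T) (u_ext (\<sigma> n) T (s (\<sigma> n)))) sequentially"
    using assms(19) by (simp add: conv_L2_def)
  obtain m0 where m0: "\<And>n. n \<ge> m0 \<Longrightarrow> L2_on (cyl T) (u_ext (\<sigma> n) T (s (\<sigma> n)))"
    using L2u by (auto simp: eventually_sequentially)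
  \<comment> \<open>The first terms are discarded so that the velocities are square integrable at
    every index. The \<open>Suc\<close> ensures at least one bubble, as the hypotheses on the
    solutions require.\<close>
  define m where "m = Suc m0"
  define \<tau> where "\<tau> = (\<lambda>n. \<sigma> (n + m))"
  have ge: "\<tau> n \<ge> n + m" for n unfolding \<tau>_def by (rule strict_mono_imp_increasing[OF assms(14)])
  then have \<tau>1: "\<tau> n \<ge> 1" for n using le_trans[of 1 "n + m" "\<tau> n"] by (simp add: m_def)
  have shift: "filterlim (\<lambda>n. n + m) at_top sequentially" by (rule filterlim_add_const_nat_at_top)
  have micro: "micro_solution P (\<tau> n) T d_inf (rhof0 I) (u0 I) (D (\<tau> n)) (s (\<tau> n)) K rho_lo rho_hi" for n
  proof (rule micro_solution.intro)
    have data: "M_inf \<le> \<tau> n * mass (D (\<tau> n)) k" if "k \<in> {1..\<tau> n}" for k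
      using assms(5)[unfolded micro_data_ok_def, THEN conjunct1, rule_format, OF \<tau>1[of n]] that by (auto simp: Let_def)
    show "mass (D (\<tau> n)) k > 0" if "k \<in> {1..\<tau> n}" for k
    proof -
      have "0 < \<tau> n * mass (D (\<tau> n)) k" using data[OF that] assms(3) by linarith
      then show ?thesis using \<tau>1[of n] by (simp add: zero_less_mult_iff)
    qed
    show "f_g_init (D (\<tau> n)) x = 1 / (2 * \<tau> n * R_init (D (\<tau> n)) k) \<and>
        rho_g_init (D (\<tau> n)) x = mass (D (\<tau> n)) k / (2 * R_init (D (\<tau> n)) k)"
      if "k \<in> {1..\<tau> n}" "x \<in> bubble (c_init (D (\<tau> n))) (R_init (D (\<tau> n))) k" for k x
      using assms(5)[unfolded micro_data_ok_def, THEN conjunct1, rule_format, OF \<tau>1[of n]] that by (auto simp: Let_def)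
  qed (rule assms \<tau>1)+
  interpret micro_sequence P T d_inf "rhof0 I" "u0 I" K rho_lo rho_hi \<tau> "\<lambda>n. D (\<tau> n)" "\<lambda>n. s (\<tau> n)" S_bar
  proof (rule micro_sequence.intro)
    show "filterlim \<tau> at_top sequentially"
      by (rule filterlim_at_top_mono[OF shift]) (simp add: ge)
    show "prob_on (phase d_inf) (S_bar t)" if "t \<in> {0..T}" for t by (rule assms(22)[OF that])
    fix \<beta> :: "real \<times> real \<Rightarrow> real" assume "continuous_on (phase d_inf) \<beta>"
    from filterlim_compose[OF assms(23)[OF this] shift]
    show "uniform_limit {0..T} (\<lambda>n t. LINT y:phase d_inf|bubble_distr (\<tau> n) (s (\<tau> n)) t. \<beta> y)
         (\<lambda>t. LINT y:phase d_inf|S_bar t. \<beta> y) sequentially"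
      by (simp add: \<tau>_def)
  qed (rule micro)
  have conv: "conv_L2 (cyl T) (\<lambda>n. w (n + m)) g" if "conv_L2 (cyl T) w g" for w g
    using that by (auto simp: conv_L2_def intro: filterlim_compose[OF _ shift] eventually_compose_filterlim[OF _ shift])
  have weak: "weak_conv_L2H1 T (\<lambda>n. w (n + m)) g" if "weak_conv_L2H1 T w g" for w g
    using that by (auto simp: weak_conv_L2H1_def intro: filterlim_compose[OF _ shift] eventually_compose_filterlim[OF _ shift])
  interpret micro_limit P T d_inf "rhof0 I" "u0 I" K rho_lo rho_hi \<tau> "\<lambda>n. D (\<tau> n)" "\<lambda>n. s (\<tau> n)" S_bar u_bar rho_g_bar Sigma_g_bar
  proof
    show "conv_L2 (cyl T) (\<lambda>n. u_ext (\<tau> n) T (s (\<tau> n))) u_bar"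
      unfolding \<tau>_def by (rule conv[OF assms(19)])
    show "conv_L2 (cyl T) (\<lambda>n. rho_g_ext (s (\<tau> n))) rho_g_bar"
      unfolding \<tau>_def by (rule conv[OF assms(17)])
    show "weak_conv_L2H1 T (\<lambda>n. stress_g_ext P (\<tau> n) T (D (\<tau> n)) (s (\<tau> n))) Sigma_g_bar"
      unfolding \<tau>_def by (rule weak[OF assms(21)])
    show "L2_on (cyl T) (u_ext (\<tau> n) T (s (\<tau> n)))" for n
      unfolding \<tau>_def by (rule m0) (simp add: m_def)
  qed
  show ?thesis using limit_continuous limit_equation by blast
qed

end
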